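(* Let $\mathcal{L}$ be an abstract intuitionistic logic and let $\mathcal{L}'$ be one of the six standard intuitionistic logics ($\mathcal{L}'\in StIL$). If $\mathcal{L}' \sqsubseteq \mathcal{L}$ (that is, $\mathcal{L}$ extends $\mathcal{L}'$), and $\mathcal{L}$ is preserved under $\mathcal{L}'$-asimulations, is $\star$-compact, and has the Tarski Union Property, then $\mathcal{L}' \bowtie \mathcal{L}$ (the two logics are expressively equivalent).
   Context: Signatures and models. A signature $\Theta$ consists of predicate letters of positive arities ($\Theta_n$ = the $n$-ary ones) and individual constants $Const_\Theta$; no function symbols. A (Kripke) $\Theta$-model is $\mathcal{M}=\langle W,\prec,\mathfrak{A},\mathbb{H}\rangle$: $W\neq\emptyset$; $\prec$ a partial order on $W$; $\mathfrak{A}$ assigns to each $w\in W$ a classical $\Theta$-structure $\mathfrak{A}_w=(A_w,I_w)$, with $A_w\cap A_v=\emptyset$ for $w\neq v$; $\mathbb{H}$ assigns to each pair $w\prec v$ a homomorphism $\mathbb{H}_{wv}:\mathfrak{A}_w\to\mathfrak{A}_v$ (predicates preserved, $I_v(c)=\mathbb{H}_{wv}(I_w(c))$), with $\mathbb{H}_{ww}=id$ and $\mathbb{H}_{wu}=\mathbb{H}_{vu}\circ\mathbb{H}_{wv}$ for $w\prec v\prec u$. $\mathbb{A}=\bigcup_w A_w$; $\mathbb{H}_{wv}\langle\bar a\rangle$ acts componentwise. A pointed model is $(\mathcal{M},w)$, $w\in W$. $[W,w]=\{v:w\prec v\}$, and $[\mathcal{M},w]$ is the restriction of $\mathcal{M}$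 to $[W,w]$. For pairwise distinct constants $\bar c_n\notin\Theta$ and $\bar a_n\in A_w^n$, $([\mathcal{M},w],\bar c_n/\bar a_n)$ is the expansion of $[\mathcal{M},w]$ interpreting $c_i$ at $v$ as $\mathbb{H}_{wv}(a_i)$. For $\mathcal{N}=\langle U,\lhd,\mathfrak{B},\mathbb{G}\rangle$ (with $\mathfrak{B}_u=(B_u,J_u)$): $\mathcal{M}\subseteq\mathcal{N}$ (submodel) iff $W\subseteq U$, $\prec=\lhd\cap(W\times W)$, each $\mathfrak{A}_w$ is a classical substructure of $\mathfrak{B}_w$, and $\mathbb{H}_{wv}=\mathbb{G}_{wv}\upharpoonright A_w$. The union of a countable $\subseteq$-chain is the componentwise union. $(\mathcal{M},w)\oplus(\bar c_n/\bar a_n)$ is the set of $(\Theta\cup\{\bar c_n\})$-models $\mathcal{N}$ with $[\mathcal{M},w]\subseteq\mathcal{N}\upharpoonright\Theta\subseteq\mathcal{M}$ and $J_w(c_i)=a_i$. An isomorphism $(g,h):\mathcal{M}\cong\mathcal{N}$ consists of bijections $g:\mathbb{A}\to\mathbb{B}$, $h:W\to U$ with $v\prec u\Leftrightarrow h(v)\lhd h(u)$, $g\upharpoonright A_v:\mathfrak{A}_v\cong\mathfrak{B}_{h(v)}$, and $g(\mathbb{H}_{vu}(a))=\mathbb{G}_{h(v)h(u)}(g(a))$. Standard semantics. Formulas are built from atoms $P(t_1,\dots,t_m)$ (terms = variables or constants), $\bot$, and (in languages with equality) $t_1\equiv t_2$, using $\wedge,\vee,\to,\forall,\exists$. At $w$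 under an assignment $\bar a$ of elements of $A_w$: atoms hold iff the values lie in $I_w(P)$ (resp. coincide); $\bot$ never; $\wedge,\vee$ as usual; $\varphi\to\psi$ holds iff for every $v$ with $w\prec v$, if $\varphi$ holds at $v$ under $\mathbb{H}_{wv}\langle\bar a\rangle$ then so does $\psi$; $\exists x\varphi$ iff some $a\in A_w$ for $x$ works; $\forall x\varphi$ iff for all $v\succ w$ and all $a\in A_v$, $\varphi$ holds at $v$ under $\mathbb{H}_{wv}\langle\bar a\rangle$ and $x\mapsto a$. $In$ (resp. $Su$) is the class of models with all $\mathbb{H}_{wv}$ injective (resp. surjective), $Bi=In\cap Su$. $StIL=\{\mathsf{IL},\mathsf{CD},\mathsf{IL}^\equiv,\mathsf{CD}^\equiv,\mathsf{In}^\equiv,\mathsf{Bi}^\equiv\}$: respectively language without $\equiv$ over all models; without $\equiv$ over $Su$; with $\equiv$ over all models; with $\equiv$ over $Su$; with $\equiv$ over $In$; with $\equiv$ over $Bi$. For such a logic, $Str(\Theta)$ = pointed $\Theta$-models from its class, $L(\Theta)$ = its sentences over $\Theta$, and $\boxplus=\oplus$. Theories and types. $Th_\mathcal{L}(\mathcal{M},w)=(\{\phi\in L(\Theta):\mathcal{M},w\models_\mathcal{L}\phi\},\{\phi\in L(\Theta):\mathcal{M},w\not\models_\mathcal{L}\phi\})$; $Th^+$ is the first component. $Tp_\mathcal{L}(\mathcal{M},w,\bar c_n/\bar a_n)=Th_\mathcal{L}(([\mathcal{M},w],\bar c_n/\bar a_n),w)$. $\mathcal{M}\preccurlyeq_\mathcal{L}\mathcal{N}$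 iff $\mathcal{M}\subseteq\mathcal{N}$ and $Tp_\mathcal{L}(\mathcal{M},w,\bar c_n/\bar a_n)=Tp_\mathcal{L}(\mathcal{N},w,\bar c_n/\bar a_n)$ for all $w\in W$, $n$, $\bar a_n\in A_w^n$ and fresh $\bar c_n$. Asimulations. Fix pairwise distinct constants $c_1,c_2,\dots\notin\Theta$. For $\mathcal{L}'\in StIL$, a relation $A$ is an $\mathcal{L}'$-asimulation from $(\mathcal{M}_1,w_1,\bar a_n)$ to $(\mathcal{M}_2,w_2,\bar b_n)$ iff $A$ relates pairs $(w;\bar\alpha_l)$ ($w\in W_i$, $\bar\alpha_l\in\mathbb{A}_i^l$) to pairs $(v;\bar\beta_l)$ ($v\in W_j$, $\bar\beta_l\in\mathbb{A}_j^l$), $\{i,j\}=\{1,2\}$; $(w_1;\bar a_n)A(w_2;\bar b_n)$; and whenever $(w;\bar\alpha_l)A(v;\bar\beta_l)$ with $w\in W_i$, $v\in W_j$, $\bar\alpha_l\in(A_i)_w^l$, $\bar\beta_l\in(A_j)_v^l$: (atom) every atomic sentence of the language of $\mathcal{L}'$ over $\Theta\cup\{c_1,\dots,c_l\}$ true at $w$ in $([\mathcal{M}_i,w],\bar c_l/\bar\alpha_l)$ is true at $v$ in $([\mathcal{M}_j,v],\bar c_l/\bar\beta_l)$; (s-back) if $v\prec_j t$ there is $u$ with $w\prec_i u$, $(u;(\mathbb{H}_i)_{wu}\langle\bar\alpha_l\rangle)A(t;(\mathbb{H}_j)_{vt}\langle\bar\beta_l\rangle)$ and $(t;(\mathbb{H}_j)_{vt}\langle\bar\beta_l\rangle)A(u;(\mathbb{H}_i)_{wu}\langle\bar\alpha_l\rangle)$;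 (obj-forth) for each $\alpha'\in(A_i)_w$ there is $\beta'\in(A_j)_v$ with $(w;\bar\alpha_l{}^\frown\alpha')A(v;\bar\beta_l{}^\frown\beta')$; (obj-back) for each $t$ with $v\prec_j t$ and $\beta'\in(A_j)_t$ there are $u$ with $w\prec_i u$ and $\alpha'\in(A_i)_u$ with $(u;(\mathbb{H}_i)_{wu}\langle\bar\alpha_l\rangle^\frown\alpha')A(t;(\mathbb{H}_j)_{vt}\langle\bar\beta_l\rangle^\frown\beta')$. Abstract intuitionistic logics. A quadruple $\mathcal{L}=(Str_\mathcal{L},L,\models_\mathcal{L},\boxplus_\mathcal{L})$: $Str_\mathcal{L}(\Theta)$ is a class of pointed $\Theta$-models closed under isomorphisms, signature renamings, changing the point within the same model, reducts to subsignatures, unions of countable $\subseteq$-chains of models with a common point, and constant extensions (if $(\mathcal{M},w)\in Str_\mathcal{L}(\Theta)$ then some $\mathcal{N}\in(\mathcal{M},w)\oplus(\bar c_n/\bar a_n)$ has $(\mathcal{N},w)\in Str_\mathcal{L}(\Theta\cup\{\bar c_n\})$); $L(\Theta)$ is a set of sentences; $\models_\mathcal{L}$ relates $(\mathcal{M},w)\in Str_\mathcal{L}(\Theta)$ to $\phi\in L(\Theta)$; $(\mathcal{M},w)\boxplus_\mathcal{L}(\bar c_n/\bar a_n)$ is a nonempty subset of $(\mathcal{M},w)\oplus(\bar c_n/\bar a_n)$ whose members $\mathcal{N}$ satisfy $(\mathcal{N},v)\in Str_\mathcal{L}(\Theta\cup\{\bar c_n\})$ for all worlds $v$, and which contains every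 $\mathcal{N}'\in(\mathcal{M},w)\oplus(\bar c_n/\bar a_n)$ agreeing at $w$ on all $L(\Theta\cup\{\bar c_n\})$-sentences with some member. Required: (Occurrence) each $\phi$ has a finite $\Theta_\phi$ with $\phi\in L(\Theta')$ iff $\Theta_\phi\subseteq\Theta'$; (Renaming) signature renamings induce truth-preserving bijections of sentences; (Isomorphism) $\mathcal{M},w\models\phi\Leftrightarrow\mathcal{N},h(w)\models\phi$ when $(g,h):\mathcal{M}\cong\mathcal{N}$; (Expansion) for $\Theta\subseteq\Theta'$, $(\mathcal{M},w)\in Str_\mathcal{L}(\Theta')$, $\phi\in L(\Theta)$: $\mathcal{M},w\models\phi\Leftrightarrow\mathcal{M}\upharpoonright\Theta,w\models\phi$; (Propositional closure) $\bot\in L(\Theta)$ and $L(\Theta)$ is closed under intuitionistic $\to,\wedge,\vee$; (Quantifier closure) for $c\notin\Theta$, $\phi\in L(\Theta\cup\{c\})$ there are $\exists c\phi,\forall c\phi\in L(\Theta)$ with $\mathcal{M},w\models\exists c\phi$ iff $\exists a\in A_w\,\exists\mathcal{N}\in(\mathcal{M},w)\boxplus_\mathcal{L}(c/a)\,(\mathcal{N},w\models\phi)$, and $\mathcal{M},w\models\forall c\phi$ iff $\forall v\succ w\,\forall a\in A_v\,\exists\mathcal{N}\in(\mathcal{M},v)\boxplus_\mathcal{L}(c/a)\,(\mathcal{N},v\models\phi)$. $\mathcal{L}'\sqsubseteq\mathcal{L}$ iff $Str_\mathcal{L}=Str_{\mathcal{L}'}$, $(\mathcal{M},w)\boxplus_\mathcal{L}(\bar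 c/\bar a)\subseteq(\mathcal{M},w)\boxplus_{\mathcal{L}'}(\bar c/\bar a)$ always, and every $\phi\in L'(\Theta_\phi)$ has $\psi\in L(\Theta_\phi)$ with $\Theta_\psi=\Theta_\phi$ true at exactly the same $(\mathcal{M},w)\in Str(\Theta_\phi)$. $\mathcal{L}\bowtie\mathcal{L}'$ iff both $\mathcal{L}\sqsubseteq\mathcal{L}'$ and $\mathcal{L}'\sqsubseteq\mathcal{L}$. Properties. $\mathcal{L}$ is preserved under $\mathcal{L}'$-asimulations iff for all $(\mathcal{M}_1,w_1),(\mathcal{M}_2,w_2)\in Str_\mathcal{L}(\Theta)$, if there is an $\mathcal{L}'$-asimulation from $(\mathcal{M}_1,w_1)$ to $(\mathcal{M}_2,w_2)$ (empty tuples) then every $\phi\in L(\Theta)$ true at $(\mathcal{M}_1,w_1)$ is true at $(\mathcal{M}_2,w_2)$. $\mathcal{L}$ is $\star$-compact iff for every $(\Gamma,\Delta)\subseteq(L(\Theta),L(\Theta))$, if for all finite $\Gamma'\subseteq\Gamma,\Delta'\subseteq\Delta$ some $(\mathcal{M},w)\in Str_\mathcal{L}(\Theta)$ makes all of $\Gamma'$ true and all of $\Delta'$ false, then some $(\mathcal{M},w)\in Str_\mathcal{L}(\Theta)$ does so for $(\Gamma,\Delta)$. $\mathcal{L}$ has the Tarski Union Property iff for every chain $\mathcal{M}_0\preccurlyeq_\mathcal{L}\mathcal{M}_1\preccurlyeq_\mathcal{L}\cdots$, $\mathcal{M}_n\preccurlyeq_\mathcal{L}\bigcup_k\mathcal{M}_k$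 for all $n$.
   Formalization: In ⊑, Θ_ψ=Θ_φ is required only if the target logic has a sentence with exactly that signature (IL, CD have none with constants but no predicate letters); for a standard logic ⊞ is ⊕ restricted to its model class, since ⊕ may leave Su. *)

theory Defs
  imports Main "HOL-Library.FuncSet" "HOL-Library.Equipollence"
begin

section \<open>The universe of sets\<close>

text \<open>
  A single type \<open>'u\<close> plays the role of the universe: symbols of signatures, worlds and elements of
  models are all taken from it. A subset of \<open>'u\<close> counts as a set if it is small, that is, has fewer
  elements than \<open>'u\<close>; all other subsets are proper classes. As in set theory, a signature therefore
  never exhausts the available symbols, and fresh constants always exist. The axioms are
  Union-Replacement (equivalently, regularity of the cardinality of \<open>'u\<close>) and smallness of the
  continuum. The cardinality of \<open>'u\<close> may be inaccessible, in which case \<open>'u\<close> is a Grothendieck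
  universe, but need not be.
\<close>

definition small :: "'u set \<Rightarrow> bool" where
  "small X \<longleftrightarrow> X \<prec> (UNIV :: 'u set)"

definition set_universe :: "'u itself \<Rightarrow> bool" where
  "set_universe (_ :: 'u itself) \<longleftrightarrow>
     (UNIV :: nat set set) \<prec> (UNIV :: 'u set) \<and>
     (\<forall>(X :: 'u set) (F :: 'u \<Rightarrow> 'u set).
        small X \<longrightarrow> (\<forall>x\<in>X. small (F x)) \<longrightarrow> small (\<Union>x\<in>X. F x))"


section \<open>Signatures and Kripke models\<close>

text \<open>A predicate letter is a name together with its arity, so \<open>preds \<Theta> n\<close> is \<open>\<Theta>\<^sub>n\<close>.\<close>

record 'u signature =
  preds :: "nat \<Rightarrow> 'u set"
  csts :: "'u set"

definition is_sig :: "'u signature \<Rightarrow> bool" where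
  "is_sig \<Theta> \<longleftrightarrow> preds \<Theta> 0 = {} \<and> (\<forall>n. small (preds \<Theta> n)) \<and> small (csts \<Theta>)"

definition finite_sig :: "'u signature \<Rightarrow> bool" where
  "finite_sig \<Theta> \<longleftrightarrow> finite (SIGMA n:UNIV. preds \<Theta> n) \<and> finite (csts \<Theta>)"

definition sub_sig :: "'u signature \<Rightarrow> 'u signature \<Rightarrow> bool" where
  "sub_sig \<Theta> \<Theta>' \<longleftrightarrow> (\<forall>n. preds \<Theta> n \<subseteq> preds \<Theta>' n) \<and> csts \<Theta> \<subseteq> csts \<Theta>'"

definition add_consts :: "'u signature \<Rightarrow> 'u list \<Rightarrow> 'u signature" where
  "add_consts \<Theta> cs = \<Theta>\<lparr>csts := csts \<Theta> \<union> set cs\<rparr>"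

text \<open>
  A model carries its signature \<open>sgn\<close>. \<open>pint M w P\<close> holds the tuples of all lengths \<open>n\<close> that satisfy
  the \<open>n\<close>-ary letter named \<open>P\<close> at \<open>w\<close>. All components are normalised outside of their domains
  (see \<open>is_model\<close>), so that equality of models is equality in the set-theoretic sense.
\<close>

record 'u kmodel =
  sgn :: "'u signature"
  wlds :: "'u set"
  acc :: "('u \<times> 'u) set"
  dmn :: "'u \<Rightarrow> 'u set"
  pint :: "'u \<Rightarrow> 'u \<Rightarrow> 'u list set"
  cint :: "'u \<Rightarrow> 'u \<Rightarrow> 'u"
  hom :: "'u \<Rightarrow> 'u \<Rightarrow> 'u \<Rightarrow> 'u"

definition is_model :: "'u signature \<Rightarrow> 'u kmodel \<Rightarrow> bool" where
  "is_model \<Theta> M \<longleftrightarrow>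
     sgn M = \<Theta> \<and>
     wlds M \<noteq> {} \<and> small (wlds M) \<and> partial_order_on (wlds M) (acc M) \<and>
     (\<forall>w\<in>wlds M. dmn M w \<noteq> {} \<and> small (dmn M w)) \<and>
     (\<forall>w. w \<notin> wlds M \<longrightarrow> dmn M w = {}) \<and>
     (\<forall>w\<in>wlds M. \<forall>v\<in>wlds M. w \<noteq> v \<longrightarrow> dmn M w \<inter> dmn M v = {}) \<and>
     (\<forall>w P. \<forall>as\<in>pint M w P. set as \<subseteq> dmn M w \<and> P \<in> preds \<Theta> (length as)) \<and>
     (\<forall>w\<in>wlds M. cint M w \<in> csts \<Theta> \<rightarrow>\<^sub>E dmn M w) \<and>
     (\<forall>w. w \<notin> wlds M \<longrightarrow> cint M w = (\<lambda>_. undefined)) \<and>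
     (\<forall>w v. (w, v) \<in> acc M \<longrightarrow>
        hom M w v \<in> dmn M w \<rightarrow>\<^sub>E dmn M v \<and>
        (\<forall>P. \<forall>as\<in>pint M w P. map (hom M w v) as \<in> pint M v P) \<and>
        (\<forall>c\<in>csts \<Theta>. cint M v c = hom M w v (cint M w c))) \<and>
     (\<forall>w v. (w, v) \<notin> acc M \<longrightarrow> hom M w v = (\<lambda>_. undefined)) \<and>
     (\<forall>w\<in>wlds M. \<forall>a\<in>dmn M w. hom M w w a = a) \<and>
     (\<forall>w v u. (w, v) \<in> acc M \<longrightarrow> (v, u) \<in> acc M \<longrightarrow>
        (\<forall>a\<in>dmn M w. hom M w u a = hom M v u (hom M w v a)))"

definition elems :: "'u kmodel \<Rightarrow> 'u set" where
  "elems M = (\<Union>w\<in>wlds M. dmn M w)"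

definition reduct :: "'u kmodel \<Rightarrow> 'u signature \<Rightarrow> 'u kmodel" where
  "reduct M \<Theta> = M\<lparr>sgn := \<Theta>,
     pint := (\<lambda>w P. {as \<in> pint M w P. P \<in> preds \<Theta> (length as)}),
     cint := (\<lambda>w. restrict (cint M w) (csts \<Theta>))\<rparr>"

text \<open>\<open>cone M w\<close> is \<open>[M, w]\<close>, and \<open>cone_exp M w cs as\<close> is \<open>([M, w], cs / as)\<close>.\<close>

definition cone :: "'u kmodel \<Rightarrow> 'u \<Rightarrow> 'u kmodel" where
  "cone M w = (let V = {v. (w, v) \<in> acc M} in
     \<lparr>sgn = sgn M, wlds = V, acc = acc M \<inter> V \<times> V,
      dmn = (\<lambda>v. if v \<in> V then dmn M v else {}),
      pint = (\<lambda>v. if v \<in> V then pint M v else (\<lambda>_. {})),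
      cint = (\<lambda>v. if v \<in> V then cint M v else (\<lambda>_. undefined)),
      hom = (\<lambda>v u. if v \<in> V \<and> u \<in> V then hom M v u else (\<lambda>_. undefined))\<rparr>)"

definition cone_exp :: "'u kmodel \<Rightarrow> 'u \<Rightarrow> 'u list \<Rightarrow> 'u list \<Rightarrow> 'u kmodel" where
  "cone_exp M w cs as = (cone M w)\<lparr>sgn := add_consts (sgn M) cs,
     cint := (\<lambda>v. if (w, v) \<in> acc M
                  then (\<lambda>c. case map_of (zip cs as) c of
                              Some a \<Rightarrow> hom M w v a
                            | None \<Rightarrow> cint M v c)
                  else (\<lambda>_. undefined))\<rparr>"

definition submodel :: "'u kmodel \<Rightarrow> 'u kmodel \<Rightarrow> bool" where
  "submodel M N \<longleftrightarrow>
     sgn M = sgn N \<and> wlds M \<subseteq> wlds N \<and> acc M = acc N \<inter> wlds M \<times> wlds M \<and>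
     (\<forall>w\<in>wlds M. dmn M w \<subseteq> dmn N w \<and>
        (\<forall>P. pint M w P = pint N w P \<inter> lists (dmn M w)) \<and>
        (\<forall>c\<in>csts (sgn M). cint M w c = cint N w c)) \<and>
     (\<forall>w v. (w, v) \<in> acc M \<longrightarrow> hom M w v = restrict (hom N w v) (dmn M w))"

text \<open>
  Componentwise union of a chain of models. Along a chain all constants and homomorphisms agree where
  defined, so reading their values off the first model in which they are defined yields the union of
  their graphs.
\<close>

definition chain_union :: "(nat \<Rightarrow> 'u kmodel) \<Rightarrow> 'u kmodel" where
  "chain_union Ms =
     \<lparr>sgn = sgn (Ms 0),
      wlds = (\<Union>n. wlds (Ms n)),
      acc = (\<Union>n. acc (Ms n)),
      dmn = (\<lambda>w. \<Union>n. dmn (Ms n) w),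
      pint = (\<lambda>w P. \<Union>n. pint (Ms n) w P),
      cint = (\<lambda>w. if \<exists>n. w \<in> wlds (Ms n)
                  then cint (Ms (LEAST n. w \<in> wlds (Ms n))) w else (\<lambda>_. undefined)),
      hom = (\<lambda>w v a. if \<exists>n. (w, v) \<in> acc (Ms n) \<and> a \<in> dmn (Ms n) w
                     then hom (Ms (LEAST n. (w, v) \<in> acc (Ms n) \<and> a \<in> dmn (Ms n) w)) w v a
                     else undefined)\<rparr>"

definition name_tuple :: "'u kmodel \<Rightarrow> 'u \<Rightarrow> 'u list \<Rightarrow> 'u list \<Rightarrow> bool" where
  "name_tuple M w cs as \<longleftrightarrow>
     distinct cs \<and> set cs \<inter> csts (sgn M) = {} \<and> length as = length cs \<and> set as \<subseteq> dmn M w"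

text \<open>\<open>oplus M w cs as\<close> is \<open>(M, w) \<oplus> (cs / as)\<close>.\<close>

definition oplus :: "'u kmodel \<Rightarrow> 'u \<Rightarrow> 'u list \<Rightarrow> 'u list \<Rightarrow> 'u kmodel set" where
  "oplus M w cs as = {N. is_model (add_consts (sgn M) cs) N \<and>
     submodel (cone M w) (reduct N (sgn M)) \<and> submodel (reduct N (sgn M)) M \<and>
     map (cint N w) cs = as}"

definition model_iso :: "('u \<Rightarrow> 'u) \<Rightarrow> ('u \<Rightarrow> 'u) \<Rightarrow> 'u kmodel \<Rightarrow> 'u kmodel \<Rightarrow> bool" where
  "model_iso g h M N \<longleftrightarrow>
     sgn M = sgn N \<and>
     bij_betw g (elems M) (elems N) \<and> bij_betw h (wlds M) (wlds N) \<and>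
     (\<forall>v\<in>wlds M. \<forall>u\<in>wlds M. (v, u) \<in> acc M \<longleftrightarrow> (h v, h u) \<in> acc N) \<and>
     (\<forall>v\<in>wlds M. bij_betw g (dmn M v) (dmn N (h v)) \<and>
        (\<forall>P. \<forall>as\<in>lists (dmn M v). as \<in> pint M v P \<longleftrightarrow> map g as \<in> pint N (h v) P) \<and>
        (\<forall>c\<in>csts (sgn M). g (cint M v c) = cint N (h v) c)) \<and>
     (\<forall>v u. (v, u) \<in> acc M \<longrightarrow> (\<forall>a\<in>dmn M v. g (hom M v u a) = hom N (h v) (h u) (g a)))"

definition is_renaming ::
    "'u signature \<Rightarrow> 'u signature \<Rightarrow> (nat \<Rightarrow> 'u \<Rightarrow> 'u) \<Rightarrow> ('u \<Rightarrow> 'u) \<Rightarrow> bool" where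
  "is_renaming \<Theta> \<Theta>' fp fc \<longleftrightarrow>
     (\<forall>n. bij_betw (fp n) (preds \<Theta> n) (preds \<Theta>' n)) \<and> bij_betw fc (csts \<Theta>) (csts \<Theta>')"

definition rename_model ::
    "'u signature \<Rightarrow> (nat \<Rightarrow> 'u \<Rightarrow> 'u) \<Rightarrow> ('u \<Rightarrow> 'u) \<Rightarrow> 'u kmodel \<Rightarrow> 'u kmodel" where
  "rename_model \<Theta>' fp fc M = M\<lparr>sgn := \<Theta>',
     pint := (\<lambda>w Q. {as. \<exists>P\<in>preds (sgn M) (length as). fp (length as) P = Q \<and> as \<in> pint M w P}),
     cint := (\<lambda>w. if w \<in> wlds M
                  then (\<lambda>d\<in>csts \<Theta>'. cint M w (inv_into (csts (sgn M)) fc d))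
                  else (\<lambda>_. undefined))\<rparr>"


section \<open>Abstract intuitionistic logics\<close>

text \<open>
  \<open>Sat L M w \<phi>\<close> is only meaningful for \<open>(M, w) \<in> Str L \<Theta>\<close> and \<open>\<phi> \<in> Sen L \<Theta>\<close>; \<open>Bpl\<close> is the
  operation \<open>\<boxplus>\<close>. The type \<open>'s\<close> of sentences is arbitrary.
\<close>

record ('u, 's) logic =
  Str :: "'u signature \<Rightarrow> ('u kmodel \<times> 'u) set"
  Sen :: "'u signature \<Rightarrow> 's set"
  Sat :: "'u kmodel \<Rightarrow> 'u \<Rightarrow> 's \<Rightarrow> bool"
  Bpl :: "'u kmodel \<Rightarrow> 'u \<Rightarrow> 'u list \<Rightarrow> 'u list \<Rightarrow> 'u kmodel set"

definition structures_ok :: "('u, 's) logic \<Rightarrow> bool" where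
  "structures_ok L \<longleftrightarrow> (\<forall>\<Theta>. is_sig \<Theta> \<longrightarrow>
     (\<forall>M w. (M, w) \<in> Str L \<Theta> \<longrightarrow>
        is_model \<Theta> M \<and> w \<in> wlds M \<and>
        (\<forall>N g h. is_model \<Theta> N \<and> model_iso g h M N \<longrightarrow> (N, h w) \<in> Str L \<Theta>) \<and>
        (\<forall>\<Theta>' fp fc. is_sig \<Theta>' \<and> is_renaming \<Theta> \<Theta>' fp fc \<longrightarrow>
           (rename_model \<Theta>' fp fc M, w) \<in> Str L \<Theta>') \<and>
        (\<forall>v\<in>wlds M. (M, v) \<in> Str L \<Theta>) \<and>
        (\<forall>\<Theta>'. is_sig \<Theta>' \<and> sub_sig \<Theta>' \<Theta> \<longrightarrow> (reduct M \<Theta>', w) \<in> Str L \<Theta>') \<and>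
        (\<forall>cs as. name_tuple M w cs as \<longrightarrow>
           (\<exists>N\<in>oplus M w cs as. (N, w) \<in> Str L (add_consts \<Theta> cs)))) \<and>
     (\<forall>Ms w. (\<forall>n. (Ms n, w) \<in> Str L \<Theta> \<and> submodel (Ms n) (Ms (Suc n))) \<longrightarrow>
        (chain_union Ms, w) \<in> Str L \<Theta>))"

definition boxplus_ok :: "('u, 's) logic \<Rightarrow> bool" where
  "boxplus_ok L \<longleftrightarrow> (\<forall>\<Theta> M w cs as.
     is_sig \<Theta> \<and> (M, w) \<in> Str L \<Theta> \<and> name_tuple M w cs as \<longrightarrow>
       Bpl L M w cs as \<noteq> {} \<and> Bpl L M w cs as \<subseteq> oplus M w cs as \<and>
       (\<forall>N\<in>Bpl L M w cs as. \<forall>v\<in>wlds N. (N, v) \<in> Str L (add_consts \<Theta> cs)) \<and>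
       (\<forall>N\<in>Bpl L M w cs as. \<forall>N'\<in>oplus M w cs as.
          (N', w) \<in> Str L (add_consts \<Theta> cs) \<and>
          (\<forall>\<phi>\<in>Sen L (add_consts \<Theta> cs). Sat L N w \<phi> \<longleftrightarrow> Sat L N' w \<phi>) \<longrightarrow>
          N' \<in> Bpl L M w cs as))"

definition occurs_exactly :: "('u, 's) logic \<Rightarrow> 's \<Rightarrow> 'u signature \<Rightarrow> bool" where
  "occurs_exactly L \<phi> \<Theta> \<longleftrightarrow> is_sig \<Theta> \<and> finite_sig \<Theta> \<and>
     (\<forall>\<Theta>'. is_sig \<Theta>' \<longrightarrow> (\<phi> \<in> Sen L \<Theta>' \<longleftrightarrow> sub_sig \<Theta> \<Theta>'))"

definition sen_sig :: "('u, 's) logic \<Rightarrow> 's \<Rightarrow> 'u signature" where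
  "sen_sig L \<phi> = (THE \<Theta>. occurs_exactly L \<phi> \<Theta>)"

definition occurrence :: "('u, 's) logic \<Rightarrow> bool" where
  "occurrence L \<longleftrightarrow> (\<forall>\<Theta>. is_sig \<Theta> \<longrightarrow> (\<forall>\<phi>\<in>Sen L \<Theta>. \<exists>\<Theta>'. occurs_exactly L \<phi> \<Theta>'))"

definition renaming :: "('u, 's) logic \<Rightarrow> bool" where
  "renaming L \<longleftrightarrow> (\<forall>\<Theta> \<Theta>' fp fc. is_sig \<Theta> \<and> is_sig \<Theta>' \<and> is_renaming \<Theta> \<Theta>' fp fc \<longrightarrow>
     (\<exists>F. bij_betw F (Sen L \<Theta>) (Sen L \<Theta>') \<and>
        (\<forall>(M, w)\<in>Str L \<Theta>. \<forall>\<phi>\<in>Sen L \<Theta>.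
           Sat L M w \<phi> \<longleftrightarrow> Sat L (rename_model \<Theta>' fp fc M) w (F \<phi>))))"

definition isomorphism_invariant :: "('u, 's) logic \<Rightarrow> bool" where
  "isomorphism_invariant L \<longleftrightarrow> (\<forall>\<Theta>. is_sig \<Theta> \<longrightarrow>
     (\<forall>(M, w)\<in>Str L \<Theta>. \<forall>N g h. is_model \<Theta> N \<and> model_iso g h M N \<longrightarrow>
        (\<forall>\<phi>\<in>Sen L \<Theta>. Sat L M w \<phi> \<longleftrightarrow> Sat L N (h w) \<phi>)))"

definition expansion :: "('u, 's) logic \<Rightarrow> bool" where
  "expansion L \<longleftrightarrow> (\<forall>\<Theta> \<Theta>'. is_sig \<Theta> \<and> is_sig \<Theta>' \<and> sub_sig \<Theta> \<Theta>' \<longrightarrow>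
     (\<forall>(M, w)\<in>Str L \<Theta>'. \<forall>\<phi>\<in>Sen L \<Theta>. Sat L M w \<phi> \<longleftrightarrow> Sat L (reduct M \<Theta>) w \<phi>))"

definition propositional_closure :: "('u, 's) logic \<Rightarrow> bool" where
  "propositional_closure L \<longleftrightarrow> (\<forall>\<Theta>. is_sig \<Theta> \<longrightarrow>
     (\<exists>\<chi>\<in>Sen L \<Theta>. \<forall>(M, w)\<in>Str L \<Theta>. \<not> Sat L M w \<chi>) \<and>
     (\<forall>\<phi>\<in>Sen L \<Theta>. \<forall>\<psi>\<in>Sen L \<Theta>.
        (\<exists>\<chi>\<in>Sen L \<Theta>. \<forall>(M, w)\<in>Str L \<Theta>.
           Sat L M w \<chi> \<longleftrightarrow> (\<forall>v. (w, v) \<in> acc M \<longrightarrow> Sat L M v \<phi> \<longrightarrow> Sat L M v \<psi>)) \<and>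
        (\<exists>\<chi>\<in>Sen L \<Theta>. \<forall>(M, w)\<in>Str L \<Theta>. Sat L M w \<chi> \<longleftrightarrow> Sat L M w \<phi> \<and> Sat L M w \<psi>) \<and>
        (\<exists>\<chi>\<in>Sen L \<Theta>. \<forall>(M, w)\<in>Str L \<Theta>. Sat L M w \<chi> \<longleftrightarrow> Sat L M w \<phi> \<or> Sat L M w \<psi>)))"

definition quantifier_closure :: "('u, 's) logic \<Rightarrow> bool" where
  "quantifier_closure L \<longleftrightarrow> (\<forall>\<Theta> c. is_sig \<Theta> \<and> c \<notin> csts \<Theta> \<longrightarrow>
     (\<forall>\<phi>\<in>Sen L (add_consts \<Theta> [c]).
        (\<exists>\<chi>\<in>Sen L \<Theta>. \<forall>(M, w)\<in>Str L \<Theta>.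
           Sat L M w \<chi> \<longleftrightarrow> (\<exists>a\<in>dmn M w. \<exists>N\<in>Bpl L M w [c] [a]. Sat L N w \<phi>)) \<and>
        (\<exists>\<chi>\<in>Sen L \<Theta>. \<forall>(M, w)\<in>Str L \<Theta>.
           Sat L M w \<chi> \<longleftrightarrow> (\<forall>v. (w, v) \<in> acc M \<longrightarrow>
             (\<forall>a\<in>dmn M v. \<exists>N\<in>Bpl L M v [c] [a]. Sat L N v \<phi>)))))"

definition abstract_logic :: "('u, 's) logic \<Rightarrow> bool" where
  "abstract_logic L \<longleftrightarrow>
     structures_ok L \<and> boxplus_ok L \<and> occurrence L \<and> renaming L \<and> isomorphism_invariant L \<and>
     expansion L \<and> propositional_closure L \<and> quantifier_closure L"

text \<open>
  \<open>extends L' L\<close> is \<open>L' \<sqsubseteq> L\<close>. The requirement that the signature of \<open>\<psi>\<close> be all of the signature of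
  \<open>\<phi>\<close> is imposed whenever \<open>L\<close> has some sentence with exactly that signature. The proviso only concerns
  a degenerate case: without equality and predicate letters, no formula can mention a constant, so an
  equality-free standard logic has no sentence whose signature consists of constants only, whereas an
  abstract logic may have one (for instance a copy of falsum tagged with a constant).
\<close>

definition extends :: "('u, 't) logic \<Rightarrow> ('u, 's) logic \<Rightarrow> bool" where
  "extends L' L \<longleftrightarrow>
     (\<forall>\<Theta>. is_sig \<Theta> \<longrightarrow> Str L \<Theta> = Str L' \<Theta>) \<and>
     (\<forall>\<Theta> M w cs as. is_sig \<Theta> \<and> (M, w) \<in> Str L \<Theta> \<and> name_tuple M w cs as \<longrightarrow>
        Bpl L M w cs as \<subseteq> Bpl L' M w cs as) \<and>
     (\<forall>\<Theta>. is_sig \<Theta> \<longrightarrow> (\<forall>\<phi>\<in>Sen L' \<Theta>. let \<Theta>\<phi> = sen_sig L' \<phi> in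
        \<exists>\<psi>\<in>Sen L \<Theta>\<phi>.
          ((\<exists>\<chi>\<in>Sen L \<Theta>\<phi>. sen_sig L \<chi> = \<Theta>\<phi>) \<longrightarrow> sen_sig L \<psi> = \<Theta>\<phi>) \<and>
          (\<forall>(M, w)\<in>Str L \<Theta>\<phi>. Sat L' M w \<phi> \<longleftrightarrow> Sat L M w \<psi>)))"

definition equally_expressive :: "('u, 't) logic \<Rightarrow> ('u, 's) logic \<Rightarrow> bool" where
  "equally_expressive L' L \<longleftrightarrow> extends L' L \<and> extends L L'"


section \<open>Theories, types and model-theoretic properties\<close>

definition Th :: "('u, 's) logic \<Rightarrow> 'u kmodel \<Rightarrow> 'u \<Rightarrow> 's set \<times> 's set" where
  "Th L M w = ({\<phi> \<in> Sen L (sgn M). Sat L M w \<phi>}, {\<phi> \<in> Sen L (sgn M). \<not> Sat L M w \<phi>})"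

definition Tp :: "('u, 's) logic \<Rightarrow> 'u kmodel \<Rightarrow> 'u \<Rightarrow> 'u list \<Rightarrow> 'u list \<Rightarrow> 's set \<times> 's set" where
  "Tp L M w cs as = Th L (cone_exp M w cs as) w"

definition elementary_submodel :: "('u, 's) logic \<Rightarrow> 'u kmodel \<Rightarrow> 'u kmodel \<Rightarrow> bool" where
  "elementary_submodel L M N \<longleftrightarrow> submodel M N \<and>
     (\<forall>w\<in>wlds M. \<forall>cs as. name_tuple M w cs as \<longrightarrow> Tp L M w cs as = Tp L N w cs as)"

definition star_compact :: "('u, 's) logic \<Rightarrow> bool" where
  "star_compact L \<longleftrightarrow> (\<forall>\<Theta> \<Gamma> \<Delta>. is_sig \<Theta> \<and> \<Gamma> \<subseteq> Sen L \<Theta> \<and> \<Delta> \<subseteq> Sen L \<Theta> \<and>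
     (\<forall>\<Gamma>' \<Delta>'. finite \<Gamma>' \<and> finite \<Delta>' \<and> \<Gamma>' \<subseteq> \<Gamma> \<and> \<Delta>' \<subseteq> \<Delta> \<longrightarrow>
        (\<exists>(M, w)\<in>Str L \<Theta>. (\<forall>\<phi>\<in>\<Gamma>'. Sat L M w \<phi>) \<and> (\<forall>\<phi>\<in>\<Delta>'. \<not> Sat L M w \<phi>))) \<longrightarrow>
     (\<exists>(M, w)\<in>Str L \<Theta>. (\<forall>\<phi>\<in>\<Gamma>. Sat L M w \<phi>) \<and> (\<forall>\<phi>\<in>\<Delta>. \<not> Sat L M w \<phi>)))"

definition tarski_union_property :: "('u, 's) logic \<Rightarrow> bool" where
  "tarski_union_property L \<longleftrightarrow> (\<forall>\<Theta> Ms. is_sig \<Theta> \<and>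
     (\<forall>n. (\<forall>w\<in>wlds (Ms n). (Ms n, w) \<in> Str L \<Theta>) \<and> is_model \<Theta> (Ms n)) \<and>
     (\<forall>n. elementary_submodel L (Ms n) (Ms (Suc n))) \<longrightarrow>
     (\<forall>n. elementary_submodel L (Ms n) (chain_union Ms)))"


section \<open>The standard intuitionistic logics\<close>

datatype 'u tm = Var nat | Cst 'u

datatype 'u fm =
    Bot
  | Atom 'u "'u tm list"
  | Eq "'u tm" "'u tm"
  | And "'u fm" "'u fm"
  | Or "'u fm" "'u fm"
  | Imp "'u fm" "'u fm"
  | All nat "'u fm"
  | Ex nat "'u fm"

fun tm_vars :: "'u tm \<Rightarrow> nat set" where
  "tm_vars (Var x) = {x}"
| "tm_vars (Cst c) = {}"

fun tm_over :: "'u signature \<Rightarrow> 'u tm \<Rightarrow> bool" where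
  "tm_over \<Theta> (Var x) \<longleftrightarrow> True"
| "tm_over \<Theta> (Cst c) \<longleftrightarrow> c \<in> csts \<Theta>"

fun fv :: "'u fm \<Rightarrow> nat set" where
  "fv Bot = {}"
| "fv (Atom P ts) = (\<Union>t\<in>set ts. tm_vars t)"
| "fv (Eq s t) = tm_vars s \<union> tm_vars t"
| "fv (And \<phi> \<psi>) = fv \<phi> \<union> fv \<psi>"
| "fv (Or \<phi> \<psi>) = fv \<phi> \<union> fv \<psi>"
| "fv (Imp \<phi> \<psi>) = fv \<phi> \<union> fv \<psi>"
| "fv (All x \<phi>) = fv \<phi> - {x}"
| "fv (Ex x \<phi>) = fv \<phi> - {x}"

text \<open>The Boolean argument says whether the language has equality.\<close>

fun fm_over :: "bool \<Rightarrow> 'u signature \<Rightarrow> 'u fm \<Rightarrow> bool" where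
  "fm_over e \<Theta> Bot \<longleftrightarrow> True"
| "fm_over e \<Theta> (Atom P ts) \<longleftrightarrow> P \<in> preds \<Theta> (length ts) \<and> (\<forall>t\<in>set ts. tm_over \<Theta> t)"
| "fm_over e \<Theta> (Eq s t) \<longleftrightarrow> e \<and> tm_over \<Theta> s \<and> tm_over \<Theta> t"
| "fm_over e \<Theta> (And \<phi> \<psi>) \<longleftrightarrow> fm_over e \<Theta> \<phi> \<and> fm_over e \<Theta> \<psi>"
| "fm_over e \<Theta> (Or \<phi> \<psi>) \<longleftrightarrow> fm_over e \<Theta> \<phi> \<and> fm_over e \<Theta> \<psi>"
| "fm_over e \<Theta> (Imp \<phi> \<psi>) \<longleftrightarrow> fm_over e \<Theta> \<phi> \<and> fm_over e \<Theta> \<psi>"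
| "fm_over e \<Theta> (All x \<phi>) \<longleftrightarrow> fm_over e \<Theta> \<phi>"
| "fm_over e \<Theta> (Ex x \<phi>) \<longleftrightarrow> fm_over e \<Theta> \<phi>"

fun tm_val :: "'u kmodel \<Rightarrow> 'u \<Rightarrow> (nat \<Rightarrow> 'u) \<Rightarrow> 'u tm \<Rightarrow> 'u" where
  "tm_val M w s (Var x) = s x"
| "tm_val M w s (Cst c) = cint M w c"

fun holds :: "'u kmodel \<Rightarrow> 'u \<Rightarrow> (nat \<Rightarrow> 'u) \<Rightarrow> 'u fm \<Rightarrow> bool" where
  "holds M w s Bot \<longleftrightarrow> False"
| "holds M w s (Atom P ts) \<longleftrightarrow> map (tm_val M w s) ts \<in> pint M w P"
| "holds M w s (Eq t1 t2) \<longleftrightarrow> tm_val M w s t1 = tm_val M w s t2"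
| "holds M w s (And \<phi> \<psi>) \<longleftrightarrow> holds M w s \<phi> \<and> holds M w s \<psi>"
| "holds M w s (Or \<phi> \<psi>) \<longleftrightarrow> holds M w s \<phi> \<or> holds M w s \<psi>"
| "holds M w s (Imp \<phi> \<psi>) \<longleftrightarrow> (\<forall>v. (w, v) \<in> acc M \<longrightarrow>
     holds M v (hom M w v \<circ> s) \<phi> \<longrightarrow> holds M v (hom M w v \<circ> s) \<psi>)"
| "holds M w s (All x \<phi>) \<longleftrightarrow> (\<forall>v. (w, v) \<in> acc M \<longrightarrow>
     (\<forall>a\<in>dmn M v. holds M v ((hom M w v \<circ> s)(x := a)) \<phi>))"
| "holds M w s (Ex x \<phi>) \<longleftrightarrow> (\<exists>a\<in>dmn M w. holds M w (s(x := a)) \<phi>)"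

datatype stil = IL | CD | IL_eq | CD_eq | In_eq | Bi_eq

fun has_eq :: "stil \<Rightarrow> bool" where
  "has_eq IL \<longleftrightarrow> False"
| "has_eq CD \<longleftrightarrow> False"
| "has_eq _ \<longleftrightarrow> True"

definition inj_model :: "'u kmodel \<Rightarrow> bool" where
  "inj_model M \<longleftrightarrow> (\<forall>(w, v)\<in>acc M. inj_on (hom M w v) (dmn M w))"

definition surj_model :: "'u kmodel \<Rightarrow> bool" where
  "surj_model M \<longleftrightarrow> (\<forall>(w, v)\<in>acc M. hom M w v ` dmn M w = dmn M v)"

fun in_class :: "stil \<Rightarrow> 'u kmodel \<Rightarrow> bool" where
  "in_class IL M \<longleftrightarrow> True"
| "in_class CD M \<longleftrightarrow> surj_model M"
| "in_class IL_eq M \<longleftrightarrow> True"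
| "in_class CD_eq M \<longleftrightarrow> surj_model M"
| "in_class In_eq M \<longleftrightarrow> inj_model M"
| "in_class Bi_eq M \<longleftrightarrow> inj_model M \<and> surj_model M"

text \<open>
  The operation \<open>\<boxplus>\<close> of a standard logic is \<open>\<oplus>\<close>, read within the class of models of that logic: a
  member of \<open>(M, w) \<oplus> (cs / as)\<close> may shrink domains outside of \<open>[M, w]\<close> and thereby lose surjectivity.
\<close>

definition std_logic :: "stil \<Rightarrow> ('u, 'u fm) logic" where
  "std_logic K =
     \<lparr>Str = (\<lambda>\<Theta>. {(M, w). is_model \<Theta> M \<and> w \<in> wlds M \<and> in_class K M}),
      Sen = (\<lambda>\<Theta>. {\<phi>. fm_over (has_eq K) \<Theta> \<phi> \<and> fv \<phi> = {}}),
      Sat = (\<lambda>M w \<phi>. \<forall>s. (\<forall>x. s x \<in> dmn M w) \<longrightarrow> holds M w s \<phi>),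
      Bpl = (\<lambda>M w cs as. {N \<in> oplus M w cs as. in_class K N})\<rparr>"


section \<open>Asimulations\<close>

definition fresh_consts :: "'u signature \<Rightarrow> nat \<Rightarrow> 'u" where
  "fresh_consts \<Theta> = (SOME c. inj c \<and> range c \<inter> csts \<Theta> = {})"

definition atomic :: "'u fm \<Rightarrow> bool" where
  "atomic \<phi> \<longleftrightarrow> (\<exists>P ts. \<phi> = Atom P ts) \<or> (\<exists>s t. \<phi> = Eq s t)"

definition asimulation :: "stil \<Rightarrow> 'u kmodel \<Rightarrow> 'u \<Rightarrow> 'u list \<Rightarrow> 'u kmodel \<Rightarrow> 'u \<Rightarrow> 'u list \<Rightarrow>
    ('u \<times> 'u list \<Rightarrow> 'u \<times> 'u list \<Rightarrow> bool) \<Rightarrow> bool" where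
  "asimulation K M1 w1 as M2 w2 bs A \<longleftrightarrow>
     (\<forall>w \<alpha> v \<beta>. A (w, \<alpha>) (v, \<beta>) \<longrightarrow> length \<alpha> = length \<beta> \<and>
        (\<exists>(Mi, Mj)\<in>{(M1, M2), (M2, M1)}.
           w \<in> wlds Mi \<and> \<alpha> \<in> lists (elems Mi) \<and> v \<in> wlds Mj \<and> \<beta> \<in> lists (elems Mj))) \<and>
     A (w1, as) (w2, bs) \<and>
     (\<forall>(Mi, Mj)\<in>{(M1, M2), (M2, M1)}. \<forall>w \<alpha> v \<beta>.
        A (w, \<alpha>) (v, \<beta>) \<and> w \<in> wlds Mi \<and> v \<in> wlds Mj \<and>
        \<alpha> \<in> lists (dmn Mi w) \<and> \<beta> \<in> lists (dmn Mj v) \<longrightarrow>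
        \<comment> \<open>atom\<close>
        (let cs = map (fresh_consts (sgn M1)) [0..<length \<alpha>] in
           \<forall>\<phi>\<in>Sen (std_logic K) (add_consts (sgn M1) cs). atomic \<phi> \<longrightarrow>
             Sat (std_logic K) (cone_exp Mi w cs \<alpha>) w \<phi> \<longrightarrow>
             Sat (std_logic K) (cone_exp Mj v cs \<beta>) v \<phi>) \<and>
        \<comment> \<open>s-back\<close>
        (\<forall>t. (v, t) \<in> acc Mj \<longrightarrow> (\<exists>u. (w, u) \<in> acc Mi \<and>
           A (u, map (hom Mi w u) \<alpha>) (t, map (hom Mj v t) \<beta>) \<and>
           A (t, map (hom Mj v t) \<beta>) (u, map (hom Mi w u) \<alpha>))) \<and>
        \<comment> \<open>obj-forth\<close>
        (\<forall>a\<in>dmn Mi w. \<exists>b\<in>dmn Mj v. A (w, \<alpha> @ [a]) (v, \<beta> @ [b])) \<and>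
        \<comment> \<open>obj-back\<close>
        (\<forall>t. (v, t) \<in> acc Mj \<longrightarrow> (\<forall>b\<in>dmn Mj t. \<exists>u. (w, u) \<in> acc Mi \<and> (\<exists>a\<in>dmn Mi u.
           A (u, map (hom Mi w u) \<alpha> @ [a]) (t, map (hom Mj v t) \<beta> @ [b])))))"

definition preserved_under_asimulations :: "stil \<Rightarrow> ('u, 's) logic \<Rightarrow> bool" where
  "preserved_under_asimulations K L \<longleftrightarrow> (\<forall>\<Theta> M1 w1 M2 w2.
     is_sig \<Theta> \<and> (M1, w1) \<in> Str L \<Theta> \<and> (M2, w2) \<in> Str L \<Theta> \<and>
     (\<exists>A. asimulation K M1 w1 [] M2 w2 [] A) \<longrightarrow>
     (\<forall>\<phi>\<in>Sen L \<Theta>. Sat L M1 w1 \<phi> \<longrightarrow> Sat L M2 w2 \<phi>))"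

end

theory Submission
  imports Defs "HOL-Library.Countable_Set"
begin

text \<open>
  If a sentence \<open>\<phi>\<close> of \<open>L\<close> with finite signature were not equivalent to a standard sentence,
  compactness would give pointed models \<open>(M1, w1)\<close> of \<open>\<phi>\<close> and \<open>(M2, w2)\<close> of its failure such that every
  standard sentence true at \<open>w1\<close> is true at \<open>w2\<close>. If both models realise enough types, inclusion of
  standard types is an asimulation between them, which contradicts preservation.

  It remains to pass to such saturated models without changing the \<open>L\<close>-theory. Bounded morphisms are
  asimulations, so a model may be replaced by its tree unravelling. The elementary diagram of a tree \<open>M\<close>
  can be expressed in \<open>L\<close> at the root: for every world \<open>v\<close> one adds letters for ``above \<open>v\<close>'' and ``not
  below \<open>v\<close>'', which together pin down \<open>v\<close>, and for every element \<open>a\<close> a letter for the images of \<open>a\<close>.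
  Further letters name the world and element that realise a given type. A model \<open>N\<close> of finitely
  satisfiable conditions of this kind exists by compactness, and \<open>M\<close> embeds in the unravelling of \<open>N\<close>
  by recursion along the tree; this is an \<open>L\<close>-elementary extension of \<open>M\<close> that realises all types
  finitely satisfiable in \<open>M\<close>. The Tarski Union Property allows one to iterate this \<open>\<omega>\<close> times.
\<close>


section \<open>Small sets\<close>

text \<open>The sentences of \<open>L\<close> are a black box, and the expansions over which its
  quantifiers range are chosen by \<open>L\<close>. Preservation removes this freedom: it makes
  \<open>L\<close> persistent and blind to everything outside the cone of a world, so that one
  canonical expansion can stand for all of them. There is no classical negation, so a diagram can
  only consist of rules stating that one formula implies another at all worlds. This is why worlds
  carry a marker for not being below them: its refutation at a world plays the part of a negation,
  and rules with it as conclusion express the existence of worlds and witnesses. A single sentence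
  has to be refuted at the root; all other refutations come from rules. Trees are needed because the
  image of a world is found above the image of a predecessor, which must therefore be unique. Finite
  signatures suffice by the occurrence condition; they make the formulas countable, so that there
  are few types, and they leave letters of large arity free for markers.\<close>

lemma lepoll_total: "A \<lesssim> B \<or> B \<lesssim> A"
  using ordLeq_total[OF card_of_Well_order[of A] card_of_Well_order[of B]]
  unfolding lepoll_def by (auto simp flip: card_of_ordLeq)

text \<open>The set \<U> is \<open>UNIV\<close> under a name: as a parameter it ties the type
  variable of the universe to the locale, so that \<open>tiny\<close> can compare sets of other
  types, such as lists, formulas and requests, with the universe.\<close>

locale universe =
  fixes \<U> :: "'u set"
  assumes \<U>_UNIV: "\<U> = UNIV"
    and set_universe: "set_universe TYPE('u)"
begin

abbreviation tiny :: "'a set \<Rightarrow> bool" where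
  "tiny X \<equiv> X \<prec> \<U>"

lemma small_iff_tiny: "small (X :: 'u set) \<longleftrightarrow> tiny X"
  by (simp add: small_def \<U>_UNIV)

lemma tiny_Pow_nat: "tiny (UNIV :: nat set set)"
  using set_universe unfolding set_universe_def \<U>_UNIV by blast

lemma small_UN: "small (X :: 'u set) \<Longrightarrow> (\<And>x. x \<in> X \<Longrightarrow> small (F x :: 'u set)) \<Longrightarrow> small (\<Union>x\<in>X. F x)"
  using set_universe unfolding set_universe_def by blast

lemma tiny_lepoll: "X \<lesssim> Y \<Longrightarrow> tiny Y \<Longrightarrow> tiny X"
  by (rule lesspoll_trans1)

lemma tiny_image: "tiny X \<Longrightarrow> tiny (f ` X)"
  by (rule tiny_lepoll[OF image_lepoll])

lemma tiny_subset: "tiny Y \<Longrightarrow> X \<subseteq> Y \<Longrightarrow> tiny X"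
  by (rule tiny_lepoll[OF subset_imp_lepoll])

lemma tiny_imp_inj: "tiny X \<Longrightarrow> \<exists>f :: _ \<Rightarrow> 'u. inj_on f X"
  using lesspoll_imp_lepoll unfolding lepoll_def by blast

lemma tiny_inj_image: "inj_on f X \<Longrightarrow> tiny (f ` X) \<longleftrightarrow> tiny X"
  using tiny_image inj_on_image_eqpoll_self[of f X] eq_lesspoll_trans eqpoll_sym by blast

lemma tiny_countable:
  assumes "countable X" shows "tiny X"
proof -
  have "X \<lesssim> (UNIV :: nat set set)"
    using assms inj_on_to_nat_on[of X] unfolding lepoll_def
    by (auto intro!: exI[of _ "\<lambda>x. {to_nat_on X x}"] simp: inj_on_def)
  then show ?thesis using tiny_Pow_nat by (rule tiny_lepoll)
qed

lemma tiny_Pow_countable: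
  assumes "countable X" shows "tiny (Pow X)"
proof -
  have "Pow X \<lesssim> (UNIV :: nat set set)"
    using inj_on_image_Pow[OF inj_on_to_nat_on[OF assms]] unfolding lepoll_def by blast
  then show ?thesis using tiny_Pow_nat by (rule tiny_lepoll)
qed

lemma infinite_universe: "infinite (UNIV :: 'u set)"
proof
  assume fin: "finite (UNIV :: 'u set)"
  have "(UNIV :: nat set) \<lesssim> (UNIV :: 'u set)"
    using tiny_countable[of "UNIV :: nat set"] lesspoll_imp_lepoll \<U>_UNIV by blast
  with fin show False unfolding lepoll_def using finite_subset[OF _ fin] finite_imageD infinite_UNIV_nat by blast
qed

section \<open>Pairs, sums and lists coded in the universe\<close>

lemma ex_pairing: "\<exists>p :: 'u \<times> 'u \<Rightarrow> 'u. inj p"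
proof -
  have "ordLeq3 (card_of (UNIV :: ('u \<times> 'u) set)) (card_of (UNIV :: 'u set))"
    using card_of_Times_same_infinite[OF infinite_universe] by (simp add: ordIso_iff_ordLeq)
  then show ?thesis unfolding card_of_ordLeq[symmetric] by blast
qed

definition pairing :: "'u \<times> 'u \<Rightarrow> 'u" where "pairing = (SOME p. inj p)"

lemma inj_pairing: "inj pairing"
  unfolding pairing_def using ex_pairing by (rule someI_ex)

lemma pairing_eq [simp]: "pairing p = pairing q \<longleftrightarrow> p = q"
  by (rule inj_eq[OF inj_pairing])

text \<open>The regularity axiom speaks of subsets of the universe only. Pairing the codes of both
  components moves the sum there, where it is the union of its coded fibres over the coded index
  set.\<close>

lemma tiny_Sigma:
  assumes "tiny X" "\<And>x. x \<in> X \<Longrightarrow> tiny (F x)"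
  shows "tiny (Sigma X F)"
proof -
  obtain f :: "_ \<Rightarrow> 'u" where f: "inj_on f X" using tiny_imp_inj[OF assms(1)] by blast
  have "\<forall>x\<in>X. \<exists>g :: _ \<Rightarrow> 'u. inj_on g (F x)" using tiny_imp_inj assms(2) by blast
  then obtain g :: "_ \<Rightarrow> _ \<Rightarrow> 'u" where g: "\<And>x. x \<in> X \<Longrightarrow> inj_on (g x) (F x)" by metis
  let ?e = "\<lambda>(x, y). pairing (f x, g x y)"
  have inj: "inj_on ?e (Sigma X F)"
    using f g by (auto simp: inj_on_def)
  have "?e ` Sigma X F = (\<Union>z\<in>f ` X. (\<lambda>y. pairing (z, g (the_inv_into X f z) y)) ` F (the_inv_into X f z))"
    using f by (force simp: the_inv_into_f_f)
  also have "small \<dots>"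
    by (rule small_UN) (use assms f in \<open>auto simp: small_iff_tiny the_inv_into_f_f intro!: tiny_image\<close>)
  finally show ?thesis using inj by (simp add: tiny_inj_image small_iff_tiny)
qed

lemma tiny_UN:
  assumes "tiny X" "\<And>x. x \<in> X \<Longrightarrow> tiny (F x)"
  shows "tiny (\<Union>x\<in>X. F x)"
proof -
  have "(\<Union>x\<in>X. F x) = snd ` Sigma X F" by force
  then show ?thesis using tiny_image[OF tiny_Sigma[OF assms]] by simp
qed

lemma tiny_finite: "finite X \<Longrightarrow> tiny X"
  by (simp add: tiny_countable countable_finite)

lemma tiny_Un:
  assumes "tiny X" "tiny Y" shows "tiny (X \<union> Y)"
proof -
  have "tiny (\<Union>b\<in>{False, True}. if b then X else Y)"
    by (rule tiny_UN) (use assms in \<open>auto simp: tiny_finite\<close>)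
  then show ?thesis by (simp add: Un_commute)
qed

text \<open>The lists of one length are tiny by induction on the length, and countable unions of
  tiny sets are tiny.\<close>

lemma tiny_lists:
  assumes "tiny X" shows "tiny (lists X)"
proof -
  have "tiny {xs \<in> lists X. length xs = n}" for n
  proof (induction n)
    case 0
    then show ?case by (rule tiny_subset[of "{[]}"]) (auto simp: tiny_finite)
  next
    case (Suc n)
    have "{xs \<in> lists X. length xs = Suc n} \<subseteq> case_prod (#) ` (X \<times> {xs \<in> lists X. length xs = n})"
      by (force simp: length_Suc_conv)
    then show ?case by (rule tiny_subset[rotated]) (intro tiny_image tiny_Sigma assms Suc)
  qed
  then have "tiny (\<Union>n. {xs \<in> lists X. length xs = n})"
    by (intro tiny_UN tiny_countable[of UNIV]) auto
  then show ?thesis by (rule tiny_subset) auto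
qed

text \<open>The complement of a small set is not tiny, since otherwise the universe would be the
  union of two tiny sets. As cardinals are comparable, it has room for every tiny set.\<close>

lemma ex_fresh_inj:
  assumes "tiny X" "small (S :: 'u set)"
  shows "\<exists>f :: _ \<Rightarrow> 'u. inj_on f X \<and> f ` X \<inter> S = {}"
proof -
  have "\<not> (UNIV - S) \<lesssim> X"
  proof
    assume "UNIV - S \<lesssim> X"
    then have "tiny (UNIV - S)" using assms(1) by (rule tiny_lepoll)
    then have "tiny ((UNIV - S) \<union> S)" using assms(2) unfolding small_iff_tiny by (rule tiny_Un)
    then show False by (simp add: lesspoll_def \<U>_UNIV)
  qed
  then have "X \<lesssim> UNIV - S" using lepoll_total by blast
  then show ?thesis unfolding lepoll_def by blast
qed

text \<open>Serves to rename a model into which another one is embedded, so that the embedding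
  becomes an inclusion: images go back to their originals, and all other elements of
  \<open>X\<close> get names outside \<open>Y\<close>.\<close>

lemma ex_inj_extending_inverse:
  assumes "small (X :: 'u set)" "small (Y :: 'u set)" "inj_on e Y" "e ` Y \<subseteq> X"
  shows "\<exists>g :: 'u \<Rightarrow> 'u. inj_on g X \<and> (\<forall>y\<in>Y. g (e y) = y)"
proof -
  obtain f :: "'u \<Rightarrow> 'u" where f: "inj_on f X" "f ` X \<inter> Y = {}"
    using ex_fresh_inj[of X Y] assms by (auto simp: small_iff_tiny)
  let ?g = "\<lambda>x. if x \<in> e ` Y then the_inv_into Y e x else f x"
  have "inj_on ?g X"
  proof (rule inj_onI)
    fix x y assume xy: "x \<in> X" "y \<in> X" "?g x = ?g y"
    have "?g z \<in> Y \<longleftrightarrow> z \<in> e ` Y" if "z \<in> X" for z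
      using that f(2) assms(3) by (auto simp: the_inv_into_f_f)
    then have "x \<in> e ` Y \<longleftrightarrow> y \<in> e ` Y" using xy by metis
    then show "x = y" using xy f(1) assms(3) by (auto simp: the_inv_into_f_f inj_on_def split: if_splits)
  qed
  then show ?thesis using assms(3) by (intro exI[of _ ?g]) (auto simp: the_inv_into_f_f)
qed

text \<open>The choice in \<open>fresh_consts\<close> succeeds because the constants of a signature
  form a small set and countable sets are tiny.\<close>

lemma fresh_consts_props:
  assumes "is_sig (\<Theta> :: 'u signature)"
  shows "inj (fresh_consts \<Theta>)" "fresh_consts \<Theta> i \<notin> csts \<Theta>"
proof -
  have "\<exists>c :: nat \<Rightarrow> 'u. inj_on c UNIV \<and> range c \<inter> csts \<Theta> = {}"
    using assms by (intro ex_fresh_inj tiny_countable) (simp_all add: is_sig_def)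
  then have "inj (fresh_consts \<Theta>) \<and> range (fresh_consts \<Theta>) \<inter> csts \<Theta> = {}"
    unfolding fresh_consts_def by (rule someI_ex)
  then show "inj (fresh_consts \<Theta>)" "fresh_consts \<Theta> i \<notin> csts \<Theta>" by auto
qed

lemma is_sig_add_consts:
  assumes "is_sig (\<Theta> :: 'u signature)" shows "is_sig (add_consts \<Theta> cs)"
proof -
  have "tiny (csts \<Theta>)" using assms unfolding is_sig_def small_iff_tiny by blast
  then have "small (csts \<Theta> \<union> set cs)" unfolding small_iff_tiny by (rule tiny_Un) (rule tiny_finite, rule finite_set)
  with assms show ?thesis by (simp add: is_sig_def add_consts_def)
qed

end

section \<open>Formulas and bounded morphisms\<close>

lemma is_modelD:
  assumes "is_model \<Theta> M"
  shows model_sgn: "sgn M = \<Theta>"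
    and model_wlds_nonempty: "wlds M \<noteq> {}"
    and model_small_wlds: "small (wlds M)"
    and model_acc_wlds: "\<And>w v. (w, v) \<in> acc M \<Longrightarrow> w \<in> wlds M \<and> v \<in> wlds M"
    and model_acc_refl: "\<And>w. w \<in> wlds M \<Longrightarrow> (w, w) \<in> acc M"
    and model_acc_trans: "\<And>w v u. (w, v) \<in> acc M \<Longrightarrow> (v, u) \<in> acc M \<Longrightarrow> (w, u) \<in> acc M"
    and model_acc_antisym: "\<And>w v. (w, v) \<in> acc M \<Longrightarrow> (v, w) \<in> acc M \<Longrightarrow> w = v"
    and model_dmn_nonempty: "\<And>w. w \<in> wlds M \<Longrightarrow> dmn M w \<noteq> {}"
    and model_small_dmn: "\<And>w. w \<in> wlds M \<Longrightarrow> small (dmn M w)"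
    and model_dmn_out: "\<And>w. w \<notin> wlds M \<Longrightarrow> dmn M w = {}"
    and model_dmn_disjoint: "\<And>w v a. a \<in> dmn M w \<Longrightarrow> a \<in> dmn M v \<Longrightarrow> w = v"
    and model_pint: "\<And>w P as. as \<in> pint M w P \<Longrightarrow> set as \<subseteq> dmn M w \<and> P \<in> preds \<Theta> (length as)"
    and model_cint: "\<And>w c. w \<in> wlds M \<Longrightarrow> c \<in> csts \<Theta> \<Longrightarrow> cint M w c \<in> dmn M w"
    and model_cint_ext: "\<And>w c. w \<in> wlds M \<Longrightarrow> c \<notin> csts \<Theta> \<Longrightarrow> cint M w c = undefined"
    and model_cint_out: "\<And>w. w \<notin> wlds M \<Longrightarrow> cint M w = (\<lambda>_. undefined)"
    and model_hom: "\<And>w v a. (w, v) \<in> acc M \<Longrightarrow> a \<in> dmn M w \<Longrightarrow> hom M w v a \<in> dmn M v"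
    and model_hom_ext: "\<And>w v a. a \<notin> dmn M w \<Longrightarrow> hom M w v a = undefined"
    and model_hom_out: "\<And>w v. (w, v) \<notin> acc M \<Longrightarrow> hom M w v = (\<lambda>_. undefined)"
    and model_pint_hom: "\<And>w v P as. (w, v) \<in> acc M \<Longrightarrow> as \<in> pint M w P \<Longrightarrow> map (hom M w v) as \<in> pint M v P"
    and model_cint_hom: "\<And>w v c. (w, v) \<in> acc M \<Longrightarrow> c \<in> csts \<Theta> \<Longrightarrow> hom M w v (cint M w c) = cint M v c"
    and model_hom_id: "\<And>w a. a \<in> dmn M w \<Longrightarrow> hom M w w a = a"
    and model_hom_comp: "\<And>w v u a. (w, v) \<in> acc M \<Longrightarrow> (v, u) \<in> acc M \<Longrightarrow> a \<in> dmn M w \<Longrightarrow>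
      hom M v u (hom M w v a) = hom M w u a"
proof -
  note m = assms[unfolded is_model_def]
  have po: "partial_order_on (wlds M) (acc M)" using m by (elim conjE)
  show "sgn M = \<Theta>" using m by (elim conjE)
  show "wlds M \<noteq> {}" using m by (elim conjE)
  show "small (wlds M)" using m by (elim conjE)
  show "\<And>w v. (w, v) \<in> acc M \<Longrightarrow> w \<in> wlds M \<and> v \<in> wlds M"
    using po by (auto simp: partial_order_on_def preorder_on_def)
  show "\<And>w. w \<in> wlds M \<Longrightarrow> (w, w) \<in> acc M"
    using po by (auto simp: partial_order_on_def preorder_on_def refl_on_def)
  show "\<And>w v u. (w, v) \<in> acc M \<Longrightarrow> (v, u) \<in> acc M \<Longrightarrow> (w, u) \<in> acc M"
    using po by (auto simp: partial_order_on_def preorder_on_def elim: transE)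
  show "\<And>w v. (w, v) \<in> acc M \<Longrightarrow> (v, w) \<in> acc M \<Longrightarrow> w = v"
    using po by (auto simp: partial_order_on_def antisym_def)
  have dmn: "\<forall>w\<in>wlds M. dmn M w \<noteq> {} \<and> small (dmn M w)" using m by (elim conjE)
  show "\<And>w. w \<in> wlds M \<Longrightarrow> dmn M w \<noteq> {}" using dmn by blast
  show "\<And>w. w \<in> wlds M \<Longrightarrow> small (dmn M w)" using dmn by blast
  have out: "\<forall>w. w \<notin> wlds M \<longrightarrow> dmn M w = {}" using m by (elim conjE)
  then show "\<And>w. w \<notin> wlds M \<Longrightarrow> dmn M w = {}" by blast
  have "\<forall>w\<in>wlds M. \<forall>v\<in>wlds M. w \<noteq> v \<longrightarrow> dmn M w \<inter> dmn M v = {}" using m by (elim conjE)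
  then show "\<And>w v a. a \<in> dmn M w \<Longrightarrow> a \<in> dmn M v \<Longrightarrow> w = v" using out by blast
  have "\<forall>w P. \<forall>as\<in>pint M w P. set as \<subseteq> dmn M w \<and> P \<in> preds \<Theta> (length as)" using m by (elim conjE)
  then show "\<And>w P as. as \<in> pint M w P \<Longrightarrow> set as \<subseteq> dmn M w \<and> P \<in> preds \<Theta> (length as)" by blast
  have c: "\<forall>w\<in>wlds M. cint M w \<in> csts \<Theta> \<rightarrow>\<^sub>E dmn M w" using m by (elim conjE)
  then show "\<And>w c. w \<in> wlds M \<Longrightarrow> c \<in> csts \<Theta> \<Longrightarrow> cint M w c \<in> dmn M w" by blast
  show "\<And>w c. w \<in> wlds M \<Longrightarrow> c \<notin> csts \<Theta> \<Longrightarrow> cint M w c = undefined" using c by (blast dest: PiE_arb)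
  have "\<forall>w. w \<notin> wlds M \<longrightarrow> cint M w = (\<lambda>_. undefined)" using m by (elim conjE)
  then show "\<And>w. w \<notin> wlds M \<Longrightarrow> cint M w = (\<lambda>_. undefined)" by blast
  have h: "\<forall>w v. (w, v) \<in> acc M \<longrightarrow>
        hom M w v \<in> dmn M w \<rightarrow>\<^sub>E dmn M v \<and>
        (\<forall>P. \<forall>as\<in>pint M w P. map (hom M w v) as \<in> pint M v P) \<and>
        (\<forall>c\<in>csts \<Theta>. cint M v c = hom M w v (cint M w c))" using m by (elim conjE)
  then show "\<And>w v a. (w, v) \<in> acc M \<Longrightarrow> a \<in> dmn M w \<Longrightarrow> hom M w v a \<in> dmn M v" by blast
  have h2: "\<forall>w v. (w, v) \<notin> acc M \<longrightarrow> hom M w v = (\<lambda>_. undefined)" using m by (elim conjE)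
  then show "\<And>w v. (w, v) \<notin> acc M \<Longrightarrow> hom M w v = (\<lambda>_. undefined)" by blast
  show "\<And>w v a. a \<notin> dmn M w \<Longrightarrow> hom M w v a = undefined"
    using h h2 by (metis PiE_arb)
  show "\<And>w v P as. (w, v) \<in> acc M \<Longrightarrow> as \<in> pint M w P \<Longrightarrow> map (hom M w v) as \<in> pint M v P"
    using h by blast
  show "\<And>w v c. (w, v) \<in> acc M \<Longrightarrow> c \<in> csts \<Theta> \<Longrightarrow> hom M w v (cint M w c) = cint M v c"
    using h by metis
  have "\<forall>w\<in>wlds M. \<forall>a\<in>dmn M w. hom M w w a = a" using m by (elim conjE)
  then show "\<And>w a. a \<in> dmn M w \<Longrightarrow> hom M w w a = a" using out by blast
  have "\<forall>w v u. (w, v) \<in> acc M \<longrightarrow> (v, u) \<in> acc M \<longrightarrow>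
        (\<forall>a\<in>dmn M w. hom M w u a = hom M v u (hom M w v a))" using m by (elim conjE)
  then show "\<And>w v u a. (w, v) \<in> acc M \<Longrightarrow> (v, u) \<in> acc M \<Longrightarrow> a \<in> dmn M w \<Longrightarrow>
      hom M v u (hom M w v a) = hom M w u a" by metis
qed

lemma (in universe) small_elems:
  assumes "is_model \<Theta> (M :: 'u kmodel)" shows "small (elems M)"
  unfolding elems_def using is_modelD[OF assms] by (intro small_UN)

lemma model_dmn_wlds: "is_model \<Theta> M \<Longrightarrow> a \<in> dmn M w \<Longrightarrow> w \<in> wlds M"
  using model_dmn_out by fastforce

section \<open>Dependence on the assignment, and persistence\<close>

lemma holds_cong:
  "(\<And>x. x \<in> fv \<phi> \<Longrightarrow> s x = s' x) \<Longrightarrow> holds M w s \<phi> \<longleftrightarrow> holds M w s' \<phi>"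
proof (induction \<phi> arbitrary: w s s')
  case (Atom P ts)
  have "tm_val M w s t = tm_val M w s' t" if "t \<in> set ts" for t
    using Atom that by (cases t) force+
  then show ?case by (simp cong: map_cong)
next
  case (Eq t1 t2)
  then show ?case by (cases t1; cases t2) auto
next
  case (Imp \<phi> \<psi>)
  have "holds M v (hom M w v \<circ> s) \<phi> = holds M v (hom M w v \<circ> s') \<phi>"
    "holds M v (hom M w v \<circ> s) \<psi> = holds M v (hom M w v \<circ> s') \<psi>" for v
    using Imp.prems by (auto intro!: Imp.IH)
  then show ?case by simp
next
  case (All x \<phi>)
  have "holds M v ((hom M w v \<circ> s)(x := a)) \<phi> = holds M v ((hom M w v \<circ> s')(x := a)) \<phi>" for v a
    using All.prems by (auto intro!: All.IH)
  then show ?case by simp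
next
  case (Ex x \<phi>)
  have "holds M w (s(x := a)) \<phi> = holds M w (s'(x := a)) \<phi>" for a
    using Ex.prems by (auto intro!: Ex.IH)
  then show ?case by simp
next
  case (And \<phi> \<psi>)
  then show ?case by (metis UnCI fv.simps(4) holds.simps(4))
next
  case (Or \<phi> \<psi>)
  then show ?case by (metis UnCI fv.simps(5) holds.simps(5))
qed simp

lemma tm_val_hom:
  assumes "is_model \<Theta> M" "(w, v) \<in> acc M" "tm_over \<Theta> t"
  shows "hom M w v (tm_val M w s t) = tm_val M v (hom M w v \<circ> s) t"
  using assms by (cases t) (auto simp: model_cint_hom)

text \<open>Only the values of free variables are required to be elements of the world. In this way
  \<open>nth\<close> of a tuple, which is unspecified beyond its length, can serve as an
  assignment.\<close>

lemma holds_persistent: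
  assumes M: "is_model \<Theta> M"
  shows "fm_over q \<Theta> \<phi> \<Longrightarrow> (w, v) \<in> acc M \<Longrightarrow> (\<And>x. x \<in> fv \<phi> \<Longrightarrow> s x \<in> dmn M w) \<Longrightarrow>
    holds M w s \<phi> \<Longrightarrow> holds M v (hom M w v \<circ> s) \<phi>"
proof (induction \<phi> arbitrary: w v s)
  case (Atom P ts)
  then have "map (hom M w v) (map (tm_val M w s) ts) \<in> pint M v P"
    by (intro model_pint_hom[OF M]) auto
  moreover have "map (hom M w v) (map (tm_val M w s) ts) = map (tm_val M v (hom M w v \<circ> s)) ts"
    using Atom.prems tm_val_hom[OF M] by auto
  ultimately show ?case by (metis holds.simps(2))
next
  case (Eq t1 t2)
  then show ?case using tm_val_hom[OF M] by (metis fm_over.simps(3) holds.simps(3))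
next
  case (And \<phi> \<psi>)
  then show ?case by auto
next
  case (Or \<phi> \<psi>)
  then show ?case by auto
next
  case (Imp \<phi> \<psi>)
  have eq: "holds M u (hom M v u \<circ> (hom M w v \<circ> s)) \<chi> = holds M u (hom M w u \<circ> s) \<chi>"
    if "(v, u) \<in> acc M" "fv \<chi> \<subseteq> fv (Imp \<phi> \<psi>)" for u \<chi>
    using that Imp.prems by (intro holds_cong) (auto simp: model_hom_comp[OF M])
  show ?case using Imp.prems eq model_acc_trans[OF M] by (auto simp del: o_apply)
next
  case (All x \<phi>)
  have eq: "holds M u ((hom M v u \<circ> (hom M w v \<circ> s))(x := a)) \<phi> = holds M u ((hom M w u \<circ> s)(x := a)) \<phi>"
    if "(v, u) \<in> acc M" for u a
    using that All.prems by (intro holds_cong) (auto simp: model_hom_comp[OF M])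
  show ?case using All.prems eq model_acc_trans[OF M] by (auto simp del: o_apply)
next
  case (Ex x \<phi>)
  then obtain a where a: "a \<in> dmn M w" "holds M w (s(x := a)) \<phi>" by auto
  have "holds M v (hom M w v \<circ> s(x := a)) \<phi>"
    by (rule Ex.IH[OF _ _ _ a(2)]) (use Ex.prems a in auto)
  moreover have "hom M w v \<circ> s(x := a) = (hom M w v \<circ> s)(x := hom M w v a)" by auto
  ultimately show ?case using model_hom[OF M _ a(1)] Ex.prems(2) by (metis holds.simps(8))
qed simp

text \<open>Bounded morphisms; only the part of \<open>M\<close> above \<open>w\<close> matters.\<close>

definition covers :: "bool \<Rightarrow> 'u signature \<Rightarrow> ('u \<Rightarrow> 'u) \<Rightarrow> ('u \<Rightarrow> 'u) \<Rightarrow> 'u kmodel \<Rightarrow> 'u \<Rightarrow> 'u kmodel \<Rightarrow> bool" where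
  "covers q \<Theta> p e M w N \<longleftrightarrow> (\<forall>v. (w, v) \<in> acc M \<longrightarrow>
     p v \<in> wlds N \<and>
     (\<forall>t. (p v, t) \<in> acc N \<longleftrightarrow> (\<exists>u. (v, u) \<in> acc M \<and> p u = t)) \<and>
     e ` dmn M v = dmn N (p v) \<and> (q \<longrightarrow> inj_on e (dmn M v)) \<and>
     (\<forall>P as. set as \<subseteq> dmn M v \<and> P \<in> preds \<Theta> (length as) \<longrightarrow> (as \<in> pint M v P \<longleftrightarrow> map e as \<in> pint N (p v) P)) \<and>
     (\<forall>c\<in>csts \<Theta>. cint M v c \<in> dmn M v \<and> e (cint M v c) = cint N (p v) c) \<and>
     (\<forall>u. (v, u) \<in> acc M \<longrightarrow> (\<forall>a\<in>dmn M v. e (hom M v u a) = hom N (p v) (p u) (e a))))"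

lemma coversD:
  assumes "covers q \<Theta> p e M w N" "(w, v) \<in> acc M"
  shows covers_wlds: "p v \<in> wlds N"
    and covers_forth: "\<And>u. (v, u) \<in> acc M \<Longrightarrow> (p v, p u) \<in> acc N"
    and covers_back: "\<And>t. (p v, t) \<in> acc N \<Longrightarrow> \<exists>u. (v, u) \<in> acc M \<and> p u = t"
    and covers_dmn: "e ` dmn M v = dmn N (p v)"
    and covers_inj: "q \<Longrightarrow> inj_on e (dmn M v)"
    and covers_pint: "\<And>P as. set as \<subseteq> dmn M v \<Longrightarrow> P \<in> preds \<Theta> (length as) \<Longrightarrow> as \<in> pint M v P \<longleftrightarrow> map e as \<in> pint N (p v) P"
    and covers_cint: "\<And>c. c \<in> csts \<Theta> \<Longrightarrow> cint M v c \<in> dmn M v \<and> e (cint M v c) = cint N (p v) c"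
    and covers_hom: "\<And>u a. (v, u) \<in> acc M \<Longrightarrow> a \<in> dmn M v \<Longrightarrow> e (hom M v u a) = hom N (p v) (p u) (e a)"
  using assms by (auto simp: covers_def)

lemma covers_tm_val:
  assumes "covers q \<Theta> p e M w N" "(w, v) \<in> acc M" "tm_over \<Theta> t" "\<And>x. x \<in> tm_vars t \<Longrightarrow> s x \<in> dmn M v"
  shows "tm_val M v s t \<in> dmn M v" "e (tm_val M v s t) = tm_val N (p v) (e \<circ> s) t"
  using assms covers_cint[OF assms(1,2)] by (cases t; auto)+

text \<open>The usual invariance under bounded morphisms: the back condition on worlds treats
  implication and universal quantification, surjectivity on domains treats both quantifiers.
  Injectivity of \<open>e\<close> settles equations and is therefore demanded only in languages with
  equality.\<close>

lemma covers_holds: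
  assumes M: "is_model \<Theta>\<^sub>M M" and cov: "covers q \<Theta> p e M w N"
  shows "fm_over q \<Theta> \<phi> \<Longrightarrow> (w, v) \<in> acc M \<Longrightarrow> (\<And>x. x \<in> fv \<phi> \<Longrightarrow> s x \<in> dmn M v) \<Longrightarrow>
    holds M v s \<phi> \<longleftrightarrow> holds N (p v) (e \<circ> s) \<phi>"
proof (induction \<phi> arbitrary: v s)
  case (Atom P ts)
  have "set (map (tm_val M v s) ts) \<subseteq> dmn M v"
    using Atom.prems by (auto intro!: covers_tm_val(1)[OF cov])
  moreover have "map e (map (tm_val M v s) ts) = map (tm_val N (p v) (e \<circ> s)) ts"
    using Atom.prems by (auto intro!: covers_tm_val(2)[OF cov])
  ultimately show ?case using covers_pint[OF cov Atom.prems(2)] Atom.prems(1) by (metis holds.simps(2) fm_over.simps(2) length_map)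
next
  case (Eq t1 t2)
  then have q: "q" and in_dmn: "tm_val M v s t1 \<in> dmn M v" "tm_val M v s t2 \<in> dmn M v"
    using covers_tm_val(1)[OF cov] by auto
  have "e (tm_val M v s t1) = tm_val N (p v) (e \<circ> s) t1" "e (tm_val M v s t2) = tm_val N (p v) (e \<circ> s) t2"
    using Eq.prems by (auto intro!: covers_tm_val(2)[OF cov])
  then show ?case using covers_inj[OF cov Eq.prems(2) q] in_dmn by (metis holds.simps(3) inj_onD)
next
  case (And \<phi> \<psi>)
  then show ?case by simp
next
  case (Or \<phi> \<psi>)
  then show ?case by simp
next
  case (Imp \<phi> \<psi>)
  have eq: "holds M u (hom M v u \<circ> s) \<chi> \<longleftrightarrow> holds N (p u) (hom N (p v) (p u) \<circ> (e \<circ> s)) \<chi>"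
    if u: "(v, u) \<in> acc M" and \<chi>: "\<chi> = \<phi> \<or> \<chi> = \<psi>" for u \<chi>
  proof -
    have "holds M u (hom M v u \<circ> s) \<chi> \<longleftrightarrow> holds N (p u) (e \<circ> (hom M v u \<circ> s)) \<chi>"
      using \<chi> Imp.prems model_acc_trans[OF M Imp.prems(2) u] model_hom[OF M u]
      by (elim disjE; hypsubst; intro Imp.IH) auto
    also have "\<dots> \<longleftrightarrow> holds N (p u) (hom N (p v) (p u) \<circ> (e \<circ> s)) \<chi>"
      using \<chi> Imp.prems u by (intro holds_cong) (auto simp: covers_hom[OF cov])
    finally show ?thesis .
  qed
  show ?case
  proof
    assume L: "holds M v s (Imp \<phi> \<psi>)"
    show "holds N (p v) (e \<circ> s) (Imp \<phi> \<psi>)"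
      unfolding holds.simps
    proof (intro allI impI)
      fix t assume t: "(p v, t) \<in> acc N" "holds N t (hom N (p v) t \<circ> (e \<circ> s)) \<phi>"
      then obtain u where "(v, u) \<in> acc M" "p u = t" using covers_back[OF cov Imp.prems(2)] by blast
      then show "holds N t (hom N (p v) t \<circ> (e \<circ> s)) \<psi>" using L t eq by (auto simp del: o_apply)
    qed
  next
    assume "holds N (p v) (e \<circ> s) (Imp \<phi> \<psi>)"
    then show "holds M v s (Imp \<phi> \<psi>)"
      using eq covers_forth[OF cov Imp.prems(2)] by (auto simp del: o_apply)
  qed
next
  case (All x \<phi>)
  have eq: "holds M u ((hom M v u \<circ> s)(x := a)) \<phi> \<longleftrightarrow> holds N (p u) ((hom N (p v) (p u) \<circ> (e \<circ> s))(x := e a)) \<phi>"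
    if u: "(v, u) \<in> acc M" and a: "a \<in> dmn M u" for u a
  proof -
    have "holds M u ((hom M v u \<circ> s)(x := a)) \<phi> \<longleftrightarrow> holds N (p u) (e \<circ> ((hom M v u \<circ> s)(x := a))) \<phi>"
      using a All.prems model_acc_trans[OF M All.prems(2) u] model_hom[OF M u] by (intro All.IH) auto
    also have "\<dots> \<longleftrightarrow> holds N (p u) ((hom N (p v) (p u) \<circ> (e \<circ> s))(x := e a)) \<phi>"
      using All.prems u by (intro holds_cong) (auto simp: covers_hom[OF cov])
    finally show ?thesis .
  qed
  have dm: "dmn N (p u) = e ` dmn M u" if "(v, u) \<in> acc M" for u
    using covers_dmn[OF cov] model_acc_trans[OF M All.prems(2) that] by blast
  show ?case
  proof
    assume L: "holds M v s (All x \<phi>)"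
    show "holds N (p v) (e \<circ> s) (All x \<phi>)"
      unfolding holds.simps
    proof (intro allI impI ballI)
      fix t b assume t: "(p v, t) \<in> acc N" and b: "b \<in> dmn N t"
      then obtain u where u: "(v, u) \<in> acc M" "p u = t" using covers_back[OF cov All.prems(2)] by blast
      then obtain a where "a \<in> dmn M u" "b = e a" using b dm by auto
      then show "holds N t ((hom N (p v) t \<circ> (e \<circ> s))(x := b)) \<phi>" using L u eq by (auto simp del: o_apply)
    qed
  next
    assume "holds N (p v) (e \<circ> s) (All x \<phi>)"
    then show "holds M v s (All x \<phi>)"
      using eq covers_forth[OF cov All.prems(2)] dm by (auto simp del: o_apply)
  qed
next
  case (Ex x \<phi>)
  have eq: "holds M v (s(x := a)) \<phi> \<longleftrightarrow> holds N (p v) ((e \<circ> s)(x := e a)) \<phi>" if a: "a \<in> dmn M v" for a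
  proof -
    have "holds M v (s(x := a)) \<phi> \<longleftrightarrow> holds N (p v) (e \<circ> (s(x := a))) \<phi>"
      using a Ex.prems by (intro Ex.IH) auto
    also have "e \<circ> (s(x := a)) = (e \<circ> s)(x := e a)" by auto
    finally show ?thesis .
  qed
  have "holds M v s (Ex x \<phi>) \<longleftrightarrow> (\<exists>a\<in>dmn M v. holds N (p v) ((e \<circ> s)(x := e a)) \<phi>)"
    using eq by auto
  also have "\<dots> \<longleftrightarrow> (\<exists>b\<in>e ` dmn M v. holds N (p v) ((e \<circ> s)(x := b)) \<phi>)" by blast
  finally show ?case using covers_dmn[OF cov Ex.prems(2)] by (metis holds.simps(8))
qed simp

section \<open>Substitution of constants for variables\<close>

fun inst_tm :: "(nat \<Rightarrow> 'u option) \<Rightarrow> 'u tm \<Rightarrow> 'u tm" where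
  "inst_tm \<sigma> (Var x) = (case \<sigma> x of None \<Rightarrow> Var x | Some c \<Rightarrow> Cst c)"
| "inst_tm \<sigma> (Cst c) = Cst c"

fun inst :: "(nat \<Rightarrow> 'u option) \<Rightarrow> 'u fm \<Rightarrow> 'u fm" where
  "inst \<sigma> Bot = Bot"
| "inst \<sigma> (Atom P ts) = Atom P (map (inst_tm \<sigma>) ts)"
| "inst \<sigma> (Eq s t) = Eq (inst_tm \<sigma> s) (inst_tm \<sigma> t)"
| "inst \<sigma> (And \<phi> \<psi>) = And (inst \<sigma> \<phi>) (inst \<sigma> \<psi>)"
| "inst \<sigma> (Or \<phi> \<psi>) = Or (inst \<sigma> \<phi>) (inst \<sigma> \<psi>)"
| "inst \<sigma> (Imp \<phi> \<psi>) = Imp (inst \<sigma> \<phi>) (inst \<sigma> \<psi>)"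
| "inst \<sigma> (All x \<phi>) = All x (inst (\<sigma>(x := None)) \<phi>)"
| "inst \<sigma> (Ex x \<phi>) = Ex x (inst (\<sigma>(x := None)) \<phi>)"

lemma fv_inst_tm: "tm_vars (inst_tm \<sigma> t) = tm_vars t - dom \<sigma>"
  by (cases t) (auto split: option.splits)

lemma fv_inst: "fv (inst \<sigma> \<phi>) = fv \<phi> - dom \<sigma>"
  by (induction \<phi> arbitrary: \<sigma>) (auto simp: fv_inst_tm split: if_splits)

lemma tm_over_inst: "tm_over \<Theta> t \<Longrightarrow> ran \<sigma> \<subseteq> set cs \<Longrightarrow> tm_over (add_consts \<Theta> cs) (inst_tm \<sigma> t)"
  by (cases t) (auto simp: add_consts_def ran_def split: option.splits)

lemma ran_upd_None: "ran (\<sigma>(x := None)) \<subseteq> ran \<sigma>"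
  by (auto simp: ran_def)

lemma fm_over_inst: "fm_over q \<Theta> \<phi> \<Longrightarrow> ran \<sigma> \<subseteq> set cs \<Longrightarrow> fm_over q (add_consts \<Theta> cs) (inst \<sigma> \<phi>)"
proof (induction \<phi> arbitrary: \<sigma>)
  case (Atom P ts)
  then have "\<forall>t\<in>set ts. tm_over (add_consts \<Theta> cs) (inst_tm \<sigma> t)"
    by (auto intro!: tm_over_inst)
  with Atom show ?case by (auto simp: add_consts_def)
next
  case (All x \<phi>)
  then show ?case using ran_upd_None[of \<sigma> x] by fastforce
next
  case (Ex x \<phi>)
  then show ?case using ran_upd_None[of \<sigma> x] by fastforce
qed (use tm_over_inst in auto)

definition inst_asg :: "'u kmodel \<Rightarrow> 'u \<Rightarrow> (nat \<Rightarrow> 'u option) \<Rightarrow> (nat \<Rightarrow> 'u) \<Rightarrow> nat \<Rightarrow> 'u" where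
  "inst_asg M w \<sigma> s x = (case \<sigma> x of None \<Rightarrow> s x | Some c \<Rightarrow> cint M w c)"

lemma tm_val_inst: "tm_val M w s (inst_tm \<sigma> t) = tm_val M w (inst_asg M w \<sigma> s) t"
  by (cases t) (auto simp: inst_asg_def split: option.splits)

text \<open>Homomorphisms preserve constants, so moving an assignment to a later world commutes with
  replacing variables by constants. This is what the cases of implication and universal
  quantification rest on.\<close>

lemma holds_inst:
  assumes M: "is_model \<Theta> M"
  shows "ran \<sigma> \<subseteq> csts \<Theta> \<Longrightarrow> holds M w s (inst \<sigma> \<phi>) \<longleftrightarrow> holds M w (inst_asg M w \<sigma> s) \<phi>"
proof (induction \<phi> arbitrary: w s \<sigma>)
  case (Atom P ts)
  then show ?case by (simp add: tm_val_inst comp_def)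
next
  case (Imp \<phi> \<psi>)
  have "inst_asg M v \<sigma> (hom M w v \<circ> s) = hom M w v \<circ> inst_asg M w \<sigma> s" if "(w, v) \<in> acc M" for v
    using that Imp.prems model_cint_hom[OF M that] by (auto simp: inst_asg_def ran_def fun_eq_iff split: option.splits)
  then show ?case using Imp by (simp del: o_apply)
next
  case (All x \<phi>)
  have "inst_asg M v (\<sigma>(x := None)) ((hom M w v \<circ> s)(x := a)) = (hom M w v \<circ> inst_asg M w \<sigma> s)(x := a)" if "(w, v) \<in> acc M" for v a
    using that All.prems model_cint_hom[OF M that] by (auto simp: inst_asg_def ran_def fun_eq_iff split: option.splits)
  moreover have "ran (\<sigma>(x := None)) \<subseteq> csts \<Theta>" using All.prems ran_upd_None[of \<sigma> x] by blast
  ultimately show ?case unfolding inst.simps holds.simps by (metis (no_types, lifting) All.IH)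
next
  case (Ex x \<phi>)
  have "inst_asg M w (\<sigma>(x := None)) (s(x := a)) = (inst_asg M w \<sigma> s)(x := a)" for a
    by (auto simp: inst_asg_def fun_eq_iff split: option.splits)
  moreover have "ran (\<sigma>(x := None)) \<subseteq> csts \<Theta>" using Ex.prems ran_upd_None[of \<sigma> x] by blast
  ultimately show ?case unfolding inst.simps holds.simps by (metis (no_types, lifting) Ex.IH)
qed (auto simp: tm_val_inst)

section \<open>Finite conjunctions, disjunctions and universal closures\<close>

fun BigAnd :: "'u fm list \<Rightarrow> 'u fm" where
  "BigAnd [] = Imp Bot Bot"
| "BigAnd (\<phi> # \<phi>s) = And \<phi> (BigAnd \<phi>s)"

fun BigOr :: "'u fm list \<Rightarrow> 'u fm" where
  "BigOr [] = Bot"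
| "BigOr (\<phi> # \<phi>s) = Or \<phi> (BigOr \<phi>s)"

lemma holds_BigAnd [simp]: "holds M w s (BigAnd \<phi>s) \<longleftrightarrow> (\<forall>\<phi>\<in>set \<phi>s. holds M w s \<phi>)"
  by (induction \<phi>s) auto

lemma holds_BigOr [simp]: "holds M w s (BigOr \<phi>s) \<longleftrightarrow> (\<exists>\<phi>\<in>set \<phi>s. holds M w s \<phi>)"
  by (induction \<phi>s) auto

lemma fv_BigAnd [simp]: "fv (BigAnd \<phi>s) = (\<Union>\<phi>\<in>set \<phi>s. fv \<phi>)"
  by (induction \<phi>s) auto

lemma fv_BigOr [simp]: "fv (BigOr \<phi>s) = (\<Union>\<phi>\<in>set \<phi>s. fv \<phi>)"
  by (induction \<phi>s) auto

lemma fm_over_BigAnd [simp]: "fm_over q \<Theta> (BigAnd \<phi>s) \<longleftrightarrow> (\<forall>\<phi>\<in>set \<phi>s. fm_over q \<Theta> \<phi>)"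
  by (induction \<phi>s) auto

lemma fm_over_BigOr [simp]: "fm_over q \<Theta> (BigOr \<phi>s) \<longleftrightarrow> (\<forall>\<phi>\<in>set \<phi>s. fm_over q \<Theta> \<phi>)"
  by (induction \<phi>s) auto

fun AllUpto :: "nat \<Rightarrow> 'u fm \<Rightarrow> 'u fm" where
  "AllUpto 0 \<phi> = \<phi>"
| "AllUpto (Suc k) \<phi> = AllUpto k (All k \<phi>)"

lemma fv_AllUpto: "fv (AllUpto k \<phi>) = fv \<phi> - {..<k}"
  by (induction k arbitrary: \<phi>) auto

lemma fm_over_AllUpto [simp]: "fm_over q \<Theta> (AllUpto k \<phi>) \<longleftrightarrow> fm_over q \<Theta> \<phi>"
  by (induction k arbitrary: \<phi>) auto

lemma holds_AllUpto:
  assumes M: "is_model \<Theta> M" and over: "fm_over q \<Theta> \<phi>"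
  shows "fv \<phi> \<subseteq> {..<k} \<Longrightarrow> w \<in> wlds M \<Longrightarrow> holds M w s (AllUpto k \<phi>) \<longleftrightarrow>
    (\<forall>v s'. (w, v) \<in> acc M \<longrightarrow> (\<forall>x<k. s' x \<in> dmn M v) \<longrightarrow> holds M v s' \<phi>)"
proof -
  \<comment> \<open>For the induction the matrix may have free variables beyond the block; their
    values are carried along to \<open>v\<close>. The case \<open>k = 0\<close> is persistence
    together with reflexivity.\<close>
  have gen: "(\<forall>x\<in>fv \<phi> - {..<k}. s x \<in> dmn M w) \<Longrightarrow> w \<in> wlds M \<Longrightarrow> fm_over q \<Theta> \<phi> \<Longrightarrow> holds M w s (AllUpto k \<phi>) \<longleftrightarrow>
    (\<forall>v s'. (w, v) \<in> acc M \<longrightarrow> (\<forall>x<k. s' x \<in> dmn M v) \<longrightarrow>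
       holds M v (\<lambda>x. if x < k then s' x else hom M w v (s x)) \<phi>)" for \<phi> w s
  proof (induction k arbitrary: \<phi>)
    case 0
    have "holds M w s \<phi> \<Longrightarrow> (w, v) \<in> acc M \<Longrightarrow> holds M v (\<lambda>x. hom M w v (s x)) \<phi>" for v
      using 0 holds_persistent[OF M 0(3), of w v s] by (auto simp: comp_def)
    moreover have "holds M w (\<lambda>x. hom M w w (s x)) \<phi> = holds M w s \<phi>"
      using 0 by (intro holds_cong) (auto simp: model_hom_id[OF M])
    ultimately show ?case using model_acc_refl[OF M 0(2)] by auto
  next
    case (Suc k)
    have "holds M w s (AllUpto (Suc k) \<phi>) \<longleftrightarrow>
      (\<forall>v s'. (w, v) \<in> acc M \<longrightarrow> (\<forall>x<k. s' x \<in> dmn M v) \<longrightarrow>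
       holds M v (\<lambda>x. if x < k then s' x else hom M w v (s x)) (All k \<phi>))"
      using Suc.prems by (subst AllUpto.simps, subst Suc.IH) auto
    also have "\<dots> \<longleftrightarrow> (\<forall>v s'. (w, v) \<in> acc M \<longrightarrow> (\<forall>x<Suc k. s' x \<in> dmn M v) \<longrightarrow>
       holds M v (\<lambda>x. if x < Suc k then s' x else hom M w v (s x)) \<phi>)" (is "?L = ?R")
    proof
      assume L: ?L
      show ?R
      proof (intro allI impI)
        fix v s' assume v: "(w, v) \<in> acc M" and s': "\<forall>x<Suc k. s' x \<in> dmn M v"
        have vv: "(v, v) \<in> acc M" using model_acc_refl[OF M] model_acc_wlds[OF M v] by blast
        have "holds M v (\<lambda>x. if x < k then s' x else hom M w v (s x)) (All k \<phi>)" using L v s' by auto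
        then have *: "holds M v ((hom M v v \<circ> (\<lambda>x. if x < k then s' x else hom M w v (s x)))(k := s' k)) \<phi>"
          using vv s' by (auto simp del: o_apply)
        have "holds M v ((hom M v v \<circ> (\<lambda>x. if x < k then s' x else hom M w v (s x)))(k := s' k)) \<phi> = holds M v (\<lambda>x. if x < Suc k then s' x else hom M w v (s x)) \<phi>"
          using s' Suc.prems(1) v by (intro holds_cong) (auto simp: model_hom_id[OF M] model_hom[OF M])
        with * show "holds M v (\<lambda>x. if x < Suc k then s' x else hom M w v (s x)) \<phi>" by simp
      qed
    next
      assume R: ?R
      show ?L
        unfolding holds.simps
      proof (intro allI impI ballI)
        fix v s' u a assume v: "(w, v) \<in> acc M" and s': "\<forall>x<k. s' x \<in> dmn M v" and u: "(v, u) \<in> acc M" and a: "a \<in> dmn M u"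
        have *: "holds M u (\<lambda>x. if x < Suc k then ((hom M v u \<circ> s')(k := a)) x else hom M w u (s x)) \<phi>"
          using R[rule_format, of u "(hom M v u \<circ> s')(k := a)"] model_acc_trans[OF M v u] s' a model_hom[OF M u] by auto
        have "holds M u (\<lambda>x. if x < Suc k then ((hom M v u \<circ> s')(k := a)) x else hom M w u (s x)) \<phi> = holds M u ((hom M v u \<circ> (\<lambda>x. if x < k then s' x else hom M w v (s x)))(k := a)) \<phi>"
          using s' Suc.prems(1) u v by (intro holds_cong) (auto simp: model_hom_comp[OF M])
        with * show "holds M u ((hom M v u \<circ> (\<lambda>x. if x < k then s' x else hom M w v (s x)))(k := a)) \<phi>" by simp
      qed
    qed
    finally show ?case .
  qed
  assume fv: "fv \<phi> \<subseteq> {..<k}" and w: "w \<in> wlds M"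
  have "holds M v (\<lambda>x. if x < k then s' x else hom M w v (s x)) \<phi> = holds M v s' \<phi>" for v s'
    using fv by (intro holds_cong) auto
  moreover have "\<forall>x\<in>fv \<phi> - {..<k}. s x \<in> dmn M w" using fv by auto
  ultimately show ?thesis using gen[of \<phi> s w] w over by simp
qed

section \<open>Constructions of models\<close>

lemma is_modelI:
  assumes "sgn M = \<Theta>" "wlds M \<noteq> {}" "small (wlds M)" "partial_order_on (wlds M) (acc M)"
    and "\<And>w. w \<in> wlds M \<Longrightarrow> dmn M w \<noteq> {}" "\<And>w. w \<in> wlds M \<Longrightarrow> small (dmn M w)"
    and "\<And>w. w \<notin> wlds M \<Longrightarrow> dmn M w = {}"
    and "\<And>w v a. w \<in> wlds M \<Longrightarrow> v \<in> wlds M \<Longrightarrow> a \<in> dmn M w \<Longrightarrow> a \<in> dmn M v \<Longrightarrow> w = v"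
    and "\<And>w P as. as \<in> pint M w P \<Longrightarrow> set as \<subseteq> dmn M w"
    and "\<And>w P as. as \<in> pint M w P \<Longrightarrow> P \<in> preds \<Theta> (length as)"
    and "\<And>w c. w \<in> wlds M \<Longrightarrow> c \<in> csts \<Theta> \<Longrightarrow> cint M w c \<in> dmn M w"
    and "\<And>w c. w \<in> wlds M \<Longrightarrow> c \<notin> csts \<Theta> \<Longrightarrow> cint M w c = undefined"
    and "\<And>w. w \<notin> wlds M \<Longrightarrow> cint M w = (\<lambda>_. undefined)"
    and "\<And>w v a. (w, v) \<in> acc M \<Longrightarrow> a \<in> dmn M w \<Longrightarrow> hom M w v a \<in> dmn M v"
    and "\<And>w v a. (w, v) \<in> acc M \<Longrightarrow> a \<notin> dmn M w \<Longrightarrow> hom M w v a = undefined"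
    and "\<And>w v P as. (w, v) \<in> acc M \<Longrightarrow> as \<in> pint M w P \<Longrightarrow> map (hom M w v) as \<in> pint M v P"
    and "\<And>w v c. (w, v) \<in> acc M \<Longrightarrow> c \<in> csts \<Theta> \<Longrightarrow> hom M w v (cint M w c) = cint M v c"
    and "\<And>w v. (w, v) \<notin> acc M \<Longrightarrow> hom M w v = (\<lambda>_. undefined)"
    and "\<And>w a. w \<in> wlds M \<Longrightarrow> a \<in> dmn M w \<Longrightarrow> hom M w w a = a"
    and "\<And>w v u a. (w, v) \<in> acc M \<Longrightarrow> (v, u) \<in> acc M \<Longrightarrow> a \<in> dmn M w \<Longrightarrow>
      hom M v u (hom M w v a) = hom M w u a"
  shows "is_model \<Theta> M"
  unfolding is_model_def
proof (intro conjI allI ballI impI)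
  show "\<And>w v. w \<in> wlds M \<Longrightarrow> v \<in> wlds M \<Longrightarrow> w \<noteq> v \<Longrightarrow> dmn M w \<inter> dmn M v = {}"
    using assms(8) by blast
  show "\<And>w. w \<in> wlds M \<Longrightarrow> cint M w \<in> csts \<Theta> \<rightarrow>\<^sub>E dmn M w"
    using assms(11,12) by (intro PiE_I)
  show "\<And>w v. (w, v) \<in> acc M \<Longrightarrow> hom M w v \<in> dmn M w \<rightarrow>\<^sub>E dmn M v"
    using assms(14,15) by (intro PiE_I)
  show "\<And>w v c. (w, v) \<in> acc M \<Longrightarrow> c \<in> csts \<Theta> \<Longrightarrow> cint M v c = hom M w v (cint M w c)"
    using assms(17) by metis
  show "\<And>w v u a. (w, v) \<in> acc M \<Longrightarrow> (v, u) \<in> acc M \<Longrightarrow> a \<in> dmn M w \<Longrightarrow>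
      hom M w u a = hom M v u (hom M w v a)" using assms(20) by metis
qed (rule assms; assumption?)+

lemma partial_order_on_restrict:
  assumes "partial_order_on W R" "V \<subseteq> W"
  shows "partial_order_on V (R \<inter> V \<times> V)"
  using assms unfolding partial_order_on_def preorder_on_def refl_on_def trans_def antisym_def by blast

text \<open>A criterion for models that share the cone of \<open>w\<close>, as far as the symbols of
  \<Theta> are concerned. Comparisons of cones, expansions and reducts on the same worlds and
  elements go through it.\<close>

lemma covers_idI:
  assumes M: "is_model \<Theta>\<^sub>M M" and N: "is_model \<Theta>\<^sub>N N" and csts: "csts \<Theta> \<subseteq> csts \<Theta>\<^sub>M"
    and acc: "\<And>v u. (w, v) \<in> acc M \<Longrightarrow> (v, u) \<in> acc N \<longleftrightarrow> (v, u) \<in> acc M"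
    and dmn: "\<And>v. (w, v) \<in> acc M \<Longrightarrow> dmn N v = dmn M v"
    and pint: "\<And>v P as. (w, v) \<in> acc M \<Longrightarrow> P \<in> preds \<Theta> (length as) \<Longrightarrow> as \<in> pint N v P \<longleftrightarrow> as \<in> pint M v P"
    and cint: "\<And>v c. (w, v) \<in> acc M \<Longrightarrow> c \<in> csts \<Theta> \<Longrightarrow> cint N v c = cint M v c"
    and hom: "\<And>v u a. (w, v) \<in> acc M \<Longrightarrow> (v, u) \<in> acc M \<Longrightarrow> a \<in> dmn M v \<Longrightarrow> hom N v u a = hom M v u a"
  shows "covers q \<Theta> (\<lambda>x. x) (\<lambda>x. x) M w N"
  unfolding covers_def
proof (intro allI impI conjI)
  fix v assume v: "(w, v) \<in> acc M"
  show "v \<in> wlds N" using acc[OF v, of v] model_acc_refl[OF M] model_acc_wlds[OF M v] model_acc_wlds[OF N] by blast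
  show "inj_on (\<lambda>x. x) (dmn M v)" by simp
  have vM: "v \<in> wlds M" using model_acc_wlds[OF M v] by blast
  show "\<forall>c\<in>csts \<Theta>. cint M v c \<in> dmn M v \<and> cint M v c = cint N v c"
    using cint[OF v] csts model_cint[OF M vM] by auto
  show "\<forall>a\<in>dmn M v. hom M v u a = hom N v u a" if "(v, u) \<in> acc M" for u using hom[OF v that] by simp
  show "(v, t) \<in> acc N \<longleftrightarrow> (\<exists>u. (v, u) \<in> acc M \<and> u = t)" for t using acc[OF v] by blast
  show "(\<lambda>x. x) ` dmn M v = dmn N v" using dmn[OF v] by simp
  show "as \<in> pint M v P \<longleftrightarrow> map (\<lambda>x. x) as \<in> pint N v P"
    if "set as \<subseteq> dmn M v \<and> P \<in> preds \<Theta> (length as)" for P as using pint[OF v] that by simp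
qed

section \<open>Cones with named elements\<close>

lemma add_consts_simps [simp]:
  "preds (add_consts \<Theta> cs) = preds \<Theta>" "csts (add_consts \<Theta> cs) = csts \<Theta> \<union> set cs"
  by (simp_all add: add_consts_def)

lemma add_consts_add_consts: "add_consts (add_consts \<Theta> cs) ds = add_consts \<Theta> (cs @ ds)"
  by (simp add: add_consts_def Un_assoc)

lemma add_consts_Nil [simp]: "add_consts \<Theta> [] = \<Theta>"
  by (simp add: add_consts_def)

lemma cone_exp_simps [simp]:
  "sgn (cone_exp M w cs as) = add_consts (sgn M) cs"
  "wlds (cone_exp M w cs as) = {v. (w, v) \<in> acc M}"
  "(v, u) \<in> acc (cone_exp M w cs as) \<longleftrightarrow> (v, u) \<in> acc M \<and> (w, v) \<in> acc M \<and> (w, u) \<in> acc M"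
  "dmn (cone_exp M w cs as) v = (if (w, v) \<in> acc M then dmn M v else {})"
  "pint (cone_exp M w cs as) v = (if (w, v) \<in> acc M then pint M v else (\<lambda>_. {}))"
  "hom (cone_exp M w cs as) v u = (if (w, v) \<in> acc M \<and> (w, u) \<in> acc M then hom M v u else (\<lambda>_. undefined))"
  by (auto simp: cone_exp_def cone_def Let_def)

lemma cone_exp_acc: "acc (cone_exp M w cs as) = acc M \<inter> {v. (w, v) \<in> acc M} \<times> {v. (w, v) \<in> acc M}"
  by (auto simp: cone_exp_def cone_def Let_def)

lemma cone_exp_cint:
  assumes "(w, v) \<in> acc M"
  shows "cint (cone_exp M w cs as) v c = (case map_of (zip cs as) c of Some a \<Rightarrow> hom M w v a | None \<Rightarrow> cint M v c)"
  using assms by (simp add: cone_exp_def)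

lemma cone_exp_cint_old: "(w, v) \<in> acc M \<Longrightarrow> c \<notin> set cs \<Longrightarrow> cint (cone_exp M w cs as) v c = cint M v c"
  by (cases "map_of (zip cs as) c") (auto simp: cone_exp_cint dest!: map_of_SomeD set_zip_leftD)

lemma cone_exp_cint_new:
  assumes "(w, v) \<in> acc M" "length as = length cs" "distinct cs" "i < length cs"
  shows "cint (cone_exp M w cs as) v (cs ! i) = hom M w v (as ! i)"
  using assms by (simp add: cone_exp_cint map_of_zip_nth)

lemma name_tupleD:
  assumes "name_tuple M w cs as"
  shows "distinct cs" "set cs \<inter> csts (sgn M) = {}" "length as = length cs" "set as \<subseteq> dmn M w"
  using assms by (auto simp: name_tuple_def)

lemma cone_exp_model:
  assumes M: "is_model \<Theta> M" and w: "w \<in> wlds M" and nt: "name_tuple M w cs as"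
  shows "is_model (add_consts \<Theta> cs) (cone_exp M w cs as)"
proof -
  note nt' = name_tupleD[OF nt]
  let ?C = "cone_exp M w cs as"
  have new: "\<exists>i<length cs. c = cs ! i \<and> (\<forall>v. (w, v) \<in> acc M \<longrightarrow> cint ?C v c = hom M w v (as ! i)) \<and> as ! i \<in> dmn M w"
    if "c \<in> set cs" for c
  proof -
    obtain i where i: "i < length cs" "c = cs ! i" using \<open>c \<in> set cs\<close> by (metis in_set_conv_nth)
    moreover have "as ! i \<in> dmn M w" using i nt'(3,4) by (metis nth_mem subsetD)
    ultimately show ?thesis using cone_exp_cint_new[OF _ nt'(3,1)] by blast
  qed
  have old: "cint ?C v c = cint M v c" if "(w, v) \<in> acc M" "c \<notin> set cs" for v c
    using that by (rule cone_exp_cint_old)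
  note D = is_modelD[OF M]
  show ?thesis
  proof (rule is_modelI)
    show "wlds ?C \<noteq> {}" using D(5)[OF w] by auto
    have "wlds ?C \<subseteq> wlds M" using D(4) by auto
    then show "small (wlds ?C)"
      using D(3) unfolding small_def by (meson lesspoll_trans1 subset_imp_lepoll)
    have sub: "{v. (w, v) \<in> acc M} \<subseteq> wlds M" using D(4) by auto
    have "partial_order_on (wlds M) (acc M)" using M by (simp add: is_model_def)
    then show "partial_order_on (wlds ?C) (acc ?C)"
      unfolding cone_exp_acc cone_exp_simps(2) using sub by (rule partial_order_on_restrict)
    show "cint ?C v c \<in> dmn ?C v"
      if "v \<in> wlds ?C" "c \<in> csts (add_consts \<Theta> cs)" for v c
    proof (cases "c \<in> set cs")
      case True
      then show ?thesis using new[OF True] that D(16) by auto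
    next
      case False
      then show ?thesis using old[OF _ False] that D(13)[of v c] D(4) by auto
    qed
    show "cint ?C v c = undefined"
      if "v \<in> wlds ?C" "c \<notin> csts (add_consts \<Theta> cs)" for v c
      using that old D(14)[of v c] D(4) by auto
    show "hom ?C v u (cint ?C v c) = cint ?C u c"
      if vu: "(v, u) \<in> acc ?C" and c: "c \<in> csts (add_consts \<Theta> cs)" for v u c
    proof (cases "c \<in> set cs")
      case True
      then show ?thesis using new[OF True] vu D(22) by auto
    next
      case False
      then show ?thesis using old[OF _ False] c vu D(20) by auto
    qed
    show "\<And>v. v \<notin> wlds ?C \<Longrightarrow> cint ?C v = (\<lambda>_. undefined)"
      by (simp add: cone_exp_def cone_def Let_def)
  next
    fix v u assume "(v, u) \<notin> acc ?C"
    then show "hom ?C v u = (\<lambda>_. undefined)" using D(18)[of v u] by auto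
  next
    fix v assume "v \<in> wlds ?C"
    then have v: "(w, v) \<in> acc M" "v \<in> wlds M" using D(4) by auto
    show "dmn ?C v \<noteq> {}" "small (dmn ?C v)" using v D(8,9) by auto
    show "\<And>a. a \<in> dmn ?C v \<Longrightarrow> hom ?C v v a = a" using v D(21) by auto
  next
    fix v u a
    assume "a \<in> dmn ?C v" "a \<in> dmn ?C u"
    then show "v = u" using D(11)[of a v u] by (auto split: if_splits)
  next
    fix v P bs
    assume "bs \<in> pint ?C v P"
    then have v: "(w, v) \<in> acc M" "bs \<in> pint M v P" by (auto split: if_splits)
    show "set bs \<subseteq> dmn ?C v" "P \<in> preds (add_consts \<Theta> cs) (length bs)" using v D(12)[OF v(2)] by auto
    fix u assume "(v, u) \<in> acc ?C"
    then show "map (hom ?C v u) bs \<in> pint ?C u P" using v D(19)[of v u bs P] by simp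
  next
    fix v u a assume "(v, u) \<in> acc ?C"
    then have vu: "(v, u) \<in> acc M" "(w, v) \<in> acc M" "(w, u) \<in> acc M" by auto
    show "a \<in> dmn ?C v \<Longrightarrow> hom ?C v u a \<in> dmn ?C u"
      using vu D(16)[OF vu(1)] by simp
    show "a \<notin> dmn ?C v \<Longrightarrow> hom ?C v u a = undefined"
      using vu D(17) by simp
    fix t assume "(u, t) \<in> acc ?C" "a \<in> dmn ?C v"
    then show "hom ?C u t (hom ?C v u a) = hom ?C v t a"
      using vu D(22)[OF vu(1), of t a] by simp
  qed (simp_all add: D(1))
qed

lemma cone_exp_in_class: "in_class K M \<Longrightarrow> in_class K (cone_exp M w cs as)"
  by (cases K) (fastforce simp: inj_model_def surj_model_def)+

lemma cone_exp_covers_base: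
  assumes M: "is_model \<Theta> M" and w: "w \<in> wlds M" and nt: "name_tuple M w cs as"
  shows "covers q \<Theta> (\<lambda>x. x) (\<lambda>x. x) (cone_exp M w cs as) w M"
proof (rule covers_idI[OF cone_exp_model[OF assms] M])
  show "cint M v c = cint (cone_exp M w cs as) v c" if "(w, v) \<in> acc (cone_exp M w cs as)" "c \<in> csts \<Theta>" for v c
    using that name_tupleD(2)[OF nt] model_sgn[OF M] by (subst cone_exp_cint_old) auto
qed (use model_acc_trans[OF M] in auto)

lemma covers_cone_exp_Nil:
  assumes M: "is_model \<Theta> M" and w: "w \<in> wlds M"
  shows "covers q \<Theta> (\<lambda>x. x) (\<lambda>x. x) M w (cone_exp M w [] [])"
proof (rule covers_idI[OF M])
  show "is_model \<Theta> (cone_exp M w [] [])"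
    using cone_exp_model[OF M w, of "[]" "[]"] by (simp add: name_tuple_def)
qed (use model_acc_trans[OF M] in \<open>auto simp: cone_exp_cint_old\<close>)

lemma name_tuple_hom:
  assumes M: "is_model \<Theta> M" and vu: "(v, u) \<in> acc M" and nt: "name_tuple M v cs as"
  shows "name_tuple M u cs (map (hom M v u) as)"
  using nt model_hom[OF M vu] by (auto simp: name_tuple_def)

text \<open>Homomorphisms compose, so seen from a later world \<open>u\<close> the constants name
  the images of the tuple at \<open>u\<close>.\<close>

lemma cone_exp_covers_shift:
  assumes M: "is_model \<Theta> M" and vu: "(v, u) \<in> acc M" and nt: "name_tuple M v cs as"
  shows "covers q (add_consts \<Theta> cs) (\<lambda>x. x) (\<lambda>x. x) (cone_exp M v cs as) u (cone_exp M u cs (map (hom M v u) as))"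
proof -
  have v: "v \<in> wlds M" and u: "u \<in> wlds M" using model_acc_wlds[OF M vu] by auto
  note nt' = name_tupleD[OF nt]
  show ?thesis
  proof (rule covers_idI[OF cone_exp_model[OF M v nt] cone_exp_model[OF M u name_tuple_hom[OF M vu nt]]])
    fix t c assume t: "(u, t) \<in> acc (cone_exp M v cs as)" and c: "c \<in> csts (add_consts \<Theta> cs)"
    have t': "(v, t) \<in> acc M" "(u, t) \<in> acc M" using t by auto
    show "cint (cone_exp M u cs (map (hom M v u) as)) t c = cint (cone_exp M v cs as) t c"
    proof (cases "c \<in> set cs")
      case True
      then obtain i where i: "i < length cs" "c = cs ! i" by (metis in_set_conv_nth)
      have "as ! i \<in> dmn M v" using i nt'(3,4) by (metis nth_mem subsetD)
      then show ?thesis unfolding i(2) using i(1) t' nt' model_hom_comp[OF M vu t'(2)]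
        by (subst (1 2) cone_exp_cint_new) auto
    next
      case False
      then show ?thesis using t' by (simp add: cone_exp_cint_old)
    qed
  qed (use model_acc_trans[OF M] vu in auto)
qed

text \<open>Nested quantifiers name one element at \<open>v\<close> and the others at a later world
  \<open>u\<close>. From \<open>u\<close> on this amounts to a single expansion at
  \<open>u\<close>.\<close>

lemma cone_exp_covers_twice:
  assumes M: "is_model \<Theta> M" and vu: "(v, u) \<in> acc M" and a: "a \<in> dmn M v"
    and nt: "name_tuple M u (c # cs) (hom M v u a # as)"
  shows "covers q (add_consts \<Theta> (c # cs)) (\<lambda>x. x) (\<lambda>x. x)
    (cone_exp (cone_exp M v [c] [a]) u cs as) u (cone_exp M u (c # cs) (hom M v u a # as))"
proof -
  have v: "v \<in> wlds M" and u: "u \<in> wlds M" using model_acc_wlds[OF M vu] by auto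
  have nt1: "name_tuple M v [c] [a]" using nt a by (auto simp: name_tuple_def)
  have nt2: "name_tuple (cone_exp M v [c] [a]) u cs as" using nt vu by (auto simp: name_tuple_def)
  have u': "u \<in> wlds (cone_exp M v [c] [a])" using vu by simp
  show ?thesis
  proof (rule covers_idI[OF cone_exp_model[OF cone_exp_model[OF M v nt1] u' nt2] cone_exp_model[OF M u nt]])
    fix t d assume t: "(u, t) \<in> acc (cone_exp (cone_exp M v [c] [a]) u cs as)" and d: "d \<in> csts (add_consts \<Theta> (c # cs))"
    have t': "(v, t) \<in> acc M" "(u, t) \<in> acc M" using t by auto
    have t2: "(u, t) \<in> acc (cone_exp M v [c] [a])" using t' vu by auto
    have fresh: "c \<notin> set cs" using name_tupleD(1)[OF nt] by simp
    show "cint (cone_exp M u (c # cs) (hom M v u a # as)) t d = cint (cone_exp (cone_exp M v [c] [a]) u cs as) t d"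
      unfolding cone_exp_cint[OF t'(2)] cone_exp_cint[OF t2] cone_exp_cint[OF t'(1)]
      using vu t' fresh model_hom_comp[OF M vu t'(2) a]
      by (cases "map_of (zip cs as) d") (auto dest!: map_of_SomeD set_zip_leftD)
  qed (use model_acc_trans[OF M] vu in auto)
qed

text \<open>Members of \<open>oplus\<close> lie between the cone of \<open>w\<close> and
  \<open>M\<close>, so above \<open>w\<close> nothing is left to choose: domains, letters and
  homomorphisms are those of \<open>M\<close>, and the new constants are determined by their values
  at \<open>w\<close>.\<close>

lemma oplus_covers_cone_exp:
  assumes M: "is_model \<Theta> M" and w: "w \<in> wlds M" and nt: "name_tuple M w cs as"
    and N: "N \<in> oplus M w cs as"
  shows "covers q (add_consts \<Theta> cs) (\<lambda>x. x) (\<lambda>x. x) N w (cone_exp M w cs as)" "w \<in> wlds N"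
proof -
  note sg = model_sgn[OF M]
  note nt' = name_tupleD[OF nt]
  have Nm: "is_model (add_consts \<Theta> cs) N" and s1: "submodel (cone M w) (reduct N \<Theta>)"
    and s2: "submodel (reduct N \<Theta>) M" and cN: "map (cint N w) cs = as"
    using N by (auto simp: oplus_def sg)
  have cone: "wlds (cone M w) = {v. (w, v) \<in> acc M}" "\<And>v. (w, v) \<in> acc M \<Longrightarrow> dmn (cone M w) v = dmn M v"
    by (auto simp: cone_def Let_def)
  have red: "wlds (reduct N \<Theta>) = wlds N" "acc (reduct N \<Theta>) = acc N" "dmn (reduct N \<Theta>) = dmn N" "hom (reduct N \<Theta>) = hom N"
    "\<And>v c. c \<in> csts \<Theta> \<Longrightarrow> cint (reduct N \<Theta>) v c = cint N v c" "sgn (reduct N \<Theta>) = \<Theta>"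
    by (auto simp: reduct_def)
  have redp: "pint (reduct N \<Theta>) v P = pint N v P" for v P
    using model_pint[OF Nm] by (auto simp: reduct_def)
  have W: "v \<in> wlds N" if "(w, v) \<in> acc M" for v using that s1 cone(1) red(1) by (auto simp: submodel_def)
  show wN: "w \<in> wlds N" using W model_acc_refl[OF M w] by blast
  have accN: "acc N = acc M \<inter> wlds N \<times> wlds N" using s2 red by (simp add: submodel_def)
  have accw: "(w, v) \<in> acc N \<longleftrightarrow> (w, v) \<in> acc M" for v using accN W wN by blast
  have s2': "dmn N v \<subseteq> dmn M v" "pint N v P = pint M v P \<inter> lists (dmn N v)" "\<And>c. c \<in> csts \<Theta> \<Longrightarrow> cint N v c = cint M v c"
    if "v \<in> wlds N" for v P
    using s2 that red redp by (auto simp: submodel_def)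
  \<comment> \<open>The cone forces \<open>N\<close> to contain the whole domain, and
    \<open>M\<close> allows no more than that.\<close>
  have dm: "dmn N v = dmn M v" if "(w, v) \<in> acc M" for v
  proof
    show "dmn N v \<subseteq> dmn M v" using s2'(1) W that by blast
    show "dmn M v \<subseteq> dmn N v" using s1 cone that red by (auto simp: submodel_def)
  qed
  have hm: "hom N v u a = hom M v u a" if "(v, u) \<in> acc N" "a \<in> dmn N v" for v u a
    using s2 red that by (simp add: submodel_def)
  show "covers q (add_consts \<Theta> cs) (\<lambda>x. x) (\<lambda>x. x) N w (cone_exp M w cs as)"
  proof (rule covers_idI[OF Nm cone_exp_model[OF M w nt]])
    fix v c assume v: "(w, v) \<in> acc N" and c: "c \<in> csts (add_consts \<Theta> cs)"
    then have v': "(w, v) \<in> acc M" using accw by blast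
    show "cint (cone_exp M w cs as) v c = cint N v c"
    proof (cases "c \<in> set cs")
      case True
      then obtain i where i: "i < length cs" "c = cs ! i" by (metis in_set_conv_nth)
      have "cint N w c = as ! i" using cN i by auto
      moreover have "cint N v c = hom N w v (cint N w c)" using model_cint_hom[OF Nm v c] by simp
      moreover have "as ! i \<in> dmn N w" using i nt'(3,4) dm[OF model_acc_refl[OF M w]] by (metis nth_mem subsetD)
      ultimately show ?thesis using i nt' v' hm[OF v] by (simp add: cone_exp_cint_new)
    next
      case False
      then show ?thesis using c v' s2'(3)[OF W[OF v']] by (simp add: cone_exp_cint_old)
    qed
  next
    fix v P as' assume v: "(w, v) \<in> acc N"
    then have v': "(w, v) \<in> acc M" using accw by blast
    show "as' \<in> pint (cone_exp M w cs as) v P \<longleftrightarrow> as' \<in> pint N v P"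
      using s2'(2)[OF W[OF v']] dm[OF v'] v' model_pint[OF M, of as' v P] by auto
  next
    fix v u assume v: "(w, v) \<in> acc N"
    then have v': "(w, v) \<in> acc M" using accw by blast
    show "(v, u) \<in> acc (cone_exp M w cs as) \<longleftrightarrow> (v, u) \<in> acc N"
      using v' accN W model_acc_trans[OF M v', of u] by auto
    show "dmn (cone_exp M w cs as) v = dmn N v" using v' dm by simp
    fix a assume vu: "(v, u) \<in> acc N" and a: "a \<in> dmn N v"
    then have "(w, u) \<in> acc M" using model_acc_trans[OF M v'] accN by blast
    then show "hom (cone_exp M w cs as) v u a = hom N v u a" using hm[OF vu a] v' by simp
  qed simp
qed

text \<open>A model over the order \<open>R\<close> with fibres \<open>D\<close>, mapped to
  \<open>N\<close> by \<open>p\<close> on worlds and by \<open>e\<close> on elements. The letters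
  are read off in \<open>N\<close>, while constants and homomorphisms are lifted by hand as
  \<open>C\<close> and \<open>H\<close>. Isomorphic copies and unravellings both have this
  form.\<close>

definition pull :: "'u kmodel \<Rightarrow> 'u set \<Rightarrow> ('u \<times> 'u) set \<Rightarrow> ('u \<Rightarrow> 'u set) \<Rightarrow> ('u \<Rightarrow> 'u) \<Rightarrow> ('u \<Rightarrow> 'u) \<Rightarrow>
    ('u \<Rightarrow> 'u \<Rightarrow> 'u) \<Rightarrow> ('u \<Rightarrow> 'u \<Rightarrow> 'u \<Rightarrow> 'u) \<Rightarrow> 'u kmodel" where
  "pull N W R D p e C H = \<lparr>sgn = sgn N, wlds = W, acc = R, dmn = (\<lambda>v. if v \<in> W then D v else {}),
     pint = (\<lambda>v P. {as. v \<in> W \<and> set as \<subseteq> D v \<and> map e as \<in> pint N (p v) P}),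
     cint = (\<lambda>v. if v \<in> W then restrict (C v) (csts (sgn N)) else (\<lambda>_. undefined)),
     hom = (\<lambda>v u. if (v, u) \<in> R then restrict (H v u) (D v) else (\<lambda>_. undefined))\<rparr>"

lemma pull_model:
  assumes N: "is_model \<Theta> N" and W: "W \<noteq> {}" "small W" and R: "partial_order_on W R"
    and D: "\<And>v. v \<in> W \<Longrightarrow> D v \<noteq> {}" "\<And>v. v \<in> W \<Longrightarrow> small (D v)"
      "\<And>v u a. v \<in> W \<Longrightarrow> u \<in> W \<Longrightarrow> a \<in> D v \<Longrightarrow> a \<in> D u \<Longrightarrow> v = u"
    and p: "\<And>v u. (v, u) \<in> R \<Longrightarrow> (p v, p u) \<in> acc N"
    and C: "\<And>v c. v \<in> W \<Longrightarrow> c \<in> csts \<Theta> \<Longrightarrow> C v c \<in> D v"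
    and H: "\<And>v u a. (v, u) \<in> R \<Longrightarrow> a \<in> D v \<Longrightarrow> H v u a \<in> D u"
      "\<And>v u a. (v, u) \<in> R \<Longrightarrow> a \<in> D v \<Longrightarrow> e (H v u a) = hom N (p v) (p u) (e a)"
      "\<And>v a. v \<in> W \<Longrightarrow> a \<in> D v \<Longrightarrow> H v v a = a"
      "\<And>v u t a. (v, u) \<in> R \<Longrightarrow> (u, t) \<in> R \<Longrightarrow> a \<in> D v \<Longrightarrow> H u t (H v u a) = H v t a"
      "\<And>v u c. (v, u) \<in> R \<Longrightarrow> c \<in> csts \<Theta> \<Longrightarrow> H v u (C v c) = C u c"
  shows "is_model \<Theta> (pull N W R D p e C H)"
proof -
  have RW: "\<And>v u. (v, u) \<in> R \<Longrightarrow> v \<in> W \<and> u \<in> W"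
    using R by (auto simp: partial_order_on_def preorder_on_def)
  have Rrefl: "\<And>v. v \<in> W \<Longrightarrow> (v, v) \<in> R"
    using R by (auto simp: partial_order_on_def preorder_on_def refl_on_def)
  have Rtrans: "\<And>v u t. (v, u) \<in> R \<Longrightarrow> (u, t) \<in> R \<Longrightarrow> (v, t) \<in> R"
    using R by (auto simp: partial_order_on_def preorder_on_def elim: transE)
  note sg = model_sgn[OF N]
  let ?P = "pull N W R D p e C H"
  show ?thesis
  proof (rule is_modelI)
    fix v P as assume "as \<in> pint ?P v P"
    then show "P \<in> preds \<Theta> (length as)" using model_pint[OF N, of "map e as" "p v" P] by (simp add: pull_def)
  next
    fix v u P as assume vu: "(v, u) \<in> acc ?P" and as: "as \<in> pint ?P v P"
    have vu': "(v, u) \<in> R" using vu by (simp add: pull_def)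
    have as': "set as \<subseteq> D v" "map e as \<in> pint N (p v) P" using as by (auto simp: pull_def)
    have hm: "hom ?P v u a = H v u a" if "a \<in> D v" for a
      using that vu' by (simp add: pull_def)
    have eq: "map (hom ?P v u) as = map (H v u) as"
      using as'(1) hm by auto
    have "map e (map (H v u) as) = map (hom N (p v) (p u)) (map e as)"
      using as'(1) H(2)[OF vu'] by auto
    then have "map e (map (H v u) as) \<in> pint N (p u) P"
      using model_pint_hom[OF N p[OF vu'] as'(2)] by metis
    then show "map (hom ?P v u) as \<in> pint ?P u P"
      unfolding eq using as'(1) H(1)[OF vu'] RW[OF vu'] by (auto simp: pull_def)
  next
    fix v u t a assume vu: "(v, u) \<in> acc ?P" and ut: "(u, t) \<in> acc ?P"
      and a: "a \<in> dmn ?P v"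
    then have *: "(v, u) \<in> R" "(u, t) \<in> R" "a \<in> D v" by (auto simp: pull_def split: if_splits)
    show "hom ?P u t (hom ?P v u a) = hom ?P v t a"
      using * H(1,4)[OF *(1)] Rtrans[OF *(1,2)] by (simp add: pull_def)
  next
    fix v u c assume vu: "(v, u) \<in> acc ?P" and c: "c \<in> csts \<Theta>"
    then have *: "(v, u) \<in> R" "v \<in> W" "u \<in> W" using RW by (auto simp: pull_def)
    show "hom ?P v u (cint ?P v c) = cint ?P u c"
      using * H(5)[OF *(1) c] C[OF *(2) c] c by (simp add: pull_def sg)
  next
    fix v a assume "v \<in> wlds ?P" "a \<in> dmn ?P v"
    then show "hom ?P v v a = a" using H(3) Rrefl by (simp add: pull_def)
  next
    fix v u a assume "(v, u) \<in> acc ?P" "a \<in> dmn ?P v"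
    then show "hom ?P v u a \<in> dmn ?P u"
      using H(1)[of v u a] RW[of v u] by (simp add: pull_def)
  next
    fix v u a assume "(v, u) \<in> acc ?P" "a \<notin> dmn ?P v"
    then show "hom ?P v u a = undefined"
      using RW[of v u] by (simp add: pull_def)
  next
    fix v c assume "v \<in> wlds ?P" "c \<in> csts \<Theta>"
    then show "cint ?P v c \<in> dmn ?P v" using C by (simp add: pull_def sg)
  next
    fix v u a assume "v \<in> wlds ?P" "u \<in> wlds ?P"
       "a \<in> dmn ?P v" "a \<in> dmn ?P u"
    then show "v = u" using D(3)[of v u a] by (simp add: pull_def)
  qed (simp_all add: pull_def sg W R D)
qed

lemma pull_covers:
  assumes N: "is_model \<Theta> N" and P: "is_model \<Theta> (pull N W R D p e C H)"
    and p: "\<And>v u. (v, u) \<in> R \<Longrightarrow> (p v, p u) \<in> acc N"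
      "\<And>v t. v \<in> W \<Longrightarrow> (p v, t) \<in> acc N \<Longrightarrow> \<exists>u. (v, u) \<in> R \<and> p u = t"
    and e: "\<And>v. v \<in> W \<Longrightarrow> e ` D v = dmn N (p v)" "\<And>v. q \<Longrightarrow> v \<in> W \<Longrightarrow> inj_on e (D v)"
      "\<And>v c. v \<in> W \<Longrightarrow> c \<in> csts \<Theta> \<Longrightarrow> e (C v c) = cint N (p v) c"
      "\<And>v u a. (v, u) \<in> R \<Longrightarrow> a \<in> D v \<Longrightarrow> e (H v u a) = hom N (p v) (p u) (e a)"
  shows "covers q \<Theta> p e (pull N W R D p e C H) w N"
  unfolding covers_def
proof (intro allI impI conjI ballI)
  note sg = model_sgn[OF N]
  let ?P = "pull N W R D p e C H"
  fix v assume "(w, v) \<in> acc ?P"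
  then have v: "v \<in> W" "(w, v) \<in> R" using model_acc_wlds[OF P] by (auto simp: pull_def)
  have RW: "\<And>v u. (v, u) \<in> R \<Longrightarrow> v \<in> W \<and> u \<in> W" using model_acc_wlds[OF P] by (auto simp: pull_def)
  show "p v \<in> wlds N" using p(1)[OF v(2)] model_acc_wlds[OF N] by blast
  show "(p v, t) \<in> acc N \<longleftrightarrow> (\<exists>u. (v, u) \<in> acc ?P \<and> p u = t)" for t
    using p(1) p(2)[OF v(1)] by (auto simp: pull_def)
  show "as \<in> pint ?P v P \<longleftrightarrow> map e as \<in> pint N (p v) P"
    if "set as \<subseteq> dmn ?P v \<and> P \<in> preds \<Theta> (length as)" for P as
    using that v by (simp add: pull_def)
  show "cint ?P v c \<in> dmn ?P v" if "c \<in> csts \<Theta>" for c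
    using model_cint[OF P _ that] v by (simp add: pull_def)
  show "e (cint ?P v c) = cint N (p v) c" if "c \<in> csts \<Theta>" for c
    using that e(3) v by (simp add: pull_def sg)
  show "e ` dmn ?P v = dmn N (p v)" using e(1) v by (simp add: pull_def)
  show "inj_on e (dmn ?P v)" if q using e(2)[OF that] v by (simp add: pull_def)
  show "e (hom ?P v u a) = hom N (p v) (p u) (e a)"
    if "(v, u) \<in> acc ?P" "a \<in> dmn ?P v" for u a
    using e(4)[of v u a] that v by (simp add: pull_def)
qed

section \<open>Isomorphic copies\<close>

lemma model_isoD:
  assumes "model_iso g h M N"
  shows iso_sgn: "sgn M = sgn N"
    and iso_g: "bij_betw g (elems M) (elems N)"
    and iso_h: "bij_betw h (wlds M) (wlds N)"
    and iso_acc: "\<And>v u. v \<in> wlds M \<Longrightarrow> u \<in> wlds M \<Longrightarrow> (v, u) \<in> acc M \<longleftrightarrow> (h v, h u) \<in> acc N"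
    and iso_dmn: "\<And>v. v \<in> wlds M \<Longrightarrow> bij_betw g (dmn M v) (dmn N (h v))"
    and iso_pint: "\<And>v P as. v \<in> wlds M \<Longrightarrow> set as \<subseteq> dmn M v \<Longrightarrow> as \<in> pint M v P \<longleftrightarrow> map g as \<in> pint N (h v) P"
    and iso_cint: "\<And>v c. v \<in> wlds M \<Longrightarrow> c \<in> csts (sgn M) \<Longrightarrow> g (cint M v c) = cint N (h v) c"
    and iso_hom: "\<And>v u a. (v, u) \<in> acc M \<Longrightarrow> a \<in> dmn M v \<Longrightarrow> g (hom M v u a) = hom N (h v) (h u) (g a)"
  using assms by (simp_all add: model_iso_def in_lists_conv_set subset_iff)

lemma iso_covers:
  assumes M: "is_model \<Theta> M" and N: "is_model \<Theta> N" and iso: "model_iso g h M N"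
  shows "covers q \<Theta> h g M w N"
  unfolding covers_def
proof (intro allI impI conjI ballI)
  note I = model_isoD[OF iso]
  fix v assume "(w, v) \<in> acc M"
  then have v: "v \<in> wlds M" using model_acc_wlds[OF M] by blast
  show "h v \<in> wlds N" using v I(3) by (auto simp: bij_betw_def)
  show "(h v, t) \<in> acc N \<longleftrightarrow> (\<exists>u. (v, u) \<in> acc M \<and> h u = t)" for t
  proof
    assume t: "(h v, t) \<in> acc N"
    then obtain u where "u \<in> wlds M" "h u = t" using I(3) model_acc_wlds[OF N] by (metis bij_betw_imp_surj_on imageE)
    then show "\<exists>u. (v, u) \<in> acc M \<and> h u = t" using t I(4) v by blast
  qed (use I(4) v model_acc_wlds[OF M] in blast)
  show "g ` dmn M v = dmn N (h v)" "inj_on g (dmn M v)" using I(5)[OF v] by (auto simp: bij_betw_def)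
  show "as \<in> pint M v P \<longleftrightarrow> map g as \<in> pint N (h v) P" if "set as \<subseteq> dmn M v \<and> P \<in> preds \<Theta> (length as)" for P as
    using I(6)[OF v] that by blast
  show "cint M v c \<in> dmn M v" "g (cint M v c) = cint N (h v) c" if "c \<in> csts \<Theta>" for c
    using model_cint[OF M v that] I(7)[OF v] that model_sgn[OF M] by auto
  show "g (hom M v u a) = hom N (h v) (h u) (g a)" if "(v, u) \<in> acc M" "a \<in> dmn M v" for u a
    using I(8) that by blast
qed

text \<open>The copy is the pullback of \<open>M\<close> along the inverses of \<open>h\<close> and
  \<open>g\<close>.\<close>

lemma (in universe) ex_iso_copy:
  fixes M :: "'u kmodel"
  assumes M: "is_model \<Theta> M" and g: "inj_on g (elems M)" and h: "inj_on h (wlds M)"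
  shows "\<exists>N. is_model \<Theta> N \<and> model_iso g h M N"
proof -
  define h' where "h' = the_inv_into (wlds M) h"
  define g' where "g' = the_inv_into (elems M) g"
  have h': "h' (h v) = v" if "v \<in> wlds M" for v using that h by (simp add: h'_def the_inv_into_f_f)
  have g'0: "g' (g a) = a" if "a \<in> elems M" for a using that g by (simp add: g'_def the_inv_into_f_f)
  have el: "a \<in> elems M" if "a \<in> dmn M v" for a v using that model_dmn_wlds[OF M] by (auto simp: elems_def)
  have g': "g' (g a) = a" if "a \<in> dmn M v" for a v using that g'0 el by blast
  define R where "R = (\<lambda>(v, u). (h v, h u)) ` acc M"
  have RI: "(v, u) \<in> R \<longleftrightarrow> (\<exists>v0 u0. v = h v0 \<and> u = h u0 \<and> (v0, u0) \<in> acc M)" for v u by (auto simp: R_def)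
  note D = is_modelD[OF M]
  have hR: "(h v, h u) \<in> R \<longleftrightarrow> (v, u) \<in> acc M" if "v \<in> wlds M" "u \<in> wlds M" for v u
    unfolding RI using that h' D(4) by metis
  let ?N = "pull M (h ` wlds M) R (\<lambda>x. g ` dmn M (h' x)) h' g' (\<lambda>x c. g (cint M (h' x) c))
    (\<lambda>x y a. g (hom M (h' x) (h' y) (g' a)))"
  have po: "partial_order_on (h ` wlds M) R"
    unfolding partial_order_on_def preorder_on_def refl_on_def
  proof (intro conjI)
    show "trans R"
    proof (rule transI)
      fix x y z assume "(x, y) \<in> R" "(y, z) \<in> R"
      then obtain x0 y0 y1 z0 where *: "x = h x0" "y = h y0" "y = h y1" "z = h z0" "(x0, y0) \<in> acc M" "(y1, z0) \<in> acc M" unfolding RI by blast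
      then have "y0 = y1" using h' D(4) by metis
      then show "(x, z) \<in> R" using * D(6) RI by blast
    qed
    show "antisym R"
    proof (rule antisymI)
      fix x y assume "(x, y) \<in> R" "(y, x) \<in> R"
      then obtain x0 y0 y1 x1 where *: "x = h x0" "y = h y0" "y = h y1" "x = h x1" "(x0, y0) \<in> acc M" "(y1, x1) \<in> acc M" unfolding RI by blast
      then have "y0 = y1" "x0 = x1" using h' D(4) by metis+
      then show "x = y" using * D(7) by blast
    qed
    show "R \<subseteq> h ` wlds M \<times> h ` wlds M" using D(4) by (auto simp: RI)
    show "\<forall>x\<in>h ` wlds M. (x, x) \<in> R" using D(5) unfolding RI by blast
  qed
  have N: "is_model \<Theta> ?N"
  proof (rule pull_model[OF M _ _ po])
    show "h ` wlds M \<noteq> {}" using D(2) by simp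
    show "small (h ` wlds M)" using D(3) by (simp add: small_iff_tiny tiny_image)
    show "small (g ` dmn M (h' v))" if "v \<in> h ` wlds M" for v using that D(9) h' by (auto simp: small_iff_tiny intro!: tiny_image)
    show "v = u" if "v \<in> h ` wlds M" "u \<in> h ` wlds M" "a \<in> g ` dmn M (h' v)" "a \<in> g ` dmn M (h' u)" for v u a
      using that g' D(11) h' by (metis imageE)
    show "g ` dmn M (h' v) \<noteq> {}" if "v \<in> h ` wlds M" for v using that D(8) h' by auto
    show "g (cint M (h' v) c) \<in> g ` dmn M (h' v)" if "v \<in> h ` wlds M" "c \<in> csts \<Theta>" for v c
      using that D(13) h' by auto
    show "g (hom M (h' v) (h' v) (g' a)) = a" if "v \<in> h ` wlds M" "a \<in> g ` dmn M (h' v)" for v a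
      using that D(21) g' by auto
    fix v u assume "(v, u) \<in> R"
    then have vu: "(h' v, h' u) \<in> acc M" using RI D(4) h' by metis
    then show "(h' v, h' u) \<in> acc M" .
    show "g (hom M (h' v) (h' u) (g' (g (cint M (h' v) c)))) = g (cint M (h' u) c)" if "c \<in> csts \<Theta>" for c
      using D(20)[OF vu that] g' D(13)[OF _ that] D(4)[OF vu] by metis
    fix a assume "a \<in> g ` dmn M (h' v)"
    then obtain a0 where a0: "a = g a0" "a0 \<in> dmn M (h' v)" by blast
    note in_u = D(16)[OF vu a0(2)]
    show "g (hom M (h' v) (h' u) (g' a)) \<in> g ` dmn M (h' u)" using in_u a0 g' by simp
    show "g' (g (hom M (h' v) (h' u) (g' a))) = hom M (h' v) (h' u) (g' a)" using in_u a0 g' by simp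
    fix t assume "(u, t) \<in> R"
    then have ut: "(h' u, h' t) \<in> acc M" using RI D(4) h' by metis
    show "g (hom M (h' u) (h' t) (g' (g (hom M (h' v) (h' u) (g' a))))) = g (hom M (h' v) (h' t) (g' a))"
      using in_u a0 g' D(22)[OF vu ut a0(2)] by simp
  qed
  have "model_iso g h M ?N"
    unfolding model_iso_def
  proof (intro conjI allI impI ballI)
    have "elems ?N = g ` elems M" using h' by (auto simp: elems_def pull_def)
    then show "bij_betw g (elems M) (elems ?N)" using g by (simp add: bij_betw_def)
    show "bij_betw h (wlds M) (wlds ?N)" using h by (simp add: bij_betw_def pull_def)
    show "bij_betw g (dmn M v) (dmn ?N (h v))" if "v \<in> wlds M" for v
      using that h' g el by (auto simp: bij_betw_def pull_def intro: inj_on_subset)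
    show "as \<in> pint M v P \<longleftrightarrow> map g as \<in> pint ?N (h v) P" if v: "v \<in> wlds M" and as: "as \<in> lists (dmn M v)" for v P as
    proof -
      have "map g' (map g as) = as" using as g'[of _ v] by (auto simp: in_lists_conv_set intro: map_idI)
      then show ?thesis using v h'[OF v] as by (auto simp: pull_def in_lists_conv_set)
    qed
    show "g (hom M v u a) = hom ?N (h v) (h u) (g a)" if "(v, u) \<in> acc M" "a \<in> dmn M v" for v u a
      using that D(4)[OF that(1)] h' g' hR by (auto simp: pull_def)
  qed (use h' hR in \<open>auto simp: pull_def\<close>)
  then show ?thesis using N by blast
qed

section \<open>Invariance under asimulations\<close>

text \<open>\<open>Sat\<close> quantifies over all assignments into the domain. The truth of a
  sentence does not depend on them, and at least one exists because domains are nonempty.\<close>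

lemma Sat_std_iff:
  assumes M: "is_model \<Theta> M" and w: "w \<in> wlds M" and \<phi>: "fv \<phi> = {}"
  shows "Sat (std_logic K) M w \<phi> \<longleftrightarrow> holds M w s \<phi>"
proof -
  obtain a where a: "a \<in> dmn M w" using model_dmn_nonempty[OF M w] by blast
  have eq: "holds M w s1 \<phi> \<Longrightarrow> holds M w s2 \<phi>" for s1 s2
    using holds_cong[of \<phi> s1 s2] \<phi> by auto
  have "(\<forall>s'. (\<forall>x. s' x \<in> dmn M w) \<longrightarrow> holds M w s' \<phi>) \<longleftrightarrow> holds M w s \<phi>"
  proof
    assume "\<forall>s'. (\<forall>x. s' x \<in> dmn M w) \<longrightarrow> holds M w s' \<phi>"
    then have "holds M w (\<lambda>_. a) \<phi>" using a by simp
    then show "holds M w s \<phi>" by (rule eq)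
  next
    assume "holds M w s \<phi>"
    then show "\<forall>s'. (\<forall>x. s' x \<in> dmn M w) \<longrightarrow> holds M w s' \<phi>" using eq by fast
  qed
  then show ?thesis by (simp add: std_logic_def)
qed

lemma Sen_std: "\<phi> \<in> Sen (std_logic K) \<Theta> \<longleftrightarrow> fm_over (has_eq K) \<Theta> \<phi> \<and> fv \<phi> = {}"
  by (simp add: std_logic_def)

text \<open>The atom clause of an asimulation speaks of atomic sentences with fresh constants,
  whereas the proof works with formulas with free variables. \<open>abs_tm\<close> turns the fresh
  constant number \<open>i\<close> into the variable \<open>i\<close>, so that the tuple itself
  becomes the assignment.\<close>

fun abs_tm :: "(nat \<Rightarrow> 'u) \<Rightarrow> nat \<Rightarrow> 'u tm \<Rightarrow> 'u tm" where
  "abs_tm c l (Var x) = Var x"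
| "abs_tm c l (Cst d) = (if d \<in> c ` {..<l} then Var (the_inv_into {..<l} c d) else Cst d)"

fun abs_atom :: "(nat \<Rightarrow> 'u) \<Rightarrow> nat \<Rightarrow> 'u fm \<Rightarrow> 'u fm" where
  "abs_atom c l (Atom P ts) = Atom P (map (abs_tm c l) ts)"
| "abs_atom c l (Eq s t) = Eq (abs_tm c l s) (abs_tm c l t)"
| "abs_atom c l \<phi> = \<phi>"

context
  fixes c :: "nat \<Rightarrow> 'u" and l :: nat and \<Theta> :: "'u signature"
  assumes inj_c: "inj c" and fresh_c: "\<And>i. c i \<notin> csts \<Theta>"
begin

lemma inv_c: "i < l \<Longrightarrow> the_inv_into {..<l} c (c i) = i"
  using inj_c by (simp add: the_inv_into_f_f inj_on_subset[OF inj_c])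

lemma abs_tm_props:
  assumes "tm_over (add_consts \<Theta> (map c [0..<l])) t" "tm_vars t = {}"
  shows "tm_over \<Theta> (abs_tm c l t)" "tm_vars (abs_tm c l t) \<subseteq> {..<l}"
  using assms by (cases t; auto simp: inv_c)+

lemma abs_atom_props:
  assumes "atomic \<phi>" "fm_over q (add_consts \<Theta> (map c [0..<l])) \<phi>" "fv \<phi> = {}"
  shows "atomic (abs_atom c l \<phi>)" "fm_over q \<Theta> (abs_atom c l \<phi>)" "fv (abs_atom c l \<phi>) \<subseteq> {..<l}"
proof -
  show "atomic (abs_atom c l \<phi>)" using assms by (auto simp: atomic_def)
  show "fm_over q \<Theta> (abs_atom c l \<phi>)" using assms abs_tm_props(1) by (auto simp: atomic_def)
  consider P ts where "\<phi> = Atom P ts" | t1 t2 where "\<phi> = Eq t1 t2" using assms(1) by (auto simp: atomic_def)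
  then show "fv (abs_atom c l \<phi>) \<subseteq> {..<l}"
  proof cases
    case 1
    then have "\<forall>t\<in>set ts. tm_vars (abs_tm c l t) \<subseteq> {..<l}"
      using assms(2,3) by (intro ballI abs_tm_props(2)) auto
    then show ?thesis using 1 by auto
  next
    case 2
    then have "tm_vars (abs_tm c l t1) \<subseteq> {..<l}" "tm_vars (abs_tm c l t2) \<subseteq> {..<l}"
      using assms(2,3) by (intro abs_tm_props(2); simp)+
    then show ?thesis using 2 by simp
  qed
qed

lemma name_tuple_c:
  assumes M: "is_model \<Theta> M" and \<alpha>: "set \<alpha> \<subseteq> dmn M w" "length \<alpha> = l"
  shows "name_tuple M w (map c [0..<l]) \<alpha>"
  using assms fresh_c model_sgn[OF M] inj_on_subset[OF inj_c]
  by (auto simp: name_tuple_def distinct_map)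

lemma tm_val_abs:
  assumes M: "is_model \<Theta> M" and w: "w \<in> wlds M" and \<alpha>: "set \<alpha> \<subseteq> dmn M w" "length \<alpha> = l"
    and t: "tm_vars t = {}"
  shows "tm_val (cone_exp M w (map c [0..<l]) \<alpha>) w s t = tm_val M w (nth \<alpha>) (abs_tm c l t)"
proof (cases t)
  case (Var x)
  then show ?thesis using t by simp
next
  case (Cst d)
  have ww: "(w, w) \<in> acc M" using model_acc_refl[OF M w] .
  note nt = name_tupleD[OF name_tuple_c[OF M \<alpha>]]
  show ?thesis
  proof (cases "d \<in> c ` {..<l}")
    case True
    then obtain i where i: "i < l" "d = c i" by auto
    then have "d = map c [0..<l] ! i" by simp
    then have "cint (cone_exp M w (map c [0..<l]) \<alpha>) w d = hom M w w (\<alpha> ! i)"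
      using cone_exp_cint_new[OF ww nt(3,1), of i] i(1) by simp
    also have "\<dots> = \<alpha> ! i" using i(1) \<alpha> by (intro model_hom_id[OF M]) auto
    finally show ?thesis using Cst i inv_c by simp
  next
    case False
    then have "d \<notin> set (map c [0..<l])" by auto
    then show ?thesis using Cst False ww by (simp add: cone_exp_cint_old)
  qed
qed

lemma holds_abs_atom:
  assumes M: "is_model \<Theta> M" and w: "w \<in> wlds M" and \<alpha>: "set \<alpha> \<subseteq> dmn M w" "length \<alpha> = l"
    and \<phi>: "atomic \<phi>" "fv \<phi> = {}"
  shows "holds (cone_exp M w (map c [0..<l]) \<alpha>) w s \<phi> \<longleftrightarrow> holds M w (nth \<alpha>) (abs_atom c l \<phi>)"
proof -
  have ww: "(w, w) \<in> acc M" using model_acc_refl[OF M w] .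
  consider P ts where "\<phi> = Atom P ts" | t1 t2 where "\<phi> = Eq t1 t2" using \<phi>(1) by (auto simp: atomic_def)
  then show ?thesis
  proof cases
    case 1
    then have "map (tm_val (cone_exp M w (map c [0..<l]) \<alpha>) w s) ts = map (tm_val M w (nth \<alpha>)) (map (abs_tm c l) ts)"
      using \<phi>(2) tm_val_abs[OF M w \<alpha>] by auto
    then show ?thesis using 1 ww by (metis abs_atom.simps(1) cone_exp_simps(5) holds.simps(2))
  next
    case 2
    then show ?thesis using \<phi>(2) tm_val_abs[OF M w \<alpha>] by simp
  qed
qed

end

section \<open>The given logic, and preservation in a convenient form\<close>

locale extension_logic = universe \<U> for \<U> :: "'u set" +
  fixes L :: "('u, 's) logic" and K :: stil
  assumes abstract: "abstract_logic L"
    and ext: "extends (std_logic K) L"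
    and preserved: "preserved_under_asimulations K L"
begin

lemma Str_iff: "is_sig \<Theta> \<Longrightarrow> (M, w) \<in> Str L \<Theta> \<longleftrightarrow> is_model \<Theta> M \<and> w \<in> wlds M \<and> in_class K M"
  using ext by (simp add: extends_def std_logic_def)

lemma Str_iso:
  assumes "is_sig \<Theta>" "(M, w) \<in> Str L \<Theta>" "is_model \<Theta> N" "model_iso g h M N"
  shows "(N, h w) \<in> Str L \<Theta>"
  using abstract assms unfolding abstract_logic_def structures_ok_def by blast

lemma Sat_iso:
  assumes "is_sig \<Theta>" "(M, w) \<in> Str L \<Theta>" "is_model \<Theta> N" "model_iso g h M N" "\<phi> \<in> Sen L \<Theta>"
  shows "Sat L M w \<phi> \<longleftrightarrow> Sat L N (h w) \<phi>"
  using abstract assms unfolding abstract_logic_def isomorphism_invariant_def by blast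

text \<open>By the occurrence condition, membership of a sentence is decided by its own finite
  signature.\<close>

lemma Sen_mono:
  assumes "is_sig \<Theta>" "is_sig \<Theta>'" "sub_sig \<Theta> \<Theta>'" "\<phi> \<in> Sen L \<Theta>"
  shows "\<phi> \<in> Sen L \<Theta>'"
proof -
  obtain \<Theta>0 where "occurs_exactly L \<phi> \<Theta>0"
    using abstract assms unfolding abstract_logic_def occurrence_def by blast
  then have "sub_sig \<Theta>0 \<Theta>" and iff: "\<phi> \<in> Sen L \<Theta>' \<longleftrightarrow> sub_sig \<Theta>0 \<Theta>'"
    using assms by (auto simp: occurs_exactly_def)
  then show ?thesis unfolding iff using assms(3) unfolding sub_sig_def by (meson order_trans)
qed

text \<open>In the definition of asimulations the side of a world is read off from membership in
  \<open>wlds\<close>, so the conditions of both directions apply at once when the two models share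
  worlds. Here the side is an explicit Boolean argument of \<open>R\<close>, and the models may
  overlap or even coincide. Moreover tuples come from the domain of their world, and atoms have
  variables instead of fresh constants.\<close>

lemma preservation:
  fixes Md :: "bool \<Rightarrow> 'u kmodel" and R :: "bool \<Rightarrow> 'u \<Rightarrow> 'u list \<Rightarrow> 'u \<Rightarrow> 'u list \<Rightarrow> bool"
  assumes sig: "is_sig \<Theta>" and S1: "(Md b0, w1) \<in> Str L \<Theta>" and S2: "(Md (\<not> b0), w2) \<in> Str L \<Theta>"
    and dom: "\<And>b w \<alpha> v \<beta>. R b w \<alpha> v \<beta> \<Longrightarrow> w \<in> wlds (Md b) \<and> v \<in> wlds (Md (\<not> b)) \<and>
      set \<alpha> \<subseteq> dmn (Md b) w \<and> set \<beta> \<subseteq> dmn (Md (\<not> b)) v \<and> length \<alpha> = length \<beta>"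
    and atom: "\<And>b w \<alpha> v \<beta> \<psi>. R b w \<alpha> v \<beta> \<Longrightarrow> atomic \<psi> \<Longrightarrow> fm_over (has_eq K) \<Theta> \<psi> \<Longrightarrow>
      fv \<psi> \<subseteq> {..<length \<alpha>} \<Longrightarrow> holds (Md b) w (nth \<alpha>) \<psi> \<Longrightarrow> holds (Md (\<not> b)) v (nth \<beta>) \<psi>"
    and s_back: "\<And>b w \<alpha> v \<beta> t. R b w \<alpha> v \<beta> \<Longrightarrow> (v, t) \<in> acc (Md (\<not> b)) \<Longrightarrow>
      \<exists>u. (w, u) \<in> acc (Md b) \<and> R b u (map (hom (Md b) w u) \<alpha>) t (map (hom (Md (\<not> b)) v t) \<beta>) \<and>
        R (\<not> b) t (map (hom (Md (\<not> b)) v t) \<beta>) u (map (hom (Md b) w u) \<alpha>)"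
    and obj_forth: "\<And>b w \<alpha> v \<beta> a. R b w \<alpha> v \<beta> \<Longrightarrow> a \<in> dmn (Md b) w \<Longrightarrow>
      \<exists>a'\<in>dmn (Md (\<not> b)) v. R b w (\<alpha> @ [a]) v (\<beta> @ [a'])"
    and obj_back: "\<And>b w \<alpha> v \<beta> t a'. R b w \<alpha> v \<beta> \<Longrightarrow> (v, t) \<in> acc (Md (\<not> b)) \<Longrightarrow> a' \<in> dmn (Md (\<not> b)) t \<Longrightarrow>
      \<exists>u. (w, u) \<in> acc (Md b) \<and> (\<exists>a\<in>dmn (Md b) u.
        R b u (map (hom (Md b) w u) \<alpha> @ [a]) t (map (hom (Md (\<not> b)) v t) \<beta> @ [a']))"
    and start: "R b0 w1 [] w2 []"
    and \<phi>: "\<phi> \<in> Sen L \<Theta>" "Sat L (Md b0) w1 \<phi>"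
  shows "Sat L (Md (\<not> b0)) w2 \<phi>"
proof -
  have mod: "is_model \<Theta> (Md b)" for b using S1 S2 Str_iff[OF sig] by (cases "b = b0") auto
  \<comment> \<open>The worlds of one model are renamed away from those of the other. Elements stay
    in place, since the clauses only concern tuples from the domain of a given world.\<close>
  obtain h0 :: "'u \<Rightarrow> 'u" where h0: "inj_on h0 (wlds (Md False))" "h0 ` wlds (Md False) \<inter> wlds (Md True) = {}"
    using ex_fresh_inj[of "wlds (Md False)" "wlds (Md True)"] model_small_wlds[OF mod] by (auto simp: small_iff_tiny)
  obtain M2 where M2: "is_model \<Theta> M2" "model_iso (\<lambda>x. x) h0 (Md False) M2"
    using ex_iso_copy[OF mod inj_on_id2 h0(1)] by blast
  define h where "h b = (if b then (\<lambda>x. x) else h0)" for b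
  define Md' where "Md' b = (if b then Md True else M2)" for b
  have mod': "is_model \<Theta> (Md' b)" for b using mod M2 by (simp add: Md'_def)
  have iso: "model_iso (\<lambda>x. x) (h b) (Md b) (Md' b)" for b
    using M2 by (cases b) (auto simp: h_def Md'_def model_iso_def bij_betw_def)
  have cov: "covers (has_eq K) \<Theta> (h b) (\<lambda>x. x) (Md b) w (Md' b)" for b w
    using iso_covers[OF mod mod' iso] .
  note rf = model_acc_refl[OF mod]
  have hinj: "b = b' \<and> w = w'" if "h b w = h b' w'" "w \<in> wlds (Md b)" "w' \<in> wlds (Md b')" for b b' w w'
    using that h0 by (cases b; cases b'; auto simp: h_def dest: inj_onD)
  have dmn': "dmn (Md' b) (h b w) = dmn (Md b) w" if "w \<in> wlds (Md b)" for b w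
    using covers_dmn[OF cov rf[OF that]] by simp
  have acc': "(h b w, t) \<in> acc (Md' b) \<longleftrightarrow> (\<exists>u. (w, u) \<in> acc (Md b) \<and> t = h b u)" if "w \<in> wlds (Md b)" for b w t
    using covers_back[OF cov rf[OF that]] covers_forth[OF cov rf[OF that]] by blast
  have hom': "map (hom (Md' b) (h b w) (h b u)) \<alpha> = map (hom (Md b) w u) \<alpha>" if "(w, u) \<in> acc (Md b)" "set \<alpha> \<subseteq> dmn (Md b) w" for b w u \<alpha>
    using covers_hom[OF cov rf that(1)] model_acc_wlds[OF mod that(1)] that(2) by (auto simp: subset_iff)
  have holds': "holds (Md' b) (h b w) s \<psi> \<longleftrightarrow> holds (Md b) w s \<psi>"
    if "w \<in> wlds (Md b)" "fm_over (has_eq K) \<Theta> \<psi>" "\<And>x. x \<in> fv \<psi> \<Longrightarrow> s x \<in> dmn (Md b) w" for b w s \<psi>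
    using covers_holds[OF mod cov that(2) rf[OF that(1)] that(3)] by (simp add: comp_def)
  define A where "A = (\<lambda>(w, \<alpha>) (v, \<beta>). \<exists>b w0 v0. w = h b w0 \<and> v = h (\<not> b) v0 \<and> R b w0 \<alpha> v0 \<beta>)"
  have AI: "R b w \<alpha> v \<beta> \<Longrightarrow> A (h b w, \<alpha>) (h (\<not> b) v, \<beta>)" for b w v \<alpha> \<beta> by (auto simp: A_def)
  have AI': "R (\<not> b) w \<alpha> v \<beta> \<Longrightarrow> A (h (\<not> b) w, \<alpha>) (h b v, \<beta>)" for b w v \<alpha> \<beta> using AI[of "\<not> b"] by simp
  have hw: "h b w \<in> wlds (Md' b)" if "w \<in> wlds (Md b)" for b w
    using covers_wlds[OF cov rf[OF that]] .
  \<comment> \<open>As the worlds are now disjoint, the world \<open>w\<close> determines the side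
    \<open>b\<close> and its origin.\<close>
  have AE: "\<exists>w0 v0. w = h b w0 \<and> v = h (\<not> b) v0 \<and> R b w0 \<alpha> v0 \<beta>"
    if Awv: "A (w, \<alpha>) (v, \<beta>)" and wb: "w \<in> wlds (Md' b)" for b w v \<alpha> \<beta>
  proof -
    obtain b' w0 v0 where *: "w = h b' w0" "v = h (\<not> b') v0" "R b' w0 \<alpha> v0 \<beta>"
      using Awv unfolding A_def prod.case by blast
    have "\<exists>w1. w1 \<in> wlds (Md b) \<and> w = h b w1" using wb iso_h[OF iso[of b]] by (metis bij_betw_imp_surj_on imageE)
    then have "b' = b" using hinj * dom[OF *(3)] by metis
    then show ?thesis using * by blast
  qed
  have pairs: "(\<forall>(Mi, Mj)\<in>{(Md' b0, Md' (\<not> b0)), (Md' (\<not> b0), Md' b0)}. Q Mi Mj) \<longleftrightarrow> (\<forall>b. Q (Md' b) (Md' (\<not> b)))" for Q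
    by (cases b0) (auto simp: all_bool_eq)
  have sgn': "sgn (Md' b) = \<Theta>" for b using model_sgn[OF mod'] .
  have asim: "asimulation K (Md' b0) (h b0 w1) [] (Md' (\<not> b0)) (h (\<not> b0) w2) [] A"
    unfolding asimulation_def
  proof (intro conjI)
    show "\<forall>w \<alpha> v \<beta>. A (w, \<alpha>) (v, \<beta>) \<longrightarrow> length \<alpha> = length \<beta> \<and>
        (\<exists>(Mi, Mj)\<in>{(Md' b0, Md' (\<not> b0)), (Md' (\<not> b0), Md' b0)}.
           w \<in> wlds Mi \<and> \<alpha> \<in> lists (elems Mi) \<and> v \<in> wlds Mj \<and> \<beta> \<in> lists (elems Mj))"
    proof (intro allI impI)
      fix w \<alpha> v \<beta> assume "A (w, \<alpha>) (v, \<beta>)"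
      then obtain b w0 v0 where *: "w = h b w0" "v = h (\<not> b) v0" "R b w0 \<alpha> v0 \<beta>"
        unfolding A_def prod.case by blast
      have el: "\<alpha> \<in> lists (elems (Md' b))" if "w \<in> wlds (Md b)" "set \<alpha> \<subseteq> dmn (Md b) w" for w b \<alpha>
        using hw[OF that(1)] dmn'[OF that(1)] that(2) by (auto simp: elems_def in_lists_conv_set)
      have "length \<alpha> = length \<beta> \<and> w \<in> wlds (Md' b) \<and> \<alpha> \<in> lists (elems (Md' b)) \<and> v \<in> wlds (Md' (\<not> b)) \<and> \<beta> \<in> lists (elems (Md' (\<not> b)))"
        using * dom[OF *(3)] hw el by blast
      then show "length \<alpha> = length \<beta> \<and>
        (\<exists>(Mi, Mj)\<in>{(Md' b0, Md' (\<not> b0)), (Md' (\<not> b0), Md' b0)}.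
           w \<in> wlds Mi \<and> \<alpha> \<in> lists (elems Mi) \<and> v \<in> wlds Mj \<and> \<beta> \<in> lists (elems Mj))"
        by (cases b; cases b0) auto
    qed
    show "A (h b0 w1, []) (h (\<not> b0) w2, [])" using AI[OF start] .
    show "\<forall>(Mi, Mj)\<in>{(Md' b0, Md' (\<not> b0)), (Md' (\<not> b0), Md' b0)}. \<forall>w \<alpha> v \<beta>.
        A (w, \<alpha>) (v, \<beta>) \<and> w \<in> wlds Mi \<and> v \<in> wlds Mj \<and>
        \<alpha> \<in> lists (dmn Mi w) \<and> \<beta> \<in> lists (dmn Mj v) \<longrightarrow>
        (let cs = map (fresh_consts (sgn (Md' b0))) [0..<length \<alpha>] in
           \<forall>\<phi>\<in>Sen (std_logic K) (add_consts (sgn (Md' b0)) cs). atomic \<phi> \<longrightarrow>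
             Sat (std_logic K) (cone_exp Mi w cs \<alpha>) w \<phi> \<longrightarrow>
             Sat (std_logic K) (cone_exp Mj v cs \<beta>) v \<phi>) \<and>
        (\<forall>t. (v, t) \<in> acc Mj \<longrightarrow> (\<exists>u. (w, u) \<in> acc Mi \<and>
           A (u, map (hom Mi w u) \<alpha>) (t, map (hom Mj v t) \<beta>) \<and>
           A (t, map (hom Mj v t) \<beta>) (u, map (hom Mi w u) \<alpha>))) \<and>
        (\<forall>a\<in>dmn Mi w. \<exists>b\<in>dmn Mj v. A (w, \<alpha> @ [a]) (v, \<beta> @ [b])) \<and>
        (\<forall>t. (v, t) \<in> acc Mj \<longrightarrow> (\<forall>b\<in>dmn Mj t. \<exists>u. (w, u) \<in> acc Mi \<and> (\<exists>a\<in>dmn Mi u.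
           A (u, map (hom Mi w u) \<alpha> @ [a]) (t, map (hom Mj v t) \<beta> @ [b]))))"
      unfolding pairs sgn'
    proof (intro allI impI)
      fix b w \<alpha> v \<beta>
      assume H: "A (w, \<alpha>) (v, \<beta>) \<and> w \<in> wlds (Md' b) \<and> v \<in> wlds (Md' (\<not> b)) \<and>
        \<alpha> \<in> lists (dmn (Md' b) w) \<and> \<beta> \<in> lists (dmn (Md' (\<not> b)) v)"
      then obtain w0 v0 where w: "w = h b w0" and v: "v = h (\<not> b) v0" and R: "R b w0 \<alpha> v0 \<beta>" using AE by blast
      note d = dom[OF R]
      have dd: "w0 \<in> wlds (Md b)" "v0 \<in> wlds (Md (\<not> b))" "set \<alpha> \<subseteq> dmn (Md b) w0" "set \<beta> \<subseteq> dmn (Md (\<not> b)) v0" "length \<alpha> = length \<beta>" using d by auto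
      have dd': "w \<in> wlds (Md' b)" "v \<in> wlds (Md' (\<not> b))" "set \<alpha> \<subseteq> dmn (Md' b) w" "set \<beta> \<subseteq> dmn (Md' (\<not> b)) v"
        using H by (auto simp: in_lists_conv_set)
      let ?cs = "map (fresh_consts \<Theta>) [0..<length \<alpha>]"
      show "(let cs = ?cs in
           \<forall>\<phi>\<in>Sen (std_logic K) (add_consts \<Theta> cs). atomic \<phi> \<longrightarrow>
             Sat (std_logic K) (cone_exp (Md' b) w cs \<alpha>) w \<phi> \<longrightarrow>
             Sat (std_logic K) (cone_exp (Md' (\<not> b)) v cs \<beta>) v \<phi>) \<and>
        (\<forall>t. (v, t) \<in> acc (Md' (\<not> b)) \<longrightarrow> (\<exists>u. (w, u) \<in> acc (Md' b) \<and>
           A (u, map (hom (Md' b) w u) \<alpha>) (t, map (hom (Md' (\<not> b)) v t) \<beta>) \<and>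
           A (t, map (hom (Md' (\<not> b)) v t) \<beta>) (u, map (hom (Md' b) w u) \<alpha>))) \<and>
        (\<forall>a\<in>dmn (Md' b) w. \<exists>a'\<in>dmn (Md' (\<not> b)) v. A (w, \<alpha> @ [a]) (v, \<beta> @ [a'])) \<and>
        (\<forall>t. (v, t) \<in> acc (Md' (\<not> b)) \<longrightarrow> (\<forall>a'\<in>dmn (Md' (\<not> b)) t. \<exists>u. (w, u) \<in> acc (Md' b) \<and> (\<exists>a\<in>dmn (Md' b) u.
           A (u, map (hom (Md' b) w u) \<alpha> @ [a]) (t, map (hom (Md' (\<not> b)) v t) \<beta> @ [a']))))"
      proof (intro conjI)
        show "let cs = ?cs in
           \<forall>\<phi>\<in>Sen (std_logic K) (add_consts \<Theta> cs). atomic \<phi> \<longrightarrow>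
             Sat (std_logic K) (cone_exp (Md' b) w cs \<alpha>) w \<phi> \<longrightarrow>
             Sat (std_logic K) (cone_exp (Md' (\<not> b)) v cs \<beta>) v \<phi>"
          unfolding Let_def
        proof (intro ballI impI)
          fix \<phi> assume \<phi>: "\<phi> \<in> Sen (std_logic K) (add_consts \<Theta> ?cs)" "atomic \<phi>"
            and sat: "Sat (std_logic K) (cone_exp (Md' b) w ?cs \<alpha>) w \<phi>"
          note fc = fresh_consts_props[OF sig]
          have \<phi>': "fm_over (has_eq K) (add_consts \<Theta> ?cs) \<phi>" "fv \<phi> = {}" using \<phi>(1) by (auto simp: Sen_std)
          let ?\<psi> = "abs_atom (fresh_consts \<Theta>) (length \<alpha>) \<phi>"
          note \<psi> = abs_atom_props[OF fc \<phi>(2) \<phi>']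
          have ce: "Sat (std_logic K) (cone_exp (Md' b) w ?cs \<gamma>) w \<phi> \<longleftrightarrow> holds (Md b) w0 (nth \<gamma>) ?\<psi>"
            if "w = h b w0" "w0 \<in> wlds (Md b)" "w \<in> wlds (Md' b)" "set \<gamma> \<subseteq> dmn (Md' b) w" "length \<gamma> = length \<alpha>" for b w w0 \<gamma>
          proof -
            have "name_tuple (Md' b) w ?cs \<gamma>" using name_tuple_c[OF fc mod' that(4,5)] .
            then have "is_model (add_consts \<Theta> ?cs) (cone_exp (Md' b) w ?cs \<gamma>)" by (rule cone_exp_model[OF mod' that(3)])
            moreover have "w \<in> wlds (cone_exp (Md' b) w ?cs \<gamma>)" using model_acc_refl[OF mod' that(3)] by simp
            ultimately have "Sat (std_logic K) (cone_exp (Md' b) w ?cs \<gamma>) w \<phi> \<longleftrightarrow> holds (cone_exp (Md' b) w ?cs \<gamma>) w (nth \<gamma>) \<phi>"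
              using \<phi>'(2) by (rule Sat_std_iff)
            also have "\<dots> \<longleftrightarrow> holds (Md' b) w (nth \<gamma>) ?\<psi>"
              using holds_abs_atom[OF fc mod' that(3-5) \<phi>(2) \<phi>'(2)] .
            also have "\<dots> \<longleftrightarrow> holds (Md b) w0 (nth \<gamma>) ?\<psi>"
              unfolding that(1)
            proof (rule holds'[OF that(2) \<psi>(2)])
              fix x assume "x \<in> fv ?\<psi>"
              then have "x < length \<gamma>" using \<psi>(3) that(5) by auto
              then show "\<gamma> ! x \<in> dmn (Md b) w0" using that(1,2,4) dmn' by (metis nth_mem subsetD)
            qed
            finally show ?thesis .
          qed
          have "holds (Md b) w0 (nth \<alpha>) ?\<psi>" using sat ce[OF w dd(1) dd'(1,3)] by simp
          then have "holds (Md (\<not> b)) v0 (nth \<beta>) ?\<psi>" using atom[OF R \<psi>] by simp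
          then show "Sat (std_logic K) (cone_exp (Md' (\<not> b)) v ?cs \<beta>) v \<phi>"
            using ce[OF v dd(2) dd'(2,4)] dd(5) by simp
        qed
        show "\<forall>t. (v, t) \<in> acc (Md' (\<not> b)) \<longrightarrow> (\<exists>u. (w, u) \<in> acc (Md' b) \<and>
           A (u, map (hom (Md' b) w u) \<alpha>) (t, map (hom (Md' (\<not> b)) v t) \<beta>) \<and>
           A (t, map (hom (Md' (\<not> b)) v t) \<beta>) (u, map (hom (Md' b) w u) \<alpha>))"
        proof (intro allI impI)
          fix t assume "(v, t) \<in> acc (Md' (\<not> b))"
          then obtain t0 where t0: "(v0, t0) \<in> acc (Md (\<not> b))" "t = h (\<not> b) t0" using acc' v dd(2) by blast
          obtain u0 where u0: "(w0, u0) \<in> acc (Md b)"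
            "R b u0 (map (hom (Md b) w0 u0) \<alpha>) t0 (map (hom (Md (\<not> b)) v0 t0) \<beta>)"
            "R (\<not> b) t0 (map (hom (Md (\<not> b)) v0 t0) \<beta>) u0 (map (hom (Md b) w0 u0) \<alpha>)"
            using s_back[OF R t0(1)] by blast
          then show "\<exists>u. (w, u) \<in> acc (Md' b) \<and>
           A (u, map (hom (Md' b) w u) \<alpha>) (t, map (hom (Md' (\<not> b)) v t) \<beta>) \<and>
           A (t, map (hom (Md' (\<not> b)) v t) \<beta>) (u, map (hom (Md' b) w u) \<alpha>)"
            unfolding w v t0(2) hom'[OF t0(1) dd(4)]
            by (intro exI[of _ "h b u0"]; unfold hom'[OF u0(1) dd(3)])
              (use AI[OF u0(2)] AI'[OF u0(3)] acc'[OF dd(1)] in blast)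
        qed
        show "\<forall>a\<in>dmn (Md' b) w. \<exists>a'\<in>dmn (Md' (\<not> b)) v. A (w, \<alpha> @ [a]) (v, \<beta> @ [a'])"
          using obj_forth[OF R] AI w v dmn'[OF dd(1)] dmn'[OF dd(2)] by metis
        show "\<forall>t. (v, t) \<in> acc (Md' (\<not> b)) \<longrightarrow> (\<forall>a'\<in>dmn (Md' (\<not> b)) t. \<exists>u. (w, u) \<in> acc (Md' b) \<and> (\<exists>a\<in>dmn (Md' b) u.
           A (u, map (hom (Md' b) w u) \<alpha> @ [a]) (t, map (hom (Md' (\<not> b)) v t) \<beta> @ [a'])))"
        proof (intro allI impI ballI)
          fix t a' assume t: "(v, t) \<in> acc (Md' (\<not> b))" and a': "a' \<in> dmn (Md' (\<not> b)) t"
          then obtain t0 where t0: "(v0, t0) \<in> acc (Md (\<not> b))" "t = h (\<not> b) t0" using acc' v dd(2) by blast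
          have "a' \<in> dmn (Md (\<not> b)) t0" using a' dmn' model_acc_wlds[OF mod t0(1)] t0(2) by blast
          then obtain u0 a where u0: "(w0, u0) \<in> acc (Md b)" "a \<in> dmn (Md b) u0"
            "R b u0 (map (hom (Md b) w0 u0) \<alpha> @ [a]) t0 (map (hom (Md (\<not> b)) v0 t0) \<beta> @ [a'])"
            using obj_back[OF R t0(1)] by blast
          have "a \<in> dmn (Md' b) (h b u0)" using u0(2) dmn' model_acc_wlds[OF mod u0(1)] by blast
          then show "\<exists>u. (w, u) \<in> acc (Md' b) \<and> (\<exists>a\<in>dmn (Md' b) u.
           A (u, map (hom (Md' b) w u) \<alpha> @ [a]) (t, map (hom (Md' (\<not> b)) v t) \<beta> @ [a']))"
            unfolding w v t0(2) hom'[OF t0(1) dd(4)]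
            by (intro exI[of _ "h b u0"]; unfold hom'[OF u0(1) dd(3)])
              (use AI[OF u0(3)] acc'[OF dd(1)] u0(1) in blast)
        qed
      qed
    qed
  qed
  have S1': "(Md' b0, h b0 w1) \<in> Str L \<Theta>" using Str_iso[OF sig S1 mod' iso] .
  have S2': "(Md' (\<not> b0), h (\<not> b0) w2) \<in> Str L \<Theta>" using Str_iso[OF sig S2 mod' iso] .
  have "Sat L (Md' b0) (h b0 w1) \<phi>" using Sat_iso[OF sig S1 mod' iso \<phi>(1)] \<phi>(2) by simp
  then have "Sat L (Md' (\<not> b0)) (h (\<not> b0) w2) \<phi>"
    using preserved asim S1' S2' sig \<phi>(1) unfolding preserved_under_asimulations_def by blast
  then show ?thesis using Sat_iso[OF sig S2 mod' iso \<phi>(1)] by simp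
qed

end

section \<open>Invariance under bounded morphisms, and persistence\<close>

context extension_logic begin

text \<open>The graph of a bounded morphism, used in both directions at once, is an asimulation: the
  clause on later worlds follows from the back condition in one direction and from the forth
  condition in the other.\<close>

lemma covers_Sat:
  assumes sig: "is_sig \<Theta>" and SM: "(M, w) \<in> Str L \<Theta>" and SN: "(N, p w) \<in> Str L \<Theta>"
    and cov: "covers (has_eq K) \<Theta> p e M w N" and \<phi>: "\<phi> \<in> Sen L \<Theta>"
  shows "Sat L M w \<phi> \<longleftrightarrow> Sat L N (p w) \<phi>"
proof -
  have M: "is_model \<Theta> M" and N: "is_model \<Theta> N" and w: "w \<in> wlds M" using SM SN Str_iff[OF sig] by auto
  define Md where "Md b = (if b then M else N)" for b
  define C where "C v \<alpha> t \<beta> \<longleftrightarrow> (w, v) \<in> acc M \<and> t = p v \<and> set \<alpha> \<subseteq> dmn M v \<and> \<beta> = map e \<alpha>" for v \<alpha> t \<beta>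
  \<comment> \<open>The Boolean tells whether a pair is read from \<open>M\<close> to
    \<open>N\<close> or backwards.\<close>
  define R where "R b x \<alpha> y \<beta> \<longleftrightarrow> (if b then C x \<alpha> y \<beta> else C y \<beta> x \<alpha>)" for b x \<alpha> y \<beta>
  note tr = model_acc_trans[OF M]
  have up: "\<exists>u. (v, u) \<in> acc M \<and> t' = p u \<and> C u (map (hom M v u) \<alpha>) t' (map (hom N t t') \<beta>)"
    if C: "C v \<alpha> t \<beta>" and t': "(t, t') \<in> acc N" for v \<alpha> t \<beta> t'
  proof -
    have wv: "(w, v) \<in> acc M" using C by (simp add: C_def)
    obtain u where u: "(v, u) \<in> acc M" "p u = t'" using covers_back[OF cov wv] C t' by (auto simp: C_def)
    have "map (hom N t t') \<beta> = map e (map (hom M v u) \<alpha>)"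
      using C covers_hom[OF cov wv u(1)] u(2) by (auto simp: C_def)
    then show ?thesis using u C tr[OF wv u(1)] model_hom[OF M u(1)] by (auto simp: C_def)
  qed
  have down: "(t, p u) \<in> acc N \<and> C u (map (hom M v u) \<alpha>) (p u) (map (hom N t (p u)) \<beta>)"
    if C: "C v \<alpha> t \<beta>" and u: "(v, u) \<in> acc M" for v \<alpha> t \<beta> u
  proof -
    have wv: "(w, v) \<in> acc M" using C by (simp add: C_def)
    have "map (hom N t (p u)) \<beta> = map e (map (hom M v u) \<alpha>)"
      using C covers_hom[OF cov wv u] by (auto simp: C_def)
    then show ?thesis using u C tr[OF wv u] model_hom[OF M u] covers_forth[OF cov wv u] by (auto simp: C_def)
  qed
  have snoc: "C v (\<alpha> @ [a]) t (\<beta> @ [e a])" if "C v \<alpha> t \<beta>" "a \<in> dmn M v" for v \<alpha> t \<beta> a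
    using that by (simp add: C_def)
  have dm: "dmn N t = e ` dmn M v" if "C v \<alpha> t \<beta>" for v \<alpha> t \<beta>
    using that covers_dmn[OF cov] by (auto simp: C_def)
  have at: "holds M v (nth \<alpha>) \<psi> \<longleftrightarrow> holds N t (nth \<beta>) \<psi>"
    if C: "C v \<alpha> t \<beta>" and \<psi>: "fm_over (has_eq K) \<Theta> \<psi>" "fv \<psi> \<subseteq> {..<length \<alpha>}" for v \<alpha> t \<beta> \<psi>
  proof -
    have v: "(w, v) \<in> acc M" "t = p v" "set \<alpha> \<subseteq> dmn M v" "\<beta> = map e \<alpha>" using C by (auto simp: C_def)
    have "holds M v (nth \<alpha>) \<psi> \<longleftrightarrow> holds N t (e \<circ> nth \<alpha>) \<psi>"
      unfolding v(2) using \<psi>(2) v(3) by (intro covers_holds[OF M cov \<psi>(1) v(1)]) (auto simp: subset_iff)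
    also have "\<dots> \<longleftrightarrow> holds N t (nth \<beta>) \<psi>"
      unfolding v(4) using \<psi>(2) by (intro holds_cong) auto
    finally show ?thesis .
  qed
  have dom: "v \<in> wlds M \<and> t \<in> wlds N \<and> set \<alpha> \<subseteq> dmn M v \<and> set \<beta> \<subseteq> dmn N t \<and> length \<alpha> = length \<beta>"
    if C: "C v \<alpha> t \<beta>" for v \<alpha> t \<beta>
    using C covers_wlds[OF cov, of v] covers_dmn[OF cov, of v] model_acc_wlds[OF M, of w v] by (auto simp: C_def)
  have start: "C w [] (p w) []" using model_acc_refl[OF M w] by (simp add: C_def)
  \<comment> \<open>Starting the relation on either side yields the two implications.\<close>
  have main: "Sat L (Md (\<not> b0)) w2 \<phi>" if b0: "(b0 \<and> w1 = w \<and> w2 = p w) \<or> (\<not> b0 \<and> w1 = p w \<and> w2 = w)" and sat: "Sat L (Md b0) w1 \<phi>" for b0 w1 w2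
  proof (rule preservation[OF sig, where R = R])
    show "(Md b0, w1) \<in> Str L \<Theta>" "(Md (\<not> b0), w2) \<in> Str L \<Theta>" using b0 SM SN by (auto simp: Md_def)
    show "R b0 w1 [] w2 []" using b0 start by (auto simp: R_def)
    fix b x \<alpha> y \<beta> assume R: "R b x \<alpha> y \<beta>"
    have len: "length \<alpha> = length \<beta>" using R dom unfolding R_def by (metis (full_types))
    show "x \<in> wlds (Md b) \<and> y \<in> wlds (Md (\<not> b)) \<and> set \<alpha> \<subseteq> dmn (Md b) x \<and> set \<beta> \<subseteq> dmn (Md (\<not> b)) y \<and> length \<alpha> = length \<beta>"
      using R dom[of x \<alpha> y \<beta>] dom[of y \<beta> x \<alpha>] by (cases b) (auto simp: R_def Md_def)
    show "holds (Md (\<not> b)) y (nth \<beta>) \<psi>"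
      if "fm_over (has_eq K) \<Theta> \<psi>" "fv \<psi> \<subseteq> {..<length \<alpha>}" "holds (Md b) x (nth \<alpha>) \<psi>" for \<psi>
      using R at[of x \<alpha> y \<beta> \<psi>] at[of y \<beta> x \<alpha> \<psi>] that len by (cases b) (auto simp: R_def Md_def)
    show "\<exists>a'\<in>dmn (Md (\<not> b)) y. R b x (\<alpha> @ [a]) y (\<beta> @ [a'])" if "a \<in> dmn (Md b) x" for a
      using that R snoc[of x \<alpha> y \<beta> a] snoc[of y \<beta> x \<alpha>] dm[of x \<alpha> y \<beta>] dm[of y \<beta> x \<alpha>] by (cases b) (auto simp: R_def Md_def)
    fix t assume t: "(y, t) \<in> acc (Md (\<not> b))"
    have sb: "\<exists>u. (x, u) \<in> acc (Md b) \<and> R b u (map (hom (Md b) x u) \<alpha>) t (map (hom (Md (\<not> b)) y t) \<beta>) \<and>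
           R (\<not> b) t (map (hom (Md (\<not> b)) y t) \<beta>) u (map (hom (Md b) x u) \<alpha>)"
    proof (cases b)
      case True
      then show ?thesis using R t up[of x \<alpha> y \<beta> t] by (auto simp: R_def Md_def)
    next
      case False
      then show ?thesis using R t down[of y \<beta> x \<alpha> t] by (auto simp: R_def Md_def)
    qed
    show "\<exists>u. (x, u) \<in> acc (Md b) \<and> R b u (map (hom (Md b) x u) \<alpha>) t (map (hom (Md (\<not> b)) y t) \<beta>) \<and>
           R (\<not> b) t (map (hom (Md (\<not> b)) y t) \<beta>) u (map (hom (Md b) x u) \<alpha>)" by (rule sb)
    fix a' assume a': "a' \<in> dmn (Md (\<not> b)) t"
    obtain u where u: "(x, u) \<in> acc (Md b)" "R b u (map (hom (Md b) x u) \<alpha>) t (map (hom (Md (\<not> b)) y t) \<beta>)"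
      using sb by blast
    have "\<exists>a\<in>dmn (Md b) u. R b u (map (hom (Md b) x u) \<alpha> @ [a]) t (map (hom (Md (\<not> b)) y t) \<beta> @ [a'])"
    proof (cases b)
      case True
      then have C: "C u (map (hom M x u) \<alpha>) t (map (hom N y t) \<beta>)" using u by (simp add: R_def Md_def)
      then obtain a where "a \<in> dmn M u" "a' = e a" using dm[OF C] a' True by (auto simp: Md_def)
      then show ?thesis using snoc[OF C, of a] True by (auto simp: R_def Md_def)
    next
      case False
      then have C: "C t (map (hom M y t) \<beta>) u (map (hom N x u) \<alpha>)" using u by (simp add: R_def Md_def)
      then show ?thesis using snoc[OF C, of a'] False dm[OF C] a' by (auto simp: R_def Md_def)
    qed
    then show "\<exists>u. (x, u) \<in> acc (Md b) \<and> (\<exists>a\<in>dmn (Md b) u.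
        R b u (map (hom (Md b) x u) \<alpha> @ [a]) t (map (hom (Md (\<not> b)) y t) \<beta> @ [a']))" using u by blast
  qed (use \<phi> sat in auto)
  show ?thesis using main[of True w "p w"] main[of False "p w" w] by (auto simp: Md_def)
qed

text \<open>Within one model, pairing a tuple at \<open>x\<close> with its image at a later world
  \<open>y\<close> is an asimulation: a world above \<open>y\<close> is also above \<open>x\<close>,
  and can be paired with itself.\<close>

lemma Sat_mono:
  assumes sig: "is_sig \<Theta>" and SM: "(M, w) \<in> Str L \<Theta>" and wv: "(w, v) \<in> acc M"
    and \<phi>: "\<phi> \<in> Sen L \<Theta>" and sat: "Sat L M w \<phi>"
  shows "Sat L M v \<phi>"
proof -
  have M: "is_model \<Theta> M" "w \<in> wlds M" "in_class K M" using SM Str_iff[OF sig] by auto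
  note D = is_modelD[OF M(1)]
  define R where "R (b :: bool) x \<alpha> y \<beta> \<longleftrightarrow> (x, y) \<in> acc M \<and> set \<alpha> \<subseteq> dmn M x \<and> \<beta> = map (hom M x y) \<alpha>" for b x \<alpha> y \<beta>
  have Rsame: "R b x \<alpha> x \<alpha>" if "x \<in> wlds M" "set \<alpha> \<subseteq> dmn M x" for b x \<alpha>
    using that D(5) D(21)[of _ x] by (auto simp: R_def subset_iff intro!: map_idI[symmetric])
  have Rup: "map (hom M y t) \<beta> = map (hom M x t) \<alpha>" "set (map (hom M x t) \<alpha>) \<subseteq> dmn M t" "(x, t) \<in> acc M" "t \<in> wlds M"
    if R: "R b x \<alpha> y \<beta>" and t: "(y, t) \<in> acc M" for b x \<alpha> y \<beta> t
  proof -
    have xy: "(x, y) \<in> acc M" "set \<alpha> \<subseteq> dmn M x" "\<beta> = map (hom M x y) \<alpha>" using R by (auto simp: R_def)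
    show "map (hom M y t) \<beta> = map (hom M x t) \<alpha>" using xy D(22)[OF xy(1) t] by auto
    show xt: "(x, t) \<in> acc M" using D(6)[OF xy(1) t] .
    show "set (map (hom M x t) \<alpha>) \<subseteq> dmn M t" using xy(2) D(16)[OF xt] by auto
    show "t \<in> wlds M" using D(4)[OF t] by blast
  qed
  have "Sat L ((\<lambda>_. M) (\<not> True)) v \<phi>"
  proof (rule preservation[OF sig, where R = R and Md = "\<lambda>_. M" and ?w1.0 = w])
    show "(M, w) \<in> Str L \<Theta>" "(M, v) \<in> Str L \<Theta>" using SM M D(4)[OF wv] Str_iff[OF sig] by auto
    show "R True w [] v []" using wv by (simp add: R_def)
    fix b x \<alpha> y \<beta> assume R: "R b x \<alpha> y \<beta>"
    then have xy: "(x, y) \<in> acc M" "set \<alpha> \<subseteq> dmn M x" "\<beta> = map (hom M x y) \<alpha>" by (auto simp: R_def)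
    show "x \<in> wlds M \<and> y \<in> wlds M \<and> set \<alpha> \<subseteq> dmn M x \<and> set \<beta> \<subseteq> dmn M y \<and> length \<alpha> = length \<beta>"
      using xy D(4)[OF xy(1)] D(16)[OF xy(1)] by auto
    show "holds M y (nth \<beta>) \<psi>"
      if \<psi>: "fm_over (has_eq K) \<Theta> \<psi>" "fv \<psi> \<subseteq> {..<length \<alpha>}" "holds M x (nth \<alpha>) \<psi>" for \<psi>
    proof -
      have "holds M y (hom M x y \<circ> nth \<alpha>) \<psi>"
        using \<psi>(2) xy(2) by (intro holds_persistent[OF M(1) \<psi>(1) xy(1) _ \<psi>(3)]) (auto simp: subset_iff)
      moreover have "holds M y (hom M x y \<circ> nth \<alpha>) \<psi> = holds M y (nth \<beta>) \<psi>"
        unfolding xy(3) using \<psi>(2) by (intro holds_cong) auto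
      ultimately show ?thesis by simp
    qed
    show "\<exists>a'\<in>dmn M y. R b x (\<alpha> @ [a]) y (\<beta> @ [a'])" if "a \<in> dmn M x" for a
      using that R D(16)[OF xy(1)] by (auto simp: R_def)
    fix t assume t: "(y, t) \<in> acc M"
    note U = Rup[OF R t]
    show "\<exists>u. (x, u) \<in> acc M \<and> R b u (map (hom M x u) \<alpha>) t (map (hom M y t) \<beta>) \<and>
           R (\<not> b) t (map (hom M y t) \<beta>) u (map (hom M x u) \<alpha>)"
      unfolding U(1) using U(3) Rsame[OF U(4,2)] by blast
    fix a' assume a': "a' \<in> dmn M t"
    have "R b t (map (hom M x t) \<alpha> @ [a']) t (map (hom M x t) \<alpha> @ [a'])"
      using U(2,4) a' by (intro Rsame) auto
    then show "\<exists>u. (x, u) \<in> acc M \<and> (\<exists>a\<in>dmn M u.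
        R b u (map (hom M x u) \<alpha> @ [a]) t (map (hom M y t) \<beta> @ [a']))"
      unfolding U(1) using U(3) a' by blast
  qed (use \<phi> sat in auto)
  then show ?thesis by simp
qed

section \<open>Cone expansions instead of members of \<open>Bpl\<close>\<close>

lemma cone_exp_Str:
  assumes sig: "is_sig \<Theta>" and M: "(M, w) \<in> Str L \<Theta>" and nt: "name_tuple M w cs as" and wv: "(w, v) \<in> acc M"
  shows "(cone_exp M w cs as, v) \<in> Str L (add_consts \<Theta> cs)"
proof -
  have "is_model \<Theta> M" "w \<in> wlds M" "in_class K M" using M Str_iff[OF sig] by auto
  then show ?thesis unfolding Str_iff[OF is_sig_add_consts[OF sig]]
    using cone_exp_model[OF _ _ nt] cone_exp_in_class wv by simp
qed

lemma Str_pt: "is_sig \<Theta> \<Longrightarrow> (M, w) \<in> Str L \<Theta> \<Longrightarrow> v \<in> wlds M \<Longrightarrow> (M, v) \<in> Str L \<Theta>"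
  by (simp add: Str_iff)

lemma Sat_cone_exp_Nil:
  assumes sig: "is_sig \<Theta>" and SM: "(M, w) \<in> Str L \<Theta>" and \<phi>: "\<phi> \<in> Sen L \<Theta>"
  shows "Sat L (cone_exp M w [] []) w \<phi> \<longleftrightarrow> Sat L M w \<phi>"
proof -
  have M: "is_model \<Theta> M" "w \<in> wlds M" using SM Str_iff[OF sig] by auto
  have nt: "name_tuple M w [] []" by (simp add: name_tuple_def)
  have "(cone_exp M w [] [], w) \<in> Str L \<Theta>"
    using cone_exp_Str[OF sig SM nt model_acc_refl[OF M]] by simp
  then show ?thesis using covers_Sat[OF sig SM _ covers_cone_exp_Nil[OF M] \<phi>] by simp
qed

lemma Sat_cone_exp_shift:
  assumes sig: "is_sig \<Theta>" and SM: "(M, v) \<in> Str L \<Theta>" and vu: "(v, u) \<in> acc M"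
    and nt: "name_tuple M v cs as" and \<phi>: "\<phi> \<in> Sen L (add_consts \<Theta> cs)"
  shows "Sat L (cone_exp M v cs as) u \<phi> \<longleftrightarrow> Sat L (cone_exp M u cs (map (hom M v u) as)) u \<phi>"
proof -
  have M: "is_model \<Theta> M" "v \<in> wlds M" using SM Str_iff[OF sig] by auto
  have u: "u \<in> wlds M" using model_acc_wlds[OF M(1) vu] by blast
  show ?thesis
    by (rule covers_Sat[OF is_sig_add_consts[OF sig] cone_exp_Str[OF sig SM nt vu] _ cone_exp_covers_shift[OF M(1) vu nt] \<phi>])
      (rule cone_exp_Str[OF sig Str_pt[OF sig SM u] name_tuple_hom[OF M(1) vu nt] model_acc_refl[OF M(1) u]])
qed

text \<open>A member of \<open>oplus\<close> agrees with the cone expansion above \<open>w\<close>,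
  so the choice that \<open>L\<close> makes through \<open>Bpl\<close> has no influence on truth at
  \<open>w\<close>.\<close>

lemma Sat_oplus:
  assumes sig: "is_sig \<Theta>" and SM: "(M, w) \<in> Str L \<Theta>" and nt: "name_tuple M w cs as"
    and N: "N \<in> oplus M w cs as" "in_class K N" and \<phi>: "\<phi> \<in> Sen L (add_consts \<Theta> cs)"
  shows "Sat L N w \<phi> \<longleftrightarrow> Sat L (cone_exp M w cs as) w \<phi>"
proof -
  have M: "is_model \<Theta> M" "w \<in> wlds M" using SM Str_iff[OF sig] by auto
  note cov = oplus_covers_cone_exp[OF M nt N(1)]
  have "(N, w) \<in> Str L (add_consts \<Theta> cs)"
    using N cov(2) model_sgn[OF M(1)] by (simp add: Str_iff is_sig_add_consts[OF sig] oplus_def)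
  then show ?thesis
    using covers_Sat[OF is_sig_add_consts[OF sig] _ cone_exp_Str[OF sig SM nt model_acc_refl[OF M]] cov(1) \<phi>] by simp
qed

lemma Bpl_props:
  assumes sig: "is_sig \<Theta>" and SM: "(M, w) \<in> Str L \<Theta>" and nt: "name_tuple M w cs as"
  shows "Bpl L M w cs as \<noteq> {}" "N \<in> Bpl L M w cs as \<Longrightarrow> N \<in> oplus M w cs as \<and> in_class K N"
proof -
  have *: "Bpl L M w cs as \<noteq> {} \<and> Bpl L M w cs as \<subseteq> oplus M w cs as \<and>
       (\<forall>N\<in>Bpl L M w cs as. \<forall>v\<in>wlds N. (N, v) \<in> Str L (add_consts \<Theta> cs))"
    using abstract assms unfolding abstract_logic_def boxplus_ok_def by blast
  show "Bpl L M w cs as \<noteq> {}" using * by blast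
  show "N \<in> Bpl L M w cs as \<Longrightarrow> N \<in> oplus M w cs as \<and> in_class K N"
    using * oplus_covers_cone_exp(2)[OF _ _ nt] SM Str_iff[OF sig] Str_iff[OF is_sig_add_consts[OF sig]] by blast
qed

section \<open>Sentences for rules at all later worlds\<close>

lemma ex_all_sentence:
  assumes sig: "is_sig \<Theta>" and c: "c \<notin> csts \<Theta>" and \<phi>: "\<phi> \<in> Sen L (add_consts \<Theta> [c])"
  shows "\<exists>\<chi>\<in>Sen L \<Theta>. \<forall>M w. (M, w) \<in> Str L \<Theta> \<longrightarrow>
    (Sat L M w \<chi> \<longleftrightarrow> (\<forall>v a. (w, v) \<in> acc M \<longrightarrow> a \<in> dmn M v \<longrightarrow> Sat L (cone_exp M v [c] [a]) v \<phi>))"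
proof -
  have "quantifier_closure L" using abstract by (simp add: abstract_logic_def)
  from this[unfolded quantifier_closure_def, rule_format, OF conjI[OF sig c] \<phi>, THEN conjunct2]
  obtain \<chi> where \<chi>: "\<chi> \<in> Sen L \<Theta>" and iff: "\<And>M w. (M, w) \<in> Str L \<Theta> \<Longrightarrow>
           Sat L M w \<chi> \<longleftrightarrow> (\<forall>v. (w, v) \<in> acc M \<longrightarrow>
             (\<forall>a\<in>dmn M v. \<exists>N\<in>Bpl L M v [c] [a]. Sat L N v \<phi>))" by blast
  \<comment> \<open>\<open>Bpl\<close> is nonempty and all its members agree with the cone
    expansion, so the quantifier over its members disappears.\<close>
  have "(\<exists>N\<in>Bpl L M v [c] [a]. Sat L N v \<phi>) \<longleftrightarrow> Sat L (cone_exp M v [c] [a]) v \<phi>"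
    if SM: "(M, w) \<in> Str L \<Theta>" and v: "(w, v) \<in> acc M" and a: "a \<in> dmn M v" for M w v a
  proof -
    have M: "is_model \<Theta> M" using SM Str_iff[OF sig] by auto
    have Sv: "(M, v) \<in> Str L \<Theta>" using Str_pt[OF sig SM] model_acc_wlds[OF M v] by blast
    have nt: "name_tuple M v [c] [a]" using a c model_sgn[OF M] by (simp add: name_tuple_def)
    show ?thesis using Bpl_props[OF sig Sv nt] Sat_oplus[OF sig Sv nt _ _ \<phi>] by blast
  qed
  then show ?thesis using \<chi> iff by (intro bexI[of _ \<chi>]) auto
qed

lemma ex_imp_sentence:
  assumes sig: "is_sig \<Theta>" and \<phi>: "\<phi> \<in> Sen L \<Theta>" and \<psi>: "\<psi> \<in> Sen L \<Theta>"
  shows "\<exists>\<chi>\<in>Sen L \<Theta>. \<forall>M w. (M, w) \<in> Str L \<Theta> \<longrightarrow>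
    (Sat L M w \<chi> \<longleftrightarrow> (\<forall>v. (w, v) \<in> acc M \<longrightarrow> Sat L M v \<phi> \<longrightarrow> Sat L M v \<psi>))"
proof -
  have "propositional_closure L" using abstract by (simp add: abstract_logic_def)
  from this[unfolded propositional_closure_def, rule_format, OF sig, THEN conjunct2, rule_format, OF \<phi> \<psi>, THEN conjunct1]
  show ?thesis by blast
qed

lemma ex_and_sentence:
  assumes sig: "is_sig \<Theta>" and \<phi>: "\<phi> \<in> Sen L \<Theta>" and \<psi>: "\<psi> \<in> Sen L \<Theta>"
  shows "\<exists>\<chi>\<in>Sen L \<Theta>. \<forall>M w. (M, w) \<in> Str L \<Theta> \<longrightarrow> (Sat L M w \<chi> \<longleftrightarrow> Sat L M w \<phi> \<and> Sat L M w \<psi>)"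
proof -
  have "propositional_closure L" using abstract by (simp add: abstract_logic_def)
  from this[unfolded propositional_closure_def, rule_format, OF sig, THEN conjunct2, rule_format, OF \<phi> \<psi>, THEN conjunct2, THEN conjunct1]
  show ?thesis by blast
qed

text \<open>The quantifier is iterated: an element named at \<open>v\<close> is carried to the later
  world \<open>u\<close> at which the next ones are chosen, so that in the end all are named at one
  world.\<close>

lemma ex_all_list_sentence:
  assumes "is_sig \<Theta>" "distinct cs" "set cs \<inter> csts \<Theta> = {}" "\<phi> \<in> Sen L (add_consts \<Theta> cs)"
  shows "\<exists>\<chi>\<in>Sen L \<Theta>. \<forall>M w. (M, w) \<in> Str L \<Theta> \<longrightarrow>
    (Sat L M w \<chi> \<longleftrightarrow> (\<forall>v as. (w, v) \<in> acc M \<longrightarrow> length as = length cs \<longrightarrow> set as \<subseteq> dmn M v \<longrightarrow>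
       Sat L (cone_exp M v cs as) v \<phi>))"
  using assms
proof (induction cs arbitrary: \<Theta>)
  case Nil
  \<comment> \<open>Without constants the sentence is \<phi> itself; that it holds at all later
    worlds is persistence.\<close>
  have "Sat L M w \<phi> \<longleftrightarrow> (\<forall>v. (w, v) \<in> acc M \<longrightarrow> Sat L (cone_exp M v [] []) v \<phi>)"
    if SM: "(M, w) \<in> Str L \<Theta>" for M w
  proof -
    have M: "is_model \<Theta> M" "w \<in> wlds M" using SM Str_iff[OF Nil(1)] by auto
    have "Sat L (cone_exp M v [] []) v \<phi> \<longleftrightarrow> Sat L M v \<phi>" if "(w, v) \<in> acc M" for v
      using Nil Str_pt[OF Nil(1) SM] model_acc_wlds[OF M(1) that] by (intro Sat_cone_exp_Nil) auto
    then show ?thesis using Sat_mono[OF Nil(1) SM] Nil(4) model_acc_refl[OF M] by auto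
  qed
  then show ?case using Nil(4) by (intro bexI[of _ \<phi>]) auto
next
  case (Cons c cs)
  have sig: "is_sig \<Theta>" and c: "c \<notin> csts \<Theta>" and c': "c \<notin> set cs" using Cons.prems by auto
  have sig': "is_sig (add_consts \<Theta> [c])" using sig by (rule is_sig_add_consts)
  have sg: "add_consts (add_consts \<Theta> [c]) cs = add_consts \<Theta> (c # cs)" by (simp add: add_consts_add_consts)
  have "\<exists>\<chi>\<in>Sen L (add_consts \<Theta> [c]). \<forall>M w. (M, w) \<in> Str L (add_consts \<Theta> [c]) \<longrightarrow>
    (Sat L M w \<chi> \<longleftrightarrow> (\<forall>v as. (w, v) \<in> acc M \<longrightarrow> length as = length cs \<longrightarrow> set as \<subseteq> dmn M v \<longrightarrow>
       Sat L (cone_exp M v cs as) v \<phi>))"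
    using Cons.prems c' by (intro Cons.IH[OF sig']) (simp_all add: sg)
  then obtain \<chi>1 where \<chi>1: "\<chi>1 \<in> Sen L (add_consts \<Theta> [c])" "\<And>M w. (M, w) \<in> Str L (add_consts \<Theta> [c]) \<Longrightarrow>
    (Sat L M w \<chi>1 \<longleftrightarrow> (\<forall>v as. (w, v) \<in> acc M \<longrightarrow> length as = length cs \<longrightarrow> set as \<subseteq> dmn M v \<longrightarrow>
       Sat L (cone_exp M v cs as) v \<phi>))" by blast
  obtain \<chi> where \<chi>: "\<chi> \<in> Sen L \<Theta>" "\<And>M w. (M, w) \<in> Str L \<Theta> \<Longrightarrow>
    (Sat L M w \<chi> \<longleftrightarrow> (\<forall>v a. (w, v) \<in> acc M \<longrightarrow> a \<in> dmn M v \<longrightarrow> Sat L (cone_exp M v [c] [a]) v \<chi>1))"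
    using ex_all_sentence[OF sig c \<chi>1(1)] by blast
  have "Sat L M w \<chi> \<longleftrightarrow> (\<forall>v as. (w, v) \<in> acc M \<longrightarrow> length as = length (c # cs) \<longrightarrow> set as \<subseteq> dmn M v \<longrightarrow>
       Sat L (cone_exp M v (c # cs) as) v \<phi>)" (is "_ \<longleftrightarrow> ?R")
    if SM: "(M, w) \<in> Str L \<Theta>" for M w
  proof -
    have M: "is_model \<Theta> M" "w \<in> wlds M" using SM Str_iff[OF sig] by auto
    have twice: "Sat L (cone_exp (cone_exp M v [c] [a]) u cs as) u \<phi> \<longleftrightarrow> Sat L (cone_exp M u (c # cs) (hom M v u a # as)) u \<phi>"
      if v: "(w, v) \<in> acc M" and a: "a \<in> dmn M v" and u: "(v, u) \<in> acc M" and as: "length as = length cs" "set as \<subseteq> dmn M u" for v a u as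
    proof -
      have vW: "v \<in> wlds M" and uW: "u \<in> wlds M" using model_acc_wlds[OF M(1) u] by auto
      have nt1: "name_tuple M v [c] [a]" using a c model_sgn[OF M(1)] by (simp add: name_tuple_def)
      have nt: "name_tuple M u (c # cs) (hom M v u a # as)"
        using as model_hom[OF M(1) u a] model_sgn[OF M(1)] Cons.prems by (simp add: name_tuple_def)
      have nt2: "name_tuple (cone_exp M v [c] [a]) u cs as"
        using as model_sgn[OF M(1)] Cons.prems u by (auto simp: name_tuple_def)
      have S1: "(cone_exp M v [c] [a], u) \<in> Str L (add_consts \<Theta> [c])"
        using cone_exp_Str[OF sig Str_pt[OF sig SM vW] nt1 u] .
      have S2: "(cone_exp (cone_exp M v [c] [a]) u cs as, u) \<in> Str L (add_consts \<Theta> (c # cs))"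
        using cone_exp_Str[OF sig' S1 nt2, of u] u model_acc_refl[OF M(1) uW] sg by simp
      have S3: "(cone_exp M u (c # cs) (hom M v u a # as), u) \<in> Str L (add_consts \<Theta> (c # cs))"
        using cone_exp_Str[OF sig Str_pt[OF sig SM uW] nt model_acc_refl[OF M(1) uW]] .
      show ?thesis
        using covers_Sat[OF is_sig_add_consts[OF sig] S2 S3 cone_exp_covers_twice[OF M(1) u a nt] Cons.prems(4)] .
    qed
    have "Sat L M w \<chi> \<longleftrightarrow> (\<forall>v a. (w, v) \<in> acc M \<longrightarrow> a \<in> dmn M v \<longrightarrow> Sat L (cone_exp M v [c] [a]) v \<chi>1)"
      using \<chi>(2) SM by blast
    also have "\<dots> \<longleftrightarrow> (\<forall>v a u as. (w, v) \<in> acc M \<longrightarrow> a \<in> dmn M v \<longrightarrow> (v, u) \<in> acc M \<longrightarrow> length as = length cs \<longrightarrow> set as \<subseteq> dmn M u \<longrightarrow>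
       Sat L (cone_exp M u (c # cs) (hom M v u a # as)) u \<phi>)"
    proof -
      have "Sat L (cone_exp M v [c] [a]) v \<chi>1 \<longleftrightarrow> (\<forall>u as. (v, u) \<in> acc M \<longrightarrow> length as = length cs \<longrightarrow> set as \<subseteq> dmn M u \<longrightarrow>
       Sat L (cone_exp M u (c # cs) (hom M v u a # as)) u \<phi>)" if v: "(w, v) \<in> acc M" and a: "a \<in> dmn M v" for v a
      proof -
        have vW: "v \<in> wlds M" using model_acc_wlds[OF M(1) v] by auto
        have nt1: "name_tuple M v [c] [a]" using a c model_sgn[OF M(1)] by (simp add: name_tuple_def)
        have S1: "(cone_exp M v [c] [a], v) \<in> Str L (add_consts \<Theta> [c])"
          using cone_exp_Str[OF sig Str_pt[OF sig SM vW] nt1 model_acc_refl[OF M(1) vW]] .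
        show ?thesis unfolding \<chi>1(2)[OF S1] using twice[OF v a] model_acc_refl[OF M(1) vW] by auto
      qed
      then show ?thesis by blast
    qed
    also have "\<dots> \<longleftrightarrow> ?R"
    proof
      assume A: "\<forall>v a u as. (w, v) \<in> acc M \<longrightarrow> a \<in> dmn M v \<longrightarrow> (v, u) \<in> acc M \<longrightarrow> length as = length cs \<longrightarrow> set as \<subseteq> dmn M u \<longrightarrow>
       Sat L (cone_exp M u (c # cs) (hom M v u a # as)) u \<phi>"
      show ?R
      proof (intro allI impI)
        fix v as assume v: "(w, v) \<in> acc M" and as: "length as = length (c # cs)" "set as \<subseteq> dmn M v"
        then obtain a as' where as': "as = a # as'" by (cases as) auto
        have "hom M v v a = a" using as as' by (intro model_hom_id[OF M(1)]) auto
        then show "Sat L (cone_exp M v (c # cs) as) v \<phi>"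
          using A[rule_format, of v a v as'] v as as' model_acc_refl[OF M(1)] model_acc_wlds[OF M(1) v] by auto
      qed
    next
      assume R: ?R
      show "\<forall>v a u as. (w, v) \<in> acc M \<longrightarrow> a \<in> dmn M v \<longrightarrow> (v, u) \<in> acc M \<longrightarrow> length as = length cs \<longrightarrow> set as \<subseteq> dmn M u \<longrightarrow>
       Sat L (cone_exp M u (c # cs) (hom M v u a # as)) u \<phi>"
        using R model_acc_trans[OF M(1)] model_hom[OF M(1)] by auto
    qed
    finally show ?thesis .
  qed
  then show ?case using \<chi>(1) by blast
qed

text \<open>Implication quantifies over later worlds once more; this is absorbed by the quantifier
  over worlds that is already there. Rules of this form are the \<open>L\<close>-sentences by which
  types of one model are controlled in another.\<close>

lemma ex_all_imp_sentence:
  assumes sig: "is_sig \<Theta>" and cs: "distinct cs" "set cs \<inter> csts \<Theta> = {}"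
    and \<phi>: "\<phi> \<in> Sen L (add_consts \<Theta> cs)" and \<psi>: "\<psi> \<in> Sen L (add_consts \<Theta> cs)"
  shows "\<exists>\<chi>\<in>Sen L \<Theta>. \<forall>M w. (M, w) \<in> Str L \<Theta> \<longrightarrow>
    (Sat L M w \<chi> \<longleftrightarrow> (\<forall>v as. (w, v) \<in> acc M \<longrightarrow> length as = length cs \<longrightarrow> set as \<subseteq> dmn M v \<longrightarrow>
       Sat L (cone_exp M v cs as) v \<phi> \<longrightarrow> Sat L (cone_exp M v cs as) v \<psi>))"
proof -
  obtain \<theta> where \<theta>: "\<theta> \<in> Sen L (add_consts \<Theta> cs)" "\<And>M w. (M, w) \<in> Str L (add_consts \<Theta> cs) \<Longrightarrow>
    (Sat L M w \<theta> \<longleftrightarrow> (\<forall>v. (w, v) \<in> acc M \<longrightarrow> Sat L M v \<phi> \<longrightarrow> Sat L M v \<psi>))"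
    using ex_imp_sentence[OF is_sig_add_consts[OF sig] \<phi> \<psi>] by blast
  obtain \<chi> where \<chi>: "\<chi> \<in> Sen L \<Theta>" "\<And>M w. (M, w) \<in> Str L \<Theta> \<Longrightarrow>
    (Sat L M w \<chi> \<longleftrightarrow> (\<forall>v as. (w, v) \<in> acc M \<longrightarrow> length as = length cs \<longrightarrow> set as \<subseteq> dmn M v \<longrightarrow>
       Sat L (cone_exp M v cs as) v \<theta>))"
    using ex_all_list_sentence[OF sig cs \<theta>(1)] by blast
  have "Sat L M w \<chi> \<longleftrightarrow> (\<forall>v as. (w, v) \<in> acc M \<longrightarrow> length as = length cs \<longrightarrow> set as \<subseteq> dmn M v \<longrightarrow>
       Sat L (cone_exp M v cs as) v \<phi> \<longrightarrow> Sat L (cone_exp M v cs as) v \<psi>)" (is "_ \<longleftrightarrow> ?R")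
    if SM: "(M, w) \<in> Str L \<Theta>" for M w
  proof -
    have M: "is_model \<Theta> M" "w \<in> wlds M" using SM Str_iff[OF sig] by auto
    have *: "Sat L (cone_exp M v cs as) v \<theta> \<longleftrightarrow> (\<forall>u. (v, u) \<in> acc M \<longrightarrow> Sat L (cone_exp M u cs (map (hom M v u) as)) u \<phi> \<longrightarrow>
       Sat L (cone_exp M u cs (map (hom M v u) as)) u \<psi>)"
      if v: "(w, v) \<in> acc M" and as: "length as = length cs" "set as \<subseteq> dmn M v" for v as
    proof -
      have vW: "v \<in> wlds M" using model_acc_wlds[OF M(1) v] by auto
      note Sv = Str_pt[OF sig SM vW]
      have nt: "name_tuple M v cs as" using as cs model_sgn[OF M(1)] by (simp add: name_tuple_def)
      have S1: "(cone_exp M v cs as, v) \<in> Str L (add_consts \<Theta> cs)"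
        using cone_exp_Str[OF sig Sv nt model_acc_refl[OF M(1) vW]] .
      show ?thesis unfolding \<theta>(2)[OF S1]
        using Sat_cone_exp_shift[OF sig Sv _ nt \<phi>] Sat_cone_exp_shift[OF sig Sv _ nt \<psi>] model_acc_refl[OF M(1) vW] by auto
    qed
    have idm: "map (hom M v v) as = as" if "set as \<subseteq> dmn M v" for v as
      using that model_hom_id[OF M(1)] by (intro map_idI) auto
    have "Sat L M w \<chi> \<longleftrightarrow> (\<forall>v as. (w, v) \<in> acc M \<longrightarrow> length as = length cs \<longrightarrow> set as \<subseteq> dmn M v \<longrightarrow>
       (\<forall>u. (v, u) \<in> acc M \<longrightarrow> Sat L (cone_exp M u cs (map (hom M v u) as)) u \<phi> \<longrightarrow>
       Sat L (cone_exp M u cs (map (hom M v u) as)) u \<psi>))"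
      unfolding \<chi>(2)[OF SM] using * by blast
    also have "\<dots> \<longleftrightarrow> ?R"
    proof
      assume A: "\<forall>v as. (w, v) \<in> acc M \<longrightarrow> length as = length cs \<longrightarrow> set as \<subseteq> dmn M v \<longrightarrow>
       (\<forall>u. (v, u) \<in> acc M \<longrightarrow> Sat L (cone_exp M u cs (map (hom M v u) as)) u \<phi> \<longrightarrow>
       Sat L (cone_exp M u cs (map (hom M v u) as)) u \<psi>)"
      show ?R
      proof (intro allI impI)
        fix v as assume v: "(w, v) \<in> acc M" "length as = length cs" "set as \<subseteq> dmn M v" "Sat L (cone_exp M v cs as) v \<phi>"
        have "(v, v) \<in> acc M" using model_acc_refl[OF M(1)] model_acc_wlds[OF M(1) v(1)] by blast
        then show "Sat L (cone_exp M v cs as) v \<psi>"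
          using A[rule_format, OF v(1-3), of v] v(4) idm[OF v(3)] by simp
      qed
    next
      assume R: ?R
      show "\<forall>v as. (w, v) \<in> acc M \<longrightarrow> length as = length cs \<longrightarrow> set as \<subseteq> dmn M v \<longrightarrow>
       (\<forall>u. (v, u) \<in> acc M \<longrightarrow> Sat L (cone_exp M u cs (map (hom M v u) as)) u \<phi> \<longrightarrow>
       Sat L (cone_exp M u cs (map (hom M v u) as)) u \<psi>)"
      proof (intro allI impI)
        fix v as u assume v: "(w, v) \<in> acc M" "length as = length cs" "set as \<subseteq> dmn M v" and u: "(v, u) \<in> acc M"
          and sat: "Sat L (cone_exp M u cs (map (hom M v u) as)) u \<phi>"
        have "set (map (hom M v u) as) \<subseteq> dmn M u" using v(3) model_hom[OF M(1) u] by auto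
        then show "Sat L (cone_exp M u cs (map (hom M v u) as)) u \<psi>"
          using R[rule_format, OF model_acc_trans[OF M(1) v(1) u]] v(2) sat by simp
      qed
    qed
    finally show ?thesis .
  qed
  then show ?thesis using \<chi>(1) by blast
qed

end

section \<open>Translation of standard sentences\<close>

instance tm :: (countable) countable by countable_datatype
instance fm :: (countable) countable by countable_datatype

lemma fm_over_symbols:
  "fm_over q \<Theta> \<phi> \<Longrightarrow> set_fm \<phi> \<subseteq> (\<Union>n. preds \<Theta> n) \<union> csts \<Theta>"
proof (induction \<phi>)
  case (Atom P ts)
  have "set_tm t \<subseteq> csts \<Theta>" if "t \<in> set ts" for t using Atom that by (cases t) auto
  then show ?case using Atom by auto
next
  case (Eq s t)
  then show ?case by (cases s; cases t) auto
qed auto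

text \<open>Coding the finitely many symbols by numbers embeds the formulas into the countable type
  of formulas over \<open>nat\<close>.\<close>

lemma countable_formulas:
  assumes "finite_sig \<Theta>"
  shows "countable {\<phi>. fm_over q \<Theta> \<phi>}"
proof -
  let ?S = "(\<Union>n. preds \<Theta> n) \<union> csts \<Theta>"
  have "(\<Union>n. preds \<Theta> n) = snd ` (SIGMA n:UNIV. preds \<Theta> n)" by force
  then have "finite ?S" using assms by (simp add: finite_sig_def)
  then have inj: "inj_on (to_nat_on ?S) ?S" by (simp add: countable_finite inj_on_to_nat_on)
  have "inj_on (map_fm (to_nat_on ?S)) {\<phi>. set_fm \<phi> \<subseteq> ?S}"
  proof (rule inj_onI)
    fix \<phi> \<psi> assume "\<phi> \<in> {\<phi>. set_fm \<phi> \<subseteq> ?S}" "\<psi> \<in> {\<phi>. set_fm \<phi> \<subseteq> ?S}"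
      "map_fm (to_nat_on ?S) \<phi> = map_fm (to_nat_on ?S) \<psi>"
    then show "\<phi> = \<psi>" using inj by (elim fm.inj_map_strong[rotated]) (auto dest: inj_onD)
  qed
  moreover have "{\<phi>. fm_over q \<Theta> \<phi>} \<subseteq> {\<phi>. set_fm \<phi> \<subseteq> ?S}"
    using fm_over_symbols by blast
  ultimately have "inj_on (map_fm (to_nat_on ?S)) {\<phi>. fm_over q \<Theta> \<phi>}"
    by (rule inj_on_subset)
  then show ?thesis using countable_image_inj_on[of "map_fm (to_nat_on ?S)"] by blast
qed

section \<open>The signature of a formula\<close>

fun tm_csts :: "'u tm \<Rightarrow> 'u set" where
  "tm_csts (Var x) = {}"
| "tm_csts (Cst c) = {c}"

fun fm_csts :: "'u fm \<Rightarrow> 'u set" where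
  "fm_csts Bot = {}"
| "fm_csts (Atom P ts) = (\<Union>t\<in>set ts. tm_csts t)"
| "fm_csts (Eq s t) = tm_csts s \<union> tm_csts t"
| "fm_csts (And \<phi> \<psi>) = fm_csts \<phi> \<union> fm_csts \<psi>"
| "fm_csts (Or \<phi> \<psi>) = fm_csts \<phi> \<union> fm_csts \<psi>"
| "fm_csts (Imp \<phi> \<psi>) = fm_csts \<phi> \<union> fm_csts \<psi>"
| "fm_csts (All x \<phi>) = fm_csts \<phi>"
| "fm_csts (Ex x \<phi>) = fm_csts \<phi>"

fun fm_preds :: "'u fm \<Rightarrow> (nat \<times> 'u) set" where
  "fm_preds Bot = {}"
| "fm_preds (Atom P ts) = {(length ts, P)}"
| "fm_preds (Eq s t) = {}"
| "fm_preds (And \<phi> \<psi>) = fm_preds \<phi> \<union> fm_preds \<psi>"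
| "fm_preds (Or \<phi> \<psi>) = fm_preds \<phi> \<union> fm_preds \<psi>"
| "fm_preds (Imp \<phi> \<psi>) = fm_preds \<phi> \<union> fm_preds \<psi>"
| "fm_preds (All x \<phi>) = fm_preds \<phi>"
| "fm_preds (Ex x \<phi>) = fm_preds \<phi>"

definition fm_sig :: "'u fm \<Rightarrow> 'u signature" where
  "fm_sig \<phi> = \<lparr>preds = (\<lambda>n. {P. (n, P) \<in> fm_preds \<phi>}), csts = fm_csts \<phi>\<rparr>"

lemma tm_over_iff: "tm_over \<Theta> t \<longleftrightarrow> tm_csts t \<subseteq> csts \<Theta>"
  by (cases t) auto

lemma fm_over_iff:
  "fm_over q \<Theta> \<phi> \<longleftrightarrow> fm_over q (fm_sig \<phi>) \<phi> \<and> sub_sig (fm_sig \<phi>) \<Theta>"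
proof -
  \<comment> \<open>Over the full signature only the flag for equality is checked; the other two
    conjuncts are the inclusion of signatures.\<close>
  have eq: "fm_over q \<Theta> \<phi> \<longleftrightarrow> fm_over q \<lparr>preds = (\<lambda>_. UNIV), csts = UNIV\<rparr> \<phi> \<and> (\<forall>n P. (n, P) \<in> fm_preds \<phi> \<longrightarrow> P \<in> preds \<Theta> n) \<and> fm_csts \<phi> \<subseteq> csts \<Theta>" for \<Theta>
    by (induction \<phi>) (auto simp: tm_over_iff)
  show ?thesis unfolding eq[of \<Theta>] eq[of "fm_sig \<phi>"] by (auto simp: fm_sig_def sub_sig_def)
qed

lemma finite_fm_sig: "finite_sig (fm_sig \<phi>)"
proof -
  have "finite (tm_csts t)" for t :: "'a tm" by (cases t) auto
  then have "finite (fm_csts \<phi>)" by (induction \<phi>) auto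
  moreover have "finite (fm_preds \<phi>)" by (induction \<phi>) auto
  moreover have "(SIGMA n:UNIV. {P. (n, P) \<in> fm_preds \<phi>}) = fm_preds \<phi>" by auto
  ultimately show ?thesis by (simp add: finite_sig_def fm_sig_def)
qed

lemma sub_sig_antisym: "sub_sig \<Theta> \<Theta>' \<Longrightarrow> sub_sig \<Theta>' \<Theta> \<Longrightarrow> \<Theta> = (\<Theta>' :: 'u signature)"
  by (rule signature.equality) (auto simp: sub_sig_def fun_eq_iff)

lemma sub_sig_refl: "sub_sig \<Theta> \<Theta>"
  by (simp add: sub_sig_def)

lemma sub_sig_trans: "sub_sig \<Theta> \<Theta>' \<Longrightarrow> sub_sig \<Theta>' \<Theta>'' \<Longrightarrow> sub_sig \<Theta> \<Theta>''"
  unfolding sub_sig_def by (meson order_trans)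

lemma sen_sig_eq:
  assumes "occurs_exactly L \<phi> \<Theta>" shows "sen_sig L \<phi> = \<Theta>"
  unfolding sen_sig_def
proof (rule the_equality[where P = "occurs_exactly L \<phi>", OF assms])
  fix \<Theta>' assume "occurs_exactly L \<phi> \<Theta>'"
  with assms have "sub_sig \<Theta> \<Theta>'" "sub_sig \<Theta>' \<Theta>"
    unfolding occurs_exactly_def using sub_sig_refl by blast+
  then show "\<Theta>' = \<Theta>" using sub_sig_antisym by blast
qed

lemma (in universe) is_sig_fm_sig:
  assumes "is_sig \<Theta>" "sub_sig (fm_sig \<phi>) (\<Theta> :: 'u signature)" shows "is_sig (fm_sig \<phi>)"
  unfolding is_sig_def
proof (intro conjI allI)
  show "preds (fm_sig \<phi>) 0 = {}" using assms by (auto simp: is_sig_def sub_sig_def)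
  show "small (preds (fm_sig \<phi>) n)" for n
    using assms unfolding is_sig_def sub_sig_def small_iff_tiny by (meson tiny_subset)
  show "small (csts (fm_sig \<phi>))"
    using assms unfolding is_sig_def sub_sig_def small_iff_tiny by (meson tiny_subset)
qed

lemma (in universe) std_occurs_exactly:
  assumes sig: "is_sig (\<Theta> :: 'u signature)" and \<phi>: "\<phi> \<in> Sen (std_logic K) \<Theta>"
  shows "occurs_exactly (std_logic K) \<phi> (fm_sig \<phi>)"
proof -
  have *: "fm_over (has_eq K) (fm_sig \<phi>) \<phi>" "sub_sig (fm_sig \<phi>) \<Theta>" "fv \<phi> = {}"
    using \<phi> fm_over_iff[of "has_eq K" \<Theta> \<phi>] by (auto simp: Sen_std)
  have "\<phi> \<in> Sen (std_logic K) \<Theta>' \<longleftrightarrow> sub_sig (fm_sig \<phi>) \<Theta>'" for \<Theta>'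
    unfolding Sen_std fm_over_iff[of "has_eq K" \<Theta>' \<phi>] using * by simp
  then show ?thesis
    unfolding occurs_exactly_def using is_sig_fm_sig[OF sig *(2)] finite_fm_sig by simp
qed

lemma reduct_simps [simp]:
  "sgn (reduct M \<Theta>) = \<Theta>" "wlds (reduct M \<Theta>) = wlds M" "acc (reduct M \<Theta>) = acc M" "dmn (reduct M \<Theta>) = dmn M"
  "hom (reduct M \<Theta>) = hom M" "as \<in> pint (reduct M \<Theta>) v P \<longleftrightarrow> as \<in> pint M v P \<and> P \<in> preds \<Theta> (length as)"
  "cint (reduct M \<Theta>) v = restrict (cint M v) (csts \<Theta>)"
  by (auto simp: reduct_def)

lemma reduct_covers:
  assumes "is_model \<Theta>' M" "is_model \<Theta> (reduct M \<Theta>)" "sub_sig \<Theta> \<Theta>'"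
  shows "covers q \<Theta> (\<lambda>x. x) (\<lambda>x. x) M w (reduct M \<Theta>)"
  by (rule covers_idI[OF assms(1,2)]) (use assms(3) in \<open>auto simp: sub_sig_def\<close>)

section \<open>Standard formulas translated into \<open>L\<close>\<close>

context extension_logic begin

lemma reduct_Str:
  assumes "is_sig \<Theta>" "is_sig \<Theta>'" "sub_sig \<Theta> \<Theta>'" "(M, w) \<in> Str L \<Theta>'"
  shows "(reduct M \<Theta>, w) \<in> Str L \<Theta>"
  using abstract assms unfolding abstract_logic_def structures_ok_def by blast

lemma Sat_reduct:
  assumes "is_sig \<Theta>" "is_sig \<Theta>'" "sub_sig \<Theta> \<Theta>'" "(M, w) \<in> Str L \<Theta>'" "\<phi> \<in> Sen L \<Theta>"
  shows "Sat L (reduct M \<Theta>) w \<phi> \<longleftrightarrow> Sat L M w \<phi>"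
  using abstract assms unfolding abstract_logic_def expansion_def by blast

text \<open>Extension provides an equivalent sentence over the signature of \<psi> alone; taking
  reducts carries the equivalence over to \<Theta>.\<close>

lemma ex_translation:
  assumes sig: "is_sig \<Theta>" and \<psi>: "\<psi> \<in> Sen (std_logic K) \<Theta>"
  shows "\<exists>\<psi>'\<in>Sen L \<Theta>. \<forall>M w s. (M, w) \<in> Str L \<Theta> \<longrightarrow> (Sat L M w \<psi>' \<longleftrightarrow> holds M w s \<psi>)"
proof -
  let ?\<Theta> = "fm_sig \<psi>"
  have \<psi>': "fm_over (has_eq K) ?\<Theta> \<psi>" "fv \<psi> = {}" and sub: "sub_sig ?\<Theta> \<Theta>"
    using \<psi> fm_over_iff[of "has_eq K" \<Theta> \<psi>] by (auto simp: Sen_std)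
  have sig': "is_sig ?\<Theta>" using is_sig_fm_sig[OF sig sub] .
  have sn: "sen_sig (std_logic K) \<psi> = ?\<Theta>" using sen_sig_eq[OF std_occurs_exactly[OF sig \<psi>]] .
  have "\<forall>\<phi>\<in>Sen (std_logic K) \<Theta>. let \<Theta>\<phi> = sen_sig (std_logic K) \<phi> in
        \<exists>\<psi>\<in>Sen L \<Theta>\<phi>.
          ((\<exists>\<chi>\<in>Sen L \<Theta>\<phi>. sen_sig L \<chi> = \<Theta>\<phi>) \<longrightarrow> sen_sig L \<psi> = \<Theta>\<phi>) \<and>
          (\<forall>(M, w)\<in>Str L \<Theta>\<phi>. Sat (std_logic K) M w \<phi> \<longleftrightarrow> Sat L M w \<psi>)"
    using ext sig unfolding extends_def by blast
  from bspec[OF this \<psi>] obtain \<chi> where \<chi>: "\<chi> \<in> Sen L ?\<Theta>"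
    "\<And>M w. (M, w) \<in> Str L ?\<Theta> \<Longrightarrow> Sat (std_logic K) M w \<psi> \<longleftrightarrow> Sat L M w \<chi>"
    unfolding sn Let_def by blast
  have "Sat L M w \<chi> \<longleftrightarrow> holds M w s \<psi>" if SM: "(M, w) \<in> Str L \<Theta>" for M w s
  proof -
    have M: "is_model \<Theta> M" "w \<in> wlds M" using SM Str_iff[OF sig] by auto
    note R = reduct_Str[OF sig' sig sub SM]
    have RM: "is_model ?\<Theta> (reduct M ?\<Theta>)" using R Str_iff[OF sig'] by auto
    have "Sat L M w \<chi> \<longleftrightarrow> Sat L (reduct M ?\<Theta>) w \<chi>" using Sat_reduct[OF sig' sig sub SM \<chi>(1)] by simp
    also have "\<dots> \<longleftrightarrow> Sat (std_logic K) (reduct M ?\<Theta>) w \<psi>" using \<chi>(2)[OF R] by simp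
    also have "\<dots> \<longleftrightarrow> holds (reduct M ?\<Theta>) w s \<psi>" using Sat_std_iff[OF RM _ \<psi>'(2)] M by simp
    also have "\<dots> \<longleftrightarrow> holds M w s \<psi>"
      using covers_holds[OF M(1) reduct_covers[OF M(1) RM sub] \<psi>'(1) model_acc_refl[OF M], of s] \<psi>'(2) by (simp add: comp_def)
    finally show ?thesis .
  qed
  then show ?thesis using Sen_mono[OF sig' sig sub \<chi>(1)] by blast
qed

text \<open>A formula with free variables becomes a sentence by substituting \<open>cs ! i\<close>
  for the variable \<open>i\<close>. This links assignments on the standard side with cone
  expansions on the side of \<open>L\<close>.\<close>

lemma ex_formula_translation:
  assumes sig: "is_sig \<Theta>" and cs: "distinct cs" "set cs \<inter> csts \<Theta> = {}"
    and \<psi>: "fm_over (has_eq K) \<Theta> \<psi>" "fv \<psi> \<subseteq> {..<length cs}"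
  shows "\<exists>\<psi>'\<in>Sen L (add_consts \<Theta> cs). \<forall>M w as. (M, w) \<in> Str L \<Theta> \<longrightarrow> length as = length cs \<longrightarrow> set as \<subseteq> dmn M w \<longrightarrow>
    (Sat L (cone_exp M w cs as) w \<psi>' \<longleftrightarrow> holds M w (nth as) \<psi>)"
proof -
  define \<sigma> where "\<sigma> i = (if i < length cs then Some (cs ! i) else None)" for i
  have ran: "ran \<sigma> \<subseteq> set cs" by (auto simp: \<sigma>_def ran_def split: if_splits)
  have dom: "dom \<sigma> = {..<length cs}" by (auto simp: \<sigma>_def dom_def)
  have "inst \<sigma> \<psi> \<in> Sen (std_logic K) (add_consts \<Theta> cs)"
    using fm_over_inst[OF \<psi>(1) ran] \<psi>(2) dom by (auto simp: Sen_std fv_inst)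
  then obtain \<psi>' where \<psi>': "\<psi>' \<in> Sen L (add_consts \<Theta> cs)"
    "\<And>M w s. (M, w) \<in> Str L (add_consts \<Theta> cs) \<Longrightarrow> Sat L M w \<psi>' \<longleftrightarrow> holds M w s (inst \<sigma> \<psi>)"
    using ex_translation[OF is_sig_add_consts[OF sig]] by blast
  have "Sat L (cone_exp M w cs as) w \<psi>' \<longleftrightarrow> holds M w (nth as) \<psi>"
    if SM: "(M, w) \<in> Str L \<Theta>" and as: "length as = length cs" "set as \<subseteq> dmn M w" for M w as
  proof -
    have M: "is_model \<Theta> M" "w \<in> wlds M" using SM Str_iff[OF sig] by auto
    note ww = model_acc_refl[OF M]
    have nt: "name_tuple M w cs as" using cs as model_sgn[OF M(1)] by (simp add: name_tuple_def)
    note CM = cone_exp_model[OF M nt]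
    have asg: "inst_asg (cone_exp M w cs as) w \<sigma> (nth as) i = as ! i" if i: "i < length cs" for i
    proof -
      have "inst_asg (cone_exp M w cs as) w \<sigma> (nth as) i = cint (cone_exp M w cs as) w (cs ! i)"
        using i by (simp add: inst_asg_def \<sigma>_def)
      also have "\<dots> = hom M w w (as ! i)" using cone_exp_cint_new[OF ww as(1) cs(1) i] .
      also have "\<dots> = as ! i" using as i by (intro model_hom_id[OF M(1)]) auto
      finally show ?thesis .
    qed
    have "Sat L (cone_exp M w cs as) w \<psi>' \<longleftrightarrow> holds (cone_exp M w cs as) w (nth as) (inst \<sigma> \<psi>)"
      by (rule \<psi>'(2)[OF cone_exp_Str[OF sig SM nt ww]])
    also have "\<dots> \<longleftrightarrow> holds (cone_exp M w cs as) w (inst_asg (cone_exp M w cs as) w \<sigma> (nth as)) \<psi>"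
      using ran by (intro holds_inst[OF CM]) auto
    also have "\<dots> \<longleftrightarrow> holds (cone_exp M w cs as) w (nth as) \<psi>"
      using asg \<psi>(2) by (intro holds_cong) auto
    also have "\<dots> \<longleftrightarrow> holds M w ((\<lambda>x. x) \<circ> nth as) \<psi>"
      using ww \<psi>(2) as by (intro covers_holds[OF CM cone_exp_covers_base[OF M nt] \<psi>(1)]) (auto simp: subset_iff)
    finally show ?thesis by (simp add: comp_def)
  qed
  then show ?thesis using \<psi>'(1) by blast
qed

lemma elementary_Sat:
  assumes sig: "is_sig \<Theta>" and M: "is_model \<Theta> M" and N: "is_model \<Theta> N"
    and el: "elementary_submodel L M N" and w: "w \<in> wlds M" and nt: "name_tuple M w cs as"
    and \<phi>: "\<phi> \<in> Sen L (add_consts \<Theta> cs)"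
  shows "Sat L (cone_exp M w cs as) w \<phi> \<longleftrightarrow> Sat L (cone_exp N w cs as) w \<phi>"
proof -
  have "Th L (cone_exp M w cs as) w = Th L (cone_exp N w cs as) w"
    using el w nt by (auto simp: elementary_submodel_def Tp_def)
  then show ?thesis using \<phi> model_sgn[OF M] model_sgn[OF N] by (auto simp: Th_def)
qed

text \<open>Elementarity is a statement on \<open>L\<close>-types. It covers standard formulas
  because these have translations, with the entries of \<alpha> named by fresh constants.\<close>

lemma elementary_holds:
  assumes sig: "is_sig \<Theta>" and M: "(M, w) \<in> Str L \<Theta>" and N: "(N, w) \<in> Str L \<Theta>"
    and el: "elementary_submodel L M N" and \<alpha>: "set \<alpha> \<subseteq> dmn M w"
    and \<psi>: "fm_over (has_eq K) \<Theta> \<psi>" "fv \<psi> \<subseteq> {..<length \<alpha>}"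
  shows "holds M w (nth \<alpha>) \<psi> \<longleftrightarrow> holds N w (nth \<alpha>) \<psi>"
proof -
  have MM: "is_model \<Theta> M" "w \<in> wlds M" and NN: "is_model \<Theta> N" using M N Str_iff[OF sig] by auto
  let ?cs = "map (fresh_consts \<Theta>) [0..<length \<alpha>]"
  note fc = fresh_consts_props[OF sig]
  have nt: "name_tuple M w ?cs \<alpha>" using name_tuple_c[OF fc MM(1) \<alpha> refl] .
  have sub: "set \<alpha> \<subseteq> dmn N w" using \<alpha> el MM(2) unfolding elementary_submodel_def submodel_def by blast
  have cs: "distinct ?cs" "set ?cs \<inter> csts \<Theta> = {}" using name_tupleD[OF nt] model_sgn[OF MM(1)] by auto
  obtain \<psi>' where \<psi>': "\<psi>' \<in> Sen L (add_consts \<Theta> ?cs)"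
    "\<And>M w as. (M, w) \<in> Str L \<Theta> \<Longrightarrow> length as = length ?cs \<Longrightarrow> set as \<subseteq> dmn M w \<Longrightarrow>
    Sat L (cone_exp M w ?cs as) w \<psi>' \<longleftrightarrow> holds M w (nth as) \<psi>"
    using ex_formula_translation[OF sig cs \<psi>(1)] \<psi>(2) by auto
  have "Sat L (cone_exp M w ?cs \<alpha>) w \<psi>' \<longleftrightarrow> Sat L (cone_exp N w ?cs \<alpha>) w \<psi>'"
    using elementary_Sat[OF sig MM(1) NN el MM(2) nt \<psi>'(1)] .
  then show ?thesis using \<psi>'(2)[OF M _ \<alpha>] \<psi>'(2)[OF N _ sub] by simp
qed

end

section \<open>Unravelling\<close>

text \<open>The rank \<open>d\<close> decreases along \<open>par\<close>, so in a model the
  predecessors of a world form a finite chain down to the root, and recursion and induction along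
  parents are available.\<close>

definition tree_rooted :: "'u kmodel \<Rightarrow> 'u \<Rightarrow> bool" where
  "tree_rooted M r \<longleftrightarrow> r \<in> wlds M \<and> (\<forall>v\<in>wlds M. (r, v) \<in> acc M) \<and>
     (\<exists>par (d :: 'u \<Rightarrow> nat). \<forall>v\<in>wlds M. v \<noteq> r \<longrightarrow> par v \<in> wlds M \<and> d (par v) < d v \<and> (par v, v) \<in> acc M \<and>
        (\<forall>u. (u, v) \<in> acc M \<longrightarrow> u = v \<or> (u, par v) \<in> acc M))"

text \<open>Without equality, no sentence can force two names of an element to have the same value, so
  models are first made injective, with distinct constants.\<close>

definition good :: "bool \<Rightarrow> 'u kmodel \<Rightarrow> 'u \<Rightarrow> bool" where
  "good q M r \<longleftrightarrow> tree_rooted M r \<and> (\<not> q \<longrightarrow> inj_model M \<and> inj_on (cint M r) (csts (sgn M)))"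

text \<open>Worlds of the unravelling are finite ascending sequences starting at \<open>r\<close>,
  ordered by extension. The domain of a sequence is a copy of the fibre \<open>Fib v\<close> over
  its last entry \<open>v\<close>; the fibre may be larger than the domain of \<open>v\<close>,
  which makes room for duplicates of elements. \<open>tau\<close> and \<open>kap\<close> lift
  homomorphisms and constants to the fibres.\<close>

lemma (in universe) ex_unravelling:
  fixes N :: "'u kmodel" and Fib :: "'u \<Rightarrow> 'u set"
  assumes N: "is_model \<Theta> N" and r: "r \<in> wlds N"
    and Fib: "\<And>v. (r, v) \<in> acc N \<Longrightarrow> small (Fib v)"
    and el: "\<And>v. (r, v) \<in> acc N \<Longrightarrow> el v ` Fib v = dmn N v" "\<And>v. (r, v) \<in> acc N \<Longrightarrow> q \<Longrightarrow> inj_on (el v) (Fib v)"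
    and tau: "\<And>v u l. (r, v) \<in> acc N \<Longrightarrow> (v, u) \<in> acc N \<Longrightarrow> l \<in> Fib v \<Longrightarrow> tau v u l \<in> Fib u \<and> el u (tau v u l) = hom N v u (el v l)"
      "\<And>v l. (r, v) \<in> acc N \<Longrightarrow> l \<in> Fib v \<Longrightarrow> tau v v l = l"
      "\<And>v u t l. (r, v) \<in> acc N \<Longrightarrow> (v, u) \<in> acc N \<Longrightarrow> (u, t) \<in> acc N \<Longrightarrow> l \<in> Fib v \<Longrightarrow> tau u t (tau v u l) = tau v t l"
    and kap: "\<And>v c. (r, v) \<in> acc N \<Longrightarrow> c \<in> csts \<Theta> \<Longrightarrow> kap v c \<in> Fib v \<and> el v (kap v c) = cint N v c"
      "\<And>v u c. (r, v) \<in> acc N \<Longrightarrow> (v, u) \<in> acc N \<Longrightarrow> c \<in> csts \<Theta> \<Longrightarrow> tau v u (kap v c) = kap u c"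
  shows "\<exists>N' r' p e. is_model \<Theta> N' \<and> tree_rooted N' r' \<and> p r' = r \<and> covers q \<Theta> p e N' r' N \<and>
    ((\<forall>v u. (r, v) \<in> acc N \<longrightarrow> (v, u) \<in> acc N \<longrightarrow> inj_on (tau v u) (Fib v)) \<longrightarrow> inj_model N') \<and>
    ((\<forall>v u. (r, v) \<in> acc N \<longrightarrow> (v, u) \<in> acc N \<longrightarrow> tau v u ` Fib v = Fib u) \<longrightarrow> surj_model N') \<and>
    (inj_on (kap r) (csts \<Theta>) \<longrightarrow> inj_on (cint N' r') (csts \<Theta>))"
proof -
  note D = is_modelD[OF N]
  \<comment> \<open>The first entry \<open>r\<close> is left implicit, so that the root is the empty
    sequence. Entries may repeat, as the order is reflexive.\<close>
  define Pa where "Pa = {xs. sorted_wrt (\<lambda>u v. (u, v) \<in> acc N) (r # xs)}"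
  define lst where "lst xs = last (r # xs)" for xs
  have Pa_lists: "Pa \<subseteq> lists (wlds N)" using D(4) by (auto simp: Pa_def in_lists_conv_set)
  have tinyPa: "tiny Pa"
    using tiny_subset[OF tiny_lists Pa_lists] D(3) by (simp add: small_iff_tiny)
  obtain enc :: "'u list \<Rightarrow> 'u" where enc: "inj_on enc Pa" using tiny_imp_inj[OF tinyPa] by blast
  define dec where "dec = the_inv_into Pa enc"
  have dec: "dec (enc xs) = xs" if "xs \<in> Pa" for xs using that enc by (simp add: dec_def the_inv_into_f_f)
  have Nil: "[] \<in> Pa" by (simp add: Pa_def)
  have prefix_Pa: "xs \<in> Pa" if "xs @ zs \<in> Pa" for xs zs using that by (auto simp: Pa_def sorted_wrt_append)
  have lst_r: "(r, lst xs) \<in> acc N" if "xs \<in> Pa" for xs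
    using that D(5)[OF r] by (cases xs rule: rev_cases) (auto simp: Pa_def lst_def sorted_wrt_append)
  have lst_prefix: "(lst xs, lst (xs @ zs)) \<in> acc N" if "xs @ zs \<in> Pa" for xs zs
  proof (cases zs rule: rev_cases)
    case Nil
    then show ?thesis using lst_r[OF that] D(4,5) by fastforce
  next
    case (snoc ys y)
    have "lst xs \<in> set (r # xs)" unfolding lst_def by (rule last_in_set) simp
    moreover have "sorted_wrt (\<lambda>u v. (u, v) \<in> acc N) ((r # xs) @ zs)" using that by (simp add: Pa_def)
    ultimately show ?thesis unfolding sorted_wrt_append using snoc by (auto simp: lst_def)
  qed
  have lst_snoc: "xs @ [t] \<in> Pa" "lst (xs @ [t]) = t" if "xs \<in> Pa" "(lst xs, t) \<in> acc N" for xs t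
  proof -
    have srt: "sorted_wrt (\<lambda>u v. (u, v) \<in> acc N) (r # xs)" using that by (simp add: Pa_def)
    have "(x, lst xs) \<in> acc N" if "x \<in> set (r # xs)" for x
    proof (cases xs rule: rev_cases)
      case Nil
      then show ?thesis using that D(5)[OF r] by (simp add: lst_def)
    next
      case (snoc ys y)
      then have "\<forall>z\<in>set (r # ys). (z, y) \<in> acc N" using srt by (auto simp: sorted_wrt_append)
      moreover have "(y, y) \<in> acc N" using calculation D(4,5) by fastforce
      ultimately show ?thesis using that snoc by (auto simp: lst_def)
    qed
    then have "(x, t) \<in> acc N" if "x \<in> set (r # xs)" for x using that D(6) \<open>(lst xs, t) \<in> acc N\<close> by blast
    then show "xs @ [t] \<in> Pa" using srt by (auto simp: Pa_def sorted_wrt_append)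
    show "lst (xs @ [t]) = t" by (simp add: lst_def)
  qed
  define W where "W = enc ` Pa"
  define p where "p x = lst (dec x)" for x
  define R where "R = {(enc xs, enc (xs @ zs)) | xs zs. xs @ zs \<in> Pa}"
  define fs sn where "fs a = fst (inv pairing a)" and "sn a = snd (inv pairing a)" for a
  have pr [simp]: "fs (pairing (x, l)) = x" "sn (pairing (x, l)) = l" for x l
    by (simp_all add: fs_def sn_def inv_f_f[OF inj_pairing])
  \<comment> \<open>Tagging codes with their world makes the domains disjoint.\<close>
  define DD where "DD x = (\<lambda>l. pairing (x, l)) ` Fib (p x)" for x
  define e where "e a = el (p (fs a)) (sn a)" for a
  define C where "C x c = pairing (x, kap (p x) c)" for x c
  define H where "H x y a = pairing (y, tau (p x) (p y) (sn a))" for x y :: 'u and a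
  define N' where "N' = pull N W R DD p e C H"
  have WE: "\<exists>xs\<in>Pa. x = enc xs" if "x \<in> W" for x using that by (auto simp: W_def)
  have pW: "(r, p x) \<in> acc N" if "x \<in> W" for x using WE[OF that] dec lst_r by (auto simp: p_def)
  have RE: "\<exists>xs zs. xs @ zs \<in> Pa \<and> xs \<in> Pa \<and> x = enc xs \<and> y = enc (xs @ zs)" if "(x, y) \<in> R" for x y
    using that prefix_Pa by (auto simp: R_def)
  have RI: "(enc xs, enc ys) \<in> R \<longleftrightarrow> (\<exists>zs. ys = xs @ zs)" if "xs \<in> Pa" "ys \<in> Pa" for xs ys
  proof
    assume "(enc xs, enc ys) \<in> R"
    then obtain xs' zs where *: "xs' @ zs \<in> Pa" "xs' \<in> Pa" "enc xs = enc xs'" "enc ys = enc (xs' @ zs)" using RE by blast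
    then have "xs = xs'" "ys = xs' @ zs" using that dec by metis+
    then show "\<exists>zs. ys = xs @ zs" by blast
  qed (use that in \<open>auto simp: R_def\<close>)
  have RW: "x \<in> W" "y \<in> W" if "(x, y) \<in> R" for x y using RE[OF that] by (auto simp: W_def)
  have pR: "(p x, p y) \<in> acc N" if "(x, y) \<in> R" for x y
    using RE[OF that] dec lst_prefix by (auto simp: p_def)
  have po: "partial_order_on W R"
    unfolding partial_order_on_def preorder_on_def refl_on_def
  proof (intro conjI)
    show "R \<subseteq> W \<times> W" using RW by auto
    show "\<forall>x\<in>W. (x, x) \<in> R" using WE RI by fastforce
    show "trans R"
    proof (rule transI)
      fix x y z assume "(x, y) \<in> R" "(y, z) \<in> R"
      moreover obtain xs ys zs where "x = enc xs" "y = enc ys" "z = enc zs" "xs \<in> Pa" "ys \<in> Pa" "zs \<in> Pa"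
        using RW WE calculation by metis
      ultimately show "(x, z) \<in> R" using RI by auto
    qed
    show "antisym R"
    proof (rule antisymI)
      fix x y assume "(x, y) \<in> R" "(y, x) \<in> R"
      moreover obtain xs ys where "x = enc xs" "y = enc ys" "xs \<in> Pa" "ys \<in> Pa"
        using RW WE calculation by metis
      ultimately show "x = y" using RI by auto
    qed
  qed
  have N': "is_model \<Theta> N'"
    unfolding N'_def
  proof (rule pull_model[OF N _ _ po])
    show "W \<noteq> {}" using Nil by (auto simp: W_def)
    show "small W" unfolding W_def small_iff_tiny using tinyPa by (rule tiny_image)
    show "(p v, p u) \<in> acc N" if "(v, u) \<in> R" for v u using pR[OF that] .
    show "v = u" if "a \<in> DD v" "a \<in> DD u" for v u a using that by (auto simp: DD_def)
    fix v assume v: "v \<in> W"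
    have "p v \<in> wlds N" using pW[OF v] D(4) by blast
    then show "DD v \<noteq> {}" using el(1)[OF pW[OF v]] D(8) by (fastforce simp: DD_def)
    show "small (DD v)" using Fib[OF pW[OF v]] by (simp add: DD_def small_iff_tiny tiny_image)
    show "C v c \<in> DD v" if "c \<in> csts \<Theta>" for c using kap(1)[OF pW[OF v] that] by (simp add: C_def DD_def)
    show "H v v a = a" if "a \<in> DD v" for a using that tau(2)[OF pW[OF v]] by (auto simp: H_def DD_def)
  next
    fix v u assume vu: "(v, u) \<in> R"
    note rv = pW[OF RW(1)[OF vu]]
    show "H v u (C v c) = C u c" if "c \<in> csts \<Theta>" for c
      using kap(2)[OF rv pR[OF vu] that] by (simp add: H_def C_def)
    fix a assume a: "a \<in> DD v"
    then obtain l where l: "a = pairing (v, l)" "l \<in> Fib (p v)" by (auto simp: DD_def)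
    note t = tau(1)[OF rv pR[OF vu] l(2)]
    show "H v u a \<in> DD u" using t l by (simp add: H_def DD_def)
    show "e (H v u a) = hom N (p v) (p u) (e a)" using t l by (simp add: H_def e_def)
    fix t assume ut: "(u, t) \<in> R"
    show "H u t (H v u a) = H v t a" using l tau(3)[OF rv pR[OF vu] pR[OF ut] l(2)] by (simp add: H_def)
  qed
  have cov: "covers q \<Theta> p e N' (enc []) N"
    unfolding N'_def
  proof (rule pull_covers[OF N N'[unfolded N'_def] pR])
    fix v assume v: "v \<in> W"
    show "\<exists>u. (v, u) \<in> R \<and> p u = t" if "(p v, t) \<in> acc N" for t
    proof -
      obtain xs where xs: "xs \<in> Pa" "v = enc xs" using WE[OF v] by blast
      have "(lst xs, t) \<in> acc N" using that xs dec by (simp add: p_def)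
      note s = lst_snoc[OF xs(1) this]
      have "(v, enc (xs @ [t])) \<in> R" using RI[OF xs(1) s(1)] xs by simp
      moreover have "p (enc (xs @ [t])) = t" using dec[OF s(1)] s(2) by (simp add: p_def)
      ultimately show ?thesis by blast
    qed
    show "e ` DD v = dmn N (p v)" unfolding DD_def image_image e_def pr using el(1)[OF pW[OF v]] .
    show "inj_on e (DD v)" if q using el(2)[OF pW[OF v] that] by (auto simp: DD_def e_def inj_on_def)
    show "e (C v c) = cint N (p v) c" if "c \<in> csts \<Theta>" for c using kap(1)[OF pW[OF v] that] by (simp add: e_def C_def)
  next
    fix v u a assume vu: "(v, u) \<in> R" and a: "a \<in> DD v"
    then obtain l where l: "a = pairing (v, l)" "l \<in> Fib (p v)" by (auto simp: DD_def)
    show "e (H v u a) = hom N (p v) (p u) (e a)"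
      using tau(1)[OF pW[OF RW(1)[OF vu]] pR[OF vu] l(2)] l by (simp add: H_def e_def)
  qed
  have N'_simps: "wlds N' = W" "acc N' = R" "\<And>v. v \<in> W \<Longrightarrow> dmn N' v = DD v"
    "\<And>v u a. (v, u) \<in> R \<Longrightarrow> a \<in> DD v \<Longrightarrow> hom N' v u a = H v u a" "\<And>c. c \<in> csts \<Theta> \<Longrightarrow> cint N' (enc []) c = C (enc []) c"
    using Nil D(1) by (auto simp: N'_def pull_def W_def)
  have pNil: "p (enc []) = r" using dec[OF Nil] by (simp add: p_def lst_def)
  have tree: "tree_rooted N' (enc [])"
    unfolding tree_rooted_def N'_simps(1,2)
  proof (intro conjI ballI exI impI allI)
    show "enc [] \<in> W" using Nil by (simp add: W_def)
    show "(enc [], v) \<in> R" if "v \<in> W" for v using WE[OF that] RI[OF Nil] by auto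
    fix v assume v: "v \<in> W" "v \<noteq> enc []"
    then obtain xs where xs: "xs \<in> Pa" "v = enc xs" using WE by blast
    then obtain ys y where ys: "xs = ys @ [y]" using v(2) by (cases xs rule: rev_cases) auto
    have ysPa: "ys \<in> Pa" using xs(1) prefix_Pa ys by blast
    let ?par = "\<lambda>v. enc (butlast (dec v))" and ?d = "\<lambda>v. length (dec v)"
    have par: "?par v = enc ys" using dec[OF xs(1)] xs(2) ys by simp
    show "?par v \<in> W" unfolding par using ysPa by (simp add: W_def)
    show "?d (?par v) < ?d v" unfolding par using dec[OF xs(1)] dec[OF ysPa] xs(2) ys by simp
    show "(?par v, v) \<in> R" unfolding par using RI[OF ysPa xs(1)] ys xs(2) by simp
    fix u assume u: "(u, v) \<in> R"
    then obtain us where us: "us \<in> Pa" "u = enc us" using WE RW(1) by blast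
    obtain zs where zs: "xs = us @ zs" using RI[OF us(1) xs(1)] u us(2) xs(2) by auto
    show "u = v \<or> (u, ?par v) \<in> R"
    proof (cases zs rule: rev_cases)
      case Nil
      then show ?thesis using zs us xs by simp
    next
      case (snoc zs' z)
      then have "ys = us @ zs'" using zs ys by simp
      then show ?thesis unfolding par using RI[OF us(1) ysPa] us(2) by auto
    qed
  qed
  have inj: "inj_model N'" if A: "\<forall>v u. (r, v) \<in> acc N \<longrightarrow> (v, u) \<in> acc N \<longrightarrow> inj_on (tau v u) (Fib v)"
    unfolding inj_model_def N'_simps(2)
  proof (intro ballI, clarify)
    fix v u assume vu: "(v, u) \<in> R"
    have "inj_on (tau (p v) (p u)) (Fib (p v))" using A pW[OF RW(1)[OF vu]] pR[OF vu] by blast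
    then have "inj_on (H v u) (DD v)" by (auto simp: inj_on_def DD_def H_def)
    then have "inj_on (hom N' v u) (DD v)" using N'_simps(4)[OF vu] by (simp cong: inj_on_cong)
    then show "inj_on (hom N' v u) (dmn N' v)" using N'_simps(3) RW(1)[OF vu] by simp
  qed
  have surj: "surj_model N'" if A: "\<forall>v u. (r, v) \<in> acc N \<longrightarrow> (v, u) \<in> acc N \<longrightarrow> tau v u ` Fib v = Fib u"
    unfolding surj_model_def N'_simps(2)
  proof (intro ballI, clarify)
    fix v u assume vu: "(v, u) \<in> R"
    have "tau (p v) (p u) ` Fib (p v) = Fib (p u)" using A pW[OF RW(1)[OF vu]] pR[OF vu] by blast
    then have "DD u = (\<lambda>l. pairing (u, tau (p v) (p u) l)) ` Fib (p v)" unfolding DD_def by (metis image_image)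
    then have "H v u ` DD v = DD u" unfolding DD_def[of v] image_image H_def pr by simp
    then have "hom N' v u ` DD v = DD u" using N'_simps(4)[OF vu] by (simp cong: image_cong_simp)
    then show "hom N' v u ` dmn N' v = dmn N' u" using N'_simps(3) RW[OF vu] by simp
  qed
  have kapinj: "inj_on (cint N' (enc [])) (csts \<Theta>)" if "inj_on (kap r) (csts \<Theta>)"
    using that N'_simps(5) pNil by (auto simp: inj_on_def C_def)
  show ?thesis
    using N' tree pNil cov inj surj kapinj by (intro exI[of _ N'] exI[of _ "enc []"] exI[of _ p] exI[of _ e]) blast
qed

context extension_logic begin

text \<open>With equality the domains themselves serve as fibres. Without equality an element may be
  duplicated: the fibre at \<open>v\<close> holds a copy of each element of the worlds below
  \<open>v\<close> and a copy of each constant. Homomorphisms act as the identity on these codes,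
  hence are injective, and distinct constants have distinct values.\<close>

lemma ex_good:
  assumes sig: "is_sig \<Theta>" and SN: "(N, r) \<in> Str L \<Theta>"
  shows "\<exists>N' r'. (N', r') \<in> Str L \<Theta> \<and> good (has_eq K) N' r' \<and> (\<forall>\<phi>\<in>Sen L \<Theta>. Sat L N' r' \<phi> \<longleftrightarrow> Sat L N r \<phi>)"
proof -
  have N: "is_model \<Theta> N" and r: "r \<in> wlds N" and cl: "in_class K N" using SN Str_iff[OF sig] by auto
  note D = is_modelD[OF N]
  have "\<exists>N' r' p e. is_model \<Theta> N' \<and> good (has_eq K) N' r' \<and> p r' = r \<and> covers (has_eq K) \<Theta> p e N' r' N \<and> in_class K N'"
  proof (cases "has_eq K")
    case True
    have "\<exists>N' r' p e. is_model \<Theta> N' \<and> tree_rooted N' r' \<and> p r' = r \<and> covers (has_eq K) \<Theta> p e N' r' N \<and>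
    ((\<forall>v u. (r, v) \<in> acc N \<longrightarrow> (v, u) \<in> acc N \<longrightarrow> inj_on (hom N v u) (dmn N v)) \<longrightarrow> inj_model N') \<and>
    ((\<forall>v u. (r, v) \<in> acc N \<longrightarrow> (v, u) \<in> acc N \<longrightarrow> hom N v u ` dmn N v = dmn N u) \<longrightarrow> surj_model N') \<and>
    (inj_on (cint N r) (csts \<Theta>) \<longrightarrow> inj_on (cint N' r') (csts \<Theta>))"
      by (rule ex_unravelling[OF N r, where el = "\<lambda>_ l. l"])
        (use D(4,9,13,16,20,21,22) in \<open>(simp; fail) | blast\<close>)+
    then obtain N' r' p e where *: "is_model \<Theta> N'" "tree_rooted N' r'" "p r' = r" "covers (has_eq K) \<Theta> p e N' r' N"
      "(\<forall>v u. (r, v) \<in> acc N \<longrightarrow> (v, u) \<in> acc N \<longrightarrow> inj_on (hom N v u) (dmn N v)) \<longrightarrow> inj_model N'"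
      "(\<forall>v u. (r, v) \<in> acc N \<longrightarrow> (v, u) \<in> acc N \<longrightarrow> hom N v u ` dmn N v = dmn N u) \<longrightarrow> surj_model N'"
      by (elim exE conjE)
    moreover have "inj_model N \<Longrightarrow> \<forall>v u. (r, v) \<in> acc N \<longrightarrow> (v, u) \<in> acc N \<longrightarrow> inj_on (hom N v u) (dmn N v)"
      "surj_model N \<Longrightarrow> \<forall>v u. (r, v) \<in> acc N \<longrightarrow> (v, u) \<in> acc N \<longrightarrow> hom N v u ` dmn N v = dmn N u"
      by (fastforce simp: inj_model_def surj_model_def)+
    ultimately have "inj_model N \<Longrightarrow> inj_model N'" "surj_model N \<Longrightarrow> surj_model N'" by metis+
    then have "in_class K N'" using cl by (cases K) auto
    moreover have "good (has_eq K) N' r'" using * True by (simp add: good_def)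
    ultimately show ?thesis using * by blast
  next
    case False
    then have K: "K = IL \<or> K = CD" by (cases K) auto
    obtain t0 t1 :: 'u where t01: "t0 \<noteq> t1"
      using infinite_universe by (metis (full_types) UNIV_eq_I finite.emptyI finite_insert singletonI)
    define fs sn where "fs a = fst (inv pairing a)" and "sn a = snd (inv pairing a)" for a
    have pr [simp]: "fs (pairing (x, l)) = x" "sn (pairing (x, l)) = l" for x l
      by (simp_all add: fs_def sn_def inv_f_f[OF inj_pairing])
    \<comment> \<open>For \<open>CD\<close> only elements of the root are copied. By surjectivity
      they reach every element of a later world, and since the fibres no longer grow, the
      unravelling is surjective as well.\<close>
    define Us where "Us v = {u. (u, v) \<in> acc N \<and> (K = CD \<longrightarrow> u = r)}" for v
    \<comment> \<open>The tags \<open>t0\<close> and \<open>t1\<close> separate copies of elements,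
      stored with the world they come from, from copies of constants.\<close>
    define Fib where "Fib v = (\<lambda>(u, a). pairing (t0, pairing (u, a))) ` (SIGMA u:Us v. dmn N u) \<union> (\<lambda>c. pairing (t1, c)) ` csts \<Theta>" for v
    define el where "el v l = (if fs l = t0 then hom N (fs (sn l)) v (sn (sn l)) else cint N v (sn l))" for v l
    have FibE: "(\<exists>u a. (u, v) \<in> acc N \<and> (K = CD \<longrightarrow> u = r) \<and> a \<in> dmn N u \<and> l = pairing (t0, pairing (u, a))) \<or> (\<exists>c\<in>csts \<Theta>. l = pairing (t1, c))"
      if "l \<in> Fib v" for l v using that by (auto simp: Fib_def Us_def)
    have FibI1: "pairing (t0, pairing (u, a)) \<in> Fib v" if "(u, v) \<in> acc N" "K = CD \<longrightarrow> u = r" "a \<in> dmn N u" for u v a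
      using that unfolding Fib_def Us_def by (intro UnI1 image_eqI[of _ _ "(u, a)"]) auto
    have FibI2: "pairing (t1, c) \<in> Fib v" if "c \<in> csts \<Theta>" for v c
      using that unfolding Fib_def by blast
    have el1: "el v (pairing (t0, pairing (u, a))) = hom N u v a" for u v a by (simp add: el_def)
    have el2: "el v (pairing (t1, c)) = cint N v c" for v c using t01 by (simp add: el_def)
    have Fib_mono: "l \<in> Fib u" if "l \<in> Fib v" "(v, u) \<in> acc N" for l v u
      using FibE[OF that(1)] FibI1 FibI2 D(6)[OF _ that(2)] by blast
    have "\<exists>N' r' p e. is_model \<Theta> N' \<and> tree_rooted N' r' \<and> p r' = r \<and> covers (has_eq K) \<Theta> p e N' r' N \<and>
    ((\<forall>v u. (r, v) \<in> acc N \<longrightarrow> (v, u) \<in> acc N \<longrightarrow> inj_on (\<lambda>l. l) (Fib v)) \<longrightarrow> inj_model N') \<and>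
    ((\<forall>v u. (r, v) \<in> acc N \<longrightarrow> (v, u) \<in> acc N \<longrightarrow> (\<lambda>l. l) ` Fib v = Fib u) \<longrightarrow> surj_model N') \<and>
    (inj_on (\<lambda>c. pairing (t1, c)) (csts \<Theta>) \<longrightarrow> inj_on (cint N' r') (csts \<Theta>))"
    proof (rule ex_unravelling[OF N r, where el = el and kap = "\<lambda>v c. pairing (t1, c)"])
      fix v assume v: "(r, v) \<in> acc N"
      then have vW: "v \<in> wlds N" using D(4) by blast
      have "Us v \<subseteq> wlds N" using D(4) by (auto simp: Us_def)
      then have "tiny (SIGMA u:Us v. dmn N u)"
        using D(3,9) unfolding small_iff_tiny by (intro tiny_Sigma) (auto intro: tiny_subset)
      moreover have "tiny (csts \<Theta>)" using sig by (simp add: is_sig_def small_iff_tiny)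
      ultimately show "small (Fib v)" unfolding Fib_def small_iff_tiny by (intro tiny_Un tiny_image)
      show "el v ` Fib v = dmn N v"
      proof
        show "el v ` Fib v \<subseteq> dmn N v"
        proof
          fix x assume "x \<in> el v ` Fib v"
          then obtain l where l: "l \<in> Fib v" "x = el v l" by blast
          then show "x \<in> dmn N v" using FibE[OF l(1)] el1 el2 D(16) D(13)[OF vW] by auto
        qed
        show "dmn N v \<subseteq> el v ` Fib v"
        proof
          fix x assume x: "x \<in> dmn N v"
          \<comment> \<open>For \<open>CD\<close> a preimage at the root exists by surjectivity;
            otherwise \<open>x\<close> is represented by its own copy at \<open>v\<close>.\<close>
          obtain u a where ua: "(u, v) \<in> acc N" "K = CD \<longrightarrow> u = r" "a \<in> dmn N u" "hom N u v a = x"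
          proof (cases "K = CD")
            case True
            then have "hom N r v ` dmn N r = dmn N v" using cl v by (fastforce simp: surj_model_def)
            then obtain a where "a \<in> dmn N r" "hom N r v a = x" using x by (metis imageE)
            then show ?thesis using that v by blast
          next
            case False
            then show ?thesis using that[of v x] x D(5)[OF vW] D(21) by blast
          qed
          then show "x \<in> el v ` Fib v" using FibI1 el1 by (metis imageI)
        qed
      qed
      show "inj_on (el v) (Fib v)" if "has_eq K" using that False by simp
      show "pairing (t1, c) \<in> Fib v \<and> el v (pairing (t1, c)) = cint N v c" if "c \<in> csts \<Theta>" for c
        using FibI2[OF that] el2 by simp
      fix u l assume u: "(v, u) \<in> acc N" and l: "l \<in> Fib v"
      have "el u l = hom N v u (el v l)"
        using FibE[OF l] el1 el2 D(22)[OF _ u] D(20)[OF u] by auto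
      then show "l \<in> Fib u \<and> el u l = hom N v u (el v l)" using Fib_mono[OF l u] by simp
    qed simp_all
    then obtain N' r' p e where **: "is_model \<Theta> N'" "tree_rooted N' r'" "p r' = r" "covers (has_eq K) \<Theta> p e N' r' N"
      "(\<forall>v u. (r, v) \<in> acc N \<longrightarrow> (v, u) \<in> acc N \<longrightarrow> inj_on (\<lambda>l. l) (Fib v)) \<longrightarrow> inj_model N'"
      "(\<forall>v u. (r, v) \<in> acc N \<longrightarrow> (v, u) \<in> acc N \<longrightarrow> (\<lambda>l. l) ` Fib v = Fib u) \<longrightarrow> surj_model N'"
      "inj_on (\<lambda>c. pairing (t1, c)) (csts \<Theta>) \<longrightarrow> inj_on (cint N' r') (csts \<Theta>)"
      by (elim exE conjE)
    have "inj_model N'" using **(5) by simp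
    moreover have "inj_on (cint N' r') (csts \<Theta>)" using **(7) by (simp add: inj_on_def)
    moreover have "surj_model N'" if "\<forall>v u. (r, v) \<in> acc N \<longrightarrow> (v, u) \<in> acc N \<longrightarrow> Fib v = Fib u"
      using **(6) that by simp
    ultimately have *: "is_model \<Theta> N'" "tree_rooted N' r'" "p r' = r" "covers (has_eq K) \<Theta> p e N' r' N"
      "inj_model N'" "(\<forall>v u. (r, v) \<in> acc N \<longrightarrow> (v, u) \<in> acc N \<longrightarrow> Fib v = Fib u) \<Longrightarrow> surj_model N'" "inj_on (cint N' r') (csts \<Theta>)"
      using **(1-4) by simp_all
    have "in_class K N'"
    proof (cases "K = CD")
      case True
      have "Us v = Us u" if "(r, v) \<in> acc N" "(v, u) \<in> acc N" for v u
        using that True D(6) by (auto simp: Us_def)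
      then have "\<forall>v u. (r, v) \<in> acc N \<longrightarrow> (v, u) \<in> acc N \<longrightarrow> Fib v = Fib u" by (simp add: Fib_def)
      then show ?thesis using *(6) True by simp
    next
      case False
      then show ?thesis using K by simp
    qed
    moreover have "good (has_eq K) N' r'" using * model_sgn[OF *(1)] by (simp add: good_def)
    ultimately show ?thesis using * by blast
  qed
  then obtain N' r' p e where *: "is_model \<Theta> N'" "good (has_eq K) N' r'" "p r' = r" "covers (has_eq K) \<Theta> p e N' r' N" "in_class K N'"
    by blast
  have S': "(N', r') \<in> Str L \<Theta>" using * by (simp add: Str_iff[OF sig] good_def tree_rooted_def)
  have "Sat L N' r' \<phi> \<longleftrightarrow> Sat L N r \<phi>" if "\<phi> \<in> Sen L \<Theta>" for \<phi>
    using covers_Sat[OF sig S' _ *(4) that] SN *(3) by simp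
  then show ?thesis using S' *(2) by blast
qed

end

section \<open>Embedding trees\<close>

text \<open>In the following lemma, \<open>AB v t\<close>, \<open>NB v t\<close> and \<open>Pn a t x\<close> say that, at the world \<open>t\<close> of \<open>N\<close>,
  the markers for ``above \<open>v\<close>'', ``not below \<open>v\<close>'' and ``image of \<open>a\<close>'' hold.\<close>

lemma ex_tree_embedding:
  assumes M: "is_model \<Theta> M" and good: "good q M r" and N: "is_model \<Theta>' N" and n0: "n0 \<in> wlds N"
    and pers: "\<And>v t t'. AB v t \<Longrightarrow> (t, t') \<in> acc N \<Longrightarrow> AB v t'"
      "\<And>a t t' x. Pn a t x \<Longrightarrow> (t, t') \<in> acc N \<Longrightarrow> Pn a t' (hom N t t' x)"
    and F1: "\<And>u v t. (u, v) \<in> acc M \<Longrightarrow> t \<in> wlds N \<Longrightarrow> \<not> NB u t \<Longrightarrow> \<exists>t'. (t, t') \<in> acc N \<and> AB v t' \<and> \<not> NB v t'"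
    and F2: "\<And>v a t. a \<in> dmn M v \<Longrightarrow> t \<in> wlds N \<Longrightarrow> AB v t \<Longrightarrow> \<exists>x\<in>dmn N t. Pn a t x"
    and F3: "\<And>v a b t x. a \<in> dmn M v \<Longrightarrow> b \<in> dmn M v \<Longrightarrow> a \<noteq> b \<Longrightarrow> x \<in> dmn N t \<Longrightarrow> Pn a t x \<Longrightarrow> Pn b t x \<Longrightarrow> NB v t"
    and F4: "\<And>v u t. v \<in> wlds M \<Longrightarrow> u \<in> wlds M \<Longrightarrow> (v, u) \<notin> acc M \<Longrightarrow> t \<in> wlds N \<Longrightarrow> AB v t \<Longrightarrow> NB u t"
    and F5: "\<And>v u a t x. (v, u) \<in> acc M \<Longrightarrow> a \<in> dmn M v \<Longrightarrow> x \<in> dmn N t \<Longrightarrow> Pn a t x \<Longrightarrow> AB u t \<Longrightarrow> Pn (hom M v u a) t x"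
    and F6: "\<And>c. c \<in> csts \<Theta> \<Longrightarrow> Pn (cint M r c) n0 (cint N n0 c)"
    and F7: "\<And>v a t x y. q \<Longrightarrow> a \<in> dmn M v \<Longrightarrow> x \<in> dmn N t \<Longrightarrow> y \<in> dmn N t \<Longrightarrow> Pn a t x \<Longrightarrow> Pn a t y \<Longrightarrow> x = y"
    and root: "AB r n0" "\<not> NB r n0" and csts: "csts \<Theta> \<subseteq> csts \<Theta>'"
  shows "\<exists>fw g. fw r = n0 \<and> (\<forall>v\<in>wlds M. fw v \<in> wlds N \<and> AB v (fw v) \<and> \<not> NB v (fw v)) \<and>
    (\<forall>v\<in>wlds M. \<forall>u\<in>wlds M. (fw v, fw u) \<in> acc N \<longleftrightarrow> (v, u) \<in> acc M) \<and>
    (\<forall>v a. a \<in> dmn M v \<longrightarrow> g a \<in> dmn N (fw v) \<and> Pn a (fw v) (g a)) \<and>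
    inj_on fw (wlds M) \<and> inj_on g (elems M) \<and>
    (\<forall>v u a. (v, u) \<in> acc M \<longrightarrow> a \<in> dmn M v \<longrightarrow> g (hom M v u a) = hom N (fw v) (fw u) (g a)) \<and>
    (\<forall>v\<in>wlds M. \<forall>c\<in>csts \<Theta>. g (cint M v c) = cint N (fw v) c)"
proof -
  note D = is_modelD[OF M]
  note E = is_modelD[OF N]
  have r: "r \<in> wlds M" and least: "\<And>v. v \<in> wlds M \<Longrightarrow> (r, v) \<in> acc M"
    using good by (auto simp: good_def tree_rooted_def)
  obtain par and d :: "_ \<Rightarrow> nat" where "\<forall>v\<in>wlds M. v \<noteq> r \<longrightarrow> par v \<in> wlds M \<and> d (par v) < d v \<and> (par v, v) \<in> acc M \<and>
      (\<forall>u. (u, v) \<in> acc M \<longrightarrow> u = v \<or> (u, par v) \<in> acc M)"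
    using good unfolding good_def tree_rooted_def by (elim exE conjE)
  then have par: "\<And>v. v \<in> wlds M \<Longrightarrow> v \<noteq> r \<Longrightarrow> par v \<in> wlds M"
    "\<And>v. v \<in> wlds M \<Longrightarrow> v \<noteq> r \<Longrightarrow> d (par v) < d v" "\<And>v. v \<in> wlds M \<Longrightarrow> v \<noteq> r \<Longrightarrow> (par v, v) \<in> acc M"
    "\<And>u v. v \<in> wlds M \<Longrightarrow> v \<noteq> r \<Longrightarrow> (u, v) \<in> acc M \<Longrightarrow> u = v \<or> (u, par v) \<in> acc M"
    by blast+
  \<comment> \<open>A stage of the recursion at \<open>v\<close> is a pair: the image of
    \<open>v\<close> in \<open>N\<close> and a map giving the images of the elements of
    \<open>v\<close>.\<close>
  define Inv where "Inv v y \<longleftrightarrow> fst y \<in> wlds N \<and> AB v (fst y) \<and> \<not> NB v (fst y) \<and>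
    (\<forall>a\<in>dmn M v. snd y a \<in> dmn N (fst y) \<and> Pn a (fst y) (snd y a))" for v and y :: "'a \<times> ('a \<Rightarrow> 'a)"
  define Step where "Step v x y \<longleftrightarrow> (fst x, fst y) \<in> acc N \<and>
    (\<forall>a\<in>dmn M (par v). snd y (hom M (par v) v a) = hom N (fst x) (fst y) (snd x a))" for v and x y :: "'a \<times> ('a \<Rightarrow> 'a)"
  define Root where "Root y \<longleftrightarrow> fst y = n0 \<and> (\<forall>c\<in>csts \<Theta>. snd y (cint M r c) = cint N n0 c)" for y :: "'a \<times> ('a \<Rightarrow> 'a)"
  define P where "P f v y \<longleftrightarrow> (v \<in> wlds M \<longrightarrow> Inv v y \<and> (v = r \<longrightarrow> Root y) \<and> (v \<noteq> r \<longrightarrow> Step v (f (par v)) y))" for f v y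
  \<comment> \<open>Each world other than the root has one parent, so its image has to be chosen
    above one given world only. This is where the tree is used.\<close>
  have "\<exists>f. \<forall>v. P f v (f v)"
  proof (rule dependent_wf_choice)
    show "wf {(par v, v) | v. v \<in> wlds M \<and> v \<noteq> r}"
      by (rule wf_subset[OF wf_measure[of d]]) (use par(2) in auto)
    show "P f v y = P f' v y" if "\<And>z. (z, v) \<in> {(par v, v) | v. v \<in> wlds M \<and> v \<noteq> r} \<Longrightarrow> f z = f' z" for f f' v y
      using that by (auto simp: P_def)
    fix v f assume IH: "\<And>y. (y, v) \<in> {(par v, v) | v. v \<in> wlds M \<and> v \<noteq> r} \<Longrightarrow> P f y (f y)"
    show "\<exists>y. P f v y"
    proof (cases "v \<in> wlds M")
      case False
      then show ?thesis by (simp add: P_def)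
    next
      case v: True
      show ?thesis
      proof (cases "v = r")
        case True
        \<comment> \<open>The values of constants are forced, and any other element takes some
          element that bears its marker. An element named by two constants causes no conflict: with
          equality its marker has at most one bearer by \<open>F7\<close>, without equality the
          constants are distinct at \<open>r\<close>.\<close>
        define \<gamma> where "\<gamma> a = (if \<exists>c\<in>csts \<Theta>. a = cint M r c then cint N n0 (SOME c. c \<in> csts \<Theta> \<and> a = cint M r c)
          else (SOME x. x \<in> dmn N n0 \<and> Pn a n0 x))" for a
        have \<gamma>: "\<gamma> a \<in> dmn N n0 \<and> Pn a n0 (\<gamma> a)" if a: "a \<in> dmn M r" for a
        proof (cases "\<exists>c\<in>csts \<Theta>. a = cint M r c")
          case True
          let ?c = "SOME c. c \<in> csts \<Theta> \<and> a = cint M r c"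
          have "\<exists>c. c \<in> csts \<Theta> \<and> a = cint M r c" using True by blast
          then have c: "?c \<in> csts \<Theta> \<and> a = cint M r ?c" by (rule someI_ex)
          have "\<gamma> a = cint N n0 ?c" using True by (simp add: \<gamma>_def)
          moreover have "cint N n0 ?c \<in> dmn N n0" using E(13)[OF n0] csts c by blast
          moreover have "Pn a n0 (cint N n0 ?c)" using F6[of ?c] c by metis
          ultimately show ?thesis by metis
        next
          case False
          have "\<exists>x. x \<in> dmn N n0 \<and> Pn a n0 x" using F2[OF a n0 root(1)] by blast
          then show ?thesis using False someI_ex[of "\<lambda>x. x \<in> dmn N n0 \<and> Pn a n0 x"] by (simp add: \<gamma>_def)
        qed
        have "\<gamma> (cint M r c) = cint N n0 c" if c: "c \<in> csts \<Theta>" for c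
        proof -
          let ?c = "SOME c'. c' \<in> csts \<Theta> \<and> cint M r c = cint M r c'"
          have c': "?c \<in> csts \<Theta> \<and> cint M r c = cint M r ?c" by (rule someI_ex) (use c in blast)
          have eq: "\<gamma> (cint M r c) = cint N n0 ?c" using c unfolding \<gamma>_def by auto
          show ?thesis
          proof (cases q)
            case True
            have ca: "cint M r c \<in> dmn M r" using D(13)[OF r c] .
            have cN: "cint N n0 ?c \<in> dmn N n0" "cint N n0 c \<in> dmn N n0" using E(13)[OF n0] csts c c' by auto
            have "Pn (cint M r c) n0 (cint N n0 ?c)" using F6[of ?c] c' by auto
            then show ?thesis unfolding eq using F7[OF True ca cN] F6[OF c] by blast
          next
            case False
            then have "inj_on (cint M r) (csts \<Theta>)" using good D(1) by (simp add: good_def)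
            then show ?thesis unfolding eq using c c' by (metis inj_onD)
          qed
        qed
        then have "P f v (n0, \<gamma>)" using True \<gamma> n0 root by (auto simp: P_def Inv_def Root_def)
        then show ?thesis by blast
      next
        case False
        note pv = par(1,3)[OF v False]
        have "P f (par v) (f (par v))" using IH v False by blast
        then have Invp: "Inv (par v) (f (par v))" using pv by (simp add: P_def)
        define t where "t = fst (f (par v))"
        define \<gamma> where "\<gamma> = snd (f (par v))"
        have tI: "t \<in> wlds N" "AB (par v) t" "\<not> NB (par v) t" "\<And>a. a \<in> dmn M (par v) \<Longrightarrow> \<gamma> a \<in> dmn N t \<and> Pn a t (\<gamma> a)"
          using Invp by (auto simp: Inv_def t_def \<gamma>_def)
        \<comment> \<open>The marker for not being below the parent fails at \<open>t\<close>; by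
          \<open>F1\<close> this leaves a world above \<open>t\<close> to which \<open>v\<close> can
          be sent.\<close>
        obtain t' where t': "(t, t') \<in> acc N" "AB v t'" "\<not> NB v t'" using F1[OF pv(2) tI(1,3)] by blast
        have t'W: "t' \<in> wlds N" using E(4)[OF t'(1)] by blast
        define sel where "sel b = (SOME a. a \<in> dmn M (par v) \<and> hom M (par v) v a = b)" for b
        \<comment> \<open>Images of elements of the parent must go where the homomorphism of
          \<open>N\<close> sends them. With equality \<open>F7\<close> makes the value independent
          of the selected preimage; without equality the preimage is unique, as \<open>M\<close> is
          injective.\<close>
        define \<gamma>' where "\<gamma>' b = (if \<exists>a\<in>dmn M (par v). hom M (par v) v a = b
          then hom N t t' (\<gamma> (sel b)) else (SOME x. x \<in> dmn N t' \<and> Pn b t' x))" for b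
        have sel: "sel (hom M (par v) v a) \<in> dmn M (par v) \<and> hom M (par v) v (sel (hom M (par v) v a)) = hom M (par v) v a"
          if "a \<in> dmn M (par v)" for a
          unfolding sel_def by (rule someI_ex) (use that in blast)
        have step: "hom N t t' (\<gamma> a) \<in> dmn N t' \<and> Pn (hom M (par v) v a) t' (hom N t t' (\<gamma> a))" if a: "a \<in> dmn M (par v)" for a
        proof -
          have x: "hom N t t' (\<gamma> a) \<in> dmn N t'" using E(16)[OF t'(1)] tI(4)[OF a] by blast
          have "Pn a t' (hom N t t' (\<gamma> a))" using pers(2)[OF _ t'(1)] tI(4)[OF a] by blast
          then show ?thesis using F5[OF pv(2) a x _ t'(2)] x by blast
        qed
        have \<gamma>': "\<gamma>' b \<in> dmn N t' \<and> Pn b t' (\<gamma>' b)" if b: "b \<in> dmn M v" for b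
        proof (cases "\<exists>a\<in>dmn M (par v). hom M (par v) v a = b")
          case True
          then obtain a where a: "a \<in> dmn M (par v)" "hom M (par v) v a = b" by blast
          show ?thesis using step[of "sel b"] sel[OF a(1)] a True by (simp add: \<gamma>'_def)
        next
          case False
          have "\<exists>x. x \<in> dmn N t' \<and> Pn b t' x" using F2[OF b t'W t'(2)] by blast
          then have "(SOME x. x \<in> dmn N t' \<and> Pn b t' x) \<in> dmn N t' \<and> Pn b t' (SOME x. x \<in> dmn N t' \<and> Pn b t' x)" by (rule someI_ex)
          then show ?thesis using False by (simp add: \<gamma>'_def)
        qed
        have "\<gamma>' (hom M (par v) v a) = hom N t t' (\<gamma> a)" if a: "a \<in> dmn M (par v)" for a
        proof -
          let ?a = "sel (hom M (par v) v a)"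
          have eq: "\<gamma>' (hom M (par v) v a) = hom N t t' (\<gamma> ?a)" using a unfolding \<gamma>'_def by auto
          show ?thesis
          proof (cases q)
            case True
            have "hom M (par v) v a \<in> dmn M v" using D(16)[OF pv(2) a] .
            then show ?thesis unfolding eq using F7[OF True] step[OF a] step[of ?a] sel[OF a] by metis
          next
            case False
            then have "inj_on (hom M (par v) v) (dmn M (par v))" using good pv(2) by (auto simp: good_def inj_model_def)
            then have "?a = a" using sel[OF a] a by (meson inj_onD)
            then show ?thesis unfolding eq by simp
          qed
        qed
        then have "Step v (f (par v)) (t', \<gamma>')" using t'(1) by (simp add: Step_def t_def \<gamma>_def)
        moreover have "Inv v (t', \<gamma>')" using t' t'W \<gamma>' by (simp add: Inv_def)
        ultimately have "P f v (t', \<gamma>')" using False by (simp add: P_def)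
        then show ?thesis by blast
      qed
    qed
  qed
  then obtain f where f: "\<And>v. P f v (f v)" by blast
  define fw where "fw v = fst (f v)" for v
  define wof where "wof a = (THE v. a \<in> dmn M v)" for a
  define g where "g a = snd (f (wof a)) a" for a
  have wof: "wof a = v" if "a \<in> dmn M v" for a v unfolding wof_def using that D(11) by blast
  have inv: "fw v \<in> wlds N" "AB v (fw v)" "\<not> NB v (fw v)" if "v \<in> wlds M" for v
    using f[of v] that by (auto simp: P_def Inv_def fw_def)
  have gv: "g a \<in> dmn N (fw v) \<and> Pn a (fw v) (g a)" if a: "a \<in> dmn M v" for a v
    using f[of v] a wof[OF a] model_dmn_wlds[OF M a] by (auto simp: P_def Inv_def fw_def g_def)
  have step: "(fw (par v), fw v) \<in> acc N" "\<And>a. a \<in> dmn M (par v) \<Longrightarrow> g (hom M (par v) v a) = hom N (fw (par v)) (fw v) (g a)"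
    if v: "v \<in> wlds M" "v \<noteq> r" for v
  proof -
    have S: "Step v (f (par v)) (f v)" using f[of v] v by (simp add: P_def)
    show "(fw (par v), fw v) \<in> acc N" using S by (simp add: Step_def fw_def)
    fix a assume a: "a \<in> dmn M (par v)"
    show "g (hom M (par v) v a) = hom N (fw (par v)) (fw v) (g a)"
      using S a wof[OF a] wof[OF D(16)[OF par(3)[OF v] a]] by (simp add: Step_def fw_def g_def)
  qed
  \<comment> \<open>The recursion relates parent and child only; induction along parents extends
    this to all comparable pairs.\<close>
  have up: "(fw u, fw v) \<in> acc N \<and> (\<forall>a\<in>dmn M u. g (hom M u v a) = hom N (fw u) (fw v) (g a))" if "(u, v) \<in> acc M" for u v
    using that
  proof (induction "d v" arbitrary: v rule: less_induct)
    case less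
    have uW: "u \<in> wlds M" and vW: "v \<in> wlds M" using D(4)[OF less.prems] by auto
    show ?case
    proof (cases "u = v")
      case True
      then show ?thesis using E(5)[OF inv(1)[OF vW]] D(21) E(21) gv by metis
    next
      case False
      then have vr: "v \<noteq> r" using D(7)[OF less.prems] least[OF uW] by blast
      have up: "(u, par v) \<in> acc M" using par(4)[OF vW vr less.prems] False by blast
      note IH = less.hyps[OF par(2)[OF vW vr] up]
      note st = step[OF vW vr]
      have "g (hom M u v a) = hom N (fw u) (fw v) (g a)" if a: "a \<in> dmn M u" for a
      proof -
        have "g (hom M u v a) = g (hom M (par v) v (hom M u (par v) a))" using D(22)[OF up par(3)[OF vW vr] a] by simp
        also have "\<dots> = hom N (fw (par v)) (fw v) (g (hom M u (par v) a))" using st(2) D(16)[OF up a] by blast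
        also have "\<dots> = hom N (fw (par v)) (fw v) (hom N (fw u) (fw (par v)) (g a))" using IH a by simp
        also have "\<dots> = hom N (fw u) (fw v) (g a)" using E(22) IH st(1) gv[OF a] by blast
        finally show ?thesis .
      qed
      then show ?thesis using E(6) IH st(1) by blast
    qed
  qed
  \<comment> \<open>The order is reflected as well: an image of \<open>u\<close> above the image of
    \<open>v\<close> inherits the marker for above \<open>v\<close>, and if \<open>u\<close> were
    not above \<open>v\<close>, \<open>F4\<close> would give it the marker that is refuted
    there.\<close>
  have ord: "(fw v, fw u) \<in> acc N \<longleftrightarrow> (v, u) \<in> acc M" if "v \<in> wlds M" "u \<in> wlds M" for v u
  proof
    assume "(fw v, fw u) \<in> acc N"
    then have "AB v (fw u)" using pers(1) inv(2)[OF that(1)] by blast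
    then show "(v, u) \<in> acc M" using F4[OF that] inv(1,3)[OF that(2)] by blast
  qed (use up in blast)
  have injf: "inj_on fw (wlds M)"
  proof (rule inj_onI)
    fix v u assume "v \<in> wlds M" "u \<in> wlds M" "fw v = fw u"
    then show "v = u" using ord E(5) inv(1) D(7) by metis
  qed
  \<comment> \<open>Domains of \<open>N\<close> are disjoint, so equal images come from elements of
    one world \<open>v\<close>. By \<open>F3\<close> two different elements of \<open>v\<close> with
    a common image would force the marker that is refuted at the image of \<open>v\<close>.\<close>
  have injg: "inj_on g (elems M)"
  proof (rule inj_onI)
    fix a b assume "a \<in> elems M" "b \<in> elems M" and eq: "g a = g b"
    then obtain v u where vu: "v \<in> wlds M" "u \<in> wlds M" "a \<in> dmn M v" "b \<in> dmn M u" by (auto simp: elems_def)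
    have "fw v = fw u" using E(11) gv[OF vu(3)] gv[OF vu(4)] eq by metis
    then have "v = u" using injf vu by (meson inj_onD)
    then show "a = b" using F3[OF vu(3) _ _ _ _ , of b "g a" "fw v"] vu gv[OF vu(3)] gv[OF vu(4)] eq inv(3)[OF vu(1)] by auto
  qed
  have fr: "fw r = n0" and cr: "\<And>c. c \<in> csts \<Theta> \<Longrightarrow> g (cint M r c) = cint N n0 c"
    using f[of r] r wof[OF D(13)[OF r]] by (auto simp: P_def Root_def fw_def g_def)
  have "g (cint M v c) = cint N (fw v) c" if v: "v \<in> wlds M" and c: "c \<in> csts \<Theta>" for v c
  proof -
    have "g (cint M v c) = g (hom M r v (cint M r c))" using D(20)[OF least[OF v] c] by simp
    also have "\<dots> = hom N (fw r) (fw v) (cint N n0 c)" using up[OF least[OF v]] D(13)[OF r c] cr[OF c] by simp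
    also have "\<dots> = cint N (fw v) c" using E(20)[of n0 "fw v" c] up[OF least[OF v]] fr c csts by auto
    finally show ?thesis .
  qed
  then show ?thesis using fr inv ord gv injf injg up by (intro exI[of _ fw] exI[of _ g]) auto
qed

section \<open>Trees and cones under isomorphism\<close>

lemma tree_rooted_iso:
  assumes M: "is_model \<Theta> M" and N: "is_model \<Theta> N" and iso: "model_iso g h M N" and tree: "tree_rooted M r"
  shows "tree_rooted N (h r)"
proof -
  note I = model_isoD[OF iso]
  have r: "r \<in> wlds M" and least: "\<And>v. v \<in> wlds M \<Longrightarrow> (r, v) \<in> acc M"
    using tree by (auto simp: tree_rooted_def)
  obtain par and d :: "_ \<Rightarrow> nat" where "\<forall>v\<in>wlds M. v \<noteq> r \<longrightarrow> par v \<in> wlds M \<and> d (par v) < d v \<and> (par v, v) \<in> acc M \<and>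
      (\<forall>u. (u, v) \<in> acc M \<longrightarrow> u = v \<or> (u, par v) \<in> acc M)"
    using tree unfolding tree_rooted_def by (elim exE conjE)
  then have par: "\<And>v. v \<in> wlds M \<Longrightarrow> v \<noteq> r \<Longrightarrow> par v \<in> wlds M"
    "\<And>v. v \<in> wlds M \<Longrightarrow> v \<noteq> r \<Longrightarrow> d (par v) < d v" "\<And>v. v \<in> wlds M \<Longrightarrow> v \<noteq> r \<Longrightarrow> (par v, v) \<in> acc M"
    "\<And>u v. v \<in> wlds M \<Longrightarrow> v \<noteq> r \<Longrightarrow> (u, v) \<in> acc M \<Longrightarrow> u = v \<or> (u, par v) \<in> acc M"
    by blast+
  define h' where "h' = the_inv_into (wlds M) h"
  have hh: "h' (h v) = v" if "v \<in> wlds M" for v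
    using that I(3) by (simp add: h'_def bij_betw_def the_inv_into_f_f)
  have ex: "\<exists>v0\<in>wlds M. v = h v0" if "v \<in> wlds N" for v using that I(3) by (auto simp: bij_betw_def)
  have hw: "h v \<in> wlds N" if "v \<in> wlds M" for v using that I(3) by (auto simp: bij_betw_def)
  show ?thesis
    unfolding tree_rooted_def
  proof (intro conjI ballI exI impI allI)
    show "h r \<in> wlds N" using hw r by blast
    show "(h r, v) \<in> acc N" if "v \<in> wlds N" for v using ex[OF that] least I(4)[OF r] by blast
    fix v assume v: "v \<in> wlds N" "v \<noteq> h r"
    then obtain v0 where v0: "v0 \<in> wlds M" "v = h v0" using ex by blast
    have v0r: "v0 \<noteq> r" using v v0 by blast
    let ?par = "\<lambda>v. h (par (h' v))" and ?d = "\<lambda>v. d (h' v)"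
    have pv: "?par v = h (par v0)" "h' v = v0" using hh v0 by auto
    note p = par(1,2,3)[OF v0(1) v0r]
    show "?par v \<in> wlds N" unfolding pv using hw p by blast
    show "?d (?par v) < ?d v" unfolding pv using hh p by simp
    show "(?par v, v) \<in> acc N" using pv v0 p I(4) by simp
    fix u assume u: "(u, v) \<in> acc N"
    obtain u0 where u0: "u0 \<in> wlds M" "u = h u0" using ex u model_acc_wlds[OF N] by blast
    have "(u0, v0) \<in> acc M" using u u0 v0 I(4) by blast
    then have "u0 = v0 \<or> (u0, par v0) \<in> acc M" using par(4)[OF v0(1) v0r] by blast
    then show "u = v \<or> (u, ?par v) \<in> acc N" using u0 v0 pv I(4) p by auto
  qed
qed

lemma good_iso:
  assumes M: "is_model \<Theta> M" and N: "is_model \<Theta> N" and iso: "model_iso g h M N" and good: "good q M r"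
  shows "good q N (h r)"
proof -
  note I = model_isoD[OF iso]
  have r: "r \<in> wlds M" using good by (auto simp: good_def tree_rooted_def)
  have "inj_model N \<and> inj_on (cint N (h r)) (csts (sgn N))" if q: "\<not> q"
  proof
    have inj: "inj_model M" "inj_on (cint M r) (csts (sgn M))" using good q by (auto simp: good_def)
    show "inj_model N"
      unfolding inj_model_def
    proof (intro ballI, clarify)
      fix v u assume vu: "(v, u) \<in> acc N"
      have "\<exists>v0\<in>wlds M. v = h v0" "\<exists>u0\<in>wlds M. u = h u0" using vu model_acc_wlds[OF N vu] I(3) by (auto simp: bij_betw_def)
      then obtain v0 u0 where 0: "v0 \<in> wlds M" "v = h v0" "u0 \<in> wlds M" "u = h u0" by blast
      have vu0: "(v0, u0) \<in> acc M" using vu 0 I(4) by blast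
      have i0: "inj_on (hom M v0 u0) (dmn M v0)" using inj vu0 by (auto simp: inj_model_def)
      show "inj_on (hom N v u) (dmn N v)"
      proof (rule inj_onI)
        fix x y assume xy: "x \<in> dmn N v" "y \<in> dmn N v" "hom N v u x = hom N v u y"
        obtain x0 y0 where x0: "x0 \<in> dmn M v0" "x = g x0" "y0 \<in> dmn M v0" "y = g y0"
          using xy I(5)[OF 0(1)] 0(2) by (metis bij_betw_imp_surj_on imageE)
        have "g (hom M v0 u0 x0) = g (hom M v0 u0 y0)" using I(8)[OF vu0] x0 xy(3) 0 by simp
        then have "hom M v0 u0 x0 = hom M v0 u0 y0"
          using I(5)[OF 0(3)] model_hom[OF M vu0] x0 by (meson bij_betw_imp_inj_on inj_onD)
        then show "x = y" using i0 x0 by (metis inj_onD)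
      qed
    qed
    have "inj_on g (dmn M r)" using I(5)[OF r] by (rule bij_betw_imp_inj_on)
    then show "inj_on (cint N (h r)) (csts (sgn N))"
      using inj(2) I(7)[OF r] I(1) model_cint[OF M r] model_sgn[OF M] by (auto simp: inj_on_def)
  qed
  moreover have "tree_rooted N (h r)" using tree_rooted_iso[OF M N iso] good by (simp add: good_def)
  ultimately show ?thesis by (simp add: good_def)
qed

lemma good_reduct: "good q M r \<Longrightarrow> sub_sig \<Theta> (sgn M) \<Longrightarrow> good q (reduct M \<Theta>) r"
  by (auto simp: good_def tree_rooted_def inj_model_def sub_sig_def inj_on_def subset_iff)

lemma iso_cone_covers:
  assumes M: "is_model \<Theta> M" and N: "is_model \<Theta> N" and iso: "model_iso g h M N" and t: "t \<in> wlds M"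
    and nt: "name_tuple M t cs as"
  shows "covers q (add_consts \<Theta> cs) h g (cone_exp M t cs as) t (cone_exp N (h t) cs (map g as))"
    "name_tuple N (h t) cs (map g as)"
proof -
  note I = model_isoD[OF iso]
  note nt' = name_tupleD[OF nt]
  let ?A = "cone_exp M t cs as" and ?B = "cone_exp N (h t) cs (map g as)"
  have gd: "g a \<in> dmn N (h v)" if "a \<in> dmn M v" "v \<in> wlds M" for a v
    using I(5)[OF that(2)] that(1) by (auto simp: bij_betw_def)
  show ntN: "name_tuple N (h t) cs (map g as)"
    using nt' gd[OF _ t] model_sgn[OF M] model_sgn[OF N] by (auto simp: name_tuple_def)
  have cov: "covers q \<Theta> h g M t N" by (rule iso_covers[OF M N iso])
  note CM = cone_exp_model[OF M t nt]
  show "covers q (add_consts \<Theta> cs) h g ?A t ?B"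
    unfolding covers_def
  proof (intro allI impI)
    fix v assume "(t, v) \<in> acc ?A"
    then have tv: "(t, v) \<in> acc M" by simp
    have tv': "(h t, h v) \<in> acc N" using covers_forth[OF cov model_acc_refl[OF M t] tv] .
    note C = coversD[OF cov tv]
    have acc: "(h v, x) \<in> acc ?B \<longleftrightarrow> (\<exists>u. (v, u) \<in> acc ?A \<and> h u = x)" for x
      using C(2) C(3)[of x] model_acc_trans[OF M tv] model_acc_trans[OF N tv'] tv tv'
      unfolding cone_exp_simps(3) by blast
    have cint: "g (cint ?A v c) = cint ?B (h v) c"
      if "c \<in> csts (add_consts \<Theta> cs)" for c
    proof (cases "c \<in> set cs")
      case True
      then obtain i where i: "i < length cs" "c = cs ! i" by (metis in_set_conv_nth)
      have "as ! i \<in> dmn M t" using i nt'(3,4) by (metis nth_mem subsetD)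
      then show ?thesis unfolding i(2) using i(1) nt' tv tv' I(8)[OF tv] by (simp add: cone_exp_cint_new)
    next
      case False
      then show ?thesis using that tv tv' C(7) by (simp add: cone_exp_cint_old)
    qed
    have cd: "cint ?A v c \<in> dmn ?A v" if "c \<in> csts (add_consts \<Theta> cs)" for c
      using model_cint[OF CM _ that] tv by simp
    have hm: "g (hom ?A v u a) = hom ?B (h v) (h u) (g a)"
      if "(v, u) \<in> acc ?A" "a \<in> dmn ?A v" for u a
      using that C(8)[of u a] tv tv' model_acc_trans[OF N tv' C(2), of u] by auto
    show "h v \<in> wlds ?B \<and>
         (\<forall>ta. (h v, ta) \<in> acc ?B \<longleftrightarrow> (\<exists>u. (v, u) \<in> acc ?A \<and> h u = ta)) \<and>
         g ` dmn ?A v = dmn ?B (h v) \<and>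
         (q \<longrightarrow> inj_on g (dmn ?A v)) \<and>
         (\<forall>P asa. set asa \<subseteq> dmn ?A v \<and> P \<in> preds (add_consts \<Theta> cs) (length asa) \<longrightarrow>
           (asa \<in> pint ?A v P) = (map g asa \<in> pint ?B (h v) P)) \<and>
         (\<forall>c\<in>csts (add_consts \<Theta> cs). cint ?A v c \<in> dmn ?A v \<and>
           g (cint ?A v c) = cint ?B (h v) c) \<and>
         (\<forall>u. (v, u) \<in> acc ?A \<longrightarrow> (\<forall>a\<in>dmn ?A v.
           g (hom ?A v u a) = hom ?B (h v) (h u) (g a)))"
    proof (intro conjI)
      show "h v \<in> wlds ?B" using tv' by simp
    qed (use acc cint cd hm C(4,5,6) tv tv' in \<open>blast | simp\<close>)+
  qed
qed

section \<open>Expansion by markers\<close>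

text \<open>\<open>mark M m X I\<close> expands \<open>M\<close> by predicate letters of all arities \<open>n \<ge> m\<close> with names in \<open>X\<close>; the
  letter \<open>x\<close> of arity \<open>n\<close> holds of the constant tuples over \<open>I n x\<close>. If all letters of the signature
  have arity below \<open>m\<close>, any elements of the universe can serve as names of new letters.\<close>

definition mark_sig :: "'u signature \<Rightarrow> nat \<Rightarrow> 'u set \<Rightarrow> 'u signature" where
  "mark_sig \<Theta> m X = \<Theta>\<lparr>preds := (\<lambda>n. if m \<le> n then X else preds \<Theta> n)\<rparr>"

definition mark :: "'u kmodel \<Rightarrow> nat \<Rightarrow> 'u set \<Rightarrow> (nat \<Rightarrow> 'u \<Rightarrow> 'u set) \<Rightarrow> 'u kmodel" where
  "mark M m X I = M\<lparr>sgn := mark_sig (sgn M) m X,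
     pint := (\<lambda>v x. pint M v x \<union> {as. m \<le> length as \<and> x \<in> X \<and> (\<exists>a. a \<in> dmn M v \<and> a \<in> I (length as) x \<and> as = replicate (length as) a)})\<rparr>"

lemma mark_simps [simp]:
  "wlds (mark M m X I) = wlds M" "acc (mark M m X I) = acc M" "dmn (mark M m X I) = dmn M"
  "hom (mark M m X I) = hom M" "cint (mark M m X I) = cint M" "sgn (mark M m X I) = mark_sig (sgn M) m X"
  "csts (mark_sig \<Theta> m X) = csts \<Theta>"
  by (simp_all add: mark_def mark_sig_def)

lemma mark_in_class [simp]: "in_class K (mark M m X I) \<longleftrightarrow> in_class K M"
  by (cases K) (simp_all add: inj_model_def surj_model_def)

context
  fixes M :: "'u kmodel" and \<Theta> :: "'u signature" and m :: nat and X :: "'u set"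
  assumes M: "is_model \<Theta> M" and high: "\<And>n. m \<le> n \<Longrightarrow> preds \<Theta> n = {}" and m: "0 < m"
begin

text \<open>Homomorphisms have to preserve the new letters, hence the condition that
  \<open>I\<close> is closed under them.\<close>

lemma mark_model:
  assumes closed: "\<And>n x v u a. (v, u) \<in> acc M \<Longrightarrow> a \<in> dmn M v \<Longrightarrow> a \<in> I n x \<Longrightarrow> hom M v u a \<in> I n x"
  shows "is_model (mark_sig \<Theta> m X) (mark M m X I)"
proof -
  note D = is_modelD[OF M]
  show ?thesis
  proof (rule is_modelI, simp_all add: D(1-3))
    show "partial_order_on (wlds M) (acc M)" using M by (simp add: is_model_def)
    fix v P as assume as: "as \<in> pint (mark M m X I) v P"
    show "set as \<subseteq> dmn M v"
    proof (cases "as \<in> pint M v P")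
      case True
      then show ?thesis using D(12) by blast
    next
      case False
      then have "\<exists>a\<in>dmn M v. as = replicate (length as) a" using as by (auto simp: mark_def)
      then show ?thesis by (metis set_replicate_conv_if empty_subsetI insert_subset)
    qed
    show "P \<in> preds (mark_sig \<Theta> m X) (length as)"
      using as D(12)[of as v P] high[of "length as"] by (fastforce simp: mark_def mark_sig_def)
    fix u assume vu: "(v, u) \<in> acc M"
    show "map (hom M v u) as \<in> pint (mark M m X I) u P"
    proof (cases "as \<in> pint M v P")
      case True
      then show ?thesis using D(19)[OF vu True] by (simp add: mark_def)
    next
      case False
      then obtain a where a: "m \<le> length as" "P \<in> X" "a \<in> dmn M v" "a \<in> I (length as) P" "as = replicate (length as) a"
        using as by (auto simp: mark_def)
      then have "map (hom M v u) as = replicate (length as) (hom M v u a)" by (metis map_replicate)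
      then show ?thesis using a closed[OF vu a(3,4)] D(16)[OF vu a(3)] by (auto simp: mark_def)
    qed
  qed ((rule D(8,9,10,13,14,15,16,17,18,20,21,22); assumption) | (rule D(11); assumption))+
qed

lemma reduct_mark: "reduct (mark M m X I) \<Theta> = M"
proof -
  note D = is_modelD[OF M]
  have "{as \<in> pint (mark M m X I) w P. P \<in> preds \<Theta> (length as)} = pint M w P" for w P
    using D(12)[of _ w P] high by (auto simp: mark_def)
  moreover have "restrict (cint M w) (csts \<Theta>) = cint M w" for w
    using D(14,15) by (cases "w \<in> wlds M") (auto simp: fun_eq_iff restrict_def)
  ultimately show ?thesis
    unfolding reduct_def by (intro kmodel.equality) (simp_all add: D(1))
qed

lemma mark_sig_props:
  shows "sub_sig \<Theta> (mark_sig \<Theta> m X)"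
  using high by (auto simp: sub_sig_def mark_sig_def)

text \<open>\<open>M\<close> has no tuples of this arity for the letter, and \<open>m > 0\<close>
  makes a constant tuple of length \<open>n\<close> determine its entry.\<close>

lemma pint_mark_replicate:
  assumes "m \<le> n" "x \<in> X" "a \<in> dmn M v"
  shows "replicate n a \<in> pint (mark M m X I) v x \<longleftrightarrow> a \<in> I n x"
proof -
  have "replicate n a \<notin> pint M v x"
    using model_pint[OF M, of "replicate n a" v x] high[OF assms(1)] by auto
  moreover have "replicate n a = replicate n b \<longleftrightarrow> a = b" for b using assms(1) m by (cases n) auto
  ultimately show ?thesis using assms by (auto simp: mark_def)
qed

end

lemma is_sig_mark_sig: "is_sig \<Theta> \<Longrightarrow> small X \<Longrightarrow> 0 < m \<Longrightarrow> is_sig (mark_sig \<Theta> m X)"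
  by (simp add: is_sig_def mark_sig_def)

section \<open>Formulas that read the markers\<close>

definition mk :: "nat \<Rightarrow> 'u \<Rightarrow> nat \<Rightarrow> 'u fm" where
  "mk n x i = Atom x (replicate n (Var i))"

lemma fm_over_mk: "m \<le> n \<Longrightarrow> x \<in> X \<Longrightarrow> fm_over q (mark_sig \<Theta> m X) (mk n x i)"
  by (auto simp: mk_def mark_sig_def)

lemma fv_mk: "0 < n \<Longrightarrow> fv (mk n x i) = {i}"
  by (auto simp: mk_def)

lemma holds_mk: "holds N t s (mk n x i) \<longleftrightarrow> replicate n (s i) \<in> pint N t x"
  by (simp add: mk_def)

text \<open>Letters have positive arity, so a property of worlds has to be carried by some element
  of the world.\<close>

definition mkw :: "nat \<Rightarrow> 'u \<Rightarrow> 'u fm" where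
  "mkw n x = Ex 0 (mk n x 0)"

lemma fm_over_mkw: "m \<le> n \<Longrightarrow> x \<in> X \<Longrightarrow> fm_over q (mark_sig \<Theta> m X) (mkw n x)"
  by (simp add: mkw_def fm_over_mk)

lemma fv_mkw: "fv (mkw n x) = {}"
  by (auto simp: mkw_def mk_def)

lemma holds_mkw: "holds N t s (mkw n x) \<longleftrightarrow> (\<exists>a\<in>dmn N t. replicate n a \<in> pint N t x)"
  by (simp add: mkw_def holds_mk)

section \<open>Compactness for rules\<close>

context extension_logic begin

text \<open>\<open>\<Omega> F\<close> consists of models that meet the finite set \<open>F\<close>
  of demands. The sentences true throughout some such class are finitely satisfiable while \<nu> is
  refuted, so they have a common model, which may be taken good. Its root sees every world, hence it
  obeys at all worlds each rule that is eventually valid in \<Omega>. The refutation of \<nu> at the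
  root is the only negative information that is passed on.\<close>

lemma ex_compact_good_model:
  assumes comp: "star_compact L" and sig: "is_sig \<Theta>"
    and \<Omega>: "\<And>F :: 'f set. finite F \<Longrightarrow> \<Omega> F \<noteq> {}" "\<And>F F'. F \<subseteq> F' \<Longrightarrow> \<Omega> F' \<subseteq> \<Omega> F"
      "\<And>F M. M \<in> \<Omega> F \<Longrightarrow> (M, r) \<in> Str L \<Theta>"
    and neg: "fm_over (has_eq K) \<Theta> \<nu>" "fv \<nu> = {}" "\<And>F M s. M \<in> \<Omega> F \<Longrightarrow> \<not> holds M r s \<nu>"
  shows "\<exists>N n0. (N, n0) \<in> Str L \<Theta> \<and> good (has_eq K) N n0 \<and> (\<forall>s. \<not> holds N n0 s \<nu>) \<and>
    (\<forall>F k \<psi>1 \<psi>2. finite F \<longrightarrow> fm_over (has_eq K) \<Theta> \<psi>1 \<longrightarrow> fm_over (has_eq K) \<Theta> \<psi>2 \<longrightarrow> fv \<psi>1 \<union> fv \<psi>2 \<subseteq> {..<k} \<longrightarrow>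
      (\<forall>M\<in>\<Omega> F. \<forall>v\<in>wlds M. \<forall>s. (\<forall>x<k. s x \<in> dmn M v) \<longrightarrow> holds M v s \<psi>1 \<longrightarrow> holds M v s \<psi>2) \<longrightarrow>
      (\<forall>t\<in>wlds N. \<forall>s. (\<forall>x<k. s x \<in> dmn N t) \<longrightarrow> holds N t s \<psi>1 \<longrightarrow> holds N t s \<psi>2)) \<and>
    (\<forall>cs \<psi>1 \<psi>2. distinct cs \<longrightarrow> set cs \<inter> csts \<Theta> = {} \<longrightarrow> \<psi>1 \<in> Sen L (add_consts \<Theta> cs) \<longrightarrow> \<psi>2 \<in> Sen L (add_consts \<Theta> cs) \<longrightarrow>
      (\<forall>M\<in>\<Omega> {}. \<forall>v\<in>wlds M. \<forall>as. length as = length cs \<longrightarrow> set as \<subseteq> dmn M v \<longrightarrow>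
         Sat L (cone_exp M v cs as) v \<psi>1 \<longrightarrow> Sat L (cone_exp M v cs as) v \<psi>2) \<longrightarrow>
      (\<forall>t\<in>wlds N. \<forall>as. length as = length cs \<longrightarrow> set as \<subseteq> dmn N t \<longrightarrow>
         Sat L (cone_exp N t cs as) t \<psi>1 \<longrightarrow> Sat L (cone_exp N t cs as) t \<psi>2))"
proof -
  obtain \<nu>' where \<nu>': "\<nu>' \<in> Sen L \<Theta>" "\<And>M w s. (M, w) \<in> Str L \<Theta> \<Longrightarrow> Sat L M w \<nu>' \<longleftrightarrow> holds M w s \<nu>"
    using ex_translation[OF sig, of \<nu>] neg(1,2) by (auto simp: Sen_std)
  define T where "T = {\<chi> \<in> Sen L \<Theta>. \<exists>F. finite F \<and> (\<forall>M\<in>\<Omega> F. Sat L M r \<chi>)}"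
  have "\<exists>(M, w)\<in>Str L \<Theta>. (\<forall>\<phi>\<in>T. Sat L M w \<phi>) \<and> (\<forall>\<phi>\<in>{\<nu>'}. \<not> Sat L M w \<phi>)"
  proof (rule comp[unfolded star_compact_def, rule_format])
    have "\<exists>(M, w)\<in>Str L \<Theta>. (\<forall>\<phi>\<in>\<Gamma>'. Sat L M w \<phi>) \<and> (\<forall>\<phi>\<in>\<Delta>'. \<not> Sat L M w \<phi>)"
      if fin: "finite \<Gamma>'" and sub: "\<Gamma>' \<subseteq> T" "\<Delta>' \<subseteq> {\<nu>'}" for \<Gamma>' \<Delta>'
    proof -
      have "\<forall>\<chi>\<in>\<Gamma>'. \<exists>F. finite F \<and> (\<forall>M\<in>\<Omega> F. Sat L M r \<chi>)" using sub(1) by (auto simp: T_def)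
      then obtain FF where FF: "\<And>\<chi>. \<chi> \<in> \<Gamma>' \<Longrightarrow> finite (FF \<chi>) \<and> (\<forall>M\<in>\<Omega> (FF \<chi>). Sat L M r \<chi>)" by metis
      \<comment> \<open>Each of the finitely many sentences comes with its own demands; since
        \<Omega> is decreasing, a model that meets their union satisfies all of the
        sentences.\<close>
      have "finite (\<Union>\<chi>\<in>\<Gamma>'. FF \<chi>)" using fin FF by blast
      then obtain M where M: "M \<in> \<Omega> (\<Union>\<chi>\<in>\<Gamma>'. FF \<chi>)" using \<Omega>(1) by blast
      have "Sat L M r \<chi>" if "\<chi> \<in> \<Gamma>'" for \<chi>
        using FF[OF that] M \<Omega>(2)[of "FF \<chi>" "\<Union>\<chi>\<in>\<Gamma>'. FF \<chi>"] that by blast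
      moreover have "\<not> Sat L M r \<nu>'" using \<nu>'(2)[OF \<Omega>(3)[OF M]] neg(3)[OF M] by blast
      ultimately show ?thesis using \<Omega>(3)[OF M] sub(2) by blast
    qed
    then show "is_sig \<Theta> \<and> T \<subseteq> Sen L \<Theta> \<and> {\<nu>'} \<subseteq> Sen L \<Theta> \<and> (\<forall>\<Gamma>' \<Delta>'. finite \<Gamma>' \<and> finite \<Delta>' \<and> \<Gamma>' \<subseteq> T \<and> \<Delta>' \<subseteq> {\<nu>'} \<longrightarrow>
        (\<exists>(M, w)\<in>Str L \<Theta>. (\<forall>\<phi>\<in>\<Gamma>'. Sat L M w \<phi>) \<and> (\<forall>\<phi>\<in>\<Delta>'. \<not> Sat L M w \<phi>)))"
      using sig \<nu>'(1) by (auto simp: T_def)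
  qed
  then obtain N1 n1 where N1: "(N1, n1) \<in> Str L \<Theta>" "\<And>\<phi>. \<phi> \<in> T \<Longrightarrow> Sat L N1 n1 \<phi>" "\<not> Sat L N1 n1 \<nu>'" by auto
  \<comment> \<open>Making the model good does not change the \<open>L\<close>-theory of its
    point.\<close>
  obtain N n0 where N: "(N, n0) \<in> Str L \<Theta>" "good (has_eq K) N n0" "\<And>\<phi>. \<phi> \<in> Sen L \<Theta> \<Longrightarrow> Sat L N n0 \<phi> \<longleftrightarrow> Sat L N1 n1 \<phi>"
    using ex_good[OF sig N1(1)] by blast
  have NT: "Sat L N n0 \<phi>" if "\<phi> \<in> T" for \<phi> using N(3)[of \<phi>] N1(2)[OF that] that by (simp add: T_def)
  have least: "(n0, t) \<in> acc N" if "t \<in> wlds N" for t using N(2) that by (simp add: good_def tree_rooted_def)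
  have Nm: "is_model \<Theta> N" "n0 \<in> wlds N" using N(1) Str_iff[OF sig] by auto
  have rule1: "holds N t s \<psi>2"
    if fin: "finite F" and over: "fm_over (has_eq K) \<Theta> \<psi>1" "fm_over (has_eq K) \<Theta> \<psi>2" and fv: "fv \<psi>1 \<union> fv \<psi>2 \<subseteq> {..<k}"
      and imp: "\<forall>M\<in>\<Omega> F. \<forall>v\<in>wlds M. \<forall>s. (\<forall>x<k. s x \<in> dmn M v) \<longrightarrow> holds M v s \<psi>1 \<longrightarrow> holds M v s \<psi>2"
      and t: "t \<in> wlds N" and s: "\<forall>x<k. s x \<in> dmn N t" and h1: "holds N t s \<psi>1" for F k \<psi>1 \<psi>2 t s
  proof -
    let ?\<chi> = "AllUpto k (Imp \<psi>1 \<psi>2)"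
    have o: "fm_over (has_eq K) \<Theta> (Imp \<psi>1 \<psi>2)" using over by simp
    have f: "fv (Imp \<psi>1 \<psi>2) \<subseteq> {..<k}" using fv by simp
    have "?\<chi> \<in> Sen (std_logic K) \<Theta>" using o f by (auto simp: Sen_std fv_AllUpto)
    then obtain \<chi> where \<chi>: "\<chi> \<in> Sen L \<Theta>" "\<And>M w s. (M, w) \<in> Str L \<Theta> \<Longrightarrow> Sat L M w \<chi> \<longleftrightarrow> holds M w s ?\<chi>"
      using ex_translation[OF sig] by blast
    have "Sat L M r \<chi>" if M\<Omega>: "M \<in> \<Omega> F" for M
    proof -
      note SM = \<Omega>(3)[OF M\<Omega>]
      have Mm: "is_model \<Theta> M" "r \<in> wlds M" using SM Str_iff[OF sig] by auto
      have "holds M r (\<lambda>_. undefined) ?\<chi>"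
        unfolding holds_AllUpto[OF Mm(1) o f Mm(2)] holds.simps
      proof (intro allI impI)
        fix v s' u assume v: "(r, v) \<in> acc M" "\<forall>x<k. s' x \<in> dmn M v" "(v, u) \<in> acc M" "holds M u (hom M v u \<circ> s') \<psi>1"
        have "u \<in> wlds M" "\<forall>x<k. (hom M v u \<circ> s') x \<in> dmn M u" using model_acc_wlds[OF Mm(1) v(3)] model_hom[OF Mm(1) v(3)] v(2) by auto
        then show "holds M u (hom M v u \<circ> s') \<psi>2" using imp M\<Omega> v(4) by blast
      qed
      then show ?thesis using \<chi>(2)[OF SM] by blast
    qed
    then have "\<chi> \<in> T" using \<chi>(1) fin by (auto simp: T_def)
    then have "holds N n0 s ?\<chi>" using NT \<chi>(2)[OF N(1)] by blast
    then have "holds N t s (Imp \<psi>1 \<psi>2)"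
      unfolding holds_AllUpto[OF Nm(1) o f Nm(2)] using least[OF t] s by blast
    then have "holds N t (hom N t t \<circ> s) \<psi>1 \<longrightarrow> holds N t (hom N t t \<circ> s) \<psi>2"
      using model_acc_refl[OF Nm(1) t] by (auto simp del: o_apply)
    moreover have "holds N t (hom N t t \<circ> s) \<psi> = holds N t s \<psi>" if "fv \<psi> \<subseteq> {..<k}" for \<psi>
      using that s by (intro holds_cong) (auto simp: model_hom_id[OF Nm(1)])
    ultimately show ?thesis using fv h1 by simp
  qed
  have rule2: "Sat L (cone_exp N t cs as) t \<psi>2"
    if cs: "distinct cs" "set cs \<inter> csts \<Theta> = {}" and \<psi>: "\<psi>1 \<in> Sen L (add_consts \<Theta> cs)" "\<psi>2 \<in> Sen L (add_consts \<Theta> cs)"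
      and imp: "\<forall>M\<in>\<Omega> {}. \<forall>v\<in>wlds M. \<forall>as. length as = length cs \<longrightarrow> set as \<subseteq> dmn M v \<longrightarrow>
         Sat L (cone_exp M v cs as) v \<psi>1 \<longrightarrow> Sat L (cone_exp M v cs as) v \<psi>2"
      and t: "t \<in> wlds N" "length as = length cs" "set as \<subseteq> dmn N t" "Sat L (cone_exp N t cs as) t \<psi>1" for cs \<psi>1 \<psi>2 t as
  proof -
    \<comment> \<open>The rule is a single sentence of \<open>L\<close>, by closure under
      implication and universal quantification.\<close>
    obtain \<chi> where \<chi>: "\<chi> \<in> Sen L \<Theta>" "\<And>M w. (M, w) \<in> Str L \<Theta> \<Longrightarrow>
      (Sat L M w \<chi> \<longleftrightarrow> (\<forall>v as. (w, v) \<in> acc M \<longrightarrow> length as = length cs \<longrightarrow> set as \<subseteq> dmn M v \<longrightarrow>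
         Sat L (cone_exp M v cs as) v \<psi>1 \<longrightarrow> Sat L (cone_exp M v cs as) v \<psi>2))"
      using ex_all_imp_sentence[OF sig cs \<psi>] by blast
    have "Sat L M r \<chi>" if M\<Omega>: "M \<in> \<Omega> {}" for M
    proof -
      note SM = \<Omega>(3)[OF M\<Omega>]
      have Mm: "is_model \<Theta> M" using SM Str_iff[OF sig] by auto
      show ?thesis unfolding \<chi>(2)[OF SM] using imp M\<Omega> model_acc_wlds[OF Mm] by blast
    qed
    then have "\<chi> \<in> T" using \<chi>(1) by (auto simp: T_def)
    then have "Sat L N n0 \<chi>" by (rule NT)
    then show ?thesis unfolding \<chi>(2)[OF N(1)] using t least by blast
  qed
  have "\<not> Sat L N n0 \<nu>'" using N(3)[OF \<nu>'(1)] N1(3) by simp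
  then have negN: "\<forall>s. \<not> holds N n0 s \<nu>" using \<nu>'(2)[OF N(1)] by blast
  show ?thesis
  proof (intro exI[of _ N] exI[of _ n0] conjI N(1,2) negN, goal_cases)
    case 1
    show ?case by (intro allI impI ballI, rule rule1; assumption)
  next
    case 2
    show ?case by (intro allI impI ballI, rule rule2; assumption)
  qed
qed

text \<open>Naming elements commutes with forgetting letters, up to a bounded morphism that is the
  identity.\<close>

lemma Sat_cone_exp_reduct:
  assumes sig: "is_sig \<Theta>" and sig': "is_sig \<Theta>'" and sub: "sub_sig \<Theta> \<Theta>'" and SM: "(M, t) \<in> Str L \<Theta>'"
    and nt: "name_tuple M t cs as" and \<phi>: "\<phi> \<in> Sen L (add_consts \<Theta> cs)"
  shows "Sat L (cone_exp M t cs as) t \<phi> \<longleftrightarrow> Sat L (cone_exp (reduct M \<Theta>) t cs as) t \<phi>"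
proof -
  have M: "is_model \<Theta>' M" "t \<in> wlds M" using SM Str_iff[OF sig'] by auto
  note SR = reduct_Str[OF sig sig' sub SM]
  have R: "is_model \<Theta> (reduct M \<Theta>)" "t \<in> wlds (reduct M \<Theta>)" using SR Str_iff[OF sig] by auto
  note nt' = name_tupleD[OF nt]
  have cs: "set cs \<inter> csts \<Theta>' = {}" using nt'(2) model_sgn[OF M(1)] by simp
  have nt2: "name_tuple (reduct M \<Theta>) t cs as" using nt' cs sub by (auto simp: name_tuple_def sub_sig_def)
  have subc: "sub_sig (add_consts \<Theta> cs) (add_consts \<Theta>' cs)" using sub by (auto simp: sub_sig_def)
  note sc = is_sig_add_consts[OF sig] and sc' = is_sig_add_consts[OF sig']
  note tt = model_acc_refl[OF M]
  note S1 = cone_exp_Str[OF sig' SM nt tt]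
  have S2: "(cone_exp (reduct M \<Theta>) t cs as, t) \<in> Str L (add_consts \<Theta> cs)"
    using cone_exp_Str[OF sig SR nt2] tt by simp
  note S3 = reduct_Str[OF sc sc' subc S1]
  have R3: "is_model (add_consts \<Theta> cs) (reduct (cone_exp M t cs as) (add_consts \<Theta> cs))" using S3 Str_iff[OF sc] by auto
  have cov: "covers (has_eq K) (add_consts \<Theta> cs) (\<lambda>x. x) (\<lambda>x. x) (reduct (cone_exp M t cs as) (add_consts \<Theta> cs)) t (cone_exp (reduct M \<Theta>) t cs as)"
  proof (rule covers_idI[OF R3 cone_exp_model[OF R nt2]])
    fix v c assume v: "(t, v) \<in> acc (reduct (cone_exp M t cs as) (add_consts \<Theta> cs))" and c: "c \<in> csts (add_consts \<Theta> cs)"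
    have tv: "(t, v) \<in> acc M" using v by simp
    show "cint (cone_exp (reduct M \<Theta>) t cs as) v c = cint (reduct (cone_exp M t cs as) (add_consts \<Theta> cs)) v c"
    proof (cases "c \<in> set cs")
      case True
      then obtain i where i: "i < length cs" "c = cs ! i" by (metis in_set_conv_nth)
      then show ?thesis using c tv nt' by (simp add: cone_exp_cint_new)
    next
      case False
      then show ?thesis using c tv by (simp add: cone_exp_cint_old)
    qed
  next
    fix v P bs assume v: "(t, v) \<in> acc (reduct (cone_exp M t cs as) (add_consts \<Theta> cs))"
    then have tv: "(t, v) \<in> acc M" by simp
    then show "bs \<in> pint (cone_exp (reduct M \<Theta>) t cs as) v P \<longleftrightarrow> bs \<in> pint (reduct (cone_exp M t cs as) (add_consts \<Theta> cs)) v P" by simp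
  qed (use model_acc_trans[OF M(1)] in auto)
  have "Sat L (cone_exp M t cs as) t \<phi> \<longleftrightarrow> Sat L (reduct (cone_exp M t cs as) (add_consts \<Theta> cs)) t \<phi>"
    using Sat_reduct[OF sc sc' subc S1 \<phi>] by simp
  also have "\<dots> \<longleftrightarrow> Sat L (cone_exp (reduct M \<Theta>) t cs as) t \<phi>"
    using covers_Sat[OF sc S3 S2 cov \<phi>] .
  finally show ?thesis .
qed

end

section \<open>Realising types in elementary extensions\<close>

text \<open>The variables below \<open>length \<alpha>\<close> stand for the images of \<alpha> at
  \<open>u\<close>, the variable \<open>length \<alpha>\<close> for the new element
  \<open>b\<close>.\<close>

definition real_at :: "'u kmodel \<Rightarrow> 'u \<Rightarrow> 'u list \<Rightarrow> 'u fm set \<Rightarrow> 'u fm set \<Rightarrow> 'u \<Rightarrow> 'u \<Rightarrow> bool" where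
  "real_at M w \<alpha> \<Gamma> \<Delta> u b \<longleftrightarrow> (w, u) \<in> acc M \<and> b \<in> dmn M u \<and>
     (\<forall>\<gamma>\<in>\<Gamma>. holds M u (nth (map (hom M w u) \<alpha> @ [b])) \<gamma>) \<and> (\<forall>\<delta>\<in>\<Delta>. \<not> holds M u (nth (map (hom M w u) \<alpha> @ [b])) \<delta>)"

text \<open>Two kinds of saturation that match the clauses of an asimulation: types with a positive
  and a negative part at later worlds, and purely positive types at \<open>w\<close> itself. The
  finite parts of a type are cut out by finite sets \<open>F\<close> of formulas.\<close>

definition realises :: "bool \<Rightarrow> 'u signature \<Rightarrow> 'u kmodel \<Rightarrow> 'u kmodel \<Rightarrow> bool" where
  "realises q \<Theta> M M' \<longleftrightarrow> (\<forall>w \<alpha> \<Gamma> \<Delta>. w \<in> wlds M \<longrightarrow> set \<alpha> \<subseteq> dmn M w \<longrightarrow>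
     (\<forall>\<psi>\<in>\<Gamma> \<union> \<Delta>. fm_over q \<Theta> \<psi> \<and> fv \<psi> \<subseteq> {..length \<alpha>}) \<longrightarrow>
     ((\<forall>F. finite F \<longrightarrow> (\<exists>u b. real_at M w \<alpha> (\<Gamma> \<inter> F) (\<Delta> \<inter> F) u b)) \<longrightarrow> (\<exists>u b. real_at M' w \<alpha> \<Gamma> \<Delta> u b)) \<and>
     ((\<forall>F. finite F \<longrightarrow> (\<exists>b. real_at M w \<alpha> (\<Gamma> \<inter> F) {} w b)) \<longrightarrow> (\<exists>b. real_at M' w \<alpha> \<Gamma> {} w b)))"

lemma real_at_mono: "real_at M w \<alpha> \<Gamma> \<Delta> u b \<Longrightarrow> \<Gamma>' \<subseteq> \<Gamma> \<Longrightarrow> \<Delta>' \<subseteq> \<Delta> \<Longrightarrow> real_at M w \<alpha> \<Gamma>' \<Delta>' u b"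
  unfolding real_at_def by blast

lemma real_at_covers:
  assumes M: "is_model \<Theta>\<^sub>M M" and cov: "covers q \<Theta> p e M w N" and w: "w \<in> wlds M" and \<alpha>: "set \<alpha> \<subseteq> dmn M w"
    and over: "\<And>\<psi>. \<psi> \<in> \<Gamma> \<union> \<Delta> \<Longrightarrow> fm_over q \<Theta> \<psi> \<and> fv \<psi> \<subseteq> {..length \<alpha>}"
    and re: "real_at M w \<alpha> \<Gamma> \<Delta> u b"
  shows "real_at N (p w) (map e \<alpha>) \<Gamma> \<Delta> (p u) (e b)"
proof -
  have wu: "(w, u) \<in> acc M" and b: "b \<in> dmn M u" using re by (auto simp: real_at_def)
  note ww = model_acc_refl[OF M w]
  have eq: "map (hom N (p w) (p u)) (map e \<alpha>) @ [e b] = map e (map (hom M w u) \<alpha> @ [b])"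
    using covers_hom[OF cov ww wu] \<alpha> by (auto simp: subset_iff)
  have "holds M u (nth (map (hom M w u) \<alpha> @ [b])) \<psi> \<longleftrightarrow> holds N (p u) (nth (map (hom N (p w) (p u)) (map e \<alpha>) @ [e b])) \<psi>"
    if "\<psi> \<in> \<Gamma> \<union> \<Delta>" for \<psi>
  proof -
    let ?l = "map (hom M w u) \<alpha> @ [b]"
    note o = over[OF that]
    have in_u: "set ?l \<subseteq> dmn M u" using \<alpha> b model_hom[OF M wu] by auto
    have fvl: "x < length ?l" if "x \<in> fv \<psi>" for x using o that by (auto simp: less_Suc_eq_le)
    have "holds M u (nth ?l) \<psi> \<longleftrightarrow> holds N (p u) (e \<circ> nth ?l) \<psi>"
      using o fvl in_u nth_mem by (intro covers_holds[OF M cov _ wu]) blast+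
    also have "\<dots> \<longleftrightarrow> holds N (p u) (nth (map e ?l)) \<psi>" using fvl by (intro holds_cong) (simp del: map_append map_map)
    finally show ?thesis unfolding eq .
  qed
  then show ?thesis using re covers_forth[OF cov ww wu] covers_dmn[OF cov wu] b by (auto simp: real_at_def)
qed

lemma fm_over_mono: "fm_over q \<Theta> \<psi> \<Longrightarrow> sub_sig \<Theta> \<Theta>' \<Longrightarrow> fm_over q \<Theta>' \<psi>"
  using fm_over_iff[of q \<Theta> \<psi>] fm_over_iff[of q \<Theta>' \<psi>] sub_sig_trans by blast

section \<open>Requests and their markers\<close>

locale extension_step = extension_logic \<U> L K for \<U> :: "'u set" and L :: "('u, 's) logic" and K +
  fixes M :: "'u kmodel" and r :: 'u and \<Theta> :: "'u signature" and m :: nat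
  assumes comp: "star_compact L" and sig: "is_sig \<Theta>" and fin: "finite_sig \<Theta>"
    and SM: "(M, r) \<in> Str L \<Theta>" and good: "good (has_eq K) M r"
    and high: "\<And>n. m \<le> n \<Longrightarrow> preds \<Theta> n = {}" and m: "0 < m"
begin

lemma M: "is_model \<Theta> M" and r: "r \<in> wlds M" and in_class: "in_class K M"
  using SM Str_iff[OF sig] by auto

lemmas D = is_modelD[OF M]

lemma least: "v \<in> wlds M \<Longrightarrow> (r, v) \<in> acc M"
  using good by (simp add: good_def tree_rooted_def)

text \<open>
  A request \<open>(w, \<alpha>, \<Gamma>, \<Delta>)\<close> asks for a world above \<open>w\<close> and an element of it that satisfy \<open>\<Gamma>\<close> and refute \<open>\<Delta>\<close>
  over \<open>\<alpha>\<close> (if it is in \<open>RA\<close>), or for an element of \<open>w\<close> that satisfies \<open>\<Gamma>\<close> over \<open>\<alpha>\<close> (if it is in \<open>RB\<close>).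
  Functions \<open>oA\<close> and \<open>oB\<close> with \<open>wit F oA oB\<close> answer all requests as far as formulas in \<open>F\<close> are concerned.
\<close>

type_synonym 'v request = "'v \<times> 'v list \<times> 'v fm set \<times> 'v fm set"

definition requests :: "'u request set" where
  "requests = wlds M \<times> lists (elems M) \<times> Pow {\<psi>. fm_over (has_eq K) \<Theta> \<psi>} \<times> Pow {\<psi>. fm_over (has_eq K) \<Theta> \<psi>}"

definition name :: "'u request \<Rightarrow> 'u" where
  "name = (SOME f. inj_on f requests)"

text \<open>There are countably many formulas, hence at most continuum many types for each of the
  tiny many tuples. This is where the universe has to exceed the continuum.\<close>

lemma tiny_requests: "tiny requests"
  unfolding requests_def using D(3) small_elems[OF M] countable_formulas[OF fin]
  by (intro tiny_Sigma tiny_lists tiny_Pow_countable) (simp_all add: small_iff_tiny)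

lemma inj_name: "inj_on name requests"
  unfolding name_def using tiny_imp_inj[OF tiny_requests] by (rule someI_ex)

text \<open>Elements, worlds and codes of requests may coincide in \<open>X\<close>: letters that
  serve different purposes will have different arities.\<close>

definition X :: "'u set" where
  "X = elems M \<union> wlds M \<union> name ` requests"

lemma small_X: "small X"
  unfolding X_def small_iff_tiny
  using small_elems[OF M] D(3) tiny_requests by (intro tiny_Un tiny_image) (simp_all add: small_iff_tiny)

definition RA :: "'u request set" where
  "RA = {(w, \<alpha>, \<Gamma>, \<Delta>) \<in> requests. set \<alpha> \<subseteq> dmn M w \<and> (\<forall>\<psi>\<in>\<Gamma> \<union> \<Delta>. fv \<psi> \<subseteq> {..length \<alpha>}) \<and>
     (\<forall>F. finite F \<longrightarrow> (\<exists>u b. real_at M w \<alpha> (\<Gamma> \<inter> F) (\<Delta> \<inter> F) u b))}"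

definition RB :: "'u request set" where
  "RB = {(w, \<alpha>, \<Gamma>, \<Delta>) \<in> requests. set \<alpha> \<subseteq> dmn M w \<and> (\<forall>\<psi>\<in>\<Gamma>. fv \<psi> \<subseteq> {..length \<alpha>}) \<and>
     (\<forall>F. finite F \<longrightarrow> (\<exists>b. real_at M w \<alpha> (\<Gamma> \<inter> F) {} w b))}"

definition wit :: "'u fm set \<Rightarrow> ('u request \<Rightarrow> 'u \<times> 'u) \<Rightarrow> ('u request \<Rightarrow> 'u) \<Rightarrow> bool" where
  "wit F oA oB \<longleftrightarrow>
     (\<forall>w \<alpha> \<Gamma> \<Delta>. (w, \<alpha>, \<Gamma>, \<Delta>) \<in> RA \<longrightarrow> real_at M w \<alpha> (\<Gamma> \<inter> F) (\<Delta> \<inter> F) (fst (oA (w, \<alpha>, \<Gamma>, \<Delta>))) (snd (oA (w, \<alpha>, \<Gamma>, \<Delta>)))) \<and>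
     (\<forall>w \<alpha> \<Gamma> \<Delta>. (w, \<alpha>, \<Gamma>, \<Delta>) \<in> RB \<longrightarrow> real_at M w \<alpha> (\<Gamma> \<inter> F) {} w (oB (w, \<alpha>, \<Gamma>, \<Delta>)))"

definition images :: "'u \<Rightarrow> 'u \<Rightarrow> 'u set" where
  "images v a = {hom M v u a | u. (v, u) \<in> acc M}"

text \<open>Domains of distinct worlds are disjoint, so a set of elements can describe a set of
  worlds. The worlds not below \<open>v\<close> form an upward closed set, as the preservation of
  letters by homomorphisms demands.\<close>

definition notbelow :: "'u \<Rightarrow> 'u set" where
  "notbelow v = {b. \<exists>u. b \<in> dmn M u \<and> (u, v) \<notin> acc M}"

definition above :: "'u \<Rightarrow> 'u set" where
  "above v = {b. \<exists>u. b \<in> dmn M u \<and> (v, u) \<in> acc M}"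

text \<open>The arity is the kind of marker: for an element of \<open>M\<close>, for worlds not
  below and above a given world, for the answer to a request in \<open>RA\<close>, for worlds not
  below the world of that answer, and for the answer to a request in \<open>RB\<close>. The first
  three kinds are fixed by \<open>M\<close>, the others vary with \<open>oA\<close> and
  \<open>oB\<close>.\<close>

definition marks :: "('u request \<Rightarrow> 'u \<times> 'u) \<Rightarrow> ('u request \<Rightarrow> 'u) \<Rightarrow> nat \<Rightarrow> 'u \<Rightarrow> 'u set" where
  "marks oA oB n x =
    (if n = m then (\<Union>v\<in>{v. x \<in> dmn M v}. images v x)
     else if n = m + 1 then notbelow x
     else if n = m + 2 then above x
     else if n = m + 3 then (\<Union>i\<in>{i \<in> RA. name i = x}. images (fst (oA i)) (snd (oA i)))
     else if n = m + 4 then (\<Union>i\<in>{i \<in> RA. name i = x}. notbelow (fst (oA i)))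
     else if n = m + 5 then (\<Union>i\<in>{i \<in> RB. name i = x}. images (fst i) (oB i))
     else {})"

lemma images_iff: "a \<in> dmn M v \<Longrightarrow> b \<in> dmn M t \<Longrightarrow> b \<in> images v a \<longleftrightarrow> (v, t) \<in> acc M \<and> b = hom M v t a"
  unfolding images_def using D(11) D(16) by blast

lemma notbelow_iff: "b \<in> dmn M t \<Longrightarrow> b \<in> notbelow v \<longleftrightarrow> (t, v) \<notin> acc M"
  using D(11) by (auto simp: notbelow_def)

lemma above_iff: "b \<in> dmn M t \<Longrightarrow> b \<in> above v \<longleftrightarrow> (v, t) \<in> acc M"
  using D(11) by (auto simp: above_def)

lemma images_closed:
  assumes "a \<in> dmn M v" "(t, u) \<in> acc M" "b \<in> dmn M t" "b \<in> images v a"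
  shows "hom M t u b \<in> images v a"
  using assms images_iff[OF assms(1,3)] images_iff[OF assms(1) D(16)[OF assms(2,3)]] D(6) D(22) by auto

lemma notbelow_closed:
  assumes "(t, u) \<in> acc M" "b \<in> dmn M t" "b \<in> notbelow v"
  shows "hom M t u b \<in> notbelow v"
  using assms notbelow_iff[OF assms(2)] notbelow_iff[OF D(16)[OF assms(1,2)]] D(6) by blast

lemma above_closed:
  assumes "(t, u) \<in> acc M" "b \<in> dmn M t" "b \<in> above v"
  shows "hom M t u b \<in> above v"
  using assms above_iff[OF assms(2)] above_iff[OF D(16)[OF assms(1,2)]] D(6) by blast

lemma RA_name: "i \<in> RA \<Longrightarrow> {j \<in> RA. name j = name i} = {i}"
  using inj_name by (auto simp: RA_def inj_on_def)

lemma RB_name: "i \<in> RB \<Longrightarrow> {j \<in> RB. name j = name i} = {i}"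
  using inj_name by (auto simp: RB_def inj_on_def)

lemma witA:
  assumes "wit F oA oB" "i \<in> RA" shows "snd (oA i) \<in> dmn M (fst (oA i))" "(fst i, fst (oA i)) \<in> acc M"
  using assms unfolding wit_def real_at_def by (cases i; auto)+

lemma witB:
  assumes "wit F oA oB" "i \<in> RB" shows "oB i \<in> dmn M (fst i)"
  using assms unfolding wit_def real_at_def by (cases i; auto)

section \<open>The marked expansions of \<open>M\<close>\<close>

abbreviation \<Theta>' :: "'u signature" where "\<Theta>' \<equiv> mark_sig \<Theta> m X"

lemma sig': "is_sig \<Theta>'"
  using is_sig_mark_sig[OF sig small_X m] .

lemma sub: "sub_sig \<Theta> \<Theta>'"
  by (rule mark_sig_props[OF M high m])

definition Mk :: "('u request \<Rightarrow> 'u \<times> 'u) \<Rightarrow> ('u request \<Rightarrow> 'u) \<Rightarrow> 'u kmodel" where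
  "Mk oA oB = mark M m X (marks oA oB)"

lemma Mk_simps [simp]:
  "wlds (Mk oA oB) = wlds M" "acc (Mk oA oB) = acc M" "dmn (Mk oA oB) = dmn M" "hom (Mk oA oB) = hom M" "cint (Mk oA oB) = cint M"
  by (simp_all add: Mk_def)

lemma Mk_model:
  assumes w: "wit F oA oB" shows "is_model \<Theta>' (Mk oA oB)"
  unfolding Mk_def
proof (rule mark_model[OF M high m])
  fix n x v u a assume vu: "(v, u) \<in> acc M" and a: "a \<in> dmn M v" and I: "a \<in> marks oA oB n x"
  consider "n = m" | "n = m + 1" | "n = m + 2" | "n = m + 3" | "n = m + 4" | "n = m + 5"
    using I by (auto simp: marks_def split: if_splits)
  then show "hom M v u a \<in> marks oA oB n x"
  proof cases
    case 1
    have e: "marks oA oB n x = (\<Union>v\<in>{v. x \<in> dmn M v}. images v x)" using 1 by (simp add: marks_def)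
    show ?thesis using I images_closed[OF _ vu a] unfolding e by blast
  next
    case 2
    have e: "marks oA oB n x = notbelow x" using 2 by (simp add: marks_def)
    show ?thesis using I notbelow_closed[OF vu a] unfolding e by blast
  next
    case 3
    have e: "marks oA oB n x = above x" using 3 by (simp add: marks_def)
    show ?thesis using I above_closed[OF vu a] unfolding e by blast
  next
    case 4
    have e: "marks oA oB n x = (\<Union>i\<in>{i \<in> RA. name i = x}. images (fst (oA i)) (snd (oA i)))" using 4 by (simp add: marks_def)
    show ?thesis using I images_closed[OF witA(1)[OF w] vu a] unfolding e by blast
  next
    case 5
    have e: "marks oA oB n x = (\<Union>i\<in>{i \<in> RA. name i = x}. notbelow (fst (oA i)))" using 5 by (simp add: marks_def)
    show ?thesis using I notbelow_closed[OF vu a] unfolding e by blast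
  next
    case 6
    have e: "marks oA oB n x = (\<Union>i\<in>{i \<in> RB. name i = x}. images (fst i) (oB i))" using 6 by (simp add: marks_def)
    show ?thesis using I images_closed[OF witB[OF w] vu a] unfolding e by blast
  qed
qed

lemma Mk_Str: "wit F oA oB \<Longrightarrow> v \<in> wlds M \<Longrightarrow> (Mk oA oB, v) \<in> Str L \<Theta>'"
  unfolding Str_iff[OF sig'] using Mk_model in_class by (simp add: Mk_def)

lemma reduct_Mk: "reduct (Mk oA oB) \<Theta> = M"
  unfolding Mk_def by (rule reduct_mark[OF M high m])

lemma holds_Mk:
  assumes w: "wit F oA oB" and \<psi>: "fm_over (has_eq K) \<Theta> \<psi>" and v: "v \<in> wlds M" and s: "\<And>x. x \<in> fv \<psi> \<Longrightarrow> s x \<in> dmn M v"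
  shows "holds (Mk oA oB) v s \<psi> \<longleftrightarrow> holds M v s \<psi>"
proof -
  have "covers (has_eq K) \<Theta> (\<lambda>x. x) (\<lambda>x. x) (Mk oA oB) v (reduct (Mk oA oB) \<Theta>)"
    by (rule reduct_covers[OF Mk_model[OF w] _ sub]) (simp add: reduct_Mk M)
  from covers_holds[OF Mk_model[OF w] this \<psi>, of v s] show ?thesis
    using v s D(5) by (simp add: reduct_Mk comp_def)
qed

lemma Mk_pint: "m \<le> n \<Longrightarrow> x \<in> X \<Longrightarrow> a \<in> dmn M v \<Longrightarrow> replicate n a \<in> pint (Mk oA oB) v x \<longleftrightarrow> a \<in> marks oA oB n x"
  unfolding Mk_def by (rule pint_mark_replicate[OF M high m])

lemma in_X: "a \<in> dmn M v \<Longrightarrow> a \<in> X" "v \<in> wlds M \<Longrightarrow> v \<in> X" "i \<in> RA \<Longrightarrow> name i \<in> X" "i \<in> RB \<Longrightarrow> name i \<in> X"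
  using model_dmn_wlds[OF M] by (auto simp: X_def elems_def RA_def RB_def)

lemma Mk_elem:
  assumes "x \<in> dmn M v" "a \<in> dmn M t"
  shows "replicate m a \<in> pint (Mk oA oB) t x \<longleftrightarrow> (v, t) \<in> acc M \<and> a = hom M v t x"
proof -
  have "{v. x \<in> dmn M v} = {v}" using assms D(11) by auto
  then show ?thesis using Mk_pint[OF order_refl in_X(1)[OF assms(1)] assms(2)] images_iff[OF assms] by (simp add: marks_def)
qed

lemma Mk_notbelow:
  assumes "v \<in> wlds M" "t \<in> wlds M"
  shows "holds (Mk oA oB) t s (mkw (m + 1) v) \<longleftrightarrow> (t, v) \<notin> acc M"
proof -
  have "replicate (m + 1) a \<in> pint (Mk oA oB) t v \<longleftrightarrow> (t, v) \<notin> acc M" if "a \<in> dmn M t" for a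
    using Mk_pint[OF _ in_X(2)[OF assms(1)] that] notbelow_iff[OF that] by (simp add: marks_def del: replicate.simps)
  then show ?thesis unfolding holds_mkw using D(8)[OF assms(2)] by auto
qed

lemma Mk_above:
  assumes "v \<in> wlds M" "t \<in> wlds M"
  shows "holds (Mk oA oB) t s (mkw (m + 2) v) \<longleftrightarrow> (v, t) \<in> acc M"
proof -
  have "replicate (m + 2) a \<in> pint (Mk oA oB) t v \<longleftrightarrow> (v, t) \<in> acc M" if "a \<in> dmn M t" for a
    using Mk_pint[OF _ in_X(2)[OF assms(1)] that] above_iff[OF that] by (simp add: marks_def del: replicate.simps)
  then show ?thesis unfolding holds_mkw using D(8)[OF assms(2)] by auto
qed

lemma Mk_realA:
  assumes "wit F oA oB" "i \<in> RA" "a \<in> dmn M t"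
  shows "replicate (m + 3) a \<in> pint (Mk oA oB) t (name i) \<longleftrightarrow> (fst (oA i), t) \<in> acc M \<and> a = hom M (fst (oA i)) t (snd (oA i))"
  using Mk_pint[OF _ in_X(3)[OF assms(2)] assms(3)] images_iff[OF witA(1)[OF assms(1,2)] assms(3)]
  by (simp add: marks_def RA_name[OF assms(2)] del: replicate.simps)

lemma Mk_notbelowA:
  assumes "i \<in> RA" "t \<in> wlds M"
  shows "holds (Mk oA oB) t s (mkw (m + 4) (name i)) \<longleftrightarrow> (t, fst (oA i)) \<notin> acc M"
proof -
  have "replicate (m + 4) a \<in> pint (Mk oA oB) t (name i) \<longleftrightarrow> (t, fst (oA i)) \<notin> acc M" if "a \<in> dmn M t" for a
    using Mk_pint[OF _ in_X(3)[OF assms(1)] that] notbelow_iff[OF that]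
    by (simp add: marks_def RA_name[OF assms(1)] del: replicate.simps)
  then show ?thesis unfolding holds_mkw using D(8)[OF assms(2)] by auto
qed

lemma Mk_realB:
  assumes "wit F oA oB" "i \<in> RB" "a \<in> dmn M t"
  shows "replicate (m + 5) a \<in> pint (Mk oA oB) t (name i) \<longleftrightarrow> (fst i, t) \<in> acc M \<and> a = hom M (fst i) t (oB i)"
proof -
  have "marks oA oB (m + 5) (name i) = (\<Union>j\<in>{j \<in> RB. name j = name i}. images (fst j) (oB j))" by (simp add: marks_def)
  then have e: "marks oA oB (m + 5) (name i) = images (fst i) (oB i)" unfolding RB_name[OF assms(2)] by simp
  show ?thesis
    unfolding Mk_pint[OF le_add1 in_X(4)[OF assms(2)] assms(3)] e
    by (rule images_iff[OF witB[OF assms(1,2)] assms(3)])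
qed

text \<open>Requests ask for types whose finite parts are all realised; for one fixed finite
  \<open>F\<close> an answer to each of them is chosen.\<close>

lemma ex_wit:
  assumes F: "finite F" shows "\<exists>oA oB. wit F oA oB"
proof -
  have "\<forall>i\<in>RA. \<exists>ub. case i of (w, \<alpha>, \<Gamma>, \<Delta>) \<Rightarrow> real_at M w \<alpha> (\<Gamma> \<inter> F) (\<Delta> \<inter> F) (fst ub) (snd ub)"
  proof
    fix i assume iRA: "i \<in> RA"
    obtain w \<alpha> \<Gamma> \<Delta> where i: "i = (w, \<alpha>, \<Gamma>, \<Delta>)" by (cases i)
    have "\<exists>u b. real_at M w \<alpha> (\<Gamma> \<inter> F) (\<Delta> \<inter> F) u b" using iRA F by (simp add: RA_def i)
    then obtain u b where "real_at M w \<alpha> (\<Gamma> \<inter> F) (\<Delta> \<inter> F) u b" by blast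
    then show "\<exists>ub. case i of (w, \<alpha>, \<Gamma>, \<Delta>) \<Rightarrow> real_at M w \<alpha> (\<Gamma> \<inter> F) (\<Delta> \<inter> F) (fst ub) (snd ub)"
      using i by (intro exI[of _ "(u, b)"]) simp
  qed
  then obtain oA where oA: "\<forall>i\<in>RA. case i of (w, \<alpha>, \<Gamma>, \<Delta>) \<Rightarrow> real_at M w \<alpha> (\<Gamma> \<inter> F) (\<Delta> \<inter> F) (fst (oA i)) (snd (oA i))"
    by (rule bchoice[THEN exE])
  have "\<forall>i\<in>RB. \<exists>b. case i of (w, \<alpha>, \<Gamma>, \<Delta>) \<Rightarrow> real_at M w \<alpha> (\<Gamma> \<inter> F) {} w b"
    using F by (auto simp: RB_def)
  then obtain oB where oB: "\<forall>i\<in>RB. case i of (w, \<alpha>, \<Gamma>, \<Delta>) \<Rightarrow> real_at M w \<alpha> (\<Gamma> \<inter> F) {} w (oB i)"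
    by (rule bchoice[THEN exE])
  have "wit F oA oB" unfolding wit_def using oA oB by auto
  then show ?thesis by blast
qed

lemma wit_mono:
  assumes "wit F' oA oB" "F \<subseteq> F'" shows "wit F oA oB"
proof -
  have "\<Gamma> \<inter> F \<subseteq> \<Gamma> \<inter> F'" for \<Gamma> using assms(2) by blast
  then show ?thesis using assms(1) unfolding wit_def by (blast intro: real_at_mono)
qed

text \<open>
  Compactness gives a model in which everything holds that holds in all expansions \<open>Mk oA oB\<close> with
  \<open>wit F oA oB\<close> for some finite \<open>F\<close>. What is needed of it is recorded as rules ``\<open>\<psi>1\<close> implies \<open>\<psi>2\<close> at every world''.
\<close>

definition obeys :: "'u kmodel \<Rightarrow> bool" where
  "obeys N \<longleftrightarrow> (\<forall>F k \<psi>1 \<psi>2 t s. finite F \<longrightarrow> fm_over (has_eq K) \<Theta>' \<psi>1 \<longrightarrow> fm_over (has_eq K) \<Theta>' \<psi>2 \<longrightarrow> fv \<psi>1 \<union> fv \<psi>2 \<subseteq> {..<k} \<longrightarrow>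
      (\<forall>oA oB v s. wit F oA oB \<longrightarrow> v \<in> wlds M \<longrightarrow> (\<forall>x<k. s x \<in> dmn M v) \<longrightarrow> holds (Mk oA oB) v s \<psi>1 \<longrightarrow> holds (Mk oA oB) v s \<psi>2) \<longrightarrow>
      t \<in> wlds N \<longrightarrow> (\<forall>x<k. s x \<in> dmn N t) \<longrightarrow> holds N t s \<psi>1 \<longrightarrow> holds N t s \<psi>2)"

text \<open>These rules serve to make the embedding elementary. For this they are used with the
  markers of worlds and elements of \<open>M\<close> only, so nothing is demanded of the formulas
  satisfied by the answers.\<close>

definition obeys_L :: "'u kmodel \<Rightarrow> bool" where
  "obeys_L N \<longleftrightarrow> (\<forall>cs \<psi>1 \<psi>2 t as. distinct cs \<longrightarrow> set cs \<inter> csts \<Theta> = {} \<longrightarrow> \<psi>1 \<in> Sen L (add_consts \<Theta>' cs) \<longrightarrow> \<psi>2 \<in> Sen L (add_consts \<Theta>' cs) \<longrightarrow>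
      (\<forall>oA oB v as. wit {} oA oB \<longrightarrow> v \<in> wlds M \<longrightarrow> length as = length cs \<longrightarrow> set as \<subseteq> dmn M v \<longrightarrow>
         Sat L (cone_exp (Mk oA oB) v cs as) v \<psi>1 \<longrightarrow> Sat L (cone_exp (Mk oA oB) v cs as) v \<psi>2) \<longrightarrow>
      t \<in> wlds N \<longrightarrow> length as = length cs \<longrightarrow> set as \<subseteq> dmn N t \<longrightarrow>
         Sat L (cone_exp N t cs as) t \<psi>1 \<longrightarrow> Sat L (cone_exp N t cs as) t \<psi>2)"

lemma obeysD:
  assumes "obeys N" "finite F" "fm_over (has_eq K) \<Theta>' \<psi>1" "fm_over (has_eq K) \<Theta>' \<psi>2" "fv \<psi>1 \<union> fv \<psi>2 \<subseteq> {..<k}"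
    "\<And>oA oB v s. wit F oA oB \<Longrightarrow> v \<in> wlds M \<Longrightarrow> \<forall>x<k. s x \<in> dmn M v \<Longrightarrow> holds (Mk oA oB) v s \<psi>1 \<Longrightarrow> holds (Mk oA oB) v s \<psi>2"
    "t \<in> wlds N" "\<forall>x<k. s x \<in> dmn N t" "holds N t s \<psi>1"
  shows "holds N t s \<psi>2"
proof -
  have A: "\<forall>oA oB v s. wit F oA oB \<longrightarrow> v \<in> wlds M \<longrightarrow> (\<forall>x<k. s x \<in> dmn M v) \<longrightarrow> holds (Mk oA oB) v s \<psi>1 \<longrightarrow> holds (Mk oA oB) v s \<psi>2"
    by (intro allI impI) (rule assms(6))
  show ?thesis
    by (rule assms(1)[unfolded obeys_def, THEN spec[where x = F], THEN spec[where x = k], THEN spec[where x = \<psi>1], THEN spec[where x = \<psi>2],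
        THEN spec[where x = t], THEN spec[where x = s], THEN mp, OF assms(2), THEN mp, OF assms(3), THEN mp, OF assms(4),
        THEN mp, OF assms(5), THEN mp, OF A, THEN mp, OF assms(7), THEN mp, OF assms(8), THEN mp, OF assms(9)])
qed

lemma obeys_LD:
  assumes "obeys_L N" "distinct cs" "set cs \<inter> csts \<Theta> = {}" "\<psi>1 \<in> Sen L (add_consts \<Theta>' cs)" "\<psi>2 \<in> Sen L (add_consts \<Theta>' cs)"
    "\<And>oA oB v as. wit {} oA oB \<Longrightarrow> v \<in> wlds M \<Longrightarrow> length as = length cs \<Longrightarrow> set as \<subseteq> dmn M v \<Longrightarrow>
         Sat L (cone_exp (Mk oA oB) v cs as) v \<psi>1 \<Longrightarrow> Sat L (cone_exp (Mk oA oB) v cs as) v \<psi>2"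
    "t \<in> wlds N" "length as = length cs" "set as \<subseteq> dmn N t" "Sat L (cone_exp N t cs as) t \<psi>1"
  shows "Sat L (cone_exp N t cs as) t \<psi>2"
proof -
  have A: "\<forall>oA oB v as. wit {} oA oB \<longrightarrow> v \<in> wlds M \<longrightarrow> length as = length cs \<longrightarrow> set as \<subseteq> dmn M v \<longrightarrow>
         Sat L (cone_exp (Mk oA oB) v cs as) v \<psi>1 \<longrightarrow> Sat L (cone_exp (Mk oA oB) v cs as) v \<psi>2"
    by (intro allI impI) (rule assms(6))
  show ?thesis
    by (rule assms(1)[unfolded obeys_L_def, THEN spec[where x = cs], THEN spec[where x = \<psi>1], THEN spec[where x = \<psi>2],
        THEN spec[where x = t], THEN spec[where x = as], THEN mp, OF assms(2), THEN mp, OF assms(3), THEN mp, OF assms(4),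
        THEN mp, OF assms(5), THEN mp, OF A, THEN mp, OF assms(7), THEN mp, OF assms(8), THEN mp, OF assms(9), THEN mp, OF assms(10)])
qed

text \<open>Compactness is applied to the marked expansions, a demand being a formula that the
  answers have to respect. The one refuted sentence says that the world is not below
  \<open>r\<close>; its refutation allows \<open>r\<close> to be sent to the root of
  \<open>N\<close>.\<close>

lemma ex_marked_model:
  "\<exists>N n0. (N, n0) \<in> Str L \<Theta>' \<and> good (has_eq K) N n0 \<and> (\<forall>s. \<not> holds N n0 s (mkw (m + 1) r)) \<and> obeys N \<and> obeys_L N"
proof -
  define \<Omega> where "\<Omega> F = {Mk oA oB | oA oB. wit F oA oB}" for F
  have \<Omega>E: "(\<forall>N\<in>\<Omega> F. Q N) \<longleftrightarrow> (\<forall>oA oB. wit F oA oB \<longrightarrow> Q (Mk oA oB))" for F Q by (auto simp: \<Omega>_def)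
  have *: "\<exists>N n0. (N, n0) \<in> Str L \<Theta>' \<and> good (has_eq K) N n0 \<and> (\<forall>s. \<not> holds N n0 s (mkw (m + 1) r)) \<and>
    (\<forall>F k \<psi>1 \<psi>2. finite F \<longrightarrow> fm_over (has_eq K) \<Theta>' \<psi>1 \<longrightarrow> fm_over (has_eq K) \<Theta>' \<psi>2 \<longrightarrow> fv \<psi>1 \<union> fv \<psi>2 \<subseteq> {..<k} \<longrightarrow>
      (\<forall>M\<in>\<Omega> F. \<forall>v\<in>wlds M. \<forall>s. (\<forall>x<k. s x \<in> dmn M v) \<longrightarrow> holds M v s \<psi>1 \<longrightarrow> holds M v s \<psi>2) \<longrightarrow>
      (\<forall>t\<in>wlds N. \<forall>s. (\<forall>x<k. s x \<in> dmn N t) \<longrightarrow> holds N t s \<psi>1 \<longrightarrow> holds N t s \<psi>2)) \<and>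
    (\<forall>cs \<psi>1 \<psi>2. distinct cs \<longrightarrow> set cs \<inter> csts \<Theta>' = {} \<longrightarrow> \<psi>1 \<in> Sen L (add_consts \<Theta>' cs) \<longrightarrow> \<psi>2 \<in> Sen L (add_consts \<Theta>' cs) \<longrightarrow>
      (\<forall>M\<in>\<Omega> {}. \<forall>v\<in>wlds M. \<forall>as. length as = length cs \<longrightarrow> set as \<subseteq> dmn M v \<longrightarrow>
         Sat L (cone_exp M v cs as) v \<psi>1 \<longrightarrow> Sat L (cone_exp M v cs as) v \<psi>2) \<longrightarrow>
      (\<forall>t\<in>wlds N. \<forall>as. length as = length cs \<longrightarrow> set as \<subseteq> dmn N t \<longrightarrow>
         Sat L (cone_exp N t cs as) t \<psi>1 \<longrightarrow> Sat L (cone_exp N t cs as) t \<psi>2))"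
  proof (rule ex_compact_good_model[OF comp sig', where r = r])
    show "\<Omega> F \<noteq> {}" if "finite F" for F using ex_wit[OF that] by (auto simp: \<Omega>_def)
    show "\<Omega> F' \<subseteq> \<Omega> F" if "F \<subseteq> F'" for F F' using wit_mono[OF _ that] by (auto simp: \<Omega>_def)
    show "(N, r) \<in> Str L \<Theta>'" if "N \<in> \<Omega> F" for F N using that Mk_Str r by (auto simp: \<Omega>_def)
    show "fm_over (has_eq K) \<Theta>' (mkw (m + 1) r)" using in_X(2)[OF r] by (simp add: fm_over_mkw)
    show "fv (mkw (m + 1) r) = {}" by (rule fv_mkw)
    show "\<not> holds N r s (mkw (m + 1) r)" if "N \<in> \<Omega> F" for F N s
      using that Mk_notbelow[OF r r] D(5)[OF r] by (auto simp: \<Omega>_def)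
  qed
  then obtain N n0 where N: "(N, n0) \<in> Str L \<Theta>'" "good (has_eq K) N n0" "\<forall>s. \<not> holds N n0 s (mkw (m + 1) r)"
    and R1: "\<forall>F k \<psi>1 \<psi>2. finite F \<longrightarrow> fm_over (has_eq K) \<Theta>' \<psi>1 \<longrightarrow> fm_over (has_eq K) \<Theta>' \<psi>2 \<longrightarrow> fv \<psi>1 \<union> fv \<psi>2 \<subseteq> {..<k} \<longrightarrow>
      (\<forall>M\<in>\<Omega> F. \<forall>v\<in>wlds M. \<forall>s. (\<forall>x<k. s x \<in> dmn M v) \<longrightarrow> holds M v s \<psi>1 \<longrightarrow> holds M v s \<psi>2) \<longrightarrow>
      (\<forall>t\<in>wlds N. \<forall>s. (\<forall>x<k. s x \<in> dmn N t) \<longrightarrow> holds N t s \<psi>1 \<longrightarrow> holds N t s \<psi>2)"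
    and R2: "\<forall>cs \<psi>1 \<psi>2. distinct cs \<longrightarrow> set cs \<inter> csts \<Theta>' = {} \<longrightarrow> \<psi>1 \<in> Sen L (add_consts \<Theta>' cs) \<longrightarrow> \<psi>2 \<in> Sen L (add_consts \<Theta>' cs) \<longrightarrow>
      (\<forall>M\<in>\<Omega> {}. \<forall>v\<in>wlds M. \<forall>as. length as = length cs \<longrightarrow> set as \<subseteq> dmn M v \<longrightarrow>
         Sat L (cone_exp M v cs as) v \<psi>1 \<longrightarrow> Sat L (cone_exp M v cs as) v \<psi>2) \<longrightarrow>
      (\<forall>t\<in>wlds N. \<forall>as. length as = length cs \<longrightarrow> set as \<subseteq> dmn N t \<longrightarrow>
         Sat L (cone_exp N t cs as) t \<psi>1 \<longrightarrow> Sat L (cone_exp N t cs as) t \<psi>2)"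
    by (elim exE conjE)
  show ?thesis
  proof (intro exI[of _ N] exI[of _ n0] conjI N, goal_cases)
    case 1
    show ?case
      unfolding obeys_def
    proof (intro allI impI, goal_cases)
      case (1 F k \<psi>1 \<psi>2 t s)
      show ?case by (rule R1[unfolded \<Omega>E Mk_simps, rule_format, OF 1(1-4) _ 1(6) _ 1(8)]) (use 1(5,7) in blast)+
    qed
  next
    case 2
    show ?case
      unfolding obeys_L_def
    proof (intro allI impI, goal_cases)
      case (1 cs \<psi>1 \<psi>2 t as)
      have cs: "set cs \<inter> csts \<Theta>' = {}" using 1(2) by simp
      show ?case by (rule R2[unfolded \<Omega>E Mk_simps, rule_format, OF 1(1) cs 1(3,4) _ 1(6-9)]) (use 1(5) in blast)
    qed
  qed
qed

end

section \<open>Embedding of \<open>M\<close> into a model of the rules\<close>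

context extension_step begin

text \<open>The marker of \<open>as ! k\<close> forces entry number \<open>k\<close> to be its
  image; the conjunct for above \<open>v\<close> settles the case of the empty tuple.\<close>

lemma Mk_tuple:
  assumes v: "v \<in> wlds M" and as: "set as \<subseteq> dmn M v" "length as = l" and t: "t \<in> wlds M" "length bs = l" "set bs \<subseteq> dmn M t"
    and h: "holds (Mk oA oB) t (nth bs) (BigAnd (mkw (m + 2) v # map (\<lambda>k. mk m (as ! k) k) [0..<l]))"
  shows "(v, t) \<in> acc M \<and> bs = map (hom M v t) as"
proof
  have "holds (Mk oA oB) t (nth bs) (mkw (m + 2) v)" using h by (simp only: BigAnd.simps holds.simps)
  then show "(v, t) \<in> acc M" using Mk_above[OF v t(1)] by blast
  show "bs = map (hom M v t) as"
  proof (rule nth_equalityI)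
    fix k assume "k < length bs"
    then have k: "k < l" using t by simp
    have "holds (Mk oA oB) t (nth bs) (mk m (as ! k) k)"
      using h k by (simp only: BigAnd.simps holds.simps holds_BigAnd) simp
    then have "replicate m (bs ! k) \<in> pint (Mk oA oB) t (as ! k)" by (simp add: holds_mk)
    moreover have "as ! k \<in> dmn M v" "bs ! k \<in> dmn M t" using as t k by auto
    ultimately show "bs ! k = map (hom M v t) as ! k" using Mk_elem as k by auto
  qed (use as t in simp)
qed

text \<open>The hypotheses of the embedding lemma that concern markers are obtained from rules valid
  in all marked expansions of \<open>M\<close>, from the preservation of letters by homomorphisms,
  and from the one refuted sentence.\<close>

lemma ex_embedding:
  assumes SN: "(N, n0) \<in> Str L \<Theta>'" and goodN: "good (has_eq K) N n0" and neg: "\<forall>s. \<not> holds N n0 s (mkw (m + 1) r)"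
    and obeys: "obeys N"
  shows "\<exists>fw g. fw r = n0 \<and> (\<forall>v\<in>wlds M. fw v \<in> wlds N \<and> (\<forall>s. holds N (fw v) s (mkw (m + 2) v)) \<and> (\<forall>s. \<not> holds N (fw v) s (mkw (m + 1) v))) \<and>
    (\<forall>v\<in>wlds M. \<forall>u\<in>wlds M. (fw v, fw u) \<in> acc N \<longleftrightarrow> (v, u) \<in> acc M) \<and>
    (\<forall>v a. a \<in> dmn M v \<longrightarrow> g a \<in> dmn N (fw v) \<and> replicate m (g a) \<in> pint N (fw v) a) \<and>
    inj_on fw (wlds M) \<and> inj_on g (elems M) \<and>
    (\<forall>v u a. (v, u) \<in> acc M \<longrightarrow> a \<in> dmn M v \<longrightarrow> g (hom M v u a) = hom N (fw v) (fw u) (g a)) \<and>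
    (\<forall>v\<in>wlds M. \<forall>c\<in>csts \<Theta>. g (cint M v c) = cint N (fw v) c)"
proof -
  note rule1 = obeysD[OF obeys]
  have N: "is_model \<Theta>' N" and n0: "n0 \<in> wlds N" using SN Str_iff[OF sig'] by auto
  define AB where "AB v t \<longleftrightarrow> holds N t (\<lambda>_. undefined) (mkw (m + 2) v)" for v t
  define NB where "NB v t \<longleftrightarrow> holds N t (\<lambda>_. undefined) (mkw (m + 1) v)" for v t
  define Pn where "Pn a t x \<longleftrightarrow> replicate m x \<in> pint N t a" for a t x
  have AB: "holds N t s (mkw (m + 2) v) \<longleftrightarrow> AB v t" for v t s by (simp add: AB_def holds_mkw)
  have NB: "holds N t s (mkw (m + 1) v) \<longleftrightarrow> NB v t" for v t s by (simp add: NB_def holds_mkw)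
  have ovw: "fm_over (has_eq K) \<Theta>' (mkw (m + 2) v)" "fm_over (has_eq K) \<Theta>' (mkw (m + 1) v)" if "v \<in> wlds M" for v
    using in_X(2)[OF that] by (auto intro!: fm_over_mkw)
  have ove: "fm_over (has_eq K) \<Theta>' (mk m a i)" if "a \<in> dmn M v" for a v i
    using in_X(1)[OF that] by (auto intro!: fm_over_mk)
  have mkP: "holds N t s (mk m a i) \<longleftrightarrow> Pn a t (s i)" for t s a i by (simp add: holds_mk Pn_def)
  have "\<exists>fw g. fw r = n0 \<and> (\<forall>v\<in>wlds M. fw v \<in> wlds N \<and> AB v (fw v) \<and> \<not> NB v (fw v)) \<and>
    (\<forall>v\<in>wlds M. \<forall>u\<in>wlds M. (fw v, fw u) \<in> acc N \<longleftrightarrow> (v, u) \<in> acc M) \<and>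
    (\<forall>v a. a \<in> dmn M v \<longrightarrow> g a \<in> dmn N (fw v) \<and> Pn a (fw v) (g a)) \<and>
    inj_on fw (wlds M) \<and> inj_on g (elems M) \<and>
    (\<forall>v u a. (v, u) \<in> acc M \<longrightarrow> a \<in> dmn M v \<longrightarrow> g (hom M v u a) = hom N (fw v) (fw u) (g a)) \<and>
    (\<forall>v\<in>wlds M. \<forall>c\<in>csts \<Theta>. g (cint M v c) = cint N (fw v) c)"
  proof (rule ex_tree_embedding[OF M good N n0])
    show "AB v t'" if "AB v t" "(t, t') \<in> acc N" for v t t'
    proof -
      obtain a where a: "a \<in> dmn N t" "replicate (m + 2) a \<in> pint N t v" using \<open>AB v t\<close> unfolding AB_def holds_mkw by blast
      have "replicate (m + 2) (hom N t t' a) \<in> pint N t' v" using model_pint_hom[OF N that(2) a(2)] by (simp only: map_replicate)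
      then show ?thesis unfolding AB_def holds_mkw using model_hom[OF N that(2) a(1)] by blast
    qed
    show "Pn a t' (hom N t t' x)" if "Pn a t x" "(t, t') \<in> acc N" for a t t' x
      using model_pint_hom[OF N that(2)] that(1) unfolding Pn_def by (metis map_replicate)
    show "\<exists>t'. (t, t') \<in> acc N \<and> AB v t' \<and> \<not> NB v t'" if uv: "(u, v) \<in> acc M" and t: "t \<in> wlds N" and nb: "\<not> NB u t" for u v t
    proof (rule ccontr)
      assume c: "\<nexists>t'. (t, t') \<in> acc N \<and> AB v t' \<and> \<not> NB v t'"
      have u: "u \<in> wlds M" and v: "v \<in> wlds M" using D(4)[OF uv] by auto
      \<comment> \<open>The rule reads: if above \<open>v\<close> implies not below
        \<open>v\<close>, then not below \<open>u\<close>. In \<open>M\<close> the implication fails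
        at \<open>v\<close>, hence at all worlds below \<open>u\<close>. In \<open>N\<close> the
        rule produces, from a world where the marker for not below \<open>u\<close> fails, a later
        world marked as above \<open>v\<close> but not as not below \<open>v\<close>.\<close>
      have "holds N t (\<lambda>_. undefined) (mkw (m + 1) u)"
      proof (rule rule1[of "{}" "Imp (mkw (m + 2) v) (mkw (m + 1) v)" _ 0])
        fix oA oB t0 s assume t0: "t0 \<in> wlds M" and h: "holds (Mk oA oB) t0 s (Imp (mkw (m + 2) v) (mkw (m + 1) v))"
        have "(t0, u) \<notin> acc M"
        proof
          assume "(t0, u) \<in> acc M"
          then have "(t0, v) \<in> acc M" using D(6) uv by blast
          then have "holds (Mk oA oB) v (hom M t0 v \<circ> s) (mkw (m + 2) v) \<longrightarrow> holds (Mk oA oB) v (hom M t0 v \<circ> s) (mkw (m + 1) v)" using h by simp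
          then show False unfolding Mk_above[OF v v] Mk_notbelow[OF v v] using D(5)[OF v] by blast
        qed
        then show "holds (Mk oA oB) t0 s (mkw (m + 1) u)" using Mk_notbelow[OF u t0] by blast
      qed (use ovw[OF u] ovw[OF v] t c AB NB in \<open>auto simp: fv_mkw\<close>)
      then show False using nb NB by blast
    qed
    show "\<exists>x\<in>dmn N t. Pn a t x" if a: "a \<in> dmn M v" and t: "t \<in> wlds N" and ab: "AB v t" for v a t
    proof -
      have v: "v \<in> wlds M" using model_dmn_wlds[OF M a] .
      have "holds N t (\<lambda>_. undefined) (mkw m a)"
      proof (rule rule1[of "{}" "mkw (m + 2) v" _ 0])
        fix oA oB t0 s assume t0: "t0 \<in> wlds M" and h: "holds (Mk oA oB) t0 s (mkw (m + 2) v)"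
        then have vt: "(v, t0) \<in> acc M" using Mk_above[OF v] by blast
        then show "holds (Mk oA oB) t0 s (mkw m a)" unfolding holds_mkw using Mk_elem[OF a] D(16)[OF vt a] by auto
      qed (use ovw[OF v] t ab AB in_X(1)[OF a] in \<open>auto simp: fv_mkw fm_over_mkw\<close>)
      then show ?thesis unfolding holds_mkw Pn_def .
    qed
    show "NB v t" if ab: "a \<in> dmn M v" "b \<in> dmn M v" "a \<noteq> b" and x: "x \<in> dmn N t" "Pn a t x" "Pn b t x" for v a b t x
    proof -
      have v: "v \<in> wlds M" using model_dmn_wlds[OF M ab(1)] .
      \<comment> \<open>At \<open>v\<close> itself the images of \<open>a\<close> and
        \<open>b\<close> are \<open>a\<close> and \<open>b\<close>. A world where they coincide is
        therefore a proper successor of \<open>v\<close>, and not below it.\<close>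
      have "holds N t (\<lambda>_. x) (mkw (m + 1) v)"
      proof (rule rule1[of "{}" "And (mk m a 0) (mk m b 0)" _ 1])
        fix oA oB t0 s assume t0: "t0 \<in> wlds M" "\<forall>x<1. s x \<in> dmn M t0" and h: "holds (Mk oA oB) t0 s (And (mk m a 0) (mk m b 0))"
        have s0: "s 0 \<in> dmn M t0" using t0 by simp
        have *: "(v, t0) \<in> acc M" "s 0 = hom M v t0 a" "s 0 = hom M v t0 b"
          using h Mk_elem[OF ab(1) s0] Mk_elem[OF ab(2) s0] by (auto simp: holds_mk)
        have "(t0, v) \<notin> acc M"
        proof
          assume "(t0, v) \<in> acc M"
          then have "t0 = v" using D(7) *(1) by blast
          then show False using * D(21)[OF ab(1)] D(21)[OF ab(2)] ab(3) by simp
        qed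
        then show "holds (Mk oA oB) t0 s (mkw (m + 1) v)" using Mk_notbelow[OF v t0(1)] by blast
      qed (use ovw[OF v] x mkP ove[OF ab(1)] ove[OF ab(2)] model_dmn_wlds[OF N x(1)] m in \<open>auto simp: fv_mkw fv_mk\<close>)
      then show ?thesis using NB by blast
    qed
    show "NB u t" if v: "v \<in> wlds M" and u: "u \<in> wlds M" and vu: "(v, u) \<notin> acc M" and t: "t \<in> wlds N" and ab: "AB v t" for v u t
    proof -
      have "holds N t (\<lambda>_. undefined) (mkw (m + 1) u)"
      proof (rule rule1[of "{}" "mkw (m + 2) v" _ 0])
        fix oA oB t0 s assume t0: "t0 \<in> wlds M" and h: "holds (Mk oA oB) t0 s (mkw (m + 2) v)"
        then show "holds (Mk oA oB) t0 s (mkw (m + 1) u)" using Mk_above[OF v t0] Mk_notbelow[OF u t0] vu D(6) by blast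
      qed (use ovw[OF v] ovw[OF u] t ab AB in \<open>auto simp: fv_mkw\<close>)
      then show ?thesis using NB by blast
    qed
    show "Pn (hom M v u a) t x" if vu: "(v, u) \<in> acc M" and a: "a \<in> dmn M v" and x: "x \<in> dmn N t" "Pn a t x" and ab: "AB u t" for v u a t x
    proof -
      have u: "u \<in> wlds M" using D(4)[OF vu] by blast
      note ha = D(16)[OF vu a]
      \<comment> \<open>Valid in \<open>M\<close> because homomorphisms compose: at a world above
        \<open>u\<close> the image of \<open>a\<close> is also the image of
        \<open>hom M v u a\<close>.\<close>
      have "holds N t (\<lambda>_. x) (mk m (hom M v u a) 0)"
      proof (rule rule1[of "{}" "And (mk m a 0) (mkw (m + 2) u)" _ 1])
        fix oA oB t0 s assume t0: "t0 \<in> wlds M" "\<forall>x<1. s x \<in> dmn M t0" and h: "holds (Mk oA oB) t0 s (And (mk m a 0) (mkw (m + 2) u))"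
        have s0: "s 0 \<in> dmn M t0" using t0 by simp
        have *: "(v, t0) \<in> acc M" "s 0 = hom M v t0 a" "(u, t0) \<in> acc M"
          using h Mk_elem[OF a s0] Mk_above[OF u t0(1)] by (auto simp: holds_mk)
        then show "holds (Mk oA oB) t0 s (mk m (hom M v u a) 0)"
          unfolding holds_mk Mk_elem[OF ha s0] using D(22)[OF vu *(3) a] by simp
      qed (use ovw[OF u] x ab AB mkP ove[OF a] ove[OF ha] model_dmn_wlds[OF N x(1)] m in \<open>auto simp: fv_mkw fv_mk\<close>)
      then show ?thesis using mkP by simp
    qed
    show "AB r n0"
    proof -
      \<comment> \<open>The premise \<open>Imp Bot Bot\<close> turns a formula valid at all worlds
        into a rule; every world of \<open>M\<close> is above \<open>r\<close>.\<close>
      have "holds N n0 (\<lambda>_. undefined) (mkw (m + 2) r)"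
        by (rule rule1[of "{}" "Imp Bot Bot" _ 0])
          (use ovw[OF r] n0 Mk_above[OF r] least in \<open>auto simp: fv_mkw\<close>)
      then show ?thesis using AB by blast
    qed
    then show "Pn (cint M r c) n0 (cint N n0 c)" if c: "c \<in> csts \<Theta>" for c
    proof -
      note cr = D(13)[OF r c]
      have "holds N n0 (\<lambda>_. undefined) (Atom (cint M r c) (replicate m (Cst c)))"
      proof (rule rule1[of "{}" "mkw (m + 2) r" _ 0])
        fix oA oB t0 s assume t0: "t0 \<in> wlds M"
        have "replicate m (cint M t0 c) \<in> pint (Mk oA oB) t0 (cint M r c)"
          using Mk_elem[OF cr D(13)[OF t0 c]] D(20)[OF least[OF t0] c] least[OF t0] by simp
        then show "holds (Mk oA oB) t0 s (Atom (cint M r c) (replicate m (Cst c)))" by simp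
      qed (use ovw[OF r] n0 \<open>AB r n0\<close> AB c in_X(1)[OF cr] in \<open>auto simp: fv_mkw mark_sig_def\<close>)
      then show ?thesis by (simp add: Pn_def)
    qed
    show "x = y" if q: "has_eq K" and a: "a \<in> dmn M v" and xy: "x \<in> dmn N t" "y \<in> dmn N t" "Pn a t x" "Pn a t y" for v a t x y
    proof -
      \<comment> \<open>That an element has only one image per world can be stated as a rule in
        languages with equality.\<close>
      have "holds N t (nth [x, y]) (Eq (Var 0) (Var 1))"
      proof (rule rule1[of "{}" "And (mk m a 0) (mk m a 1)" _ 2])
        fix oA oB t0 s assume t0: "t0 \<in> wlds M" "\<forall>x<2. s x \<in> dmn M t0" and h: "holds (Mk oA oB) t0 s (And (mk m a 0) (mk m a 1))"
        have s0: "s 0 \<in> dmn M t0" "s 1 \<in> dmn M t0" using t0 by simp_all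
        then show "holds (Mk oA oB) t0 s (Eq (Var 0) (Var 1))"
          using h Mk_elem[OF a s0(1)] Mk_elem[OF a s0(2)] by (simp add: holds_mk)
      qed (use q xy mkP ove[OF a] model_dmn_wlds[OF N xy(1)] m in \<open>auto simp: fv_mk nth_Cons split: nat.splits\<close>)
      then show ?thesis by simp
    qed
    show "\<not> NB r n0" using neg NB by blast
    show "csts \<Theta> \<subseteq> csts \<Theta>'" by simp
  qed
  then show ?thesis by (simp only: AB NB Pn_def simp_thms)
qed

end

section \<open>Types and requests along the embedding\<close>

context extension_step begin

text \<open>If \<phi> holds of the tuple at \<open>v\<close>, persistence makes it a rule that
  \<phi> holds wherever the tuple is marked. If \<phi> fails at \<open>v\<close>, it is a rule that
  a marked tuple satisfying \<phi> occurs only at worlds not below \<open>v\<close>; as this marker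
  is refuted at \<open>t\<close>, \<phi> fails there too.\<close>

lemma embedding_types:
  assumes SN: "(N, n0) \<in> Str L \<Theta>'"
    and obeys_L: "obeys_L N"
    and v: "v \<in> wlds M" and t: "t \<in> wlds N" "\<forall>s. holds N t s (mkw (m + 2) v)" "\<forall>s. \<not> holds N t s (mkw (m + 1) v)"
    and g: "\<And>a. a \<in> dmn M v \<Longrightarrow> g a \<in> dmn N t \<and> replicate m (g a) \<in> pint N t a"
    and nt: "name_tuple M v cs as" and \<phi>: "\<phi> \<in> Sen L (add_consts \<Theta> cs)"
  shows "Sat L (cone_exp M v cs as) v \<phi> \<longleftrightarrow> Sat L (cone_exp N t cs (map g as)) t \<phi>"
proof -
  note rule2 = obeys_LD[OF obeys_L]
  note nt' = name_tupleD[OF nt]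
  let ?l = "length cs"
  have cs: "distinct cs" "set cs \<inter> csts \<Theta> = {}" "set cs \<inter> csts \<Theta>' = {}" using nt' D(1) by auto
  have subc: "sub_sig (add_consts \<Theta> cs) (add_consts \<Theta>' cs)" using sub by (auto simp: sub_sig_def)
  have \<phi>': "\<phi> \<in> Sen L (add_consts \<Theta>' cs)"
    using Sen_mono[OF is_sig_add_consts[OF sig] is_sig_add_consts[OF sig'] subc \<phi>] .
  let ?P = "BigAnd (mkw (m + 2) v # map (\<lambda>k. mk m (as ! k) k) [0..<?l])"
  have asv: "as ! k \<in> dmn M v" if "k < ?l" for k using nt'(3,4) that by auto
  have oP: "fm_over (has_eq K) \<Theta>' ?P" unfolding fm_over_BigAnd
    using in_X(2)[OF v] in_X(1)[OF asv] by (auto intro!: fm_over_mk fm_over_mkw simp del: fm_over.simps)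
  have fP: "fv ?P \<subseteq> {..<?l}" using m by (auto simp: fv_mkw fv_mk simp del: BigAnd.simps)
  \<comment> \<open>In \<open>L\<close>, \<pi> says that the constants name marked images of
    \<open>as\<close> at a world above \<open>v\<close>, and \<kappa> below says that the world is
    not below \<open>v\<close>.\<close>
  obtain \<pi> where \<pi>: "\<pi> \<in> Sen L (add_consts \<Theta>' cs)" "\<And>M w as. (M, w) \<in> Str L \<Theta>' \<Longrightarrow> length as = ?l \<Longrightarrow> set as \<subseteq> dmn M w \<Longrightarrow>
    Sat L (cone_exp M w cs as) w \<pi> \<longleftrightarrow> holds M w (nth as) ?P"
    using ex_formula_translation[OF sig' cs(1,3) oP fP] by blast
  have oQ: "fm_over (has_eq K) \<Theta>' (mkw (m + 1) v)" using in_X(2)[OF v] by (auto intro!: fm_over_mkw)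
  obtain \<kappa> where \<kappa>: "\<kappa> \<in> Sen L (add_consts \<Theta>' cs)" "\<And>M w as. (M, w) \<in> Str L \<Theta>' \<Longrightarrow> length as = ?l \<Longrightarrow> set as \<subseteq> dmn M w \<Longrightarrow>
    Sat L (cone_exp M w cs as) w \<kappa> \<longleftrightarrow> holds M w (nth as) (mkw (m + 1) v)"
    using ex_formula_translation[OF sig' cs(1,3) oQ] fv_mkw[of "m + 1" v] by auto
  obtain \<mu> where \<mu>: "\<mu> \<in> Sen L (add_consts \<Theta>' cs)" "\<And>M w. (M, w) \<in> Str L (add_consts \<Theta>' cs) \<Longrightarrow> Sat L M w \<mu> \<longleftrightarrow> Sat L M w \<pi> \<and> Sat L M w \<phi>"
    using ex_and_sentence[OF is_sig_add_consts[OF sig'] \<pi>(1) \<phi>'] by blast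
  have key: "Sat L (cone_exp (Mk oA oB) u cs bs) u \<phi> \<longleftrightarrow> Sat L (cone_exp M u cs bs) u \<phi>"
    if w: "wit {} oA oB" and u: "u \<in> wlds M" and bs: "length bs = ?l" "set bs \<subseteq> dmn M u" for oA oB u bs
  proof -
    have "name_tuple (Mk oA oB) u cs bs" using cs bs D(1) by (simp add: name_tuple_def Mk_def)
    from Sat_cone_exp_reduct[OF sig sig' sub Mk_Str[OF w u] this \<phi>] show ?thesis by (simp add: reduct_Mk)
  qed
  have StN: "(N, t) \<in> Str L \<Theta>'" using Str_pt[OF sig' SN t(1)] .
  have gl: "length (map g as) = ?l" "set (map g as) \<subseteq> dmn N t" using nt'(3,4) g by auto
  have PN: "holds N t (nth (map g as)) ?P"
    unfolding holds_BigAnd using t(2) g asv nt'(3) by (auto simp: holds_mk)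
  have Sv: "(M, v) \<in> Str L \<Theta>" using Str_pt[OF sig SM v] .
  show ?thesis
  proof
    assume sat: "Sat L (cone_exp M v cs as) v \<phi>"
    show "Sat L (cone_exp N t cs (map g as)) t \<phi>"
    proof (rule rule2[OF cs(1,2) \<pi>(1) \<phi>' _ t(1) gl])
      show "Sat L (cone_exp N t cs (map g as)) t \<pi>" using \<pi>(2)[OF StN gl] PN by blast
      fix oA oB u bs assume w: "wit {} oA oB" and u: "u \<in> wlds M" and bs: "length bs = ?l" "set bs \<subseteq> dmn M u"
        and h: "Sat L (cone_exp (Mk oA oB) u cs bs) u \<pi>"
      have "holds (Mk oA oB) u (nth bs) ?P" using \<pi>(2)[OF Mk_Str[OF w u] bs(1)] bs(2) h by simp
      then have vu: "(v, u) \<in> acc M" and eq: "bs = map (hom M v u) as"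
        using Mk_tuple[OF v nt'(4,3) u bs] by auto
      have vv: "(v, v) \<in> acc M" using D(5)[OF v] .
      have "Sat L (cone_exp M v cs as) u \<phi>"
        using Sat_mono[OF is_sig_add_consts[OF sig] cone_exp_Str[OF sig Sv nt vv] _ \<phi> sat, of u] vu vv by simp
      then have "Sat L (cone_exp M u cs bs) u \<phi>"
        using Sat_cone_exp_shift[OF sig Sv vu nt \<phi>] eq by simp
      then show "Sat L (cone_exp (Mk oA oB) u cs bs) u \<phi>" using key[OF w u bs] by simp
    qed
  next
    assume sat: "Sat L (cone_exp N t cs (map g as)) t \<phi>"
    show "Sat L (cone_exp M v cs as) v \<phi>"
    proof (rule ccontr)
      assume nsat: "\<not> Sat L (cone_exp M v cs as) v \<phi>"
      have ntN: "name_tuple N t cs (map g as)" using cs gl model_sgn[of \<Theta>' N] StN Str_iff[OF sig'] by (simp add: name_tuple_def)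
      have NN: "is_model \<Theta>' N" using StN Str_iff[OF sig'] by blast
      have "Sat L (cone_exp N t cs (map g as)) t \<kappa>"
      proof (rule rule2[OF cs(1,2) \<mu>(1) \<kappa>(1) _ t(1) gl])
        show "Sat L (cone_exp N t cs (map g as)) t \<mu>"
          using \<mu>(2)[OF cone_exp_Str[OF sig' StN ntN model_acc_refl[OF NN t(1)]]] sat \<pi>(2)[OF StN gl] PN by blast
        fix oA oB u bs assume w: "wit {} oA oB" and u: "u \<in> wlds M" and bs: "length bs = ?l" "set bs \<subseteq> dmn M u"
          and h: "Sat L (cone_exp (Mk oA oB) u cs bs) u \<mu>"
        note SMk = Mk_Str[OF w u]
        have ntM: "name_tuple (Mk oA oB) u cs bs" using cs bs D(1) by (simp add: name_tuple_def Mk_def)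
        have SC: "(cone_exp (Mk oA oB) u cs bs, u) \<in> Str L (add_consts \<Theta>' cs)"
          using cone_exp_Str[OF sig' SMk ntM] D(5)[OF u] by simp
        have h': "Sat L (cone_exp (Mk oA oB) u cs bs) u \<pi>" "Sat L (cone_exp (Mk oA oB) u cs bs) u \<phi>"
          using \<mu>(2)[OF SC] h by auto
        have "holds (Mk oA oB) u (nth bs) ?P" using \<pi>(2)[OF SMk bs(1)] bs(2) h'(1) by simp
        then have vu: "(v, u) \<in> acc M" and eq: "bs = map (hom M v u) as"
          using Mk_tuple[OF v nt'(4,3) u bs] by auto
        \<comment> \<open>A world with the marked tuple lies above \<open>v\<close>. Were it also
          below \<open>v\<close>, it would be \<open>v\<close> itself, where \<phi> fails.\<close>
        have "(u, v) \<notin> acc M"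
        proof
          assume "(u, v) \<in> acc M"
          then have "u = v" using D(7) vu by blast
          moreover have "map (hom M v v) as = as" using nt'(4) D(21) by (intro map_idI) auto
          ultimately show False using nsat h'(2) key[OF w u bs] eq by simp
        qed
        then have "holds (Mk oA oB) u (nth bs) (mkw (m + 1) v)" using Mk_notbelow[OF v u] by blast
        then show "Sat L (cone_exp (Mk oA oB) u cs bs) u \<kappa>" using \<kappa>(2)[OF SMk bs(1)] bs(2) by simp
      qed
      then show False using \<kappa>(2)[OF StN gl] t(3) by blast
    qed
  qed
qed

text \<open>The world and the element are found by the rule: if each later bearer of the marker of
  the answer lives at a world not below the world of the answer, then the present world is not below
  \<open>w\<close>. That the bearer satisfies \<Gamma> and refutes \<Delta> is shown formula by
  formula, each time with a rule that demands only that the answers respect this one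
  formula.\<close>

lemma embedding_realA:
  assumes N: "is_model \<Theta>' N"
    and obeys: "obeys N"
    and i: "(w, \<alpha>, \<Gamma>, \<Delta>) \<in> RA" and t: "t \<in> wlds N" "\<forall>s. \<not> holds N t s (mkw (m + 1) w)"
    and g: "\<And>a. a \<in> dmn M w \<Longrightarrow> g a \<in> dmn N t \<and> replicate m (g a) \<in> pint N t a"
  shows "\<exists>u b. real_at N t (map g \<alpha>) \<Gamma> \<Delta> u b"
proof -
  note rule1 = obeysD[OF obeys]
  note E = is_modelD[OF N]
  let ?i = "(w, \<alpha>, \<Gamma>, \<Delta>)"
  let ?l = "length \<alpha>"
  have w: "w \<in> wlds M" and \<alpha>: "set \<alpha> \<subseteq> dmn M w" and over: "\<And>\<psi>. \<psi> \<in> \<Gamma> \<union> \<Delta> \<Longrightarrow> fm_over (has_eq K) \<Theta> \<psi>"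
    and fv: "\<And>\<psi>. \<psi> \<in> \<Gamma> \<union> \<Delta> \<Longrightarrow> fv \<psi> \<subseteq> {..?l}"
    using i by (auto simp: RA_def requests_def)
  have over': "\<psi> \<in> \<Gamma> \<union> \<Delta> \<Longrightarrow> fm_over (has_eq K) \<Theta>' \<psi>" for \<psi> using over fm_over_mono sub by blast
  have nX: "name ?i \<in> X" using in_X(3)[OF i] .
  have oR: "fm_over (has_eq K) \<Theta>' (mk (m + 3) (name ?i) j)" for j using nX by (auto intro!: fm_over_mk)
  have oN: "fm_over (has_eq K) \<Theta>' (mkw (m + 4) (name ?i))" using nX by (auto intro!: fm_over_mkw)
  have oW: "fm_over (has_eq K) \<Theta>' (mkw (m + 1) w)" using in_X(2)[OF w] by (auto intro!: fm_over_mkw)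
  have "\<exists>u b. (t, u) \<in> acc N \<and> b \<in> dmn N u \<and> replicate (m + 3) b \<in> pint N u (name ?i) \<and> (\<forall>s. \<not> holds N u s (mkw (m + 4) (name ?i)))"
  proof (rule ccontr)
    assume c: "\<not> ?thesis"
    \<comment> \<open>If there were no suitable bearer, the premise of the rule would hold at
      \<open>t\<close>.\<close>
    have "holds N t (\<lambda>_. undefined) (All 0 (Imp (mk (m + 3) (name ?i) 0) (mkw (m + 4) (name ?i))))"
      unfolding holds.simps
    proof (intro allI impI ballI)
      fix u a x assume u: "(t, u) \<in> acc N" and a: "a \<in> dmn N u" and x: "(u, x) \<in> acc N"
        and h: "holds N x (hom N u x \<circ> (hom N t u \<circ> (\<lambda>_. undefined))(0 := a)) (mk (m + 3) (name ?i) 0)"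
      have "replicate (m + 3) (hom N u x a) \<in> pint N x (name ?i)" using h by (simp add: holds_mk del: replicate.simps)
      then show "holds N x (hom N u x \<circ> (hom N t u \<circ> (\<lambda>_. undefined))(0 := a)) (mkw (m + 4) (name ?i))"
        using c E(6)[OF u x] E(16)[OF x a] unfolding holds_mkw by blast
    qed
    moreover have "holds N t (\<lambda>_. undefined) (mkw (m + 1) w)"
      if "holds N t (\<lambda>_. undefined) (All 0 (Imp (mk (m + 3) (name ?i) 0) (mkw (m + 4) (name ?i))))"
    proof (rule rule1[of "{}" "All 0 (Imp (mk (m + 3) (name ?i) 0) (mkw (m + 4) (name ?i)))" _ 0])
      fix oA oB v s assume wt: "wit {} oA oB" and v: "v \<in> wlds M"
        and h: "holds (Mk oA oB) v s (All 0 (Imp (mk (m + 3) (name ?i) 0) (mkw (m + 4) (name ?i))))"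
      let ?u = "fst (oA ?i)" and ?b = "snd (oA ?i)"
      note wi = witA[OF wt i]
      have uW: "?u \<in> wlds M" using model_dmn_wlds[OF M wi(1)] .
      \<comment> \<open>From a world below \<open>w\<close> the answer itself is reached, and it is
        a counterexample to the premise.\<close>
      have "(v, w) \<notin> acc M"
      proof
        assume "(v, w) \<in> acc M"
        then have vu: "(v, ?u) \<in> acc M" using D(6) wi(2) by auto
        have uu: "(?u, ?u) \<in> acc M" using D(5)[OF uW] .
        let ?s = "hom M ?u ?u \<circ> (hom M v ?u \<circ> s)(0 := ?b)"
        have "holds (Mk oA oB) ?u ?s (mk (m + 3) (name ?i) 0) \<longrightarrow> holds (Mk oA oB) ?u ?s (mkw (m + 4) (name ?i))"
          using h vu uu wi(1) unfolding holds.simps Mk_simps by blast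
        moreover have "?s 0 = ?b" using D(21)[OF wi(1)] by simp
        then have "holds (Mk oA oB) ?u ?s (mk (m + 3) (name ?i) 0)"
          unfolding holds_mk using Mk_realA[OF wt i wi(1)] uu D(21)[OF wi(1)] by simp
        ultimately show False using Mk_notbelowA[OF i uW] uu by blast
      qed
      then show "holds (Mk oA oB) v s (mkw (m + 1) w)" using Mk_notbelow[OF w v] by blast
    qed (use oR oN oW t that in \<open>simp_all add: fv_mkw fv_mk\<close>)
    ultimately show False using t(2) by blast
  qed
  then obtain u b where u: "(t, u) \<in> acc N" and b: "b \<in> dmn N u" and rb: "replicate (m + 3) b \<in> pint N u (name ?i)"
    and nb: "\<forall>s. \<not> holds N u s (mkw (m + 4) (name ?i))" by blast
  have uW: "u \<in> wlds N" using E(4)[OF u] by blast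
  let ?bs = "map (hom N t u) (map g \<alpha>) @ [b]"
  have bs_in: "\<forall>x<Suc ?l. ?bs ! x \<in> dmn N u"
  proof (intro allI impI)
    fix x assume x: "x < Suc ?l"
    have "set ?bs \<subseteq> dmn N u" using b E(16)[OF u] g \<alpha> by auto
    moreover have "?bs ! x \<in> set ?bs" using x by (intro nth_mem) simp
    ultimately show "?bs ! x \<in> dmn N u" by blast
  qed
  \<comment> \<open>The markers of the answer and of the entries of \<alpha>, in the order in which
    \<open>real_at\<close> arranges the tuple.\<close>
  let ?Ps = "mk (m + 3) (name ?i) ?l # map (\<lambda>k. mk m (\<alpha> ! k) k) [0..<?l]"
  have \<alpha>k: "\<alpha> ! k \<in> dmn M w" if "k < ?l" for k using \<alpha> that by auto
  have Ps_over: "\<forall>\<psi>\<in>set ?Ps. fm_over (has_eq K) \<Theta>' \<psi>" using oR in_X(1)[OF \<alpha>k] by (auto intro!: fm_over_mk)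
  have Ps_fv: "\<forall>\<psi>\<in>set ?Ps. fv \<psi> \<subseteq> {..<Suc ?l}" using m by (auto simp: fv_mk)
  have Ps_N: "\<forall>\<psi>\<in>set ?Ps. holds N u (nth ?bs) \<psi>"
  proof -
    have "replicate m (?bs ! k) \<in> pint N u (\<alpha> ! k)" if k: "k < ?l" for k
      using model_pint_hom[OF N u, of "replicate m (g (\<alpha> ! k))" "\<alpha> ! k"] g[OF \<alpha>k[OF k]] k by (simp add: nth_append)
    moreover have "?bs ! ?l = b" by (simp add: nth_append)
    ultimately show ?thesis using rb by (auto simp: holds_mk simp del: replicate.simps)
  qed
  \<comment> \<open>In a marked expansion a tuple with these markers is the image of \<alpha>
    together with the answer, at a world above that of the answer.\<close>
  have Ps_M: "real_at M w \<alpha> (\<Gamma> \<inter> F) (\<Delta> \<inter> F) (fst (oA ?i)) (snd (oA ?i)) \<and> (fst (oA ?i), v) \<in> acc M \<and>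
      (\<forall>x<Suc ?l. s x = hom M (fst (oA ?i)) v ((map (hom M w (fst (oA ?i))) \<alpha> @ [snd (oA ?i)]) ! x))"
    if wt: "wit F oA oB" and v: "v \<in> wlds M" and s: "\<forall>x<Suc ?l. s x \<in> dmn M v" and h: "\<forall>\<psi>\<in>set ?Ps. holds (Mk oA oB) v s \<psi>" for F oA oB v s
  proof -
    let ?u = "fst (oA ?i)" and ?b = "snd (oA ?i)"
    note wi = witA[OF wt i]
    have re: "real_at M w \<alpha> (\<Gamma> \<inter> F) (\<Delta> \<inter> F) ?u ?b" using wt i by (simp add: wit_def)
    have "replicate (m + 3) (s ?l) \<in> pint (Mk oA oB) v (name ?i)" using h by (simp add: holds_mk del: replicate.simps)
    then have uv: "(?u, v) \<in> acc M" and sl: "s ?l = hom M ?u v ?b" using Mk_realA[OF wt i] s by auto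
    have "s k = hom M ?u v (hom M w ?u (\<alpha> ! k))" if k: "k < ?l" for k
    proof -
      have "replicate m (s k) \<in> pint (Mk oA oB) v (\<alpha> ! k)" using h k by (auto simp: holds_mk)
      then have "s k = hom M w v (\<alpha> ! k)" using Mk_elem[OF \<alpha>k[OF k]] s k by simp
      then show ?thesis using D(22)[OF _ uv \<alpha>k[OF k]] wi(2) by simp
    qed
    then show ?thesis using re uv sl by (auto simp: less_Suc_eq nth_append)
  qed
  have push: "holds M v s \<gamma>" if "(u0, v) \<in> acc M" and s: "\<forall>x<Suc ?l. s x = hom M u0 v (\<beta> ! x)" and \<beta>: "length \<beta> = Suc ?l" "set \<beta> \<subseteq> dmn M u0"
    and \<gamma>: "\<gamma> \<in> \<Gamma> \<union> \<Delta>" "holds M u0 (nth \<beta>) \<gamma>" for u0 v s \<beta> \<gamma>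
  proof -
    have fx: "x < Suc ?l" if "x \<in> fv \<gamma>" for x using fv[OF \<gamma>(1)] that by (auto simp: less_Suc_eq_le)
    have "\<beta> ! x \<in> dmn M u0" if "x < Suc ?l" for x using \<beta> that nth_mem[of x \<beta>] by auto
    then have "holds M v (hom M u0 v \<circ> nth \<beta>) \<gamma>"
      using fx by (intro holds_persistent[OF M over[OF \<gamma>(1)] that(1) _ \<gamma>(2)]) blast
    moreover have "holds M v (hom M u0 v \<circ> nth \<beta>) \<gamma> = holds M v s \<gamma>" using fx s by (intro holds_cong) simp
    ultimately show ?thesis by simp
  qed
  have l_in: "length (map (hom M w u0) \<alpha> @ [b0]) = Suc ?l \<and> set (map (hom M w u0) \<alpha> @ [b0]) \<subseteq> dmn M u0"
    if "(w, u0) \<in> acc M" "b0 \<in> dmn M u0" for u0 b0 using that \<alpha> D(16)[OF that(1)] by auto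
  \<comment> \<open>A rule for the demand \<gamma> alone: the answers satisfy \<gamma>, and by
    persistence so do their images.\<close>
  have "holds N u (nth ?bs) \<gamma>" if \<gamma>: "\<gamma> \<in> \<Gamma>" for \<gamma>
  proof (rule rule1[of "{\<gamma>}" "BigAnd ?Ps" \<gamma> "Suc ?l"])
    show "fm_over (has_eq K) \<Theta>' (BigAnd ?Ps)" using Ps_over unfolding fm_over_BigAnd .
    show "fv (BigAnd ?Ps) \<union> fv \<gamma> \<subseteq> {..<Suc ?l}" using Ps_fv fv[of \<gamma>] \<gamma> unfolding fv_BigAnd lessThan_Suc_atMost by blast
    show "holds N u (nth ?bs) (BigAnd ?Ps)" using Ps_N unfolding holds_BigAnd .
    fix oA oB v s assume wt: "wit {\<gamma>} oA oB" and v: "v \<in> wlds M" and s: "\<forall>x<Suc ?l. s x \<in> dmn M v" and h: "holds (Mk oA oB) v s (BigAnd ?Ps)"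
    let ?u = "fst (oA ?i)" and ?b = "snd (oA ?i)"
    note P = Ps_M[OF wt v s h[unfolded holds_BigAnd]]
    have "(w, ?u) \<in> acc M" "?b \<in> dmn M ?u" "holds M ?u (nth (map (hom M w ?u) \<alpha> @ [?b])) \<gamma>" using P \<gamma> by (auto simp: real_at_def)
    then have "holds M v s \<gamma>" using push[of ?u v s "map (hom M w ?u) \<alpha> @ [?b]" \<gamma>] P l_in \<gamma> by blast
    then show "holds (Mk oA oB) v s \<gamma>"
      using holds_Mk[OF wt over v, of \<gamma> s] \<gamma> s fv[of \<gamma>] by (auto simp: less_Suc_eq_le subset_iff)
  qed (use over'[of \<gamma>] \<gamma> uW bs_in in auto)
  moreover have "\<not> holds N u (nth ?bs) \<delta>" if \<delta>: "\<delta> \<in> \<Delta>" for \<delta>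
  proof
    assume hd: "holds N u (nth ?bs) \<delta>"
    \<comment> \<open>The answer refutes \<delta>, but its images at later worlds may satisfy it.
      Such worlds are not below the world of the answer; as this marker fails at \<open>u\<close>,
      so does \<delta>.\<close>
    have "holds N u (nth ?bs) (mkw (m + 4) (name ?i))"
    proof (rule rule1[of "{\<delta>}" "BigAnd (\<delta> # ?Ps)" _ "Suc ?l"])
      show "fm_over (has_eq K) \<Theta>' (BigAnd (\<delta> # ?Ps))" using Ps_over over'[of \<delta>] \<delta> unfolding fm_over_BigAnd by simp
      show "fv (BigAnd (\<delta> # ?Ps)) \<union> fv (mkw (m + 4) (name ?i)) \<subseteq> {..<Suc ?l}"
        using Ps_fv fv[of \<delta>] \<delta> unfolding fv_BigAnd fv_mkw lessThan_Suc_atMost set_simps by blast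
      show "holds N u (nth ?bs) (BigAnd (\<delta> # ?Ps))" using Ps_N hd unfolding holds_BigAnd set_simps by blast
      fix oA oB v s assume wt: "wit {\<delta>} oA oB" and v: "v \<in> wlds M" and s: "\<forall>x<Suc ?l. s x \<in> dmn M v" and h: "holds (Mk oA oB) v s (BigAnd (\<delta> # ?Ps))"
      let ?u = "fst (oA ?i)" and ?b = "snd (oA ?i)"
      have hPs: "\<forall>\<psi>\<in>set ?Ps. holds (Mk oA oB) v s \<psi>" and hd: "holds (Mk oA oB) v s \<delta>" using h unfolding holds_BigAnd by simp_all
      note P = Ps_M[OF wt v s hPs]
      have hd': "holds M v s \<delta>"
        using holds_Mk[OF wt over v, of \<delta> s] \<delta> s fv[of \<delta>] hd by (auto simp: less_Suc_eq_le subset_iff)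
      have nh: "\<not> holds M ?u (nth (map (hom M w ?u) \<alpha> @ [?b])) \<delta>" and wu: "(w, ?u) \<in> acc M" and bu: "?b \<in> dmn M ?u" using P \<delta> by (auto simp: real_at_def)
      have "(v, ?u) \<notin> acc M"
      proof
        assume "(v, ?u) \<in> acc M"
        then have vu: "v = ?u" using P D(7) by blast
        have "holds M ?u s \<delta> = holds M ?u (nth (map (hom M w ?u) \<alpha> @ [?b])) \<delta>"
        proof (rule holds_cong)
          fix x assume "x \<in> fv \<delta>"
          then have x: "x < Suc ?l" using fv[of \<delta>] \<delta> by (auto simp: less_Suc_eq_le)
          have "(map (hom M w ?u) \<alpha> @ [?b]) ! x \<in> set (map (hom M w ?u) \<alpha> @ [?b])" using x by (intro nth_mem) simp
          then have in_u: "(map (hom M w ?u) \<alpha> @ [?b]) ! x \<in> dmn M ?u" using l_in[OF wu bu] by blast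
          have "s x = hom M ?u v ((map (hom M w ?u) \<alpha> @ [?b]) ! x)" using P x by blast
          then show "s x = (map (hom M w ?u) \<alpha> @ [?b]) ! x" unfolding vu using D(21)[OF in_u] by simp
        qed
        then show False using nh hd' vu by simp
      qed
      then show "holds (Mk oA oB) v s (mkw (m + 4) (name ?i))" using Mk_notbelowA[OF i v] by blast
    qed (use oN uW bs_in in auto)
    then show False using nb by blast
  qed
  ultimately show ?thesis unfolding real_at_def using u b by blast
qed

text \<open>The world is given here: \<open>t\<close> has the marker for above \<open>w\<close>,
  which implies that some element bears the marker of the answer. The formulas of \<Gamma> persist
  from \<open>w\<close> to the images of the answer, so rules without refuted markers do the
  work.\<close>

lemma embedding_realB:
  assumes N: "is_model \<Theta>' N"
    and obeys: "obeys N"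
    and i: "(w, \<alpha>, \<Gamma>, \<Delta>) \<in> RB" and t: "t \<in> wlds N" "\<forall>s. holds N t s (mkw (m + 2) w)"
    and g: "\<And>a. a \<in> dmn M w \<Longrightarrow> g a \<in> dmn N t \<and> replicate m (g a) \<in> pint N t a"
  shows "\<exists>b. real_at N t (map g \<alpha>) \<Gamma> {} t b"
proof -
  note rule1 = obeysD[OF obeys]
  note E = is_modelD[OF N]
  let ?i = "(w, \<alpha>, \<Gamma>, \<Delta>)"
  let ?l = "length \<alpha>"
  have w: "w \<in> wlds M" and \<alpha>: "set \<alpha> \<subseteq> dmn M w" and over: "\<And>\<psi>. \<psi> \<in> \<Gamma> \<Longrightarrow> fm_over (has_eq K) \<Theta> \<psi>"
    and fv: "\<And>\<psi>. \<psi> \<in> \<Gamma> \<Longrightarrow> fv \<psi> \<subseteq> {..?l}"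
    using i by (auto simp: RB_def requests_def)
  have over': "\<psi> \<in> \<Gamma> \<Longrightarrow> fm_over (has_eq K) \<Theta>' \<psi>" for \<psi> using over fm_over_mono sub by blast
  have nX: "name ?i \<in> X" using in_X(4)[OF i] .
  have oR: "fm_over (has_eq K) \<Theta>' (mk (m + 5) (name ?i) j)" for j using nX by (auto intro!: fm_over_mk)
  have oN: "fm_over (has_eq K) \<Theta>' (mkw (m + 5) (name ?i))" using nX by (auto intro!: fm_over_mkw)
  have oW: "fm_over (has_eq K) \<Theta>' (mkw (m + 2) w)" using in_X(2)[OF w] by (auto intro!: fm_over_mkw)
  have "holds N t (\<lambda>_. undefined) (mkw (m + 5) (name ?i))"
  proof (rule rule1[of "{}" "mkw (m + 2) w" _ 0])
    fix oA oB v s assume wt: "wit {} oA oB" and v: "v \<in> wlds M" and h: "holds (Mk oA oB) v s (mkw (m + 2) w)"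
    have wv: "(w, v) \<in> acc M" using h Mk_above[OF w v] by blast
    have b: "oB ?i \<in> dmn M w" using witB[OF wt i] by simp
    note hb = D(16)[OF wv b]
    have "replicate (m + 5) (hom M w v (oB ?i)) \<in> pint (Mk oA oB) v (name ?i)" using Mk_realB[OF wt i hb] wv by simp
    then show "holds (Mk oA oB) v s (mkw (m + 5) (name ?i))" unfolding holds_mkw Mk_simps using hb by blast
  qed (use oN oW t in \<open>simp_all add: fv_mkw\<close>)
  then obtain b where b: "b \<in> dmn N t" and rb: "replicate (m + 5) b \<in> pint N t (name ?i)" unfolding holds_mkw by blast
  note tt = E(5)[OF t(1)]
  let ?bs = "map (hom N t t) (map g \<alpha>) @ [b]"
  have bs_in: "\<forall>x<Suc ?l. ?bs ! x \<in> dmn N t"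
  proof (intro allI impI)
    fix x assume x: "x < Suc ?l"
    have "set ?bs \<subseteq> dmn N t" using b E(16)[OF tt] g \<alpha> by auto
    moreover have "?bs ! x \<in> set ?bs" using x by (intro nth_mem) simp
    ultimately show "?bs ! x \<in> dmn N t" by blast
  qed
  let ?Ps = "mk (m + 5) (name ?i) ?l # map (\<lambda>k. mk m (\<alpha> ! k) k) [0..<?l]"
  have \<alpha>k: "\<alpha> ! k \<in> dmn M w" if "k < ?l" for k using \<alpha> that by auto
  have Ps_over: "\<forall>\<psi>\<in>set ?Ps. fm_over (has_eq K) \<Theta>' \<psi>" using oR in_X(1)[OF \<alpha>k] by (auto intro!: fm_over_mk)
  have Ps_fv: "\<forall>\<psi>\<in>set ?Ps. fv \<psi> \<subseteq> {..<Suc ?l}" using m by (auto simp: fv_mk)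
  have Ps_N: "\<forall>\<psi>\<in>set ?Ps. holds N t (nth ?bs) \<psi>"
  proof -
    have "replicate m (?bs ! k) \<in> pint N t (\<alpha> ! k)" if k: "k < ?l" for k
      using model_pint_hom[OF N tt, of "replicate m (g (\<alpha> ! k))" "\<alpha> ! k"] g[OF \<alpha>k[OF k]] k by (simp add: nth_append)
    moreover have "?bs ! ?l = b" by (simp add: nth_append)
    ultimately show ?thesis using rb by (auto simp: holds_mk simp del: replicate.simps)
  qed
  have "holds N t (nth ?bs) \<gamma>" if \<gamma>: "\<gamma> \<in> \<Gamma>" for \<gamma>
  proof (rule rule1[of "{\<gamma>}" "BigAnd ?Ps" \<gamma> "Suc ?l"])
    show "fm_over (has_eq K) \<Theta>' (BigAnd ?Ps)" using Ps_over unfolding fm_over_BigAnd .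
    show "fv (BigAnd ?Ps) \<union> fv \<gamma> \<subseteq> {..<Suc ?l}" using Ps_fv fv[of \<gamma>] \<gamma> unfolding fv_BigAnd lessThan_Suc_atMost by blast
    show "holds N t (nth ?bs) (BigAnd ?Ps)" using Ps_N unfolding holds_BigAnd .
    fix oA oB v s assume wt: "wit {\<gamma>} oA oB" and v: "v \<in> wlds M" and s: "\<forall>x<Suc ?l. s x \<in> dmn M v" and h: "holds (Mk oA oB) v s (BigAnd ?Ps)"
    note h = h[unfolded holds_BigAnd]
    let ?b = "oB ?i"
    let ?\<beta> = "map (hom M w w) \<alpha> @ [?b]"
    have re: "real_at M w \<alpha> (\<Gamma> \<inter> {\<gamma>}) {} w ?b" using wt i by (simp add: wit_def)
    then have hg: "holds M w (nth ?\<beta>) \<gamma>" and bw: "?b \<in> dmn M w" using \<gamma> by (auto simp: real_at_def)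
    have "replicate (m + 5) (s ?l) \<in> pint (Mk oA oB) v (name ?i)" using h by (simp add: holds_mk del: replicate.simps)
    then have wv: "(w, v) \<in> acc M" and sl: "s ?l = hom M w v ?b" using Mk_realB[OF wt i] s by auto
    have sk: "s k = hom M w v (\<alpha> ! k)" if k: "k < ?l" for k
    proof -
      have "replicate m (s k) \<in> pint (Mk oA oB) v (\<alpha> ! k)" using h k by (auto simp: holds_mk)
      then show ?thesis using Mk_elem[OF \<alpha>k[OF k]] s k by simp
    qed
    have fx: "x < Suc ?l" if "x \<in> fv \<gamma>" for x using fv[OF \<gamma>] that by (auto simp: less_Suc_eq_le)
    have \<beta>: "?\<beta> ! x \<in> dmn M w \<and> hom M w v (?\<beta> ! x) = s x" if "x < Suc ?l" for x
      using that \<alpha>k bw sl sk D(21)[of _ w] by (auto simp: less_Suc_eq nth_append)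
    have "holds M v (hom M w v \<circ> nth ?\<beta>) \<gamma>"
      using fx \<beta> by (intro holds_persistent[OF M over[OF \<gamma>] wv _ hg]) blast
    moreover have "holds M v (hom M w v \<circ> nth ?\<beta>) \<gamma> = holds M v s \<gamma>" using fx \<beta> by (intro holds_cong) simp
    ultimately have "holds M v s \<gamma>" by simp
    then show "holds (Mk oA oB) v s \<gamma>"
      using holds_Mk[OF wt over v, of \<gamma> s] \<gamma> s fv[of \<gamma>] by (auto simp: less_Suc_eq_le subset_iff)
  qed (use over'[of \<gamma>] \<gamma> t(1) bs_in in auto)
  then show ?thesis unfolding real_at_def using tt b by blast
qed

end

section \<open>The elementary extension\<close>

context extension_step begin

text \<open>The reduct of the compactness model to \<Theta> is renamed along injections that invert
  the embedding, so that \<open>M\<close> becomes a submodel.\<close>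

lemma ex_realising_extension:
  "\<exists>M'. (M', r) \<in> Str L \<Theta> \<and> good (has_eq K) M' r \<and> elementary_submodel L M M' \<and> realises (has_eq K) \<Theta> M M'"
proof -
  obtain N n0 where SN: "(N, n0) \<in> Str L \<Theta>'" and goodN: "good (has_eq K) N n0" and neg: "\<forall>s. \<not> holds N n0 s (mkw (m + 1) r)"
    and obeys: "obeys N" "obeys_L N"
    using ex_marked_model by (elim exE conjE)
  have N: "is_model \<Theta>' N" "n0 \<in> wlds N" using SN Str_iff[OF sig'] by auto
  obtain fw g where fr: "fw r = n0"
    and fw: "\<forall>v\<in>wlds M. fw v \<in> wlds N \<and> (\<forall>s. holds N (fw v) s (mkw (m + 2) v)) \<and> (\<forall>s. \<not> holds N (fw v) s (mkw (m + 1) v))"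
    and ord: "\<forall>v\<in>wlds M. \<forall>u\<in>wlds M. (fw v, fw u) \<in> acc N \<longleftrightarrow> (v, u) \<in> acc M"
    and g: "\<forall>v a. a \<in> dmn M v \<longrightarrow> g a \<in> dmn N (fw v) \<and> replicate m (g a) \<in> pint N (fw v) a"
    and injf: "inj_on fw (wlds M)" and injg: "inj_on g (elems M)"
    and homg: "\<forall>v u a. (v, u) \<in> acc M \<longrightarrow> a \<in> dmn M v \<longrightarrow> g (hom M v u a) = hom N (fw v) (fw u) (g a)"
    and cintg: "\<forall>v\<in>wlds M. \<forall>c\<in>csts \<Theta>. g (cint M v c) = cint N (fw v) c"
    using ex_embedding[OF SN goodN neg obeys(1)] by (elim exE conjE)
  define NR where "NR = reduct N \<Theta>"
  have SR: "(NR, n0) \<in> Str L \<Theta>" unfolding NR_def using reduct_Str[OF sig sig' sub SN] .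
  have NR: "is_model \<Theta> NR" using SR Str_iff[OF sig] by blast
  have goodR: "good (has_eq K) NR n0" unfolding NR_def using good_reduct[OF goodN] sub model_sgn[OF N(1)] by simp
  have NRs: "wlds NR = wlds N" "acc NR = acc N" "dmn NR = dmn N" "hom NR = hom N" by (simp_all add: NR_def)
  have eN: "elems NR = elems N" by (simp add: elems_def NRs)
  have "fw ` wlds M \<subseteq> wlds N" using fw by blast
  then obtain h' where h': "inj_on h' (wlds N)" "\<forall>v\<in>wlds M. h' (fw v) = v"
    using ex_inj_extending_inverse[OF model_small_wlds[OF N(1)] D(3) injf] by blast
  have "g ` elems M \<subseteq> elems N" using g fw by (fastforce simp: elems_def)
  then obtain g' where g': "inj_on g' (elems N)" "\<forall>a\<in>elems M. g' (g a) = a"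
    using ex_inj_extending_inverse[OF small_elems[OF N(1)] small_elems[OF M] injg] by blast
  have gg: "g' (g a) = a" if "a \<in> dmn M v" for a v using g'(2) that model_dmn_wlds[OF M that] by (auto simp: elems_def)
  obtain M' where M': "is_model \<Theta> M'" and iso: "model_iso g' h' NR M'"
    using ex_iso_copy[OF NR, of g' h'] g'(1) h'(1) by (auto simp: eN NRs)
  note I = model_isoD[OF iso]
  have hr: "h' n0 = r" using h'(2) r fr by force
  have SM': "(M', r) \<in> Str L \<Theta>" using Str_iso[OF sig SR M' iso] hr by simp
  have good': "good (has_eq K) M' r" using good_iso[OF NR M' iso goodR] hr by simp
  have types: "Sat L (cone_exp M v cs as) v \<phi> \<longleftrightarrow> Sat L (cone_exp M' v cs as) v \<phi>"
    if v: "v \<in> wlds M" and nt: "name_tuple M v cs as" and \<phi>: "\<phi> \<in> Sen L (add_consts \<Theta> cs)" for v cs as \<phi>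
  proof -
    note nt' = name_tupleD[OF nt]
    have fv: "fw v \<in> wlds N" "\<forall>s. holds N (fw v) s (mkw (m + 2) v)" "\<forall>s. \<not> holds N (fw v) s (mkw (m + 1) v)" using fw v by blast+
    have ga: "a \<in> dmn M v \<Longrightarrow> g a \<in> dmn N (fw v) \<and> replicate m (g a) \<in> pint N (fw v) a" for a using g by blast
    have SNv: "(N, fw v) \<in> Str L \<Theta>'" using Str_pt[OF sig' SN fv(1)] .
    have SRv: "(NR, fw v) \<in> Str L \<Theta>" using Str_pt[OF sig SR] fv(1) NRs by simp
    have ntN: "name_tuple N (fw v) cs (map g as)" using nt' ga D(1) model_sgn[OF N(1)] by (auto simp: name_tuple_def)
    have ntR: "name_tuple NR (fw v) cs (map g as)" using nt' ga D(1) model_sgn[OF NR] by (auto simp: name_tuple_def NRs)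
    have mm: "map g' (map g as) = as" using nt'(4) gg by (auto intro!: map_idI)
    have hv: "h' (fw v) = v" using h'(2) v by blast
    have fvR: "fw v \<in> wlds NR" using fv(1) NRs by simp
    note cov = iso_cone_covers[OF NR M' iso fvR ntR]
    have "Sat L (cone_exp M v cs as) v \<phi> \<longleftrightarrow> Sat L (cone_exp N (fw v) cs (map g as)) (fw v) \<phi>"
      using embedding_types[OF SN obeys(2) v fv ga nt \<phi>] .
    also have "\<dots> \<longleftrightarrow> Sat L (cone_exp NR (fw v) cs (map g as)) (fw v) \<phi>"
      unfolding NR_def using Sat_cone_exp_reduct[OF sig sig' sub SNv ntN \<phi>] .
    also have "\<dots> \<longleftrightarrow> Sat L (cone_exp M' v cs as) v \<phi>"
    proof -
      have S1: "(cone_exp NR (fw v) cs (map g as), fw v) \<in> Str L (add_consts \<Theta> cs)"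
        using cone_exp_Str[OF sig SRv ntR model_acc_refl[OF NR fvR]] .
      have vM': "v \<in> wlds M'" using I(3) fvR hv by (metis bij_betwE)
      have S2: "(cone_exp M' v cs as, v) \<in> Str L (add_consts \<Theta> cs)"
        using cone_exp_Str[OF sig Str_pt[OF sig SM' vM'] _ model_acc_refl[OF M' vM']] cov(2) unfolding hv mm by blast
      show ?thesis using covers_Sat[OF is_sig_add_consts[OF sig] S1 _ cov(1) \<phi>] S2 unfolding hv mm by blast
    qed
    finally show ?thesis .
  qed
  have wM': "v \<in> wlds M'" if "v \<in> wlds M" for v
    using I(3) h'(2) that fw NRs(1) by (metis bij_betwE)
  have dM': "a \<in> dmn M' v" if "a \<in> dmn M v" for a v
  proof -
    have v: "v \<in> wlds M" using model_dmn_wlds[OF M that] .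
    have "g' ` dmn NR (fw v) = dmn M' (h' (fw v))" using I(5)[of "fw v"] fw v NRs by (auto simp: bij_betw_def)
    moreover have "g a \<in> dmn NR (fw v)" using g that NRs by simp
    ultimately have "g' (g a) \<in> dmn M' (h' (fw v))" by blast
    then show ?thesis using gg[OF that] h'(2) v by simp
  qed
  have accM': "(v, u) \<in> acc M' \<longleftrightarrow> (v, u) \<in> acc M" if "v \<in> wlds M" "u \<in> wlds M" for v u
  proof -
    have "(fw v, fw u) \<in> acc NR \<longleftrightarrow> (h' (fw v), h' (fw u)) \<in> acc M'" using I(4) fw that NRs by simp
    then show ?thesis using h'(2) that ord NRs by simp
  qed
  have homM': "hom M' v u a = hom M v u a" if vu: "(v, u) \<in> acc M" and a: "a \<in> dmn M v" for v u a
  proof -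
    have v: "v \<in> wlds M" and u: "u \<in> wlds M" using D(4)[OF vu] by auto
    have fvu: "(fw v, fw u) \<in> acc NR" using ord v u vu NRs by simp
    have ga: "g a \<in> dmn NR (fw v)" using g a NRs by simp
    have "hom M' v u a = hom M' (h' (fw v)) (h' (fw u)) (g' (g a))" using h'(2) v u gg[OF a] by simp
    also have "\<dots> = g' (hom NR (fw v) (fw u) (g a))" using I(8)[OF fvu ga] by simp
    also have "\<dots> = g' (g (hom M v u a))" using homg vu a NRs by simp
    also have "\<dots> = hom M v u a" using gg D(16)[OF vu a] by blast
    finally show ?thesis .
  qed
  \<comment> \<open>The embedding not only preserves but also reflects letters, because
    \<open>L\<close>-types agree and atomic formulas have translations into
    \<open>L\<close>.\<close>
  have pintM': "as \<in> pint M v P \<longleftrightarrow> as \<in> pint M' v P" if v: "v \<in> wlds M" and as: "set as \<subseteq> dmn M v" for v as P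
  proof (cases "P \<in> preds \<Theta> (length as)")
    case False
    then show ?thesis using D(12)[of as v P] model_pint[OF M', of as v P] by blast
  next
    case True
    let ?\<psi> = "Atom P (map Var [0..<length as])"
    let ?cs = "map (fresh_consts \<Theta>) [0..<length as]"
    note nt = name_tuple_c[OF fresh_consts_props[OF sig] M as refl]
    have cs: "distinct ?cs" "set ?cs \<inter> csts \<Theta> = {}" using name_tupleD[OF nt] D(1) by auto
    have "fm_over (has_eq K) \<Theta> ?\<psi>" using True by auto
    moreover have "fv ?\<psi> \<subseteq> {..<length ?cs}" by auto
    ultimately obtain \<psi>' where \<psi>': "\<psi>' \<in> Sen L (add_consts \<Theta> ?cs)"
      "\<And>M w as'. (M, w) \<in> Str L \<Theta> \<Longrightarrow> length as' = length ?cs \<Longrightarrow> set as' \<subseteq> dmn M w \<Longrightarrow>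
        Sat L (cone_exp M w ?cs as') w \<psi>' \<longleftrightarrow> holds M w (nth as') ?\<psi>"
      using ex_formula_translation[OF sig cs] by blast
    have h\<psi>: "holds A v (nth as) ?\<psi> \<longleftrightarrow> as \<in> pint A v P" for A by (simp add: comp_def map_nth)
    have "holds M v (nth as) ?\<psi> \<longleftrightarrow> Sat L (cone_exp M v ?cs as) v \<psi>'"
      using \<psi>'(2)[OF Str_pt[OF sig SM v] _ as] by simp
    also have "\<dots> \<longleftrightarrow> Sat L (cone_exp M' v ?cs as) v \<psi>'" using types[OF v nt \<psi>'(1)] .
    also have "\<dots> \<longleftrightarrow> holds M' v (nth as) ?\<psi>"
      using \<psi>'(2)[OF Str_pt[OF sig SM' wM'[OF v]], of as] as dM'[of _ v] by auto
    finally show ?thesis unfolding h\<psi> .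
  qed
  have cintM': "cint M v c = cint M' v c" if v: "v \<in> wlds M" and c: "c \<in> csts \<Theta>" for v c
  proof -
    have "cint M' v c = cint M' (h' (fw v)) c" using h'(2) v by simp
    also have "\<dots> = g' (cint NR (fw v) c)" using I(7)[of "fw v" c] fw v c NRs model_sgn[OF NR] by simp
    also have "\<dots> = g' (g (cint M v c))" using cintg v c by (simp add: NR_def)
    also have "\<dots> = cint M v c" using gg D(13)[OF v c] by blast
    finally show ?thesis by simp
  qed
  have sgs: "sgn M = \<Theta>" "sgn M' = \<Theta>" using D(1) model_sgn[OF M'] by auto
  have subm: "submodel M M'"
    unfolding submodel_def sgs
  proof (intro conjI ballI allI impI)
    show "wlds M \<subseteq> wlds M'" using wM' by blast
    show "acc M = acc M' \<inter> wlds M \<times> wlds M" using accM' D(4) by auto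
    show "dmn M v \<subseteq> dmn M' v" if "v \<in> wlds M" for v using dM' by blast
    show "pint M v P = pint M' v P \<inter> lists (dmn M v)" if "v \<in> wlds M" for v P
      using pintM'[OF that] D(12)[of _ v P] by (auto simp: in_lists_conv_set subset_iff)
    show "cint M v c = cint M' v c" if "v \<in> wlds M" "c \<in> csts \<Theta>" for v c using cintM' that by blast
    show "hom M v u = restrict (hom M' v u) (dmn M v)" if "(v, u) \<in> acc M" for v u
      using homM'[OF that] D(17)[of _ v u] by (auto simp: fun_eq_iff restrict_def)
  qed (rule refl)
  have el: "elementary_submodel L M M'"
    unfolding elementary_submodel_def Tp_def Th_def
    using subm types by (auto simp: sgs)
  \<comment> \<open>Realisations in \<open>N\<close> pass through the reduct, since the formulas are
    over \<Theta>, and through the isomorphism, which sends images back to their originals.\<close>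
  have transfer: "real_at M' w \<alpha> \<Gamma> \<Delta> (h' u) (g' b)"
    if w: "w \<in> wlds M" and \<alpha>: "set \<alpha> \<subseteq> dmn M w" and over: "\<forall>\<psi>\<in>\<Gamma> \<union> \<Delta>. fm_over (has_eq K) \<Theta> \<psi> \<and> fv \<psi> \<subseteq> {..length \<alpha>}"
      and re: "real_at N (fw w) (map g \<alpha>) \<Gamma> \<Delta> u b" for w \<alpha> \<Gamma> \<Delta> u b
  proof -
    have fw': "fw w \<in> wlds N" using fw w by blast
    have g\<alpha>: "set (map g \<alpha>) \<subseteq> dmn N (fw w)" using g \<alpha> by auto
    have o: "\<And>\<psi>. \<psi> \<in> \<Gamma> \<union> \<Delta> \<Longrightarrow> fm_over (has_eq K) \<Theta> \<psi> \<and> fv \<psi> \<subseteq> {..length (map g \<alpha>)}" using over by simp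
    have "real_at NR (fw w) (map (\<lambda>x. x) (map g \<alpha>)) \<Gamma> \<Delta> u b"
      unfolding NR_def
      by (rule real_at_covers[OF N(1) reduct_covers[OF N(1) NR[unfolded NR_def] sub] fw' g\<alpha> o re])
    then have "real_at NR (fw w) (map g \<alpha>) \<Gamma> \<Delta> u b" by simp
    from real_at_covers[OF NR iso_covers[OF NR M' iso] _ _ o this]
    have "real_at M' (h' (fw w)) (map g' (map g \<alpha>)) \<Gamma> \<Delta> (h' u) (g' b)" using fw' g\<alpha> NRs by simp
    moreover have "map g' (map g \<alpha>) = \<alpha>" using \<alpha> gg by (auto intro!: map_idI)
    ultimately show ?thesis using h'(2) w by simp
  qed
  have "realises (has_eq K) \<Theta> M M'"
    unfolding realises_def
  proof (intro allI impI)
    fix w \<alpha> \<Gamma> \<Delta> assume w: "w \<in> wlds M" and \<alpha>: "set \<alpha> \<subseteq> dmn M w" and over: "\<forall>\<psi>\<in>\<Gamma> \<union> \<Delta>. fm_over (has_eq K) \<Theta> \<psi> \<and> fv \<psi> \<subseteq> {..length \<alpha>}"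
    have fw': "fw w \<in> wlds N" "\<forall>s. holds N (fw w) s (mkw (m + 2) w)" "\<forall>s. \<not> holds N (fw w) s (mkw (m + 1) w)" using fw w by blast+
    have ga: "a \<in> dmn M w \<Longrightarrow> g a \<in> dmn N (fw w) \<and> replicate m (g a) \<in> pint N (fw w) a" for a using g by blast
    have rq: "(w, \<alpha>, \<Gamma>, \<Delta>) \<in> requests" using w \<alpha> over by (auto simp: requests_def elems_def in_lists_conv_set)
    show "((\<forall>F. finite F \<longrightarrow> (\<exists>u b. real_at M w \<alpha> (\<Gamma> \<inter> F) (\<Delta> \<inter> F) u b)) \<longrightarrow> (\<exists>u b. real_at M' w \<alpha> \<Gamma> \<Delta> u b)) \<and>
     ((\<forall>F. finite F \<longrightarrow> (\<exists>b. real_at M w \<alpha> (\<Gamma> \<inter> F) {} w b)) \<longrightarrow> (\<exists>b. real_at M' w \<alpha> \<Gamma> {} w b))"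
    proof (intro conjI impI)
      assume "\<forall>F. finite F \<longrightarrow> (\<exists>u b. real_at M w \<alpha> (\<Gamma> \<inter> F) (\<Delta> \<inter> F) u b)"
      then have "(w, \<alpha>, \<Gamma>, \<Delta>) \<in> RA" using rq \<alpha> over by (auto simp: RA_def)
      from embedding_realA[OF N(1) obeys(1) this fw'(1,3) ga]
      obtain u b where "real_at N (fw w) (map g \<alpha>) \<Gamma> \<Delta> u b" by blast
      then show "\<exists>u b. real_at M' w \<alpha> \<Gamma> \<Delta> u b" using transfer[OF w \<alpha> over] by blast
    next
      assume "\<forall>F. finite F \<longrightarrow> (\<exists>b. real_at M w \<alpha> (\<Gamma> \<inter> F) {} w b)"
      then have "(w, \<alpha>, \<Gamma>, \<Delta>) \<in> RB" using rq \<alpha> over by (auto simp: RB_def)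
      from embedding_realB[OF N(1) obeys(1) this fw'(1,2) ga]
      obtain b where "real_at N (fw w) (map g \<alpha>) \<Gamma> {} (fw w) b" by blast
      then have "real_at M' w \<alpha> \<Gamma> {} (h' (fw w)) (g' b)" using over by (intro transfer[OF w \<alpha>]) auto
      then show "\<exists>b. real_at M' w \<alpha> \<Gamma> {} w b" using h'(2) w by auto
    qed
  qed
  then show ?thesis using SM' good' el by blast
qed

end

section \<open>Saturated models and definability\<close>

text \<open>A failure of the universal implication is exactly a later world with an element at which
  all of \<open>\<gamma>s\<close> hold and all of \<open>\<delta>s\<close> fail. Finite
  realisability of a type at later worlds thus becomes a matter of formulas over \<alpha>.\<close>

lemma real_at_formula:
  assumes M: "is_model \<Theta> M" and w: "w \<in> wlds M" and \<alpha>: "set \<alpha> \<subseteq> dmn M w"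
    and fv: "\<forall>\<psi>\<in>set \<gamma>s \<union> set \<delta>s. fv \<psi> \<subseteq> {..length \<alpha>}"
  shows "(\<exists>u b. real_at M w \<alpha> (set \<gamma>s) (set \<delta>s) u b) \<longleftrightarrow> \<not> holds M w (nth \<alpha>) (All (length \<alpha>) (Imp (BigAnd \<gamma>s) (BigOr \<delta>s)))"
proof -
  note D = is_modelD[OF M]
  let ?l = "length \<alpha>"
  have eq: "holds M u (hom M v u \<circ> (hom M w v \<circ> nth \<alpha>)(?l := a)) \<psi> \<longleftrightarrow> holds M u (nth (map (hom M w u) \<alpha> @ [hom M v u a])) \<psi>"
    if \<psi>: "\<psi> \<in> set \<gamma>s \<union> set \<delta>s" and wv: "(w, v) \<in> acc M" and vu: "(v, u) \<in> acc M" for v u a \<psi>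
  proof (rule holds_cong)
    fix x assume "x \<in> fv \<psi>"
    then have x: "x < ?l \<or> x = ?l" using fv \<psi> by force
    then show "(hom M v u \<circ> (hom M w v \<circ> nth \<alpha>)(?l := a)) x = (map (hom M w u) \<alpha> @ [hom M v u a]) ! x"
    proof
      assume x: "x < ?l"
      then have "\<alpha> ! x \<in> dmn M w" using \<alpha> by auto
      then show ?thesis using x D(22)[OF wv vu] by (simp add: nth_append)
    qed (simp add: nth_append)
  qed
  show ?thesis
  proof
    assume "\<exists>u b. real_at M w \<alpha> (set \<gamma>s) (set \<delta>s) u b"
    then obtain u b where wu: "(w, u) \<in> acc M" and b: "b \<in> dmn M u"
      and pos: "\<forall>\<gamma>\<in>set \<gamma>s. holds M u (nth (map (hom M w u) \<alpha> @ [b])) \<gamma>" and neg: "\<forall>\<delta>\<in>set \<delta>s. \<not> holds M u (nth (map (hom M w u) \<alpha> @ [b])) \<delta>"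
      unfolding real_at_def by blast
    have uu: "(u, u) \<in> acc M" using D(4)[OF wu] D(5) by blast
    have "hom M u u b = b" using D(21)[OF b] .
    then have "holds M u (hom M u u \<circ> (hom M w u \<circ> nth \<alpha>)(?l := b)) \<psi> \<longleftrightarrow> holds M u (nth (map (hom M w u) \<alpha> @ [b])) \<psi>"
      if "\<psi> \<in> set \<gamma>s \<union> set \<delta>s" for \<psi> using eq[OF that wu uu, of b] by simp
    then have "holds M u (hom M u u \<circ> (hom M w u \<circ> nth \<alpha>)(?l := b)) (BigAnd \<gamma>s)" "\<not> holds M u (hom M u u \<circ> (hom M w u \<circ> nth \<alpha>)(?l := b)) (BigOr \<delta>s)"
      unfolding holds_BigAnd holds_BigOr using pos neg by blast+
    then show "\<not> holds M w (nth \<alpha>) (All ?l (Imp (BigAnd \<gamma>s) (BigOr \<delta>s)))"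
      unfolding holds.simps using wu b uu by blast
  next
    assume "\<not> holds M w (nth \<alpha>) (All ?l (Imp (BigAnd \<gamma>s) (BigOr \<delta>s)))"
    then obtain v a u where wv: "(w, v) \<in> acc M" and a: "a \<in> dmn M v" and vu: "(v, u) \<in> acc M"
      and h: "holds M u (hom M v u \<circ> (hom M w v \<circ> nth \<alpha>)(?l := a)) (BigAnd \<gamma>s)" "\<not> holds M u (hom M v u \<circ> (hom M w v \<circ> nth \<alpha>)(?l := a)) (BigOr \<delta>s)"
      unfolding holds.simps by blast
    have "real_at M w \<alpha> (set \<gamma>s) (set \<delta>s) u (hom M v u a)"
      unfolding real_at_def using h eq[OF _ wv vu, of _ a] D(6)[OF wv vu] D(16)[OF vu a] unfolding holds_BigAnd holds_BigOr by blast
    then show "\<exists>u b. real_at M w \<alpha> (set \<gamma>s) (set \<delta>s) u b" by blast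
  qed
qed

text \<open>The counterpart for elements of \<open>w\<close> itself, where an existential formula is
  available.\<close>

lemma real_at_formula_here:
  assumes M: "is_model \<Theta> M" and w: "w \<in> wlds M" and \<alpha>: "set \<alpha> \<subseteq> dmn M w"
    and fv: "\<forall>\<psi>\<in>set \<gamma>s. fv \<psi> \<subseteq> {..length \<alpha>}"
  shows "(\<exists>b. real_at M w \<alpha> (set \<gamma>s) {} w b) \<longleftrightarrow> holds M w (nth \<alpha>) (Ex (length \<alpha>) (BigAnd \<gamma>s))"
proof -
  note D = is_modelD[OF M]
  let ?l = "length \<alpha>"
  have idm: "map (hom M w w) \<alpha> = \<alpha>" using \<alpha> D(21) by (intro map_idI) auto
  have "holds M w ((nth \<alpha>)(?l := a)) \<psi> \<longleftrightarrow> holds M w (nth (map (hom M w w) \<alpha> @ [a])) \<psi>" if "\<psi> \<in> set \<gamma>s" for a \<psi>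
    unfolding idm
  proof (rule holds_cong)
    fix x assume "x \<in> fv \<psi>"
    then have x: "x < ?l \<or> x = ?l" using fv that by force
    then show "((nth \<alpha>)(?l := a)) x = (\<alpha> @ [a]) ! x" by (auto simp: nth_append)
  qed
  then show ?thesis unfolding real_at_def holds.simps holds_BigAnd using D(5)[OF w] by blast
qed

lemma submodelD:
  assumes "submodel M N"
  shows "wlds M \<subseteq> wlds N" "acc M = acc N \<inter> wlds M \<times> wlds M" "w \<in> wlds M \<Longrightarrow> dmn M w \<subseteq> dmn N w"
    "(w, v) \<in> acc M \<Longrightarrow> a \<in> dmn M w \<Longrightarrow> hom N w v a = hom M w v a"
  using assms by (auto simp: submodel_def)

lemma realisesD:
  assumes "realises q \<Theta> M M'" "w \<in> wlds M" "set \<alpha> \<subseteq> dmn M w" "\<forall>\<psi>\<in>\<Gamma> \<union> \<Delta>. fm_over q \<Theta> \<psi> \<and> fv \<psi> \<subseteq> {..length \<alpha>}"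
  shows "\<forall>F. finite F \<longrightarrow> (\<exists>u b. real_at M w \<alpha> (\<Gamma> \<inter> F) (\<Delta> \<inter> F) u b) \<Longrightarrow> \<exists>u b. real_at M' w \<alpha> \<Gamma> \<Delta> u b"
    "\<forall>F. finite F \<longrightarrow> (\<exists>b. real_at M w \<alpha> (\<Gamma> \<inter> F) {} w b) \<Longrightarrow> \<exists>b. real_at M' w \<alpha> \<Gamma> {} w b"
  using assms unfolding realises_def by blast+

text \<open>From arity \<open>m\<close> on all names are free to serve as markers.\<close>

lemma finite_sig_bound:
  assumes "finite_sig \<Theta>"
  shows "\<exists>m>0. \<forall>n\<ge>m. preds \<Theta> n = {}"
proof -
  have "finite (fst ` (SIGMA n:UNIV. preds \<Theta> n))" using assms by (simp add: finite_sig_def)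
  then obtain k where k: "\<forall>n\<in>fst ` (SIGMA n:UNIV. preds \<Theta> n). n \<le> k" using finite_nat_set_iff_bounded_le by blast
  have "preds \<Theta> n = {}" if "n \<ge> Suc k" for n using k that by force
  then show ?thesis by blast
qed

context extension_logic begin

lemma real_at_elementary:
  assumes sig: "is_sig \<Theta>" and SM: "(M, w) \<in> Str L \<Theta>" and SN: "(N, w) \<in> Str L \<Theta>" and el: "elementary_submodel L M N"
    and \<alpha>: "set \<alpha> \<subseteq> dmn M w" and over: "\<forall>\<psi>\<in>\<Gamma> \<union> \<Delta>. fm_over (has_eq K) \<Theta> \<psi> \<and> fv \<psi> \<subseteq> {..length \<alpha>}"
    and re: "real_at M w \<alpha> \<Gamma> \<Delta> u b"
  shows "real_at N w \<alpha> \<Gamma> \<Delta> u b"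
proof -
  have M: "is_model \<Theta> M" and N: "is_model \<Theta> N" using SM SN Str_iff[OF sig] by auto
  have sub: "submodel M N" using el by (simp add: elementary_submodel_def)
  have wu: "(w, u) \<in> acc M" and b: "b \<in> dmn M u" using re by (auto simp: real_at_def)
  have u: "u \<in> wlds M" using model_acc_wlds[OF M wu] by blast
  have eq: "map (hom N w u) \<alpha> = map (hom M w u) \<alpha>" using submodelD(4)[OF sub wu] \<alpha> by auto
  have "holds M u (nth (map (hom M w u) \<alpha> @ [b])) \<psi> \<longleftrightarrow> holds N u (nth (map (hom M w u) \<alpha> @ [b])) \<psi>" if "\<psi> \<in> \<Gamma> \<union> \<Delta>" for \<psi>
  proof (rule elementary_holds[OF sig _ _ el])
    show "(M, u) \<in> Str L \<Theta>" "(N, u) \<in> Str L \<Theta>" using Str_pt[OF sig SM u] Str_pt[OF sig SN] u submodelD(1)[OF sub] by auto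
    show "set (map (hom M w u) \<alpha> @ [b]) \<subseteq> dmn M u" using b \<alpha> model_hom[OF M wu] by auto
    have "fv \<psi> \<subseteq> {..length \<alpha>}" using over that by blast
    then show "fv \<psi> \<subseteq> {..<length (map (hom M w u) \<alpha> @ [b])}" by (simp add: lessThan_Suc_atMost)
  qed (use over that in blast)
  then show ?thesis using re submodelD(2,3)[OF sub] u unfolding real_at_def eq by blast
qed

end

section \<open>Saturated models and the separation argument\<close>

locale lindstroem = extension_logic \<U> L K for \<U> :: "'u set" and L :: "('u, 's) logic" and K +
  assumes comp: "star_compact L" and tup: "tarski_union_property L"
begin

text \<open>A tuple of the union of the chain occurs at a finite stage. Finite realisability of a
  type over it passes from the union down to that stage, being expressed by formulas; the next stage
  realises the whole type, and the union inherits the realisation.\<close>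

lemma ex_saturated:
  assumes sig: "is_sig \<Theta>" and fin: "finite_sig \<Theta>" and SM: "(M, r) \<in> Str L \<Theta>"
  shows "\<exists>M' r'. (M', r') \<in> Str L \<Theta> \<and> (\<forall>\<phi>\<in>Sen L \<Theta>. Sat L M' r' \<phi> \<longleftrightarrow> Sat L M r \<phi>) \<and> realises (has_eq K) \<Theta> M' M'"
proof -
  obtain M0 r0 where M0: "(M0, r0) \<in> Str L \<Theta>" "good (has_eq K) M0 r0" "\<forall>\<phi>\<in>Sen L \<Theta>. Sat L M0 r0 \<phi> \<longleftrightarrow> Sat L M r \<phi>"
    using ex_good[OF sig SM] by blast
  obtain m where m: "m > 0" "\<And>n. m \<le> n \<Longrightarrow> preds \<Theta> n = {}" using finite_sig_bound[OF fin] by blast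
  \<comment> \<open>Goodness is carried along the chain because each extension step starts from a
    good model.\<close>
  have "\<exists>Ms. \<forall>n. ((Ms n, r0) \<in> Str L \<Theta> \<and> good (has_eq K) (Ms n) r0 \<and> (n = 0 \<longrightarrow> Ms n = M0)) \<and>
    (elementary_submodel L (Ms n) (Ms (Suc n)) \<and> realises (has_eq K) \<Theta> (Ms n) (Ms (Suc n)))"
  proof (rule dependent_nat_choice)
    show "\<exists>N. (N, r0) \<in> Str L \<Theta> \<and> good (has_eq K) N r0 \<and> ((0 :: nat) = 0 \<longrightarrow> N = M0)" using M0 by blast
    fix N and n :: nat assume N: "(N, r0) \<in> Str L \<Theta> \<and> good (has_eq K) N r0 \<and> (n = 0 \<longrightarrow> N = M0)"
    interpret extension_step \<U> L K N r0 \<Theta> m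
      by unfold_locales (use comp sig fin N m in auto)
    show "\<exists>N'. ((N', r0) \<in> Str L \<Theta> \<and> good (has_eq K) N' r0 \<and> (Suc n = 0 \<longrightarrow> N' = M0)) \<and>
      (elementary_submodel L N N' \<and> realises (has_eq K) \<Theta> N N')"
      using ex_realising_extension by blast
  qed
  then obtain Ms where Ms: "\<And>n. (Ms n, r0) \<in> Str L \<Theta>" "Ms 0 = M0" "\<And>n. elementary_submodel L (Ms n) (Ms (Suc n))"
    "\<And>n. realises (has_eq K) \<Theta> (Ms n) (Ms (Suc n))" by metis
  define U where "U = chain_union Ms"
  have mod: "is_model \<Theta> (Ms n)" for n using Ms(1) Str_iff[OF sig] by blast
  have pts: "\<forall>w\<in>wlds (Ms n). (Ms n, w) \<in> Str L \<Theta>" for n using Str_pt[OF sig Ms(1)] by blast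
  have sub: "submodel (Ms n) (Ms (Suc n))" for n using Ms(3) by (simp add: elementary_submodel_def)
  have SU: "(U, r0) \<in> Str L \<Theta>"
    using abstract sig Ms(1) sub unfolding abstract_logic_def structures_ok_def U_def by blast
  have U: "is_model \<Theta> U" "r0 \<in> wlds U" using SU Str_iff[OF sig] by auto
  have el: "elementary_submodel L (Ms n) U" for n
    using tup sig pts mod Ms(3) unfolding tarski_union_property_def U_def by blast
  have subU: "submodel (Ms n) U" for n using el by (simp add: elementary_submodel_def)
  have Uw: "wlds U = (\<Union>n. wlds (Ms n))" "\<And>w. dmn U w = (\<Union>n. dmn (Ms n) w)" by (simp_all add: U_def chain_union_def)
  have mono_w: "wlds (Ms n) \<subseteq> wlds (Ms k)" if "n \<le> k" for n k
    using that by (induction rule: dec_induct) (use submodelD(1)[OF sub] in blast)+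
  have mono_d: "dmn (Ms n) w \<subseteq> dmn (Ms k) w" if "n \<le> k" for n k w
    using that
  proof (induction rule: dec_induct)
    case (step k)
    have "dmn (Ms k) w \<subseteq> dmn (Ms (Suc k)) w"
      using submodelD(3)[OF sub, of w k] model_dmn_out[OF mod] by (cases "w \<in> wlds (Ms k)") auto
    then show ?case using step by blast
  qed simp
  have stage: "\<exists>n. w \<in> wlds (Ms n) \<and> set \<alpha> \<subseteq> dmn (Ms n) w" if w: "w \<in> wlds U" and \<alpha>: "set \<alpha> \<subseteq> dmn U w" for w \<alpha>
    using \<alpha>
  proof (induction \<alpha>)
    case Nil
    then show ?case using w Uw by auto
  next
    case (Cons a \<alpha>)
    then obtain n k where nk: "w \<in> wlds (Ms n)" "set \<alpha> \<subseteq> dmn (Ms n) w" "a \<in> dmn (Ms k) w" using Uw(2) by auto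
    have "w \<in> wlds (Ms (max n k))" "set (a # \<alpha>) \<subseteq> dmn (Ms (max n k)) w"
      using nk mono_w[of n "max n k"] mono_d[of n "max n k" w] mono_d[of k "max n k" w] by auto
    then show ?case by blast
  qed
  have "realises (has_eq K) \<Theta> U U"
    unfolding realises_def
  proof (intro allI impI)
    fix w \<alpha> \<Gamma> \<Delta> assume w: "w \<in> wlds U" and \<alpha>: "set \<alpha> \<subseteq> dmn U w" and over: "\<forall>\<psi>\<in>\<Gamma> \<union> \<Delta>. fm_over (has_eq K) \<Theta> \<psi> \<and> fv \<psi> \<subseteq> {..length \<alpha>}"
    obtain n where n: "w \<in> wlds (Ms n)" "set \<alpha> \<subseteq> dmn (Ms n) w" using stage[OF w \<alpha>] by blast
    have n': "w \<in> wlds (Ms (Suc n))" "set \<alpha> \<subseteq> dmn (Ms (Suc n)) w" using n mono_w[of n "Suc n"] mono_d[of n "Suc n"] by fastforce+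
    have SUw: "(U, w) \<in> Str L \<Theta>" using Str_pt[OF sig SU w] .
    have Sn: "(Ms n, w) \<in> Str L \<Theta>" "(Ms (Suc n), w) \<in> Str L \<Theta>" using pts n n' by blast+
    have ho: "holds (Ms n) w (nth \<alpha>) \<psi> \<longleftrightarrow> holds U w (nth \<alpha>) \<psi>" if "fm_over (has_eq K) \<Theta> \<psi>" "fv \<psi> \<subseteq> {..<length \<alpha>}" for \<psi>
      using elementary_holds[OF sig Sn(1) SUw el n(2) that] .
    note re = realisesD[OF Ms(4)[of n] n over]
    show "((\<forall>F. finite F \<longrightarrow> (\<exists>u b. real_at U w \<alpha> (\<Gamma> \<inter> F) (\<Delta> \<inter> F) u b)) \<longrightarrow> (\<exists>u b. real_at U w \<alpha> \<Gamma> \<Delta> u b)) \<and>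
     ((\<forall>F. finite F \<longrightarrow> (\<exists>b. real_at U w \<alpha> (\<Gamma> \<inter> F) {} w b)) \<longrightarrow> (\<exists>b. real_at U w \<alpha> \<Gamma> {} w b))"
    proof (intro conjI impI)
      assume A: "\<forall>F. finite F \<longrightarrow> (\<exists>u b. real_at U w \<alpha> (\<Gamma> \<inter> F) (\<Delta> \<inter> F) u b)"
      have "\<exists>u b. real_at (Ms n) w \<alpha> (\<Gamma> \<inter> F) (\<Delta> \<inter> F) u b" if F: "finite F" for F
      proof -
        obtain \<gamma>s \<delta>s where l: "set \<gamma>s = \<Gamma> \<inter> F" "set \<delta>s = \<Delta> \<inter> F" using F by (meson finite_Int finite_list)
        have fv: "\<forall>\<psi>\<in>set \<gamma>s \<union> set \<delta>s. fv \<psi> \<subseteq> {..length \<alpha>}" and ov: "\<forall>\<psi>\<in>set \<gamma>s \<union> set \<delta>s. fm_over (has_eq K) \<Theta> \<psi>" using over l by auto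
        let ?\<chi> = "All (length \<alpha>) (Imp (BigAnd \<gamma>s) (BigOr \<delta>s))"
        have f\<chi>: "fv ?\<chi> \<subseteq> {..<length \<alpha>}" using fv by fastforce
        have o\<chi>: "fm_over (has_eq K) \<Theta> ?\<chi>" using ov by simp
        have "\<exists>u b. real_at U w \<alpha> (set \<gamma>s) (set \<delta>s) u b" using A F l by simp
        then show ?thesis
          unfolding real_at_formula[OF U(1) w \<alpha> fv] using ho[OF o\<chi> f\<chi>] real_at_formula[OF mod n fv] l by metis
      qed
      then obtain u b where "real_at (Ms (Suc n)) w \<alpha> \<Gamma> \<Delta> u b" using re by blast
      then show "\<exists>u b. real_at U w \<alpha> \<Gamma> \<Delta> u b" using real_at_elementary[OF sig Sn(2) SUw el n'(2) over] by blast
    next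
      assume A: "\<forall>F. finite F \<longrightarrow> (\<exists>b. real_at U w \<alpha> (\<Gamma> \<inter> F) {} w b)"
      have "\<exists>b. real_at (Ms n) w \<alpha> (\<Gamma> \<inter> F) {} w b" if F: "finite F" for F
      proof -
        obtain \<gamma>s where l: "set \<gamma>s = \<Gamma> \<inter> F" using F by (meson finite_Int finite_list)
        have fv: "\<forall>\<psi>\<in>set \<gamma>s. fv \<psi> \<subseteq> {..length \<alpha>}" and ov: "\<forall>\<psi>\<in>set \<gamma>s. fm_over (has_eq K) \<Theta> \<psi>" using over l by auto
        let ?\<chi> = "Ex (length \<alpha>) (BigAnd \<gamma>s)"
        have f\<chi>: "fv ?\<chi> \<subseteq> {..<length \<alpha>}" using fv by fastforce
        have o\<chi>: "fm_over (has_eq K) \<Theta> ?\<chi>" using ov by simp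
        have "\<exists>b. real_at U w \<alpha> (set \<gamma>s) {} w b" using A F l by simp
        then show ?thesis
          unfolding real_at_formula_here[OF U(1) w \<alpha> fv] using ho[OF o\<chi> f\<chi>] real_at_formula_here[OF mod n fv] l by metis
      qed
      then obtain b where "real_at (Ms (Suc n)) w \<alpha> \<Gamma> {} w b" using re by blast
      then have "real_at U w \<alpha> \<Gamma> {} w b" using over by (intro real_at_elementary[OF sig Sn(2) SUw el n'(2)]) auto
      then show "\<exists>b. real_at U w \<alpha> \<Gamma> {} w b" by blast
    qed
  qed
  moreover have "Sat L U r0 \<phi> \<longleftrightarrow> Sat L M r \<phi>" if \<phi>: "\<phi> \<in> Sen L \<Theta>" for \<phi>
  proof -
    have r0: "r0 \<in> wlds (Ms 0)" using Ms(1) Str_iff[OF sig] by blast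
    have nt: "name_tuple (Ms 0) r0 [] []" by (simp add: name_tuple_def)
    have "Sat L (cone_exp (Ms 0) r0 [] []) r0 \<phi> \<longleftrightarrow> Sat L (cone_exp U r0 [] []) r0 \<phi>"
      using elementary_Sat[OF sig mod U(1) el r0 nt] \<phi> by simp
    then show ?thesis using Sat_cone_exp_Nil[OF sig Ms(1) \<phi>] Sat_cone_exp_Nil[OF sig SU \<phi>] Ms(2) M0(3) \<phi> by auto
  qed
  ultimately show ?thesis using SU by blast
qed

text \<open>At a later world the complete type of the tuple, with positive and negative part, is
  realised on the other side, which gives inclusions in both directions. For a new element at a
  later world it is enough to realise the formulas it refutes as refuted, and for a new element at
  the same world those it satisfies as true.\<close>

lemma saturated_preservation:
  fixes Md :: "bool \<Rightarrow> 'u kmodel"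
  assumes sig: "is_sig \<Theta>" and S1: "(Md True, w1) \<in> Str L \<Theta>" and S2: "(Md False, w2) \<in> Str L \<Theta>"
    and sat: "\<And>b. realises (has_eq K) \<Theta> (Md b) (Md b)"
    and th: "\<And>\<psi>. \<psi> \<in> Sen (std_logic K) \<Theta> \<Longrightarrow> holds (Md True) w1 (nth []) \<psi> \<Longrightarrow> holds (Md False) w2 (nth []) \<psi>"
    and \<phi>: "\<phi> \<in> Sen L \<Theta>" "Sat L (Md True) w1 \<phi>"
  shows "Sat L (Md False) w2 \<phi>"
proof -
  have mod: "is_model \<Theta> (Md b)" for b using S1 S2 Str_iff[OF sig] by (cases b) auto
  define Fm where "Fm l = {\<psi>. fm_over (has_eq K) \<Theta> \<psi> \<and> fv \<psi> \<subseteq> {..<l}}" for l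
  define R where "R b w \<alpha> v \<beta> \<longleftrightarrow> w \<in> wlds (Md b) \<and> v \<in> wlds (Md (\<not> b)) \<and> set \<alpha> \<subseteq> dmn (Md b) w \<and> set \<beta> \<subseteq> dmn (Md (\<not> b)) v \<and>
    length \<alpha> = length \<beta> \<and> (\<forall>\<psi>\<in>Fm (length \<alpha>). holds (Md b) w (nth \<alpha>) \<psi> \<longrightarrow> holds (Md (\<not> b)) v (nth \<beta>) \<psi>)" for b w \<alpha> v \<beta>
  have FmI: "\<psi> \<in> Fm (Suc l) \<longleftrightarrow> fm_over (has_eq K) \<Theta> \<psi> \<and> fv \<psi> \<subseteq> {..l}" for \<psi> l by (simp add: Fm_def lessThan_Suc_atMost)
  \<comment> \<open>If a type is realised above \<open>v\<close>, the universal implications that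
    exclude its finite parts fail at \<open>v\<close>. They also fail at \<open>w\<close>, since
    truth is inherited from \<open>w\<close> to \<open>v\<close>, and saturation realises the type
    above \<open>w\<close>.\<close>
  have above: "\<exists>u b'. real_at (Md b) w \<alpha> \<Gamma> \<Delta> u b'"
    if R: "R b w \<alpha> v \<beta>" and GD: "\<Gamma> \<union> \<Delta> \<subseteq> Fm (Suc (length \<alpha>))" and re: "real_at (Md (\<not> b)) v \<beta> \<Gamma> \<Delta> t c" for b w \<alpha> v \<beta> \<Gamma> \<Delta> t c
  proof -
    have d: "w \<in> wlds (Md b)" "v \<in> wlds (Md (\<not> b))" "set \<alpha> \<subseteq> dmn (Md b) w" "set \<beta> \<subseteq> dmn (Md (\<not> b)) v" "length \<alpha> = length \<beta>"
      and imp: "\<And>\<psi>. \<psi> \<in> Fm (length \<alpha>) \<Longrightarrow> holds (Md b) w (nth \<alpha>) \<psi> \<Longrightarrow> holds (Md (\<not> b)) v (nth \<beta>) \<psi>"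
      using R unfolding R_def by blast+
    have over: "\<forall>\<psi>\<in>\<Gamma> \<union> \<Delta>. fm_over (has_eq K) \<Theta> \<psi> \<and> fv \<psi> \<subseteq> {..length \<alpha>}" using GD FmI by blast
    have "\<exists>u b'. real_at (Md b) w \<alpha> (\<Gamma> \<inter> F) (\<Delta> \<inter> F) u b'" if F: "finite F" for F
    proof -
      obtain \<gamma>s \<delta>s where l: "set \<gamma>s = \<Gamma> \<inter> F" "set \<delta>s = \<Delta> \<inter> F" using F by (meson finite_Int finite_list)
      have fv: "\<forall>\<psi>\<in>set \<gamma>s \<union> set \<delta>s. fv \<psi> \<subseteq> {..length \<alpha>}" and ov: "\<forall>\<psi>\<in>set \<gamma>s \<union> set \<delta>s. fm_over (has_eq K) \<Theta> \<psi>" using over l by auto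
      have fv': "\<forall>\<psi>\<in>set \<gamma>s \<union> set \<delta>s. fv \<psi> \<subseteq> {..length \<beta>}" using fv d(5) by simp
      let ?\<chi> = "All (length \<alpha>) (Imp (BigAnd \<gamma>s) (BigOr \<delta>s))"
      have \<chi>: "?\<chi> \<in> Fm (length \<alpha>)" unfolding Fm_def using fv ov by fastforce
      have "real_at (Md (\<not> b)) v \<beta> (set \<gamma>s) (set \<delta>s) t c" using real_at_mono[OF re] l by simp
      then have "\<not> holds (Md (\<not> b)) v (nth \<beta>) ?\<chi>" using real_at_formula[OF mod d(2,4) fv'] d(5) by auto
      then have "\<not> holds (Md b) w (nth \<alpha>) ?\<chi>" using imp[OF \<chi>] by blast
      then show ?thesis using real_at_formula[OF mod d(1,3) fv] l by simp
    qed
    then show ?thesis using realisesD(1)[OF sat d(1,3) over] by blast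
  qed
  have "Sat L (Md (\<not> True)) w2 \<phi>"
  proof (rule preservation[OF sig, where R = R and ?w1.0 = w1])
    show "(Md True, w1) \<in> Str L \<Theta>" "(Md (\<not> True), w2) \<in> Str L \<Theta>" using S1 S2 by auto
    show "R True w1 [] w2 []" using S1 S2 th Str_iff[OF sig] by (auto simp: R_def Fm_def Sen_std)
    show "\<phi> \<in> Sen L \<Theta>" "Sat L (Md True) w1 \<phi>" by fact+
    fix b w \<alpha> v \<beta> assume R: "R b w \<alpha> v \<beta>"
    have d: "w \<in> wlds (Md b)" "v \<in> wlds (Md (\<not> b))" "set \<alpha> \<subseteq> dmn (Md b) w" "set \<beta> \<subseteq> dmn (Md (\<not> b)) v" "length \<alpha> = length \<beta>"
      and imp: "\<And>\<psi>. \<psi> \<in> Fm (length \<alpha>) \<Longrightarrow> holds (Md b) w (nth \<alpha>) \<psi> \<Longrightarrow> holds (Md (\<not> b)) v (nth \<beta>) \<psi>"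
      using R unfolding R_def by blast+
    let ?l = "length \<alpha>"
    show "w \<in> wlds (Md b) \<and> v \<in> wlds (Md (\<not> b)) \<and> set \<alpha> \<subseteq> dmn (Md b) w \<and> set \<beta> \<subseteq> dmn (Md (\<not> b)) v \<and> length \<alpha> = length \<beta>" using d by blast
    show "holds (Md (\<not> b)) v (nth \<beta>) \<psi>"
      if "fm_over (has_eq K) \<Theta> \<psi>" "fv \<psi> \<subseteq> {..<length \<alpha>}" "holds (Md b) w (nth \<alpha>) \<psi>" for \<psi> using imp that by (simp add: Fm_def)
    show "\<exists>a'\<in>dmn (Md (\<not> b)) v. R b w (\<alpha> @ [a]) v (\<beta> @ [a'])" if a: "a \<in> dmn (Md b) w" for a
    proof -
      define \<Gamma> where "\<Gamma> = {\<gamma> \<in> Fm (Suc ?l). holds (Md b) w (nth (\<alpha> @ [a])) \<gamma>}"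
      have idm: "map (hom (Md b) w w) \<alpha> = \<alpha>" "map (hom (Md (\<not> b)) v v) \<beta> = \<beta>"
        using d(3,4) model_hom_id[OF mod] by (auto intro!: map_idI)
      have over: "\<forall>\<psi>\<in>\<Gamma> \<union> {}. fm_over (has_eq K) \<Theta> \<psi> \<and> fv \<psi> \<subseteq> {..length \<beta>}" using FmI d(5) by (auto simp: \<Gamma>_def)
      have here: "real_at (Md b) w \<alpha> \<Gamma> {} w a" unfolding real_at_def idm using a model_acc_refl[OF mod d(1)] by (simp add: \<Gamma>_def)
      have "\<exists>b'. real_at (Md (\<not> b)) v \<beta> (\<Gamma> \<inter> F) {} v b'" if F: "finite F" for F
      proof -
        obtain \<gamma>s where l: "set \<gamma>s = \<Gamma> \<inter> F" using F by (meson finite_Int finite_list)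
        have fv': "\<forall>\<psi>\<in>set \<gamma>s. fv \<psi> \<subseteq> {..length \<beta>}" and ov: "\<forall>\<psi>\<in>set \<gamma>s. fm_over (has_eq K) \<Theta> \<psi>" using over l by auto
        have fv: "\<forall>\<psi>\<in>set \<gamma>s. fv \<psi> \<subseteq> {..?l}" using fv' d(5) by simp
        let ?\<chi> = "Ex ?l (BigAnd \<gamma>s)"
        have \<chi>: "?\<chi> \<in> Fm ?l" unfolding Fm_def using fv ov by fastforce
        have "real_at (Md b) w \<alpha> (set \<gamma>s) {} w a" using real_at_mono[OF here] l by simp
        then have "holds (Md b) w (nth \<alpha>) ?\<chi>" using real_at_formula_here[OF mod d(1,3) fv] by blast
        then have "holds (Md (\<not> b)) v (nth \<beta>) ?\<chi>" using imp[OF \<chi>] by blast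
        then show ?thesis using real_at_formula_here[OF mod d(2,4) fv'] l d(5) by simp
      qed
      then obtain a' where a': "real_at (Md (\<not> b)) v \<beta> \<Gamma> {} v a'"
        using realisesD(2)[OF sat d(2,4) over] by blast
      then have "a' \<in> dmn (Md (\<not> b)) v" "\<forall>\<gamma>\<in>\<Gamma>. holds (Md (\<not> b)) v (nth (\<beta> @ [a'])) \<gamma>" unfolding real_at_def idm by auto
      then show ?thesis using d a by (intro bexI[of _ a']) (auto simp: R_def \<Gamma>_def)
    qed
    fix t assume t: "(v, t) \<in> acc (Md (\<not> b))"
    have tW: "t \<in> wlds (Md (\<not> b))" using model_acc_wlds[OF mod t] by blast
    let ?\<beta> = "map (hom (Md (\<not> b)) v t) \<beta>"
    have \<beta>t: "set ?\<beta> \<subseteq> dmn (Md (\<not> b)) t" using d(4) model_hom[OF mod t] by auto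
    show "\<exists>u. (w, u) \<in> acc (Md b) \<and> R b u (map (hom (Md b) w u) \<alpha>) t ?\<beta> \<and> R (\<not> b) t ?\<beta> u (map (hom (Md b) w u) \<alpha>)"
    proof -
      \<comment> \<open>\<open>real_at\<close> always appends an element, so an arbitrary one is
        taken; the formulas of \<open>Fm ?l\<close> do not mention it.\<close>
      obtain c where c: "c \<in> dmn (Md (\<not> b)) t" using model_dmn_nonempty[OF mod tW] by blast
      have snoc: "holds N x (nth (\<xi> @ [y])) \<psi> \<longleftrightarrow> holds N x (nth \<xi>) \<psi>" if "\<psi> \<in> Fm ?l" "length \<xi> = ?l" for N x \<xi> y \<psi>
        using that by (intro holds_cong) (auto simp: Fm_def nth_append subset_iff)
      define \<Gamma> \<Delta> where "\<Gamma> = {\<gamma> \<in> Fm ?l. holds (Md (\<not> b)) t (nth ?\<beta>) \<gamma>}" and "\<Delta> = {\<gamma> \<in> Fm ?l. \<not> holds (Md (\<not> b)) t (nth ?\<beta>) \<gamma>}"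
      have sub: "\<Gamma> \<union> \<Delta> \<subseteq> Fm (Suc ?l)" by (auto simp: \<Gamma>_def \<Delta>_def Fm_def)
      have "real_at (Md (\<not> b)) v \<beta> \<Gamma> \<Delta> t c"
        unfolding real_at_def using t c snoc[of _ ?\<beta>] d(5) by (simp add: \<Gamma>_def \<Delta>_def)
      then obtain u b' where re: "real_at (Md b) w \<alpha> \<Gamma> \<Delta> u b'" using above[OF R sub] by blast
      then have wu: "(w, u) \<in> acc (Md b)" by (simp add: real_at_def)
      let ?\<alpha> = "map (hom (Md b) w u) \<alpha>"
      have \<alpha>u: "set ?\<alpha> \<subseteq> dmn (Md b) u" and uW: "u \<in> wlds (Md b)" using d(3) model_hom[OF mod wu] model_acc_wlds[OF mod wu] by auto
      have "holds (Md b) u (nth ?\<alpha>) \<psi> \<longleftrightarrow> holds (Md (\<not> b)) t (nth ?\<beta>) \<psi>" if "\<psi> \<in> Fm ?l" for \<psi>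
        using re that snoc[OF that, of ?\<alpha> "Md b" u b'] unfolding real_at_def \<Gamma>_def \<Delta>_def by auto
      then show ?thesis using wu \<alpha>u uW tW \<beta>t d(5) by (intro exI[of _ u]) (simp add: R_def)
    qed
    fix a' assume a': "a' \<in> dmn (Md (\<not> b)) t"
    define \<Delta> where "\<Delta> = {\<gamma> \<in> Fm (Suc ?l). \<not> holds (Md (\<not> b)) t (nth (?\<beta> @ [a'])) \<gamma>}"
    have "real_at (Md (\<not> b)) v \<beta> {} \<Delta> t a'" unfolding real_at_def using t a' by (simp add: \<Delta>_def)
    moreover have "{} \<union> \<Delta> \<subseteq> Fm (Suc ?l)" by (auto simp: \<Delta>_def)
    ultimately obtain u a where re: "real_at (Md b) w \<alpha> {} \<Delta> u a" using above[OF R] by blast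
    then have wu: "(w, u) \<in> acc (Md b)" and a: "a \<in> dmn (Md b) u" by (simp_all add: real_at_def)
    let ?\<alpha> = "map (hom (Md b) w u) \<alpha>"
    have \<alpha>u: "set ?\<alpha> \<subseteq> dmn (Md b) u" and uW: "u \<in> wlds (Md b)" using d(3) model_hom[OF mod wu] model_acc_wlds[OF mod wu] by auto
    have "R b u (?\<alpha> @ [a]) t (?\<beta> @ [a'])"
      using re \<alpha>u uW tW \<beta>t d(5) a a' unfolding R_def real_at_def \<Delta>_def by auto
    then show "\<exists>u. (w, u) \<in> acc (Md b) \<and> (\<exists>a\<in>dmn (Md b) u. R b u (map (hom (Md b) w u) \<alpha> @ [a]) t (?\<beta> @ [a']))"
      using wu a by blast
  qed
  then show ?thesis by simp
qed

text \<open>If no finite conjunction of standard consequences of \<phi> implies \<phi>, compactness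
  gives a model of all of them that refutes \<phi>. No finite disjunction of standard sentences
  failing there is implied by \<phi>, so a second use of compactness gives a model of \<phi> that
  refutes them all.\<close>

lemma definable:
  assumes sig: "is_sig \<Theta>" and fin: "finite_sig \<Theta>" and \<phi>: "\<phi> \<in> Sen L \<Theta>"
  shows "\<exists>\<psi>\<in>Sen (std_logic K) \<Theta>. \<forall>M w. (M, w) \<in> Str L \<Theta> \<longrightarrow> (Sat L M w \<phi> \<longleftrightarrow> Sat (std_logic K) M w \<psi>)"
proof (rule ccontr)
  assume undef: "\<not> ?thesis"
  let ?S = "Sen (std_logic K) \<Theta>"
  have "\<forall>\<psi>\<in>?S. \<exists>\<psi>'. \<psi>' \<in> Sen L \<Theta> \<and> (\<forall>M w s. (M, w) \<in> Str L \<Theta> \<longrightarrow> (Sat L M w \<psi>' \<longleftrightarrow> holds M w s \<psi>))"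
    using ex_translation[OF sig] by blast
  then obtain \<tau> where \<tau>: "\<And>\<psi>. \<psi> \<in> ?S \<Longrightarrow> \<tau> \<psi> \<in> Sen L \<Theta>"
    "\<And>\<psi> M w s. \<psi> \<in> ?S \<Longrightarrow> (M, w) \<in> Str L \<Theta> \<Longrightarrow> Sat L M w (\<tau> \<psi>) \<longleftrightarrow> holds M w s \<psi>" by metis
  let ?s = "nth []"
  have std: "Sat (std_logic K) M w \<psi> \<longleftrightarrow> holds M w ?s \<psi>" if "\<psi> \<in> ?S" "(M, w) \<in> Str L \<Theta>" for M w \<psi>
    using Sat_std_iff[of \<Theta> M w \<psi> K ?s] that Str_iff[OF sig] by (simp add: Sen_std)
  define C where "C = {\<psi> \<in> ?S. \<forall>M w. (M, w) \<in> Str L \<Theta> \<longrightarrow> Sat L M w \<phi> \<longrightarrow> holds M w ?s \<psi>}"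
  have "\<exists>(M, w)\<in>Str L \<Theta>. (\<forall>\<chi>\<in>\<tau> ` C. Sat L M w \<chi>) \<and> (\<forall>\<chi>\<in>{\<phi>}. \<not> Sat L M w \<chi>)"
  proof (rule comp[unfolded star_compact_def, rule_format], intro conjI allI impI)
    show "is_sig \<Theta>" by fact
    show "\<tau> ` C \<subseteq> Sen L \<Theta>" "{\<phi>} \<subseteq> Sen L \<Theta>" using \<tau>(1) \<phi> by (auto simp: C_def)
    fix \<Gamma>' \<Delta>' assume fs: "finite \<Gamma>' \<and> finite \<Delta>' \<and> \<Gamma>' \<subseteq> \<tau> ` C \<and> \<Delta>' \<subseteq> {\<phi>}"
    obtain C' where C': "C' \<subseteq> C" "finite C'" "\<Gamma>' = \<tau> ` C'" using fs finite_subset_image[of \<Gamma>' \<tau> C] by blast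
    obtain cs where cs: "set cs = C'" using finite_list[OF C'(2)] by blast
    have CS: "C' \<subseteq> ?S" using C'(1) by (auto simp: C_def)
    have conj: "BigAnd cs \<in> ?S" using CS cs by (auto simp: Sen_std)
    have "\<exists>M w. (M, w) \<in> Str L \<Theta> \<and> holds M w ?s (BigAnd cs) \<and> \<not> Sat L M w \<phi>"
    proof (rule ccontr)
      assume none: "\<not> ?thesis"
      have "Sat L M w \<phi> \<longleftrightarrow> Sat (std_logic K) M w (BigAnd cs)" if "(M, w) \<in> Str L \<Theta>" for M w
        unfolding std[OF conj that] using none that C'(1) cs unfolding C_def holds_BigAnd by blast
      then show False using undef conj by blast
    qed
    then obtain M w where Mw: "(M, w) \<in> Str L \<Theta>" "holds M w ?s (BigAnd cs)" "\<not> Sat L M w \<phi>" by blast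
    have "\<forall>\<chi>\<in>\<Gamma>'. Sat L M w \<chi>" using Mw(1,2) C'(3) cs CS \<tau>(2)[of _ M w ?s] by (auto simp: subset_iff)
    moreover have "\<forall>\<chi>\<in>\<Delta>'. \<not> Sat L M w \<chi>" using Mw(3) fs by blast
    ultimately show "\<exists>(M, w)\<in>Str L \<Theta>. (\<forall>\<chi>\<in>\<Gamma>'. Sat L M w \<chi>) \<and> (\<forall>\<chi>\<in>\<Delta>'. \<not> Sat L M w \<chi>)" using Mw(1) by blast
  qed
  then obtain M2 w2 where M2: "(M2, w2) \<in> Str L \<Theta>" "\<forall>\<chi>\<in>\<tau> ` C. Sat L M2 w2 \<chi>" "\<not> Sat L M2 w2 \<phi>" by auto
  define B where "B = {\<psi> \<in> ?S. \<not> holds M2 w2 ?s \<psi>}"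
  have "\<exists>(M, w)\<in>Str L \<Theta>. (\<forall>\<chi>\<in>{\<phi>}. Sat L M w \<chi>) \<and> (\<forall>\<chi>\<in>\<tau> ` B. \<not> Sat L M w \<chi>)"
  proof (rule comp[unfolded star_compact_def, rule_format], intro conjI allI impI)
    show "is_sig \<Theta>" by fact
    show "\<tau> ` B \<subseteq> Sen L \<Theta>" "{\<phi>} \<subseteq> Sen L \<Theta>" using \<tau>(1) \<phi> by (auto simp: B_def)
    fix \<Gamma>' \<Delta>' assume fs: "finite \<Gamma>' \<and> finite \<Delta>' \<and> \<Gamma>' \<subseteq> {\<phi>} \<and> \<Delta>' \<subseteq> \<tau> ` B"
    obtain B' where B': "B' \<subseteq> B" "finite B'" "\<Delta>' = \<tau> ` B'" using fs finite_subset_image[of \<Delta>' \<tau> B] by blast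
    obtain bs where bs: "set bs = B'" using finite_list[OF B'(2)] by blast
    have BS: "B' \<subseteq> ?S" using B'(1) by (auto simp: B_def)
    have disj: "BigOr bs \<in> ?S" using BS bs by (auto simp: Sen_std)
    have "\<exists>M w. (M, w) \<in> Str L \<Theta> \<and> \<not> holds M w ?s (BigOr bs) \<and> Sat L M w \<phi>"
    proof (rule ccontr)
      assume none: "\<not> ?thesis"
      \<comment> \<open>A disjunction implied by \<phi> is one of the consequences of \<phi>, hence
        true at \<open>w2\<close>, although each of its members fails there.\<close>
      then have "BigOr bs \<in> C" using disj by (auto simp: C_def)
      then have "holds M2 w2 ?s (BigOr bs)" using M2(2) \<tau>(2)[OF disj M2(1)] by blast
      then show False using B'(1) bs by (auto simp: B_def)
    qed
    then obtain M w where Mw: "(M, w) \<in> Str L \<Theta>" "\<not> holds M w ?s (BigOr bs)" "Sat L M w \<phi>" by blast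
    have "\<forall>\<chi>\<in>\<Delta>'. \<not> Sat L M w \<chi>" using Mw(1,2) B'(3) bs BS \<tau>(2)[of _ M w ?s] by (auto simp: subset_iff)
    moreover have "\<forall>\<chi>\<in>\<Gamma>'. Sat L M w \<chi>" using Mw(3) fs by blast
    ultimately show "\<exists>(M, w)\<in>Str L \<Theta>. (\<forall>\<chi>\<in>\<Gamma>'. Sat L M w \<chi>) \<and> (\<forall>\<chi>\<in>\<Delta>'. \<not> Sat L M w \<chi>)" using Mw(1) by blast
  qed
  then obtain M1 w1 where M1: "(M1, w1) \<in> Str L \<Theta>" "Sat L M1 w1 \<phi>" "\<forall>\<chi>\<in>\<tau> ` B. \<not> Sat L M1 w1 \<chi>" by auto
  obtain U1 r1 where U1: "(U1, r1) \<in> Str L \<Theta>" "\<forall>\<phi>\<in>Sen L \<Theta>. Sat L U1 r1 \<phi> \<longleftrightarrow> Sat L M1 w1 \<phi>" "realises (has_eq K) \<Theta> U1 U1"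
    using ex_saturated[OF sig fin M1(1)] by blast
  obtain U2 r2 where U2: "(U2, r2) \<in> Str L \<Theta>" "\<forall>\<phi>\<in>Sen L \<Theta>. Sat L U2 r2 \<phi> \<longleftrightarrow> Sat L M2 w2 \<phi>" "realises (has_eq K) \<Theta> U2 U2"
    using ex_saturated[OF sig fin M2(1)] by blast
  define Md where "Md b = (if b then U1 else U2)" for b
  have "Sat L (Md False) r2 \<phi>"
  proof (rule saturated_preservation[OF sig, of Md r1])
    fix \<psi> assume \<psi>: "\<psi> \<in> ?S" and h: "holds (Md True) r1 ?s \<psi>"
    have "Sat L M1 w1 (\<tau> \<psi>)" using h \<tau>(2)[OF \<psi> U1(1)] U1(2) \<tau>(1)[OF \<psi>] by (simp add: Md_def)
    then have "\<psi> \<notin> B" using M1(3) by blast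
    then have "Sat L M2 w2 (\<tau> \<psi>)" using \<psi> \<tau>(2)[OF \<psi> M2(1)] by (simp add: B_def)
    then show "holds (Md False) r2 ?s \<psi>" using \<tau>(2)[OF \<psi> U2(1)] U2(2) \<tau>(1)[OF \<psi>] by (simp add: Md_def)
  qed (use U1 U2 M1(2) \<phi> in \<open>auto simp: Md_def\<close>)
  then show False using U2(2) \<phi> M2(3) by (simp add: Md_def)
qed

text \<open>By the closure condition on \<open>Bpl L\<close>, a member of \<open>oplus\<close> whose
  points are structures of \<open>L\<close> belongs to it as soon as it has the
  \<open>L\<close>-theory of some member at \<open>w\<close>. All members of \<open>oplus\<close>
  within the class have the \<open>L\<close>-theory of the cone expansion.\<close>

lemma Bpl_std_subset:
  assumes sig: "is_sig \<Theta>" and SM: "(M, w) \<in> Str L \<Theta>" and nt: "name_tuple M w cs as"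
  shows "Bpl (std_logic K) M w cs as \<subseteq> Bpl L M w cs as"
proof
  fix N assume "N \<in> Bpl (std_logic K) M w cs as"
  then have N: "N \<in> oplus M w cs as" "in_class K N" by (auto simp: std_logic_def)
  have M: "is_model \<Theta> M" "w \<in> wlds M" using SM Str_iff[OF sig] by auto
  obtain N0 where N0: "N0 \<in> Bpl L M w cs as" using Bpl_props(1)[OF sig SM nt] by blast
  have "(N, w) \<in> Str L (add_consts \<Theta> cs)"
    using N oplus_covers_cone_exp(2)[OF M nt N(1)] model_sgn[OF M(1)] by (simp add: Str_iff is_sig_add_consts[OF sig] oplus_def)
  moreover have "Sat L N0 w \<phi> \<longleftrightarrow> Sat L N w \<phi>" if "\<phi> \<in> Sen L (add_consts \<Theta> cs)" for \<phi>
    using Sat_oplus[OF sig SM nt N that] Sat_oplus[OF sig SM nt _ _ that] Bpl_props(2)[OF sig SM nt N0] by blast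
  moreover have "\<forall>N\<in>Bpl L M w cs as. \<forall>N'\<in>oplus M w cs as.
          (N', w) \<in> Str L (add_consts \<Theta> cs) \<and>
          (\<forall>\<phi>\<in>Sen L (add_consts \<Theta> cs). Sat L N w \<phi> \<longleftrightarrow> Sat L N' w \<phi>) \<longrightarrow>
          N' \<in> Bpl L M w cs as"
    using abstract sig SM nt unfolding abstract_logic_def boxplus_ok_def by blast
  ultimately show "N \<in> Bpl L M w cs as" using N0 N(1) by blast
qed

lemma std_extends: "extends L (std_logic K)"
  unfolding extends_def
proof (intro conjI allI impI)
  show StrE: "Str (std_logic K) \<Theta> = Str L \<Theta>" if "is_sig \<Theta>" for \<Theta>
    using ext that by (simp add: extends_def)
  show "Bpl (std_logic K) M w cs as \<subseteq> Bpl L M w cs as"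
    if "is_sig \<Theta> \<and> (M, w) \<in> Str (std_logic K) \<Theta> \<and> name_tuple M w cs as" for \<Theta> M w cs as
    using that StrE Bpl_std_subset by blast
  fix \<Theta> :: "'u signature" assume sig: "is_sig \<Theta>"
  show "\<forall>\<phi>\<in>Sen L \<Theta>. let \<Theta>\<phi> = sen_sig L \<phi> in \<exists>\<psi>\<in>Sen (std_logic K) \<Theta>\<phi>.
      ((\<exists>\<chi>\<in>Sen (std_logic K) \<Theta>\<phi>. sen_sig (std_logic K) \<chi> = \<Theta>\<phi>) \<longrightarrow> sen_sig (std_logic K) \<psi> = \<Theta>\<phi>) \<and>
      (\<forall>(M, w)\<in>Str (std_logic K) \<Theta>\<phi>. Sat L M w \<phi> = Sat (std_logic K) M w \<psi>)"
  proof
    fix \<phi> assume "\<phi> \<in> Sen L \<Theta>"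
    then obtain \<Theta>0 where o: "occurs_exactly L \<phi> \<Theta>0"
      using abstract sig unfolding abstract_logic_def occurrence_def by blast
    have sn: "sen_sig L \<phi> = \<Theta>0" using sen_sig_eq[OF o] .
    have sig0: "is_sig \<Theta>0" "finite_sig \<Theta>0" "\<phi> \<in> Sen L \<Theta>0" using o sub_sig_refl[of \<Theta>0] by (auto simp: occurs_exactly_def)
    obtain \<psi>0 where \<psi>0: "\<psi>0 \<in> Sen (std_logic K) \<Theta>0" "\<And>M w. (M, w) \<in> Str L \<Theta>0 \<Longrightarrow> Sat L M w \<phi> \<longleftrightarrow> Sat (std_logic K) M w \<psi>0"
      using definable[OF sig0] by blast
    have "\<exists>\<psi>\<in>Sen (std_logic K) \<Theta>0.
      ((\<exists>\<chi>\<in>Sen (std_logic K) \<Theta>0. sen_sig (std_logic K) \<chi> = \<Theta>0) \<longrightarrow> sen_sig (std_logic K) \<psi> = \<Theta>0) \<and>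
      (\<forall>(M, w)\<in>Str (std_logic K) \<Theta>0. Sat L M w \<phi> = Sat (std_logic K) M w \<psi>)"
    proof (cases "\<exists>\<chi>\<in>Sen (std_logic K) \<Theta>0. sen_sig (std_logic K) \<chi> = \<Theta>0")
      case False
      then show ?thesis using \<psi>0 StrE[OF sig0(1)] by blast
    next
      case True
      then obtain \<chi> where \<chi>: "\<chi> \<in> Sen (std_logic K) \<Theta>0" "sen_sig (std_logic K) \<chi> = \<Theta>0" by blast
      \<comment> \<open>Conjoining the tautology \<open>Imp \<chi> \<chi>\<close> supplies the
        symbols missing in \<open>\<psi>0\<close>, so that the signature becomes all of
        \<open>\<Theta>0\<close>.\<close>
      let ?\<psi> = "And \<psi>0 (Imp \<chi> \<chi>)"
      have \<psi>: "?\<psi> \<in> Sen (std_logic K) \<Theta>0" using \<psi>0(1) \<chi>(1) by (simp add: Sen_std)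
      have c: "fm_sig \<chi> = \<Theta>0" using sen_sig_eq[OF std_occurs_exactly[OF sig0(1) \<chi>(1)]] \<chi>(2) by simp
      have "sub_sig (fm_sig \<psi>0) \<Theta>0" using \<psi>0(1) fm_over_iff[of "has_eq K" \<Theta>0 \<psi>0] by (simp add: Sen_std)
      then have "fm_sig ?\<psi> = \<Theta>0"
        unfolding c[symmetric] by (auto simp: fm_sig_def sub_sig_def fun_eq_iff)
      then have "sen_sig (std_logic K) ?\<psi> = \<Theta>0" using sen_sig_eq[OF std_occurs_exactly[OF sig0(1) \<psi>]] by simp
      moreover have "Sat L M w \<phi> = Sat (std_logic K) M w ?\<psi>" if S: "(M, w) \<in> Str L \<Theta>0" for M w
      proof -
        have M: "is_model \<Theta>0 M" "w \<in> wlds M" using S Str_iff[OF sig0(1)] by auto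
        have "fv ?\<psi> = {}" "fv \<psi>0 = {}" using \<psi> \<psi>0(1) by (simp_all add: Sen_std)
        then show ?thesis
          unfolding \<psi>0(2)[OF S] using Sat_std_iff[OF M, of _ K "nth []"] by (metis holds.simps(4,6))
      qed
      ultimately show ?thesis using \<psi> StrE[OF sig0(1)] by blast
    qed
    then show "let \<Theta>\<phi> = sen_sig L \<phi> in \<exists>\<psi>\<in>Sen (std_logic K) \<Theta>\<phi>.
      ((\<exists>\<chi>\<in>Sen (std_logic K) \<Theta>\<phi>. sen_sig (std_logic K) \<chi> = \<Theta>\<phi>) \<longrightarrow> sen_sig (std_logic K) \<psi> = \<Theta>\<phi>) \<and>
      (\<forall>(M, w)\<in>Str (std_logic K) \<Theta>\<phi>. Sat L M w \<phi> = Sat (std_logic K) M w \<psi>)"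
      unfolding Let_def sn .
  qed
qed

end

theorem theorem5p2:
  fixes L :: "('u, 's) logic" and K :: stil
  assumes "set_universe TYPE('u)"
    and "abstract_logic L"
    and "extends (std_logic K) L"
    and "preserved_under_asimulations K L"
    and "star_compact L"
    and "tarski_union_property L"
  shows "equally_expressive (std_logic K) L"
proof -
  interpret lindstroem UNIV L K
    using assms by unfold_locales auto
  show ?thesis unfolding equally_expressive_def using assms(3) std_extends by blast
qed

end
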